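(* Let $\varepsilon,\mu:\Omega\to\mathbb{R}^{3\times 3}$ be matrix fields with bounded measurable entries such that $\varepsilon(x)$ and $\mu(x)$ are symmetric for all $x\in\Omega$, and such that there exist constants $\varepsilon_*>0$ and $\mu_*>0$ with $\varepsilon(x)\xi\cdot\xi\ge\varepsilon_*|\xi|^2$ and $\mu(x)\xi\cdot\xi\ge\mu_*|\xi|^2$ for all $x\in\Omega$ and all $\xi\in\mathbb{R}^3$. Let $j(x,t,\xi)=j_0(x,t)+j_1(x,t,\xi)$ for $(x,t,\xi)\in Q_T\times\mathbb{R}^3$, where $j_0\in L^2(Q_T)^3$ and $j_1:Q_T\times\mathbb{R}^3\to\mathbb{R}^3$ is a Carath\'eodory function such that, for some constant $c_1>0$, $|j_1(x,t,\xi)|\le c_1|\xi|$ for all $(x,t,\xi)\in Q_T\times\mathbb{R}^3$. Suppose moreover that $$\big(j(x,t,\xi)-j(x,t,\eta)\big)\cdot(\xi-\eta)\ge 0\qquad\text{for all }(x,t)\in Q_T\text{ and all }\xi,\eta\in\mathbb{R}^3.$$ Then for every $(e_0,h_0)\in H\times H$ there exists a weak solution $$(e,h)\in L^\infty(0,T;H)\times L^\infty(0,T;H)$$ of the Maxwell problem with data $(\varepsilon,\mu,j,e_0,h_0)$ which satisfies the estimate $$\|e(t)\|_{H_\varepsilon}^2+\|h(t)\|_{H_\mu}^2\le c\Big(\|e_0\|_{H_\varepsilon}^2+\|h_0\|_{H_\mu}^2+\|j_0\|_{L^2(Q_T)^3}^2\Big)\qquad\text{for a.e. }t\in[0,T],$$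 where $c=c(c_1,\varepsilon_*,T)>0$ is a constant depending on $c_1$, $\varepsilon_*$ and $T$.
   Context: Setting and notation. $\Omega\subset\mathbb{R}^3$ is an open set, $0<T<+\infty$, $Q_T=\Omega\times\,]0,T[$. $H:=L^2(\Omega)^3$ with scalar product $(u,v)_H=\int_\Omega u\cdot v\,dx$; weighted scalar products on $H$ are $(u,v)_{H_\varepsilon}=\int_\Omega\varepsilon(x)u(x)\cdot v(x)\,dx$ and $(u,v)_{H_\mu}=\int_\Omega\mu(x)u(x)\cdot v(x)\,dx$, with induced norms $\|\cdot\|_{H_\varepsilon}$, $\|\cdot\|_{H_\mu}$. $V$ is the space of all $u\in L^2(\Omega)^3$ whose distributional curl is represented by a field in $L^2(\Omega)^3$, i.e. there is $F=:\operatorname{curl}u\in L^2(\Omega)^3$ with $\int_\Omega u\cdot\operatorname{curl}\varphi\,dx=\int_\Omega F\cdot\varphi\,dx$ for all $\varphi\in C_c^\infty(\Omega)^3$; it is a Hilbert space with scalar product $(u,v)_V=\int_\Omega(u\cdot v+\operatorname{curl}u\cdot\operatorname{curl}v)\,dx$. $V_0$ is the closed subspace $V_0:=\{u\in V:\int_\Omega(\operatorname{curl}u)\cdot\psi\,dx=\int_\Omega u\cdot\operatorname{curl}\psi\,dx\text{ for all }\psi\in V\}$. $L^2(Q_T)^3$ is identified with the Bochner space $L^2(0,T;H)$ via $u\mapsto(t\mapsto u(\cdot,t))$. Carath\'eodory function: $(x,t)\mapsto j_1(x,t,\xi)$ is measurable in $Q_T$ for all $\xi\in\mathbb{R}^3$,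 and $\xi\mapsto j_1(x,t,\xi)$ is continuous on $\mathbb{R}^3$ for a.e. $(x,t)\in Q_T$. For $u\in L^2(Q_T)^3$, $j(u)$ denotes the field $(x,t)\mapsto j(x,t,u(x,t))$, which lies in $L^2(Q_T)^3$. Weak solution: $(e,h)\in L^2(Q_T)^3\times L^2(Q_T)^3$ is a weak solution of the Maxwell problem with data $(\varepsilon,\mu,j,e_0,h_0)$ (that is, of $\partial_t(\varepsilon e)=\operatorname{curl}h-j$, $\partial_t(\mu h)=-\operatorname{curl}e$ in $Q_T$, $n\times e=0$ on $\partial\Omega\times\,]0,T[$, $e=e_0$, $h=h_0$ at $t=0$) if $$-\int_{Q_T}(\varepsilon e)\cdot\partial_t\Phi\,dx\,dt+\int_{Q_T}\big(-h\cdot\operatorname{curl}\Phi+j(e)\cdot\Phi\big)\,dx\,dt=\int_\Omega(\varepsilon e_0)(x)\cdot\Phi(x,0)\,dx$$ for all $\Phi\in L^2(0,T;V_0)$ with $\partial_t\Phi\in L^2(Q_T)^3$ and $\Phi(\cdot,T)=0$ a.e. in $\Omega$, and $$-\int_{Q_T}(\mu h)\cdot\partial_t\Psi\,dx\,dt+\int_{Q_T}e\cdot\operatorname{curl}\Psi\,dx\,dt=\int_\Omega(\mu h_0)(x)\cdot\Psi(x,0)\,dx$$ for all $\Psi\in L^2(0,T;V)$ with $\partial_t\Psi\in L^2(Q_T)^3$ and $\Psi(\cdot,T)=0$ a.e. in $\Omega$. (Values of $\Phi,\Psi$ at $t=0,T$ are those of the representatives in $C([0,T];H)$.) *)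

theory Defs
  imports "HOL-Analysis.Analysis"
begin

section \<open>Square integrable vector fields\<close>

text \<open>
  Elements of Lebesgue spaces are represented by functions. Fields on \<open>S\<close> are total functions whose
  values outside \<open>S\<close> are irrelevant. Measurability is Lebesgue measurability. A field on the
  space-time cylinder is a function of the pair \<open>(x, t)\<close>.
\<close>

definition L2_fields :: "'a::euclidean_space set \<Rightarrow> ('a \<Rightarrow> real^3) set" where
  "L2_fields S = {u. u \<in> borel_measurable (lebesgue_on S) \<and>
                     integrable (lebesgue_on S) (\<lambda>x. (norm (u x))\<^sup>2)}"

definition L2_norm :: "'a::euclidean_space set \<Rightarrow> ('a \<Rightarrow> real^3) \<Rightarrow> real" where
  "L2_norm S u = sqrt (\<integral>x. u x \<bullet> u x \<partial>lebesgue_on S)"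

definition weighted_inner ::
    "(real^3) set \<Rightarrow> (real^3 \<Rightarrow> real^3^3) \<Rightarrow> (real^3 \<Rightarrow> real^3) \<Rightarrow> (real^3 \<Rightarrow> real^3) \<Rightarrow> real" where
  "weighted_inner \<Omega> A u v = (\<integral>x. (A x *v u x) \<bullet> v x \<partial>lebesgue_on \<Omega>)"

definition weighted_norm :: "(real^3) set \<Rightarrow> (real^3 \<Rightarrow> real^3^3) \<Rightarrow> (real^3 \<Rightarrow> real^3) \<Rightarrow> real" where
  "weighted_norm \<Omega> A u = sqrt (weighted_inner \<Omega> A u u)"


section \<open>Test functions and weak derivatives\<close>

text \<open>\<open>C_k n f\<close>: all iterated directional derivatives of \<open>f\<close> up to order \<open>n\<close> exist and are continuous.\<close>

primrec C_k :: "nat \<Rightarrow> ('a::euclidean_space \<Rightarrow> 'b::real_normed_vector) \<Rightarrow> bool" where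
  "C_k 0 f = continuous_on UNIV f"
| "C_k (Suc n) f = (f differentiable_on UNIV \<and> (\<forall>v. C_k n (\<lambda>x. frechet_derivative f (at x) v)))"

text \<open>A compactly supported test function on the open set \<open>S\<close> is identified with its extension by zero.\<close>

definition test_functions :: "'a::euclidean_space set \<Rightarrow> ('a \<Rightarrow> real^3) set" where
  "test_functions S = {\<phi>. (\<forall>n. C_k n \<phi>) \<and> compact (closure {x. \<phi> x \<noteq> 0}) \<and>
                          closure {x. \<phi> x \<noteq> 0} \<subseteq> S}"

definition curl :: "(real^3 \<Rightarrow> real^3) \<Rightarrow> real^3 \<Rightarrow> real^3" where
  "curl \<phi> x = (let J = jacobian \<phi> (at x) in
     vector [J $ 3 $ 2 - J $ 2 $ 3, J $ 1 $ 3 - J $ 3 $ 1, J $ 2 $ 1 - J $ 1 $ 2])"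

definition has_weak_curl :: "(real^3) set \<Rightarrow> (real^3 \<Rightarrow> real^3) \<Rightarrow> (real^3 \<Rightarrow> real^3) \<Rightarrow> bool" where
  "has_weak_curl \<Omega> u F \<longleftrightarrow> u \<in> L2_fields \<Omega> \<and> F \<in> L2_fields \<Omega> \<and>
     (\<forall>\<phi>\<in>test_functions \<Omega>.
        (\<integral>x. u x \<bullet> curl \<phi> x \<partial>lebesgue_on \<Omega>) = (\<integral>x. F x \<bullet> \<phi> x \<partial>lebesgue_on \<Omega>))"

text \<open>The weak curl is unique up to equality almost everywhere; this selects a representative.\<close>

definition weak_curl :: "(real^3) set \<Rightarrow> (real^3 \<Rightarrow> real^3) \<Rightarrow> real^3 \<Rightarrow> real^3" where
  "weak_curl \<Omega> u = (SOME F. has_weak_curl \<Omega> u F)"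

definition V_space :: "(real^3) set \<Rightarrow> (real^3 \<Rightarrow> real^3) set" where
  "V_space \<Omega> = {u. \<exists>F. has_weak_curl \<Omega> u F}"

definition V_norm :: "(real^3) set \<Rightarrow> (real^3 \<Rightarrow> real^3) \<Rightarrow> real" where
  "V_norm \<Omega> u =
     sqrt (\<integral>x. u x \<bullet> u x + weak_curl \<Omega> u x \<bullet> weak_curl \<Omega> u x \<partial>lebesgue_on \<Omega>)"

definition V0_space :: "(real^3) set \<Rightarrow> (real^3 \<Rightarrow> real^3) set" where
  "V0_space \<Omega> = {u \<in> V_space \<Omega>. \<forall>\<psi>\<in>V_space \<Omega>.
     (\<integral>x. weak_curl \<Omega> u x \<bullet> \<psi> x \<partial>lebesgue_on \<Omega>) = (\<integral>x. u x \<bullet> weak_curl \<Omega> \<psi> x \<partial>lebesgue_on \<Omega>)}"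

definition cylinder :: "(real^3) set \<Rightarrow> real \<Rightarrow> ((real^3) \<times> real) set" where
  "cylinder \<Omega> T = \<Omega> \<times> {0<..<T}"

text \<open>The distributional time derivative in the cylinder; \<open>(0, 1)\<close> is the time direction.\<close>

definition has_weak_time_derivative ::
    "(real^3) set \<Rightarrow> real \<Rightarrow> ((real^3) \<times> real \<Rightarrow> real^3) \<Rightarrow> ((real^3) \<times> real \<Rightarrow> real^3) \<Rightarrow> bool" where
  "has_weak_time_derivative \<Omega> T u w \<longleftrightarrow>
     u \<in> L2_fields (cylinder \<Omega> T) \<and> w \<in> L2_fields (cylinder \<Omega> T) \<and>
     (\<forall>\<phi>\<in>test_functions (cylinder \<Omega> T).
        (\<integral>z. u z \<bullet> frechet_derivative \<phi> (at z) (0, 1) \<partial>lebesgue_on (cylinder \<Omega> T))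
        = - (\<integral>z. w z \<bullet> \<phi> z \<partial>lebesgue_on (cylinder \<Omega> T)))"


section \<open>Bochner spaces\<close>

text \<open>
  \<open>X\<close> is a space of fields with (semi)norm \<open>N\<close>. Strong measurability: almost everywhere limit, with
  respect to \<open>N\<close>, of a sequence of \<open>X\<close>-valued simple functions.
\<close>

definition bochner_measurable ::
    "real \<Rightarrow> (real^3 \<Rightarrow> real^3) set \<Rightarrow> ((real^3 \<Rightarrow> real^3) \<Rightarrow> real) \<Rightarrow> (real \<Rightarrow> real^3 \<Rightarrow> real^3) \<Rightarrow> bool" where
  "bochner_measurable T X N u \<longleftrightarrow>
     (AE t in lebesgue_on {0<..<T}. u t \<in> X) \<and>
     (\<exists>s. (\<forall>n. simple_function (lebesgue_on {0<..<T}) (s n) \<and> s n ` {0<..<T} \<subseteq> X) \<and>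
          (AE t in lebesgue_on {0<..<T}. (\<lambda>n. N (\<lambda>x. s n t x - u t x)) \<longlonglongrightarrow> 0))"

definition L2_bochner ::
    "real \<Rightarrow> (real^3 \<Rightarrow> real^3) set \<Rightarrow> ((real^3 \<Rightarrow> real^3) \<Rightarrow> real) \<Rightarrow> (real \<Rightarrow> real^3 \<Rightarrow> real^3) set" where
  "L2_bochner T X N = {u. bochner_measurable T X N u \<and>
                          integrable (lebesgue_on {0<..<T}) (\<lambda>t. (N (u t))\<^sup>2)}"

definition Linf_bochner ::
    "real \<Rightarrow> (real^3 \<Rightarrow> real^3) set \<Rightarrow> ((real^3 \<Rightarrow> real^3) \<Rightarrow> real) \<Rightarrow> (real \<Rightarrow> real^3 \<Rightarrow> real^3) set" where
  "Linf_bochner T X N = {u. bochner_measurable T X N u \<and>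
                            (\<exists>M. AE t in lebesgue_on {0<..<T}. N (u t) \<le> M)}"

text \<open>The map \<open>t \<mapsto> u(\<cdot>, t)\<close>.\<close>

definition time_slices :: "((real^3) \<times> real \<Rightarrow> real^3) \<Rightarrow> real \<Rightarrow> real^3 \<Rightarrow> real^3" where
  "time_slices u = (\<lambda>t x. u (x, t))"

text \<open>\<open>v\<close> is a representative of \<open>u\<close> in \<open>C([0,T]; H)\<close>.\<close>

definition continuous_rep ::
    "(real^3) set \<Rightarrow> real \<Rightarrow> ((real^3) \<times> real \<Rightarrow> real^3) \<Rightarrow> (real \<Rightarrow> real^3 \<Rightarrow> real^3) \<Rightarrow> bool" where
  "continuous_rep \<Omega> T u v \<longleftrightarrow>
     (\<forall>t\<in>{0..T}. v t \<in> L2_fields \<Omega>) \<and>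
     (\<forall>t\<in>{0..T}. ((\<lambda>s. L2_norm \<Omega> (\<lambda>x. v s x - v t x)) \<longlongrightarrow> 0) (at t within {0..T})) \<and>
     (AE t in lebesgue_on {0<..<T}. AE x in lebesgue_on \<Omega>. u (x, t) = v t x)"


section \<open>Weak solutions of the Maxwell problem\<close>

text \<open>
  Admissible test fields \<open>\<Phi> \<in> L\<^sup>2(0,T;W)\<close>, for \<open>W\<close> one of the spaces \<open>V\<close> and \<open>V\<^sub>0\<close>, with
  \<open>\<partial>\<^sub>t\<Phi> \<in> L\<^sup>2(Q\<^sub>T)\<^sup>3\<close> and \<open>\<Phi>(\<cdot>, T) = 0\<close>, together with representatives \<open>R\<close> of \<open>curl \<Phi>\<close>, \<open>D\<close> of \<open>\<partial>\<^sub>t\<Phi>\<close>,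
  and \<open>v\<close> of \<open>\<Phi>\<close> in \<open>C([0,T]; H)\<close>. All three exist for every such \<open>\<Phi>\<close> and are unique up to null
  sets. The field \<open>R\<close> is explicit because choosing a representative of the curl of each time slice
  separately by \<^const>\<open>weak_curl\<close> need not produce a jointly measurable field.
\<close>

definition maxwell_test_field ::
    "(real^3) set \<Rightarrow> real \<Rightarrow> (real^3 \<Rightarrow> real^3) set \<Rightarrow> ((real^3) \<times> real \<Rightarrow> real^3) \<Rightarrow>
     ((real^3) \<times> real \<Rightarrow> real^3) \<Rightarrow> ((real^3) \<times> real \<Rightarrow> real^3) \<Rightarrow> (real \<Rightarrow> real^3 \<Rightarrow> real^3) \<Rightarrow> bool" where
  "maxwell_test_field \<Omega> T W \<Phi> R D v \<longleftrightarrow>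
     \<Phi> \<in> L2_fields (cylinder \<Omega> T) \<and>
     time_slices \<Phi> \<in> L2_bochner T W (V_norm \<Omega>) \<and>
     R \<in> L2_fields (cylinder \<Omega> T) \<and>
     (AE t in lebesgue_on {0<..<T}. has_weak_curl \<Omega> (time_slices \<Phi> t) (time_slices R t)) \<and>
     has_weak_time_derivative \<Omega> T \<Phi> D \<and>
     continuous_rep \<Omega> T \<Phi> v \<and>
     (AE x in lebesgue_on \<Omega>. v T x = 0)"

definition maxwell_weak_solution ::
    "(real^3) set \<Rightarrow> real \<Rightarrow> (real^3 \<Rightarrow> real^3^3) \<Rightarrow> (real^3 \<Rightarrow> real^3^3) \<Rightarrow>
     ((real^3) \<times> real \<Rightarrow> real^3 \<Rightarrow> real^3) \<Rightarrow> (real^3 \<Rightarrow> real^3) \<Rightarrow> (real^3 \<Rightarrow> real^3) \<Rightarrow>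
     ((real^3) \<times> real \<Rightarrow> real^3) \<Rightarrow> ((real^3) \<times> real \<Rightarrow> real^3) \<Rightarrow> bool" where
  "maxwell_weak_solution \<Omega> T \<epsilon> \<mu> j e0 h0 e h \<longleftrightarrow>
     e \<in> L2_fields (cylinder \<Omega> T) \<and> h \<in> L2_fields (cylinder \<Omega> T) \<and>
     (\<forall>\<Phi> R D v. maxwell_test_field \<Omega> T (V0_space \<Omega>) \<Phi> R D v \<longrightarrow>
        - (\<integral>z. (\<epsilon> (fst z) *v e z) \<bullet> D z \<partial>lebesgue_on (cylinder \<Omega> T))
        + (\<integral>z. - (h z \<bullet> R z) + j z (e z) \<bullet> \<Phi> z \<partial>lebesgue_on (cylinder \<Omega> T))
        = (\<integral>x. (\<epsilon> x *v e0 x) \<bullet> v 0 x \<partial>lebesgue_on \<Omega>)) \<and>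
     (\<forall>\<Psi> R D v. maxwell_test_field \<Omega> T (V_space \<Omega>) \<Psi> R D v \<longrightarrow>
        - (\<integral>z. (\<mu> (fst z) *v h z) \<bullet> D z \<partial>lebesgue_on (cylinder \<Omega> T))
        + (\<integral>z. e z \<bullet> R z \<partial>lebesgue_on (cylinder \<Omega> T))
        = (\<integral>x. (\<mu> x *v h0 x) \<bullet> v 0 x \<partial>lebesgue_on \<Omega>))"


section \<open>Assumptions on the data\<close>

definition material_matrix :: "(real^3) set \<Rightarrow> real \<Rightarrow> (real^3 \<Rightarrow> real^3^3) \<Rightarrow> bool" where
  "material_matrix \<Omega> a A \<longleftrightarrow>
     (\<forall>i k. (\<lambda>x. A x $ i $ k) \<in> borel_measurable (lebesgue_on \<Omega>)) \<and>
     (\<exists>M. \<forall>x\<in>\<Omega>. \<forall>i k. \<bar>A x $ i $ k\<bar> \<le> M) \<and>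
     (\<forall>x\<in>\<Omega>. transpose (A x) = A x) \<and>
     (\<forall>x\<in>\<Omega>. \<forall>\<xi>. (A x *v \<xi>) \<bullet> \<xi> \<ge> a * (norm \<xi>)\<^sup>2)"

definition caratheodory :: "((real^3) \<times> real) set \<Rightarrow> ((real^3) \<times> real \<Rightarrow> real^3 \<Rightarrow> real^3) \<Rightarrow> bool" where
  "caratheodory Q f \<longleftrightarrow>
     (\<forall>\<xi>. (\<lambda>z. f z \<xi>) \<in> borel_measurable (lebesgue_on Q)) \<and>
     (AE z in lebesgue_on Q. continuous_on UNIV (f z))"

end

theory Submission
  imports Defs
begin

text \<open>
  Maxwell's equations have the form \<open>M u' + A u + B u = g\<close> for \<open>u = (e, h)\<close>, where \<open>M\<close> is multiplication by
  the material matrices, \<open>A\<close> is the skew-adjoint operator \<open>(e, h) \<mapsto> (- curl h, curl\<^sup>* e)\<close>, and \<open>B\<close> is the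
  monotone superposition operator of \<open>j\<^sub>1\<close> acting on \<open>e\<close>. The whole problem is posed in a Hilbert space of
  square integrable functions of space and time. There time differentiation is replaced by its inverse,
  the Volterra operator, which is bounded and commutes with \<open>M\<close> and \<open>A\<close>.

  The basic fact is the energy inequality for weak solutions of the linear equation
  (\<open>energy_inequality\<close>), with a Lipschitz weight in time. Formally one multiplies the equation by \<open>\<Theta> u\<close>
  and uses \<open>A u \<bullet> \<Theta> u = 0\<close>. For a weak solution this is justified by applying the resolvent of \<open>A\<close>:
  it commutes with the time operations, hence produces a strong solution of the same equation with
  smoothed data, and it converges strongly (\<open>smoothed_weak_solution\<close>, \<open>resolvent_tendsto\<close>).

  Linear weak solutions exist by duality (\<open>weak_solution_exists\<close>). For the monotone equation, \<open>B\<close> is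
  replaced by its Yosida approximation. The regularised equations are solved by a contraction in a
  weighted norm, and the energy inequality for differences shows that the solutions form a Cauchy
  sequence (\<open>monotone_weak_solution_exists\<close>). Convergence is strong, so continuity of \<open>B\<close> suffices
  to pass to the limit.

  Since every weak solution satisfies the energy inequality, the estimate follows by choosing the
  weights \<open>\<Theta>(t) = \<integral>\<^sub>t\<^sup>T k\<close> with indicator functions \<open>k\<close> (\<open>energy_estimate\<close>); monotonicity and
  \<open>j\<^sub>1(x, t, 0) = 0\<close> remove the nonlinear term.

  Fields on \<open>\<Omega>\<close> are extended by zero. The definition of \<open>V\<^sub>0\<close> says that its curl is the adjoint of the curl
  on \<open>V\<close>, which is closed on every time slice and hence on space-time fields. Finally, an admissible test
  field is the backward primitive of its time derivative (\<open>test_field_volterra\<close>), so the operator equation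
  contains the weak formulation.
\<close>

section \<open>Hilbert space preliminaries\<close>

lemma ex_orthogonal_projection:
  fixes S :: "'a::{real_inner,banach} set"
  assumes "closed S" "subspace S"
  shows "\<exists>y\<in>S. \<forall>z\<in>S. (x - y) \<bullet> z = 0"
proof -
  define D where "D = (\<lambda>z. (norm (x - z))\<^sup>2) ` S"
  define d where "d = Inf D"
  have ne: "D \<noteq> {}" using subspace_0[OF assms(2)] by (auto simp: D_def)
  have bdd: "bdd_below D" unfolding D_def by (rule bdd_belowI2[of _ 0]) auto
  have d_le: "d \<le> (norm (x - z))\<^sup>2" if "z \<in> S" for z
    unfolding d_def using that bdd by (intro cInf_lower) (auto simp: D_def)
  have "\<exists>z\<in>S. (norm (x - z))\<^sup>2 < d + inverse (real (Suc n))" for n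
  proof -
    have "Inf D < d + inverse (real (Suc n))" by (simp add: d_def)
    from cInf_lessD[OF ne this] show ?thesis by (auto simp: D_def)
  qed
  then obtain y where yS: "\<And>n. y n \<in> S"
    and y: "\<And>n. (norm (x - y n))\<^sup>2 < d + inverse (real (Suc n))" by metis
  have par: "(norm (y n - y k))\<^sup>2 \<le> 2 * inverse (real (Suc n)) + 2 * inverse (real (Suc k))" for n k
  proof -
    have "(1/2) *\<^sub>R (y n + y k) \<in> S"
      using yS assms(2) by (intro subspace_scale subspace_add) auto
    note * = d_le[OF this]
    have "(norm (y n - y k))\<^sup>2 = 2 * (norm (x - y n))\<^sup>2 + 2 * (norm (x - y k))\<^sup>2
        - 4 * (norm (x - (1/2) *\<^sub>R (y n + y k)))\<^sup>2"
      unfolding power2_norm_eq_inner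
      by (simp add: inner_diff_left inner_diff_right inner_add_left inner_add_right inner_commute algebra_simps)
    with * y[of n] y[of k] show ?thesis by linarith
  qed
  have "Cauchy y"
  proof (rule metric_CauchyI)
    fix e :: real assume "0 < e"
    then have "0 < e\<^sup>2 / 4" by simp
    from reals_Archimedean[OF this] obtain N where N: "inverse (real (Suc N)) < e\<^sup>2/4" by blast
    have "dist (y n) (y k) < e" if "n \<ge> N" "k \<ge> N" for n k
    proof -
      have "inverse (real (Suc n)) \<le> inverse (real (Suc N))" "inverse (real (Suc k)) \<le> inverse (real (Suc N))"
        using that by (auto intro!: le_imp_inverse_le)
      then have "(norm (y n - y k))\<^sup>2 < e\<^sup>2" using par[of n k] N by linarith
      then show ?thesis using \<open>0 < e\<close> by (simp add: dist_norm power2_less_imp_less)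
    qed
    then show "\<exists>M. \<forall>m\<ge>M. \<forall>n\<ge>M. dist (y m) (y n) < e" by blast
  qed
  then obtain l where l: "y \<longlonglongrightarrow> l" using Cauchy_convergent convergent_def by blast
  have lS: "l \<in> S" using closed_sequentially[OF assms(1)] yS l by blast
  have lim: "(\<lambda>n. (norm (x - y n))\<^sup>2) \<longlonglongrightarrow> (norm (x - l))\<^sup>2"
    by (intro tendsto_intros l)
  have "(\<lambda>n. d + inverse (real (Suc n))) \<longlonglongrightarrow> d + 0"
    by (intro tendsto_intros LIMSEQ_inverse_real_of_nat)
  from LIMSEQ_le[OF lim this] y have ld: "(norm (x - l))\<^sup>2 \<le> d" by (force intro: less_imp_le)
  have "(x - l) \<bullet> z = 0" if "z \<in> S" for z
  proof (rule ccontr)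
    assume nz: "(x - l) \<bullet> z \<noteq> 0"
    define t where "t = ((x - l) \<bullet> z) / (z \<bullet> z)"
    have zz: "z \<bullet> z > 0" using nz by (auto simp: inner_gt_zero_iff)
    have "l + t *\<^sub>R z \<in> S" using lS that assms(2) by (intro subspace_add subspace_scale)
    from d_le[OF this] ld have "(norm (x - l))\<^sup>2 \<le> (norm (x - (l + t *\<^sub>R z)))\<^sup>2" by linarith
    also have "\<dots> = (norm (x - l))\<^sup>2 - 2 * t * ((x - l) \<bullet> z) + t\<^sup>2 * (z \<bullet> z)"
      unfolding power2_norm_eq_inner
      by (simp add: inner_diff_left inner_diff_right inner_add_left inner_add_right inner_commute
            algebra_simps power2_eq_square)
    also have "\<dots> = (norm (x - l))\<^sup>2 - ((x - l) \<bullet> z)\<^sup>2 / (z \<bullet> z)"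
      using zz by (simp add: t_def field_simps power2_eq_square)
    finally have "((x - l) \<bullet> z)\<^sup>2 / (z \<bullet> z) \<le> 0" by simp
    then show False using zz nz by (simp add: divide_le_0_iff)
  qed
  with lS show ?thesis by blast
qed

text \<open>
  A closed subspace is its own second orthogonal complement. Membership is checked in this way
  throughout, because operators are given by closed graphs.
\<close>

lemma mem_closed_subspace_if_orthogonal:
  fixes S :: "'a::{real_inner,banach} set"
  assumes "closed S" "subspace S" and "\<And>z. (\<And>s. s \<in> S \<Longrightarrow> z \<bullet> s = 0) \<Longrightarrow> z \<bullet> x = 0"
  shows "x \<in> S"
proof -
  obtain y where y: "y \<in> S" "\<forall>z\<in>S. (x - y) \<bullet> z = 0"
    using ex_orthogonal_projection[OF assms(1,2)] by blast
  have "(x - y) \<bullet> x = 0" using y(2) by (intro assms(3)) blast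
  moreover have "(x - y) \<bullet> y = 0" using y by blast
  ultimately have "(x - y) \<bullet> (x - y) = 0" by (simp add: inner_diff_right)
  with y(1) show ?thesis by simp
qed

lemma closed_subspace_closure:
  fixes S :: "'a::real_normed_vector set"
  assumes "subspace S" shows "subspace (closure S)"
proof (rule subspaceI)
  show "0 \<in> closure S" using subspace_0[OF assms] closure_subset by blast
next
  fix x y assume "x \<in> closure S" "y \<in> closure S"
  then obtain f g where f: "\<And>n. f n \<in> S" "f \<longlonglongrightarrow> x" and g: "\<And>n. g n \<in> S" "g \<longlonglongrightarrow> y"
    unfolding closure_sequential by blast
  have "(\<lambda>n. f n + g n) \<longlonglongrightarrow> x + y" "\<And>n. f n + g n \<in> S"
    using f g assms by (auto intro: tendsto_add subspace_add)
  then show "x + y \<in> closure S" unfolding closure_sequential by (intro exI[of _ "\<lambda>n. f n + g n"]) auto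
next
  fix c :: real and x assume "x \<in> closure S"
  then obtain f where f: "\<And>n. f n \<in> S" "f \<longlonglongrightarrow> x"
    unfolding closure_sequential by blast
  have "(\<lambda>n. c *\<^sub>R f n) \<longlonglongrightarrow> c *\<^sub>R x" "\<And>n. c *\<^sub>R f n \<in> S"
    using f assms by (auto intro: tendsto_intros subspace_scale)
  then show "c *\<^sub>R x \<in> closure S" unfolding closure_sequential by (intro exI[of _ "\<lambda>n. c *\<^sub>R f n"]) auto
qed

text \<open>
  The functional is a relation \<open>Z\<close>, since it is only defined on the range of an operator that is not
  known to be injective. If \<open>n\<close> is the component of \<open>(0, 1)\<close> orthogonal to \<open>Z\<close>, its second entry is
  nonzero by the bound, and \<open>n \<bullet> (y, r) = 0\<close> can be solved for \<open>r\<close>.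
\<close>

lemma riesz_dominated:
  fixes Z :: "('a::{real_inner,banach} \<times> real) set"
  assumes Z: "subspace Z" and C: "\<And>y r. (y, r) \<in> Z \<Longrightarrow> \<bar>r\<bar> \<le> C * norm y"
  shows "\<exists>u. \<forall>(y, r)\<in>Z. r = u \<bullet> y"
proof -
  obtain p where p: "p \<in> closure Z" "\<forall>z\<in>closure Z. ((0, 1) - p) \<bullet> z = 0"
    using ex_orthogonal_projection[of "closure Z" "(0, 1)"] closed_subspace_closure[OF Z] closed_closure by blast
  define n where "n = (0, 1) - p"
  have dom: "\<bar>snd z\<bar> \<le> C * norm (fst z)" if z: "z \<in> closure Z" for z
  proof -
    from z obtain f where f: "\<And>n. f n \<in> Z" "f \<longlonglongrightarrow> z" unfolding closure_sequential by blast
    have "(\<lambda>n. \<bar>snd (f n)\<bar>) \<longlonglongrightarrow> \<bar>snd z\<bar>" "(\<lambda>n. C * norm (fst (f n))) \<longlonglongrightarrow> C * norm (fst z)"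
      by (intro tendsto_intros f)+
    moreover have "\<bar>snd (f n)\<bar> \<le> C * norm (fst (f n))" for n using C f(1)[of n] by (cases "f n") auto
    ultimately show ?thesis by (meson LIMSEQ_le)
  qed
  have n2: "snd n \<noteq> 0"
  proof
    assume s: "snd n = 0"
    have "n \<bullet> n = n \<bullet> (0, 1) - n \<bullet> p" by (simp add: n_def inner_diff_right)
    also have "\<dots> = 0" using p s by (cases n) (auto simp: n_def[symmetric])
    finally have "p = (0, 1)" by (simp add: n_def)
    with dom[OF p(1)] show False by simp
  qed
  have "r = (- (1 / snd n) *\<^sub>R fst n) \<bullet> y" if "(y, r) \<in> Z" for y r
  proof -
    have "n \<bullet> (y, r) = 0" using p(2) that closure_subset[of Z] by (auto simp: n_def)
    then have "fst n \<bullet> y + snd n * r = 0" by (cases n) simp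
    then have "snd n * r = - (fst n \<bullet> y)" by linarith
    then have "r = - (fst n \<bullet> y) / snd n" using n2 by (metis nonzero_mult_div_cancel_left)
    then show ?thesis by simp
  qed
  then show ?thesis by (intro exI[of _ "- (1 / snd n) *\<^sub>R fst n"]) auto
qed

text \<open>
  Banach's fixed point theorem for an equivalent norm, given through its square \<open>q\<close>.
\<close>

lemma contraction_fixpoint:
  fixes F :: "'a::{real_inner,banach} \<Rightarrow> 'a"
  assumes "0 < c" and lo: "\<And>v. c * (norm v)\<^sup>2 \<le> q v" and hi: "\<And>v. q v \<le> C * (norm v)\<^sup>2"
    and \<rho>: "0 \<le> \<rho>" "\<rho> < 1" and F: "\<And>u v. q (F u - F v) \<le> \<rho>\<^sup>2 * q (u - v)"
  shows "\<exists>u. F u = u"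
proof -
  define x where "x n = (F ^^ n) 0" for n
  have xS: "x (Suc n) = F (x n)" for n by (simp add: x_def)
  define D where "D = q (x 1 - x 0)"
  have q0: "0 \<le> q v" for v using lo[of v] \<open>0 < c\<close> by (meson mult_nonneg_nonneg less_imp_le order_trans zero_le_power2)
  have step: "q (x (Suc n) - x n) \<le> (\<rho> ^ n)\<^sup>2 * D" for n
  proof (induction n)
    case (Suc n)
    have "q (x (Suc (Suc n)) - x (Suc n)) \<le> \<rho>\<^sup>2 * q (x (Suc n) - x n)"
      using F by (simp only: xS)
    also have "\<dots> \<le> \<rho>\<^sup>2 * ((\<rho> ^ n)\<^sup>2 * D)" by (intro mult_left_mono Suc.IH) simp
    finally show ?case by (simp add: power_mult_distrib mult.assoc)
  qed (simp add: D_def)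
  have nstep: "norm (x (Suc n) - x n) \<le> \<rho> ^ n * sqrt (D / c)" for n
  proof -
    have "c * (norm (x (Suc n) - x n))\<^sup>2 \<le> (\<rho> ^ n)\<^sup>2 * D" using lo step order_trans by blast
    then have "(norm (x (Suc n) - x n))\<^sup>2 \<le> (\<rho> ^ n)\<^sup>2 * (D / c)" using \<open>0 < c\<close> by (simp add: field_simps)
    also have "\<dots> = (\<rho> ^ n * sqrt (D / c))\<^sup>2" using q0 \<open>0 < c\<close> by (simp add: power_mult_distrib D_def)
    finally show ?thesis
      by (rule power2_le_imp_le) (use \<rho> q0[of "x 1 - x 0"] \<open>0 < c\<close> in \<open>simp add: D_def\<close>)
  qed
  have "summable (\<lambda>n. x (Suc n) - x n)"
    by (rule summable_comparison_test'[OF summable_mult2[OF summable_geometric] nstep]) (use \<rho> in simp)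
  from summable_LIMSEQ[OF this] have "(\<lambda>m. x m - x 0) \<longlonglongrightarrow> (\<Sum>n. x (Suc n) - x n)"
    by (simp add: sum_lessThan_telescope)
  from tendsto_add[OF this tendsto_const[of "x 0"]] obtain l where l: "x \<longlonglongrightarrow> l" by auto
  have lF: "(\<lambda>n. F (x n)) \<longlonglongrightarrow> F l"
  proof -
    have "norm (F (x n) - F l) \<le> sqrt (C / c) * norm (x n - l)" for n
    proof -
      have "c * (norm (F (x n) - F l))\<^sup>2 \<le> \<rho>\<^sup>2 * q (x n - l)" using lo F order_trans by blast
      also have "\<dots> \<le> 1 * q (x n - l)" using \<rho> q0 by (intro mult_right_mono) (auto simp: power_le_one)
      also have "\<dots> \<le> C * (norm (x n - l))\<^sup>2" using hi by simp
      finally have "(norm (F (x n) - F l))\<^sup>2 \<le> C / c * (norm (x n - l))\<^sup>2" using \<open>0 < c\<close> by (simp add: field_simps)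
      then have "sqrt ((norm (F (x n) - F l))\<^sup>2) \<le> sqrt (C / c * (norm (x n - l))\<^sup>2)" by (rule real_sqrt_le_mono)
      then show ?thesis by (simp only: real_sqrt_mult real_sqrt_abs abs_norm_cancel)
    qed
    note le = this
    have "(\<lambda>n. sqrt (C / c) * norm (x n - l)) \<longlonglongrightarrow> sqrt (C / c) * norm (l - l)"
      by (intro tendsto_intros l)
    then have lim0: "(\<lambda>n. sqrt (C / c) * norm (x n - l)) \<longlonglongrightarrow> 0" by simp
    have "(\<lambda>n. F (x n) - F l) \<longlonglongrightarrow> 0"
      by (rule Lim_null_comparison[OF always_eventually lim0]) (intro allI le)
    then show ?thesis using LIM_zero_iff by blast
  qed
  have "(\<lambda>n. x (Suc n)) \<longlonglongrightarrow> l" using l by (rule LIMSEQ_Suc)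
  then have "F l = l" using LIMSEQ_unique[OF lF] by (simp add: xS)
  then show ?thesis by blast
qed

section \<open>Abstract evolution equations with a skew-adjoint generator\<close>

text \<open>
  Operators are linear relations, so that multivalued ones are admitted: for fields on the whole space,
  the curl in \<open>\<Omega>\<close> leaves the values outside \<open>\<Omega>\<close> undetermined.
\<close>

definition adjoint_relation :: "('a::real_inner \<times> 'b::real_inner) set \<Rightarrow> ('b \<times> 'a) set" where
  "adjoint_relation G = {(v, b). \<forall>(u, a)\<in>G. u \<bullet> b = a \<bullet> v}"

definition skew_adjoint :: "('a::real_inner \<times> 'a) set \<Rightarrow> bool" where
  "skew_adjoint A \<longleftrightarrow> subspace A \<and>
     (\<forall>u a. (u, a) \<in> A \<longleftrightarrow> (\<forall>(v, b)\<in>A. a \<bullet> v = - (u \<bullet> b)))"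

lemma skew_adjointD: "skew_adjoint A \<Longrightarrow> (u, a) \<in> A \<Longrightarrow> (v, b) \<in> A \<Longrightarrow> a \<bullet> v = - (u \<bullet> b)"
  unfolding skew_adjoint_def by blast

lemma skew_adjointI: "skew_adjoint A \<Longrightarrow> (\<And>v b. (v, b) \<in> A \<Longrightarrow> a \<bullet> v = - (u \<bullet> b)) \<Longrightarrow> (u, a) \<in> A"
  unfolding skew_adjoint_def by blast

lemma skew_adjoint_0: "skew_adjoint A \<Longrightarrow> (u, a) \<in> A \<Longrightarrow> a \<bullet> u = 0"
  using skew_adjointD[of A u a u a] by (simp add: inner_commute)

lemma skew_adjoint_diff: "skew_adjoint A \<Longrightarrow> (u, a) \<in> A \<Longrightarrow> (v, b) \<in> A \<Longrightarrow> (u - v, a - b) \<in> A"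
  using subspace_diff[of A "(u, a)" "(v, b)"] by (simp add: skew_adjoint_def)

definition coercive :: "('a::real_inner \<Rightarrow> 'a) \<Rightarrow> real \<Rightarrow> bool" where
  "coercive M m \<longleftrightarrow> bounded_linear M \<and> (\<forall>u v. M u \<bullet> v = u \<bullet> M v) \<and> 0 < m \<and> (\<forall>u. m * (norm u)\<^sup>2 \<le> M u \<bullet> u)"

lemma coerciveD:
  assumes "coercive M m"
  shows "bounded_linear M" "M u \<bullet> v = u \<bullet> M v" "0 < m" "m * (norm u)\<^sup>2 \<le> M u \<bullet> u"
  using assms by (auto simp: coercive_def)

text \<open>
  By skew-adjointness the operator \<open>M - \<delta> A\<close> is bounded below, so \<open>f\<close> defines a bounded functional on
  its range. The representing vector satisfies the weak form of the resolvent equation, and a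
  skew-adjoint operator coincides with its weak extension.
\<close>

lemma resolvent_exists:
  fixes A :: "('a::{real_inner,banach} \<times> 'a) set"
  assumes A: "skew_adjoint A" and M: "coercive M m" and \<delta>: "\<delta> \<noteq> 0"
  shows "\<exists>v b. (v, b) \<in> A \<and> M v + \<delta> *\<^sub>R b = f"
proof -
  interpret M: bounded_linear M by (rule coerciveD[OF M])
  note M = coerciveD[OF M]
  define Z where "Z = (\<lambda>(w, b). (M w - \<delta> *\<^sub>R b, f \<bullet> w)) ` A"
  have lin: "linear (\<lambda>(w, b). (M w - \<delta> *\<^sub>R b, f \<bullet> w))"
    by (rule linearI) (auto simp: M.add M.scaleR inner_add_right algebra_simps)
  have "subspace Z" unfolding Z_def using A by (intro linear_subspace_image lin) (simp add: skew_adjoint_def)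
  moreover have "\<bar>r\<bar> \<le> norm f / m * norm y" if "(y, r) \<in> Z" for y r
  proof -
    from that obtain w b where wb: "(w, b) \<in> A" "y = M w - \<delta> *\<^sub>R b" "r = f \<bullet> w"
      by (auto simp: Z_def)
    have "m * (norm w)\<^sup>2 \<le> y \<bullet> w"
      using M(4)[of w] skew_adjoint_0[OF A wb(1)] by (simp add: wb(2) inner_diff_left)
    also have "\<dots> \<le> norm y * norm w" by (rule norm_cauchy_schwarz)
    finally have "norm w * (m * norm w) \<le> norm w * norm y" by (simp add: power2_eq_square ac_simps)
    then have "m * norm w \<le> norm y" by (cases "norm w = 0") (auto simp: mult_le_cancel_left)
    then have "norm w \<le> norm y / m" using M(3) by (simp add: field_simps)
    have "\<bar>r\<bar> \<le> norm f * norm w" unfolding wb(3) by (rule Cauchy_Schwarz_ineq2)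
    also have "\<dots> \<le> norm f * (norm y / m)" by (intro mult_left_mono) (fact, simp)
    finally show ?thesis by simp
  qed
  ultimately obtain v where v: "\<forall>(y, r)\<in>Z. r = v \<bullet> y" using riesz_dominated by blast
  have "(v, (1 / \<delta>) *\<^sub>R (f - M v)) \<in> A"
  proof (rule skew_adjointI[OF A])
    fix w b assume "(w, b) \<in> A"
    then have "(M w - \<delta> *\<^sub>R b, f \<bullet> w) \<in> Z" by (force simp: Z_def)
    with v have "f \<bullet> w = v \<bullet> (M w - \<delta> *\<^sub>R b)" by blast
    then have "f \<bullet> w - M v \<bullet> w = - (\<delta> * (v \<bullet> b))" by (simp add: inner_diff_right M(2))
    then have "(f \<bullet> w - M v \<bullet> w) / \<delta> = - (v \<bullet> b)" using \<delta> by (simp add: field_simps)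
    then show "(1 / \<delta>) *\<^sub>R (f - M v) \<bullet> w = - (v \<bullet> b)" by (simp add: inner_diff_left)
  qed
  with \<delta> show ?thesis by (intro exI[of _ v] exI[of _ "(1 / \<delta>) *\<^sub>R (f - M v)"]) simp
qed

text \<open>
  Both bounds come from testing the resolvent equation with \<open>v\<close>, which gives \<open>f \<bullet> v = M v \<bullet> v\<close>.
\<close>

lemma resolvent_bounds:
  assumes A: "skew_adjoint A" and M: "coercive M m"
    and v: "(v, b) \<in> A" "M v + \<delta> *\<^sub>R b = f"
  shows "m * norm v \<le> norm f" and "f = M u \<Longrightarrow> M v \<bullet> v \<le> M u \<bullet> u"
proof -
  interpret M: bounded_linear M by (rule coerciveD[OF M])
  note M = coerciveD[OF M]
  have fv: "f \<bullet> v = M v \<bullet> v" using skew_adjoint_0[OF A v(1)] by (simp flip: v(2) add: inner_add_left)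
  have "m * (norm v)\<^sup>2 \<le> f \<bullet> v" using fv M(4) by simp
  also have "\<dots> \<le> norm f * norm v" by (rule norm_cauchy_schwarz)
  finally have "norm v * (m * norm v) \<le> norm v * norm f" by (simp add: power2_eq_square ac_simps)
  then show "m * norm v \<le> norm f" by (cases "norm v = 0") (auto simp: mult_le_cancel_left)
  assume "f = M u"
  then have "M u \<bullet> v = M v \<bullet> v" using fv by simp
  moreover have "0 \<le> M (u - v) \<bullet> (u - v)"
    using M(4)[of "u - v"] M(3) by (meson mult_nonneg_nonneg less_imp_le order_trans zero_le_power2)
  ultimately show "M v \<bullet> v \<le> M u \<bullet> u"
    using M(2)[of v u] by (simp add: M.diff inner_diff_left inner_diff_right inner_commute)
qed

text \<open>
  The orthogonality assumption says that \<open>u\<close> lies in the closure of the domain, because the orthogonal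
  complement of the domain consists of the values of \<open>A\<close> at zero. On the domain the resolvents
  converge with a rate; the uniform bound extends the convergence to the closure.
\<close>

lemma resolvent_tendsto:
  fixes A :: "('a::{real_inner,banach} \<times> 'a) set"
  assumes A: "skew_adjoint A" and M: "coercive M m"
    and v: "\<And>n. (v n, b n) \<in> A" "\<And>n. M (v n) + \<delta> n *\<^sub>R b n = M u"
    and \<delta>: "\<delta> \<longlonglongrightarrow> 0" "\<And>n. 0 < \<delta> n"
    and u: "\<And>a. (0, a) \<in> A \<Longrightarrow> u \<bullet> a = 0"
  shows "v \<longlonglongrightarrow> u"
proof -
  interpret M: bounded_linear M by (rule coerciveD[OF M])
  note M' = coerciveD[OF M]
  obtain C where C: "0 < C" "\<And>x. norm (M x) \<le> norm x * C" using M.pos_bounded by blast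
  have sub: "subspace (fst ` A)" using A by (intro linear_subspace_image linear_fst) (simp add: skew_adjoint_def)
  have "u \<in> closure (fst ` A)"
  proof (rule mem_closed_subspace_if_orthogonal)
    show "closed (closure (fst ` A))" "subspace (closure (fst ` A))"
      using closed_subspace_closure[OF sub] by auto
    fix z assume z: "\<And>s. s \<in> closure (fst ` A) \<Longrightarrow> z \<bullet> s = 0"
    have "(0, z) \<in> A"
    proof (rule skew_adjointI[OF A])
      fix w c assume "(w, c) \<in> A"
      then have "w \<in> closure (fst ` A)" using closure_subset[of "fst ` A"] by force
      then show "z \<bullet> w = - (0 \<bullet> c)" using z by simp
    qed
    then show "z \<bullet> u = 0" using u inner_commute by metis
  qed
  show ?thesis
  proof (rule LIMSEQ_I)
    fix r :: real assume r: "0 < r"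
    define k where "k = 1 + C / m"
    have k: "0 < k" using divide_pos_pos[OF C(1) M'(3)] by (simp add: k_def)
    define e where "e = r / (2 * k)"
    have e: "0 < e" using r k by (simp add: e_def)
    obtain w where "w \<in> fst ` A" "dist w u < e"
      using \<open>u \<in> closure _\<close> e unfolding closure_approachable by blast
    then obtain c where wc: "(w, c) \<in> A" and wu: "norm (w - u) < e" by (auto simp: dist_norm)
    have "(\<lambda>n. \<delta> n * norm c / m) \<longlonglongrightarrow> 0 * norm c / m"
      by (intro tendsto_intros \<delta>) (use M'(3) in auto)
    then have "(\<lambda>n. \<delta> n * norm c / m) \<longlonglongrightarrow> 0" by simp
    from LIMSEQ_D[OF this, of "r / 2"] r obtain N where N: "\<And>n. n \<ge> N \<Longrightarrow> \<bar>\<delta> n * norm c / m\<bar> < r / 2"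
      by auto
    have "norm (v n - u) < r" if n: "n \<ge> N" for n
    proof -
      \<comment> \<open>\<open>v n - w\<close> is the resolvent of \<open>M (u - w) - \<delta> n c\<close>\<close>
      have "(v n - w, b n - c) \<in> A" by (rule skew_adjoint_diff[OF A v(1) wc])
      moreover have "M (v n - w) + \<delta> n *\<^sub>R (b n - c) = M (u - w) - \<delta> n *\<^sub>R c"
        using v(2)[of n] by (simp add: M.diff algebra_simps)
      ultimately have "m * norm (v n - w) \<le> norm (M (u - w) - \<delta> n *\<^sub>R c)"
        by (rule resolvent_bounds(1)[OF A M])
      also have "\<dots> \<le> norm (u - w) * C + \<delta> n * norm c"
        using norm_triangle_ineq4[of "M (u - w)" "\<delta> n *\<^sub>R c"] C(2)[of "u - w"] \<delta>(2)[of n] by simp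
      also have "\<dots> \<le> e * C + \<delta> n * norm c"
        using wu C(1) by (simp add: norm_minus_commute)
      finally have "norm (v n - w) \<le> e * C / m + \<delta> n * norm c / m"
        using M'(3) by (simp add: field_simps)
      moreover have "norm (v n - u) \<le> norm (v n - w) + norm (w - u)"
        using norm_triangle_ineq[of "v n - w" "w - u"] by simp
      moreover have "e * C / m + e = r / 2"
      proof -
        have "k \<noteq> 0" using k by simp
        have "e * C / m + e = e * k" by (simp add: k_def algebra_simps)
        also have "\<dots> = r / 2" using \<open>k \<noteq> 0\<close> by (simp add: e_def)
        finally show ?thesis .
      qed
      moreover have "\<delta> n * norm c / m < r / 2" using N[OF n] by (meson abs_ge_self le_less_trans)
      moreover have "b < 2 * h" if "a \<le> p + q" "b \<le> a + d" "p + e = h" "q < h" "d < e" for a b d h p q :: real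
        using that by linarith
      ultimately have "norm (v n - u) < 2 * (r / 2)" using wu by blast
      then show ?thesis by simp
    qed
    then show "\<exists>no. \<forall>n\<ge>no. norm (v n - u) < r" by blast
  qed
qed

text \<open>
  The equation \<open>M u' + A u = g\<close> in operator form. The space \<open>'x\<close> consists of functions of time with
  values in \<open>'h\<close>, and \<open>A\<close> is \<open>A0\<close> acting at every time. \<open>E\<close> extends a vector to a constant function of
  time and \<open>K\<close> integrates from the initial time; their adjoints are integration over the whole interval
  and integration up to the final time. Time operations commute with \<open>M\<close> and preserve the graph of \<open>A\<close>.
\<close>

locale evolution =
  fixes M :: "'x::{real_inner,banach} \<Rightarrow> 'x" and m :: real
    and M0 :: "'h::{real_inner,banach} \<Rightarrow> 'h" and m0 :: real
    and A :: "('x \<times> 'x) set" and A0 :: "('h \<times> 'h) set"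
    and E :: "'h \<Rightarrow> 'x" and E' :: "'x \<Rightarrow> 'h" and K K' :: "'x \<Rightarrow> 'x"
  assumes M: "coercive M m" and M0: "coercive M0 m0"
    and A: "skew_adjoint A" and A0: "skew_adjoint A0"
    and E: "bounded_linear E" and E': "bounded_linear E'" and K: "bounded_linear K" and K': "bounded_linear K'"
    and K_adj: "\<And>u v. K u \<bullet> v = u \<bullet> K' v" and E_adj: "\<And>y v. E y \<bullet> v = y \<bullet> E' v"
    and K'_eq: "\<And>u. K' u = E (E' u) - K u"
    and KM: "\<And>u. K (M u) = M (K u)" and EM: "\<And>y. E (M0 y) = M (E y)"
    and A_K: "\<And>u a. (u, a) \<in> A \<Longrightarrow> (K u, K a) \<in> A"
    and A_E: "\<And>y b. (y, b) \<in> A0 \<Longrightarrow> (E y, E b) \<in> A"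
begin

sublocale M: bounded_linear M by (rule coerciveD[OF M])
sublocale M0: bounded_linear M0 by (rule coerciveD[OF M0])
sublocale E: bounded_linear E by (rule E)
sublocale E': bounded_linear E' by (rule E')
sublocale K: bounded_linear K by (rule K)
sublocale K': bounded_linear K' by (rule K')

lemmas M_sym = coerciveD(2)[OF M] and m_pos = coerciveD(3)[OF M] and M_ge = coerciveD(4)[OF M]
lemmas m0_pos = coerciveD(3)[OF M0] and M0_ge = coerciveD(4)[OF M0]

lemma M0_nonneg: "0 \<le> M0 u \<bullet> u"
  using M0_ge[of u] m0_pos by (meson mult_nonneg_nonneg less_imp_le order_trans zero_le_power2)

lemma A_K': "(u, a) \<in> A \<Longrightarrow> (K' u, K' a) \<in> A"
  using skew_adjointD[OF A _ A_K] K_adj by (intro skew_adjointI[OF A]) (metis inner_commute)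

text \<open>
  \<open>M u' + A u = g\<close>, \<open>u(0) = u\<^sub>0\<close> in weak form: the test function is \<open>w = K' d\<close>, i.e. \<open>d = - w'\<close> and \<open>w(T) = 0\<close>.
\<close>

definition weak_solution :: "'h \<Rightarrow> 'x \<Rightarrow> 'x \<Rightarrow> bool" where
  "weak_solution u0 g u \<longleftrightarrow>
     (\<forall>d a. (K' d, a) \<in> A \<longrightarrow> M u \<bullet> d - u \<bullet> a = g \<bullet> K' d + M (E u0) \<bullet> d)"

lemma weak_solutionD:
  "weak_solution u0 g u \<Longrightarrow> (K' d, a) \<in> A \<Longrightarrow> M u \<bullet> d - u \<bullet> a = g \<bullet> K' d + M (E u0) \<bullet> d"
  unfolding weak_solution_def by blast

lemma weak_solution_diff:
  assumes "weak_solution u0 g u" "weak_solution v0 h v"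
  shows "weak_solution (u0 - v0) (g - h) (u - v)"
  unfolding weak_solution_def
proof (intro allI impI)
  fix d a assume "(K' d, a) \<in> A"
  from weak_solutionD[OF assms(1) this] weak_solutionD[OF assms(2) this]
  show "M (u - v) \<bullet> d - (u - v) \<bullet> a = (g - h) \<bullet> K' d + M (E (u0 - v0)) \<bullet> d"
    by (simp add: M.diff E.diff inner_diff_left)
qed

lemma weak_solution_limit:
  assumes "\<And>n. weak_solution u0 (g n) (u n)" "g \<longlonglongrightarrow> h" "u \<longlonglongrightarrow> v"
  shows "weak_solution u0 h v"
  unfolding weak_solution_def
proof (intro allI impI)
  fix d a assume da: "(K' d, a) \<in> A"
  have "(\<lambda>n. M (u n) \<bullet> d - u n \<bullet> a) \<longlonglongrightarrow> M v \<bullet> d - v \<bullet> a"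
    by (intro tendsto_intros M.tendsto assms)
  moreover have "(\<lambda>n. g n \<bullet> K' d + M (E u0) \<bullet> d) \<longlonglongrightarrow> h \<bullet> K' d + M (E u0) \<bullet> d"
    by (intro tendsto_intros assms)
  ultimately show "M v \<bullet> d - v \<bullet> a = h \<bullet> K' d + M (E u0) \<bullet> d"
    using LIMSEQ_unique weak_solutionD[OF assms(1) da] by simp
qed

text \<open>
  Multiplication by a Lipschitz function of time with derivative \<open>\<Theta>d\<close> and boundary values \<open>a\<close>, \<open>b\<close>. The
  last condition is the integrated product rule for \<open>\<Theta> M v \<bullet> v\<close> with \<open>v = E y + K p\<close>, that is
  \<open>v' = p\<close> and \<open>v(0) = y\<close>.
\<close>

definition time_weight :: "('x \<Rightarrow> 'x) \<Rightarrow> ('x \<Rightarrow> 'x) \<Rightarrow> real \<Rightarrow> real \<Rightarrow> bool" where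
  "time_weight \<Theta> \<Theta>d a b \<longleftrightarrow> bounded_linear \<Theta> \<and> bounded_linear \<Theta>d \<and> (\<forall>u v. \<Theta> u \<bullet> v = u \<bullet> \<Theta> v) \<and>
     (\<forall>u c. (u, c) \<in> A \<longrightarrow> (\<Theta> u, \<Theta> c) \<in> A) \<and>
     (\<forall>y p. 2 * (M p \<bullet> \<Theta> (E y + K p)) + \<Theta>d (E y + K p) \<bullet> M (E y + K p)
        = b * (M0 (y + E' p) \<bullet> (y + E' p)) - a * (M0 y \<bullet> y))"

lemma resolvent_dual:
  assumes "(x, a) \<in> A" "(z, bz) \<in> A" "M z + (- \<delta>) *\<^sub>R bz = y"
  shows "(M x + \<delta> *\<^sub>R a) \<bullet> z = x \<bullet> y"
  using skew_adjointD[OF A assms(1,2)] by (simp flip: assms(3) add: inner_add_left inner_diff_right M_sym)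

text \<open>
  The resolvent \<open>v\<close> of \<open>M u\<close> is a strong solution. Since \<open>b = M (u - v) / \<delta>\<close>, the conclusion reads
  \<open>M v' + b = M q\<close> and \<open>v(0) = v0\<close>: the same equation with resolvents as data. It follows from the weak
  equation tested with resolvents of the dual problem, because resolvents commute with \<open>K\<close> and \<open>E\<close>.
\<close>

lemma smoothed_weak_solution:
  assumes sol: "weak_solution u0 g u" and \<delta>: "0 < \<delta>"
    and v: "(v, b) \<in> A" "M v + \<delta> *\<^sub>R b = M u"
    and v0: "(v0, b0) \<in> A0" "M0 v0 + \<delta> *\<^sub>R b0 = M0 u0"
    and q: "(q, c) \<in> A" "M q + \<delta> *\<^sub>R c = g"
  shows "v = E v0 + K (q - (1 / \<delta>) *\<^sub>R (u - v))"
proof -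
  define v' where "v' = E v0 + K (q - (1 / \<delta>) *\<^sub>R (u - v))"
  have "(v - v') \<bullet> y = 0" for y
  proof -
    obtain z bz where z: "(z, bz) \<in> A" "M z + (- \<delta>) *\<^sub>R bz = y"
      using resolvent_exists[OF A M, of "- \<delta>" y] \<delta> by auto
    note dual = resolvent_dual[OF _ z]
    have 1: "M u \<bullet> z = v \<bullet> y" using dual[OF v(1)] by (simp add: v(2))
    have "M (E u0) = M (E v0) + \<delta> *\<^sub>R E b0"
      by (simp only: EM[symmetric] v0(2)[symmetric] E.add E.scaleR)
    then have 2: "M (E u0) \<bullet> z = E v0 \<bullet> y" using dual[OF A_E[OF v0(1)]] by simp
    have "K g = M (K q) + \<delta> *\<^sub>R K c" by (simp only: KM[symmetric] q(2)[symmetric] K.add K.scaleR)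
    then have 3: "g \<bullet> K' z = K q \<bullet> y" using dual[OF A_K[OF q(1)]] by (simp flip: K_adj)
    have "M (K u) = M (K v) + \<delta> *\<^sub>R K b" by (simp only: KM[symmetric] v(2)[symmetric] K.add K.scaleR)
    then have "M (K u) \<bullet> z = K v \<bullet> y" using dual[OF A_K[OF v(1)]] by simp
    moreover have "\<delta> * (K u \<bullet> bz) = K u \<bullet> M z - K u \<bullet> y"
      by (simp flip: z(2) add: inner_diff_right)
    ultimately have "\<delta> * (K u \<bullet> bz) = K v \<bullet> y - K u \<bullet> y" by (simp add: M_sym)
    then have 4: "u \<bullet> K' bz = - (1 / \<delta>) * (K (u - v) \<bullet> y)"
      using \<delta> by (simp add: K_adj[symmetric] K.diff inner_diff_left field_simps)
    from weak_solutionD[OF sol A_K'[OF z(1)]] 1 2 3 4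
    show ?thesis by (simp add: v'_def inner_diff_left inner_add_left K.diff K.scaleR)
  qed
  then have "v - v' = 0" by (metis inner_eq_zero_iff)
  then show ?thesis by (simp add: v'_def)
qed

text \<open>
  For the smoothed solution the inequality is the product rule, since \<open>b \<bullet> \<Theta> v = 0\<close> by
  skew-symmetry. Only the initial energy has to be kept: resolvents decrease it, and the final energy is
  dropped because \<open>b \<ge> 0\<close>. Then \<open>\<delta>\<close> tends to zero.
\<close>

lemma energy_inequality:
  assumes sol: "weak_solution u0 g u" and tw: "time_weight \<Theta> \<Theta>d a b" and "0 \<le> a" "0 \<le> b"
  shows "- (\<Theta>d u \<bullet> M u) \<le> a * (M0 u0 \<bullet> u0) + 2 * (g \<bullet> \<Theta> u)"
proof -
  interpret \<Theta>: bounded_linear \<Theta> using tw by (simp add: time_weight_def)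
  interpret \<Theta>d: bounded_linear \<Theta>d using tw by (simp add: time_weight_def)
  have sym: "\<Theta> x \<bullet> y = x \<bullet> \<Theta> y" for x y using tw by (simp add: time_weight_def)
  have \<Theta>A: "(x, c) \<in> A \<Longrightarrow> (\<Theta> x, \<Theta> c) \<in> A" for x c using tw by (simp add: time_weight_def)
  have prod: "2 * (M p \<bullet> \<Theta> (E y + K p)) + \<Theta>d (E y + K p) \<bullet> M (E y + K p)
        = b * (M0 (y + E' p) \<bullet> (y + E' p)) - a * (M0 y \<bullet> y)" for y p
    using tw unfolding time_weight_def by blast
  define \<delta> where "\<delta> n = inverse (real (Suc n))" for n
  have \<delta>: "0 < \<delta> n" for n by (simp add: \<delta>_def)
  have \<delta>0: "\<delta> \<longlonglongrightarrow> 0" unfolding \<delta>_def by (rule LIMSEQ_inverse_real_of_nat)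
  have "\<forall>n. \<exists>v b. (v, b) \<in> A \<and> M v + \<delta> n *\<^sub>R b = M u"
    using resolvent_exists[OF A M] \<delta> by (metis less_irrefl)
  then obtain v b' where v: "\<And>n. (v n, b' n) \<in> A" "\<And>n. M (v n) + \<delta> n *\<^sub>R b' n = M u" by metis
  have "\<forall>n. \<exists>v b. (v, b) \<in> A \<and> M v + \<delta> n *\<^sub>R b = g"
    using resolvent_exists[OF A M] \<delta> by (metis less_irrefl)
  then obtain q c where q: "\<And>n. (q n, c n) \<in> A" "\<And>n. M (q n) + \<delta> n *\<^sub>R c n = g" by metis
  have "\<forall>n. \<exists>v b. (v, b) \<in> A0 \<and> M0 v + \<delta> n *\<^sub>R b = M0 u0"
    using resolvent_exists[OF A0 M0] \<delta> by (metis less_irrefl)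
  then obtain v0 b0 where v0: "\<And>n. (v0 n, b0 n) \<in> A0" "\<And>n. M0 (v0 n) + \<delta> n *\<^sub>R b0 n = M0 u0" by metis
  have vu: "v \<longlonglongrightarrow> u"
  proof (rule resolvent_tendsto[OF A M v \<delta>0 \<delta>])
    show "u \<bullet> a = 0" if "(0, a) \<in> A" for a using weak_solutionD[OF sol, of 0 a] that by simp
  qed
  have ineq: "- (\<Theta>d (v n) \<bullet> M (v n)) \<le> a * (M0 u0 \<bullet> u0) + 2 * (g \<bullet> \<Theta> (v n) + q n \<bullet> \<Theta> (M (u - v n)))" for n
  proof -
    define p where "p = q n - (1 / \<delta> n) *\<^sub>R (u - v n)"
    have veq: "v n = E (v0 n) + K p"
      unfolding p_def by (rule smoothed_weak_solution[OF sol \<delta> v v0 q])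
    have bM: "\<delta> n *\<^sub>R b' n = M (u - v n)" using v(2)[of n] by (simp add: M.diff algebra_simps)
    have Mp: "M p = M (q n) - b' n"
      using \<delta>[of n] unfolding p_def by (simp only: M.diff M.scaleR bM[unfolded M.diff, symmetric]) simp
    have "b' n \<bullet> \<Theta> (v n) = 0"
      using skew_adjointD[OF A v(1)[of n] \<Theta>A[OF v(1)[of n]]] sym[of "v n" "b' n"] by (simp add: inner_commute)
    then have "M p \<bullet> \<Theta> (v n) = M (q n) \<bullet> \<Theta> (v n)" by (simp add: Mp inner_diff_left)
    also have "M (q n) = g - \<delta> n *\<^sub>R c n" using q(2)[of n] by (simp add: algebra_simps)
    also have "(g - \<delta> n *\<^sub>R c n) \<bullet> \<Theta> (v n) = g \<bullet> \<Theta> (v n) + q n \<bullet> \<Theta> (\<delta> n *\<^sub>R b' n)"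
      using skew_adjointD[OF A q(1)[of n] \<Theta>A[OF v(1)[of n]]]
      by (simp add: inner_diff_left \<Theta>.scaleR)
    finally have Mpv: "M p \<bullet> \<Theta> (v n) = g \<bullet> \<Theta> (v n) + q n \<bullet> \<Theta> (M (u - v n))" by (simp add: bM)
    have "a * (M0 (v0 n) \<bullet> v0 n) \<le> a * (M0 u0 \<bullet> u0)"
      by (intro mult_left_mono resolvent_bounds(2)[OF A0 M0 v0] \<open>0 \<le> a\<close> refl)
    moreover have "0 \<le> b * (M0 (v0 n + E' p) \<bullet> (v0 n + E' p))"
      by (intro mult_nonneg_nonneg M0_nonneg \<open>0 \<le> b\<close>)
    ultimately show ?thesis using prod[of p "v0 n"] Mpv by (simp flip: veq)
  qed
  have lhs: "(\<lambda>n. - (\<Theta>d (v n) \<bullet> M (v n))) \<longlonglongrightarrow> - (\<Theta>d u \<bullet> M u)"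
    by (intro tendsto_intros M.tendsto \<Theta>d.tendsto vu)
  have q_bd: "norm (q n) \<le> norm g / m" for n
    using resolvent_bounds(1)[OF A M q] m_pos by (simp add: field_simps)
  have null: "(\<lambda>n. q n \<bullet> \<Theta> (M (u - v n))) \<longlonglongrightarrow> 0"
  proof (rule Lim_null_comparison[OF always_eventually])
    show "\<forall>n. norm (q n \<bullet> \<Theta> (M (u - v n))) \<le> norm g / m * norm (\<Theta> (M (u - v n)))"
    proof
      fix n
      have "norm (q n \<bullet> \<Theta> (M (u - v n))) \<le> norm (q n) * norm (\<Theta> (M (u - v n)))"
        using Cauchy_Schwarz_ineq2 by (simp del: norm_conv_dist)
      also have "\<dots> \<le> norm g / m * norm (\<Theta> (M (u - v n)))" by (intro mult_right_mono q_bd) simp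
      finally show "norm (q n \<bullet> \<Theta> (M (u - v n))) \<le> norm g / m * norm (\<Theta> (M (u - v n)))" .
    qed
    have "(\<lambda>n. norm g / m * norm (\<Theta> (M (u - v n)))) \<longlonglongrightarrow> norm g / m * norm (\<Theta> (M (u - u)))"
      by (intro tendsto_intros M.tendsto \<Theta>.tendsto vu)
    then show "(\<lambda>n. norm g / m * norm (\<Theta> (M (u - v n)))) \<longlonglongrightarrow> 0" by (simp add: M.zero \<Theta>.zero)
  qed
  have "(\<lambda>n. a * (M0 u0 \<bullet> u0) + 2 * (g \<bullet> \<Theta> (v n) + q n \<bullet> \<Theta> (M (u - v n))))
      \<longlonglongrightarrow> a * (M0 u0 \<bullet> u0) + 2 * (g \<bullet> \<Theta> u + 0)"
    by (intro tendsto_intros \<Theta>.tendsto vu null)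
  from LIMSEQ_le[OF lhs this] ineq show ?thesis by auto
qed

text \<open>
  Existence by duality. Testing the backward problem with \<open>\<Theta> w\<close>, where \<open>\<Theta>\<close> has derivative \<open>1\<close>, bounds the
  test function \<open>w\<close> and its initial value by the adjoint operator applied to it. The data functional is
  thus dominated and represented by a vector \<open>u\<close>. The zeroth-order term \<open>s u\<close> is included for the
  regularised equations below; it only improves the bound.
\<close>

lemma weak_solution_exists:
  assumes tw: "time_weight \<Theta> (\<lambda>x. x) 1 b" and pos: "\<And>v. 0 \<le> v \<bullet> \<Theta> v" and "0 \<le> s"
  shows "\<exists>u. weak_solution u0 (g - s *\<^sub>R u) u"
proof -
  interpret \<Theta>: bounded_linear \<Theta> using tw by (simp add: time_weight_def)
  have sym: "\<Theta> x \<bullet> y = x \<bullet> \<Theta> y" for x y using tw by (simp add: time_weight_def)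
  have \<Theta>A: "(x, c) \<in> A \<Longrightarrow> (\<Theta> x, \<Theta> c) \<in> A" for x c using tw by (simp add: time_weight_def)
  have prod: "2 * (M p \<bullet> \<Theta> (E y + K p)) + (E y + K p) \<bullet> M (E y + K p)
        = b * (M0 (y + E' p) \<bullet> (y + E' p)) - 1 * (M0 y \<bullet> y)" for y p
    using tw unfolding time_weight_def by blast
  obtain C where C: "0 < C" "\<And>x. norm (\<Theta> x) \<le> norm x * C" using \<Theta>.pos_bounded by blast
  define Z where "Z = (\<lambda>(d, a). (M d - a + s *\<^sub>R K' d, g \<bullet> K' d + M (E u0) \<bullet> d)) `
    ((\<lambda>(d, a). (K' d, a)) -` A)"
  have lin1: "linear (\<lambda>(d, a). (K' d, a :: 'x))"
    by (rule linearI) (auto simp: K'.add K'.scaleR)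
  have lin2: "linear (\<lambda>(d, a). (M d - a + s *\<^sub>R K' d, g \<bullet> K' d + M (E u0) \<bullet> d))"
    by (rule linearI) (auto simp: K'.add K'.scaleR M.add M.scaleR inner_add_right algebra_simps)
  have "subspace Z" unfolding Z_def
    using A by (intro linear_subspace_image linear_subspace_vimage lin1 lin2) (simp add: skew_adjoint_def)
  moreover have "\<bar>r\<bar> \<le> (norm g * (2 * C / m) + norm (M0 u0) * sqrt (4 * C\<^sup>2 / (m * m0))) * norm y"
    if yr: "(y, r) \<in> Z" for y r
  proof -
    from yr obtain d a where da: "(K' d, a) \<in> A" "y = M d - a + s *\<^sub>R K' d" "r = g \<bullet> K' d + M (E u0) \<bullet> d"
      by (auto simp: Z_def)
    define w e where "w = K' d" and "e = E' d"
    have weq: "w = E e + K (- d)" by (simp add: w_def e_def K'_eq K.neg)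
    have id: "2 * (M d \<bullet> \<Theta> w) = M0 e \<bullet> e + w \<bullet> M w"
    proof -
      have "e + E' (- d) = 0" by (simp add: e_def E'.neg)
      with prod[of "- d" e] show ?thesis by (simp add: weq[symmetric] M.neg)
    qed
    have "a \<bullet> \<Theta> w = 0"
      using skew_adjointD[OF A da(1) \<Theta>A[OF da(1)]] sym[of w a] by (simp add: inner_commute w_def)
    then have "2 * (y \<bullet> \<Theta> w) = M0 e \<bullet> e + w \<bullet> M w + 2 * s * (w \<bullet> \<Theta> w)"
      using id by (simp add: da(2) inner_add_left inner_diff_left w_def)
    then have "m0 * (norm e)\<^sup>2 + m * (norm w)\<^sup>2 \<le> 2 * (y \<bullet> \<Theta> w)"
      using M0_ge[of e] M_ge[of w] mult_nonneg_nonneg[OF \<open>0 \<le> s\<close> pos[of w]] by (simp add: inner_commute)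
    also have "y \<bullet> \<Theta> w \<le> norm y * (norm w * C)"
      by (rule order_trans[OF norm_cauchy_schwarz]) (intro mult_left_mono C norm_ge_zero)
    finally have bd: "m0 * (norm e)\<^sup>2 + m * (norm w)\<^sup>2 \<le> 2 * C * norm y * norm w" by (simp add: ac_simps)
    have "m * (norm w)\<^sup>2 \<le> 2 * C * norm y * norm w"
      using bd mult_nonneg_nonneg[OF less_imp_le[OF m0_pos] zero_le_power2[of "norm e"]] by linarith
    then have "norm w * (m * norm w) \<le> norm w * (2 * C * norm y)" by (simp add: power2_eq_square ac_simps)
    then have w: "norm w \<le> 2 * C / m * norm y"
      using m_pos C(1) by (cases "norm w = 0") (auto simp: mult_le_cancel_left field_simps)
    have "m0 * (norm e)\<^sup>2 \<le> 2 * C * norm y * norm w"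
      using bd mult_nonneg_nonneg[OF less_imp_le[OF m_pos] zero_le_power2[of "norm w"]] by linarith
    also have "\<dots> \<le> 2 * C * norm y * (2 * C / m * norm y)" by (intro mult_left_mono w) (use C(1) in auto)
    finally have "(norm e)\<^sup>2 \<le> 4 * C\<^sup>2 / (m * m0) * (norm y)\<^sup>2"
      using m_pos m0_pos by (simp add: field_simps power2_eq_square)
    then have "sqrt ((norm e)\<^sup>2) \<le> sqrt (4 * C\<^sup>2 / (m * m0) * (norm y)\<^sup>2)" by (rule real_sqrt_le_mono)
    then have e: "norm e \<le> sqrt (4 * C\<^sup>2 / (m * m0)) * norm y"
      by (simp only: real_sqrt_mult real_sqrt_abs abs_norm_cancel)
    have "r = g \<bullet> w + M0 u0 \<bullet> e" using E_adj[of "M0 u0" d] by (simp add: da(3) w_def e_def EM)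
    then have "\<bar>r\<bar> \<le> norm g * norm w + norm (M0 u0) * norm e"
      using Cauchy_Schwarz_ineq2[of g w] Cauchy_Schwarz_ineq2[of "M0 u0" e] by linarith
    also have "\<dots> \<le> norm g * (2 * C / m * norm y) + norm (M0 u0) * (sqrt (4 * C\<^sup>2 / (m * m0)) * norm y)"
      by (intro add_mono mult_left_mono w e) auto
    finally show ?thesis by (simp add: algebra_simps)
  qed
  ultimately obtain u where u: "\<forall>(y, r)\<in>Z. r = u \<bullet> y" using riesz_dominated by blast
  have "weak_solution u0 (g - s *\<^sub>R u) u"
    unfolding weak_solution_def
  proof (intro allI impI)
    fix d a assume "(K' d, a) \<in> A"
    then have "(M d - a + s *\<^sub>R K' d, g \<bullet> K' d + M (E u0) \<bullet> d) \<in> Z" by (force simp: Z_def)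
    with u have "g \<bullet> K' d + M (E u0) \<bullet> d = u \<bullet> (M d - a + s *\<^sub>R K' d)" by blast
    then show "M u \<bullet> d - u \<bullet> a = (g - s *\<^sub>R u) \<bullet> K' d + M (E u0) \<bullet> d"
      by (simp add: inner_add_right inner_diff_right inner_diff_left M_sym)
  qed
  then show ?thesis by blast
qed

end

text \<open>
  A monotone perturbation \<open>B\<close> with resolvents \<open>J \<tau> = (1 + \<tau> B)\<inverse>\<close>. The Yosida approximation
  \<open>B (J \<tau> u) = (u - J \<tau> u) / \<tau>\<close> turns the equation into a fixed point problem for the linear equation
  with an additional term \<open>u / \<tau>\<close>. The map is a contraction in the norm with weight \<open>Q\<close>: the derivative of
  \<open>Q\<close> is \<open>-1\<close>, so the energy inequality also controls the norm of the solution without weight, which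
  gives a contraction factor below one. The difference of the approximations for \<open>\<tau>\<close> and \<open>\<sigma>\<close> is bounded
  by a multiple of \<open>\<tau> + \<sigma>\<close> in the squared norm by monotonicity, so they converge strongly, and
  continuity of \<open>B\<close> suffices to pass to the limit.
\<close>

theorem (in evolution) monotone_weak_solution_exists:
  assumes \<Theta>: "time_weight \<Theta> (\<lambda>x. x) 1 b'" "\<And>v. 0 \<le> v \<bullet> \<Theta> v"
    and Q: "time_weight Q (\<lambda>x. - x) a b" "0 \<le> a" "0 \<le> b" "0 < c" "\<And>v. c * (norm v)\<^sup>2 \<le> v \<bullet> Q v"
    and \<tau>0: "0 < \<tau>0" and L: "0 \<le> L"
    and JB: "\<And>\<tau> u. 0 < \<tau> \<Longrightarrow> \<tau> < \<tau>0 \<Longrightarrow> u - J \<tau> u = \<tau> *\<^sub>R B (J \<tau> u)"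
    and J_nonexp: "\<And>\<tau> u v. 0 < \<tau> \<Longrightarrow> \<tau> < \<tau>0 \<Longrightarrow>
        (J \<tau> u - J \<tau> v) \<bullet> Q (J \<tau> u - J \<tau> v) \<le> (u - v) \<bullet> Q (u - v)"
    and J_le: "\<And>\<tau> u. 0 < \<tau> \<Longrightarrow> \<tau> < \<tau>0 \<Longrightarrow> norm (J \<tau> u) \<le> norm u"
    and B_le: "\<And>u. norm (B u) \<le> L * norm u"
    and B_mono: "\<And>u v. 0 \<le> (B u - B v) \<bullet> Q (u - v)"
    and B_cont: "continuous_on UNIV B"
  shows "\<exists>u. weak_solution u0 (g - B u) u"
proof -
  interpret Q: bounded_linear Q using Q(1) by (simp add: time_weight_def)
  have Q_sym: "Q x \<bullet> y = x \<bullet> Q y" for x y using Q(1) by (simp add: time_weight_def)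
  obtain C where C: "0 < C" "\<And>x. norm (Q x) \<le> norm x * C" using Q.pos_bounded by blast
  have CS: "\<bar>x \<bullet> Q y\<bar> \<le> C * (norm x * norm y)" for x y
  proof -
    have "\<bar>x \<bullet> Q y\<bar> \<le> norm x * norm (Q y)" by (rule Cauchy_Schwarz_ineq2)
    also have "\<dots> \<le> norm x * (norm y * C)" by (intro mult_left_mono C) simp
    finally show ?thesis by (simp add: ac_simps)
  qed
  define q where "q v = v \<bullet> Q v" for v
  have q_lo: "c * (norm v)\<^sup>2 \<le> q v" for v using Q(5) by (simp add: q_def)
  have q_hi: "q v \<le> C * (norm v)\<^sup>2" for v using CS[of v v] by (simp add: q_def power2_eq_square)
  have q0: "0 \<le> q v" for v using q_lo[of v] Q(4) by (meson mult_nonneg_nonneg less_imp_le order_trans zero_le_power2)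
  have qCS: "2 * (x \<bullet> Q y) \<le> q x + q y" for x y
    using q0[of "x - y"] Q_sym[of y x] by (simp add: q_def Q.diff inner_diff_left inner_diff_right inner_commute)
  have en: "m * (norm d)\<^sup>2 \<le> a * (M0 y \<bullet> y) + 2 * (h \<bullet> Q d)" if "weak_solution y h d" for d h y
    using energy_inequality[OF that Q(1-3)] M_ge[of d] by (simp add: inner_commute)
  \<comment> \<open>solve the Yosida-regularised equation by a fixed point argument\<close>
  have step: "\<exists>u. weak_solution u0 (g - B (J \<tau> u)) u" if \<tau>: "0 < \<tau>" "\<tau> < \<tau>0" for \<tau>
  proof -
    have "\<exists>F. \<forall>w. weak_solution u0 (g + (1/\<tau>) *\<^sub>R J \<tau> w - (1/\<tau>) *\<^sub>R F w) (F w)"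
      using weak_solution_exists[OF \<Theta>, of "1/\<tau>" u0] \<tau>(1) by (intro choice) auto
    then obtain F where F: "\<And>w. weak_solution u0 (g + (1/\<tau>) *\<^sub>R J \<tau> w - (1/\<tau>) *\<^sub>R F w) (F w)" by blast
    define k where "k = 1 + \<tau> * m / C"
    have k: "1 < k" using \<tau> C(1) m_pos by (simp add: k_def)
    have "q (F u - F v) \<le> (sqrt (1 / k))\<^sup>2 * q (u - v)" for u v
    proof -
      define d where "d = F u - F v"
      define j where "j = J \<tau> u - J \<tau> v"
      have "weak_solution 0 ((1/\<tau>) *\<^sub>R (j - d)) d"
        using weak_solution_diff[OF F[of u] F[of v]] by (simp add: d_def j_def algebra_simps)
      from en[OF this] have "m * (norm d)\<^sup>2 \<le> 2 / \<tau> * (j \<bullet> Q d - q d)"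
        by (simp add: M0.zero inner_diff_left q_def)
      also have "2 / \<tau> * (j \<bullet> Q d - q d) = 1 / \<tau> * (2 * (j \<bullet> Q d) - 2 * q d)" by (simp add: algebra_simps)
      also have "\<dots> \<le> 1 / \<tau> * (q j - q d)" using qCS[of j d] \<tau> by (intro mult_left_mono) auto
      finally have "\<tau> * (m * (norm d)\<^sup>2) \<le> q j - q d" using \<tau> by (simp add: field_simps)
      moreover have "\<tau> * m / C * q d \<le> \<tau> * m / C * (C * (norm d)\<^sup>2)"
        using \<tau> C(1) m_pos by (intro mult_left_mono q_hi) auto
      then have "\<tau> * m / C * q d \<le> \<tau> * (m * (norm d)\<^sup>2)" using C(1) by simp
      moreover have "q j \<le> q (u - v)" using J_nonexp[OF \<tau>] by (simp add: q_def j_def)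
      ultimately have "k * q d \<le> q (u - v)" by (simp add: k_def algebra_simps)
      then show ?thesis using k by (simp add: d_def[symmetric] field_simps)
    qed
    from contraction_fixpoint[OF Q(4) q_lo q_hi _ _ this] k obtain u where u: "F u = u" by auto
    have "(1/\<tau>) *\<^sub>R (u - J \<tau> u) = B (J \<tau> u)" using JB[OF \<tau>] \<tau> by simp
    moreover have "g + (1/\<tau>) *\<^sub>R J \<tau> u - (1/\<tau>) *\<^sub>R u = g - (1/\<tau>) *\<^sub>R (u - J \<tau> u)" by (simp add: algebra_simps)
    ultimately show ?thesis using F[of u] u by metis
  qed
  define \<tau> where "\<tau> n = \<tau>0 / 2 * inverse (real (Suc n))" for n
  have \<tau>: "0 < \<tau> n" "\<tau> n < \<tau>0" for n
  proof -
    show "0 < \<tau> n" using \<tau>0 by (simp add: \<tau>_def)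
    have "\<tau> n \<le> \<tau>0 / 2 * 1" unfolding \<tau>_def using \<tau>0 by (intro mult_left_mono) (auto simp: inverse_le_1_iff)
    then show "\<tau> n < \<tau>0" using \<tau>0 by simp
  qed
  have "(\<lambda>n. \<tau>0 / 2 * inverse (real (Suc n))) \<longlonglongrightarrow> \<tau>0 / 2 * 0"
    by (intro tendsto_intros LIMSEQ_inverse_real_of_nat)
  then have \<tau>_lim: "\<tau> \<longlonglongrightarrow> 0" by (simp add: \<tau>_def[abs_def])
  from step[OF \<tau>] obtain u where u: "\<And>n. weak_solution u0 (g - B (J (\<tau> n) (u n))) (u n)" by metis
  define j \<beta> where "j n = J (\<tau> n) (u n)" and "\<beta> n = B (j n)" for n
  have uj: "u n = j n + \<tau> n *\<^sub>R \<beta> n" for n using JB[OF \<tau>(1)[of n] \<tau>(2)[of n], of "u n"] by (simp add: j_def \<beta>_def algebra_simps)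
  have B0: "B 0 = 0" using B_le[of 0] by simp
  define R where "R = 1 + (a * (M0 u0 \<bullet> u0) + 2 * C * norm g) / m"
  have D0: "0 \<le> a * (M0 u0 \<bullet> u0)" using Q(2) M0_nonneg by simp
  have "0 \<le> 2 * C * norm g" using C(1) by simp
  with D0 have "0 \<le> (a * (M0 u0 \<bullet> u0) + 2 * C * norm g) / m" using m_pos by simp
  then have R1: "1 \<le> R" by (simp add: R_def)
  \<comment> \<open>a bound that does not depend on \<open>\<tau>\<close>\<close>
  have u_le: "norm (u n) \<le> R" for n
  proof (cases "norm (u n) \<le> 1")
    case False
    have "0 \<le> \<beta> n \<bullet> Q (j n)" using B_mono[of "j n" 0] by (simp add: B0 \<beta>_def)
    then have "0 \<le> \<beta> n \<bullet> Q (u n)"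
      using mult_nonneg_nonneg[OF less_imp_le[OF \<tau>(1)[of n]] q0[of "\<beta> n"]]
      by (simp add: uj Q.add Q.scaleR inner_add_right q_def)
    with en[OF u[of n]] have "m * (norm (u n))\<^sup>2 \<le> a * (M0 u0 \<bullet> u0) + 2 * (g \<bullet> Q (u n))"
      by (simp add: inner_diff_left j_def[symmetric] \<beta>_def[symmetric])
    also have "\<dots> \<le> a * (M0 u0 \<bullet> u0) * norm (u n) + 2 * (C * (norm g * norm (u n)))"
    proof -
      have "a * (M0 u0 \<bullet> u0) * 1 \<le> a * (M0 u0 \<bullet> u0) * norm (u n)"
        using False by (intro mult_left_mono D0) simp
      then show ?thesis using CS[of g "u n"] by simp
    qed
    finally have "norm (u n) * (m * norm (u n)) \<le> norm (u n) * (a * (M0 u0 \<bullet> u0) + 2 * C * norm g)"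
      by (simp add: power2_eq_square algebra_simps)
    moreover have "0 < norm (u n)" using False by linarith
    ultimately have "m * norm (u n) \<le> a * (M0 u0 \<bullet> u0) + 2 * C * norm g" by (simp only: mult_le_cancel_left_pos)
    then have "norm (u n) \<le> (a * (M0 u0 \<bullet> u0) + 2 * C * norm g) / m" using m_pos by (simp add: field_simps)
    then show ?thesis by (simp add: R_def)
  qed (use R1 in linarith)
  have \<beta>_le: "norm (\<beta> n) \<le> L * R" for n
  proof -
    have "norm (\<beta> n) \<le> L * norm (j n)" by (simp add: \<beta>_def B_le)
    also have "\<dots> \<le> L * R" using J_le[OF \<tau>(1)[of n] \<tau>(2)[of n], of "u n"] u_le[of n] L by (intro mult_left_mono) (auto simp: j_def)
    finally show ?thesis .
  qed
  have LR: "0 \<le> L * R" using L R1 by simp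
  define G where "G = 4 * C * (L * R)\<^sup>2 / m"
  have G: "0 \<le> G" using C(1) m_pos by (simp add: G_def)
  \<comment> \<open>split \<open>u n - u k\<close> into the resolvents, where monotonicity applies, and a remainder of order \<open>\<tau> n + \<tau> k\<close>\<close>
  have diff: "(norm (u n - u k))\<^sup>2 \<le> G * (\<tau> n + \<tau> k)" for n k
  proof -
    define d where "d = u n - u k"
    have "weak_solution 0 (\<beta> k - \<beta> n) d"
      using weak_solution_diff[OF u[of n] u[of k]] by (simp add: d_def j_def \<beta>_def)
    from en[OF this] have "m * (norm d)\<^sup>2 \<le> 2 * ((\<beta> k - \<beta> n) \<bullet> Q d)" by (simp add: M0.zero)
    also have "(\<beta> k - \<beta> n) \<bullet> Q d = - ((\<beta> n - \<beta> k) \<bullet> Q (j n - j k))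
        + (\<beta> k - \<beta> n) \<bullet> Q (\<tau> n *\<^sub>R \<beta> n - \<tau> k *\<^sub>R \<beta> k)"
    proof -
      have "d = (j n - j k) + (\<tau> n *\<^sub>R \<beta> n - \<tau> k *\<^sub>R \<beta> k)" by (simp add: d_def uj)
      then show ?thesis by (simp only: Q.add inner_add_right) (simp add: inner_diff_left)
    qed
    also have "\<dots> \<le> C * (norm (\<beta> k - \<beta> n) * norm (\<tau> n *\<^sub>R \<beta> n - \<tau> k *\<^sub>R \<beta> k))"
      using B_mono[of "j n" "j k"] CS[of "\<beta> k - \<beta> n" "\<tau> n *\<^sub>R \<beta> n - \<tau> k *\<^sub>R \<beta> k"] by (simp add: \<beta>_def)
    also have "\<dots> \<le> C * ((L * R + L * R) * (\<tau> n * (L * R) + \<tau> k * (L * R)))"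
    proof (intro mult_left_mono mult_mono)
      show "norm (\<beta> k - \<beta> n) \<le> L * R + L * R"
        using norm_triangle_ineq4[of "\<beta> k" "\<beta> n"] \<beta>_le[of k] \<beta>_le[of n] by linarith
      have nb: "norm (\<tau> i *\<^sub>R \<beta> i) \<le> \<tau> i * (L * R)" for i
        using \<tau>(1)[of i] \<beta>_le[of i] by simp
      show "norm (\<tau> n *\<^sub>R \<beta> n - \<tau> k *\<^sub>R \<beta> k) \<le> \<tau> n * (L * R) + \<tau> k * (L * R)"
        using norm_triangle_ineq4[of "\<tau> n *\<^sub>R \<beta> n" "\<tau> k *\<^sub>R \<beta> k"] nb[of n] nb[of k]
        by linarith
    qed (use LR C(1) in auto)
    finally have "m * (norm d)\<^sup>2 \<le> 4 * C * (L * R)\<^sup>2 * (\<tau> n + \<tau> k)"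
      by (simp add: power2_eq_square algebra_simps)
    then show ?thesis using m_pos by (simp add: G_def d_def field_simps)
  qed
  have "Cauchy u"
  proof (rule metric_CauchyI)
    fix e :: real assume e: "0 < e"
    have "(\<lambda>n. G * \<tau> n) \<longlonglongrightarrow> G * 0" by (intro tendsto_intros \<tau>_lim)
    from LIMSEQ_D[OF this, of "e\<^sup>2 / 2"] e obtain N where N: "\<And>n. n \<ge> N \<Longrightarrow> \<bar>G * \<tau> n\<bar> < e\<^sup>2 / 2" by auto
    have "dist (u n) (u k) < e" if "n \<ge> N" "k \<ge> N" for n k
    proof -
      have "(norm (u n - u k))\<^sup>2 < e\<^sup>2"
        using diff[of n k] N[OF that(1)] N[OF that(2)] abs_ge_self[of "G * \<tau> n"] abs_ge_self[of "G * \<tau> k"]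
        unfolding distrib_left by linarith
      then show ?thesis using e by (simp add: dist_norm power2_less_imp_less)
    qed
    then show "\<exists>M. \<forall>m\<ge>M. \<forall>n\<ge>M. dist (u m) (u n) < e" by blast
  qed
  then obtain l where l: "u \<longlonglongrightarrow> l" using Cauchy_convergent convergent_def by blast
  have "(\<lambda>n. \<tau> n *\<^sub>R \<beta> n) \<longlonglongrightarrow> 0"
  proof (rule Lim_null_comparison[OF always_eventually])
    show "\<forall>n. norm (\<tau> n *\<^sub>R \<beta> n) \<le> \<tau> n * (L * R)" using \<tau>(1) \<beta>_le by (auto simp: abs_of_pos)
    have "(\<lambda>n. \<tau> n * (L * R)) \<longlonglongrightarrow> 0 * (L * R)" by (intro tendsto_intros \<tau>_lim)
    then show "(\<lambda>n. \<tau> n * (L * R)) \<longlonglongrightarrow> 0" by simp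
  qed
  from tendsto_diff[OF l this] have "j \<longlonglongrightarrow> l" by (simp add: uj)
  then have "\<beta> \<longlonglongrightarrow> B l" unfolding \<beta>_def[abs_def]
    by (intro continuous_on_tendsto_compose[OF B_cont]) auto
  then have lim: "(\<lambda>n. g - \<beta> n) \<longlonglongrightarrow> g - B l" by (intro tendsto_intros)
  have "weak_solution u0 (g - \<beta> n) (u n)" for n using u[of n] by (simp add: j_def \<beta>_def)
  then have "weak_solution u0 (g - B l) l" by (rule weak_solution_limit[OF _ lim l])
  then show ?thesis by blast
qed

section \<open>The Hilbert space of square integrable functions\<close>

definition sq_integrable :: "('a::euclidean_space \<Rightarrow> 'b::euclidean_space) \<Rightarrow> bool" where
  "sq_integrable f \<longleftrightarrow> f \<in> borel_measurable lborel \<and> integrable lborel (\<lambda>x. (norm (f x))\<^sup>2)"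

lemma norm_add_sq_le: "(norm (a + b :: 'a::real_inner))\<^sup>2 \<le> 2 * (norm a)\<^sup>2 + 2 * (norm b)\<^sup>2"
proof -
  have "0 \<le> (norm (a - b))\<^sup>2" by simp
  then show ?thesis by (simp add: power2_norm_eq_inner inner_add_left inner_add_right inner_diff_left inner_diff_right inner_commute)
qed

lemma abs_inner_le_sq: "\<bar>a \<bullet> b\<bar> \<le> (norm (a::'a::real_inner))\<^sup>2 + (norm b)\<^sup>2"
proof -
  have "\<bar>a \<bullet> b\<bar> \<le> norm a * norm b" by (rule Cauchy_Schwarz_ineq2)
  moreover have "0 \<le> (norm a - norm b)\<^sup>2" by simp
  ultimately show ?thesis using zero_le_power2[of "norm a"] zero_le_power2[of "norm b"]
    by (simp add: power2_diff)
qed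

lemma sq_integrable_measurable[measurable_dest]: "sq_integrable f \<Longrightarrow> f \<in> borel_measurable borel"
  by (simp add: sq_integrable_def)

lemma sq_integrable_norm: "sq_integrable f \<Longrightarrow> integrable lborel (\<lambda>x. (norm (f x))\<^sup>2)"
  by (simp add: sq_integrable_def)

lemma sq_integrable_bound:
  assumes "f \<in> borel_measurable borel" "integrable lborel g" "AE x in lborel. (norm (f x))\<^sup>2 \<le> g x"
  shows "sq_integrable f"
  unfolding sq_integrable_def
proof
  note [measurable] = assms(1)
  show "f \<in> borel_measurable lborel" by simp
  show "integrable lborel (\<lambda>x. (norm (f x))\<^sup>2)"
    by (rule Bochner_Integration.integrable_bound[OF assms(2)]) (use assms(3) in auto)
qed

lemma sq_integrable_0: "sq_integrable (\<lambda>x. 0)"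
  by (simp add: sq_integrable_def)

lemma sq_integrable_add: "sq_integrable f \<Longrightarrow> sq_integrable g \<Longrightarrow> sq_integrable (\<lambda>x. f x + g x)"
proof (rule sq_integrable_bound)
  assume f: "sq_integrable f" and g: "sq_integrable g"
  note [measurable] = f[THEN sq_integrable_measurable] g[THEN sq_integrable_measurable]
  show "(\<lambda>x. f x + g x) \<in> borel_measurable borel" by measurable
  show "integrable lborel (\<lambda>x. 2 * (norm (f x))\<^sup>2 + 2 * (norm (g x))\<^sup>2)"
    using f g by (simp add: sq_integrable_norm)
qed (simp add: norm_add_sq_le)

lemma sq_integrable_scaleR: "sq_integrable f \<Longrightarrow> sq_integrable (\<lambda>x. c *\<^sub>R f x)"
  by (auto simp: sq_integrable_def power_mult_distrib)

lemma sq_integrable_uminus: "sq_integrable f \<Longrightarrow> sq_integrable (\<lambda>x. - f x)"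
  by (auto simp: sq_integrable_def)

lemma sq_integrable_diff: "sq_integrable f \<Longrightarrow> sq_integrable g \<Longrightarrow> sq_integrable (\<lambda>x. f x - g x)"
  using sq_integrable_add[OF _ sq_integrable_uminus, of f g] by simp

lemma integral_inner_self_eq_0_iff:
  assumes f: "sq_integrable f"
  shows "(\<integral>x. f x \<bullet> f x \<partial>lborel) = 0 \<longleftrightarrow> (AE x in lborel. f x = 0)"
proof -
  have "(\<integral>x. f x \<bullet> f x \<partial>lborel) = 0 \<longleftrightarrow> (AE x in lborel. (norm (f x))\<^sup>2 = 0)"
    unfolding power2_norm_eq_inner[symmetric]
    by (rule integral_nonneg_eq_0_iff_AE[OF sq_integrable_norm[OF f]]) simp
  then show ?thesis by simp
qed

lemma integrable_inner:
  assumes f: "sq_integrable f" and g: "sq_integrable g" shows "integrable lborel (\<lambda>x. f x \<bullet> g x)"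
proof -
  note [measurable] = f[THEN sq_integrable_measurable] g[THEN sq_integrable_measurable]
  have "integrable lborel (\<lambda>x. (norm (f x))\<^sup>2 + (norm (g x))\<^sup>2)"
    using f g by (simp add: sq_integrable_norm)
  then show ?thesis
  proof (rule Bochner_Integration.integrable_bound)
    show "(\<lambda>x. f x \<bullet> g x) \<in> borel_measurable lborel" by measurable
  qed (use abs_inner_le_sq in auto)
qed

lemma part_equivp_sq_integrable:
  "part_equivp (\<lambda>(f :: 'a::euclidean_space \<Rightarrow> 'b::euclidean_space) g.
     sq_integrable f \<and> sq_integrable g \<and> (AE x in lborel. f x = g x))" (is "part_equivp ?R")
proof (rule part_equivpI)
  show "\<exists>f. ?R f f" using sq_integrable_0 by blast
  show "symp ?R" by (auto simp: symp_def eq_commute)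
  have "?R f h" if "?R f g" "?R g h" for f g h
  proof -
    from that have "AE x in lborel. f x = g x" "AE x in lborel. g x = h x" by blast+
    then have "AE x in lborel. f x = h x" by eventually_elim simp
    with that show ?thesis by blast
  qed
  then show "transp ?R" unfolding transp_def by blast
qed

text \<open>
  Functions on the whole space up to equality almost everywhere. A field on an open set is extended by
  zero, so one type serves for all domains, and Borel measurability avoids the completed product measure.
\<close>

quotient_type (overloaded) ('a, 'b) L2 = "'a::euclidean_space \<Rightarrow> 'b::euclidean_space" /
  partial: "\<lambda>f g. sq_integrable f \<and> sq_integrable g \<and> (AE x in lborel. f x = g x)"
  by (rule part_equivp_sq_integrable)

instantiation L2 :: (euclidean_space, euclidean_space) real_vector
begin

lift_definition zero_L2 :: "('a, 'b) L2" is "\<lambda>x. 0" by (simp add: sq_integrable_0)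
lift_definition plus_L2 :: "('a, 'b) L2 \<Rightarrow> ('a, 'b) L2 \<Rightarrow> ('a, 'b) L2" is "\<lambda>f g x. f x + g x"
  by (auto intro: sq_integrable_add elim: eventually_elim2)
lift_definition scaleR_L2 :: "real \<Rightarrow> ('a, 'b) L2 \<Rightarrow> ('a, 'b) L2" is "\<lambda>c f x. c *\<^sub>R f x"
  by (auto intro: sq_integrable_scaleR)
lift_definition uminus_L2 :: "('a, 'b) L2 \<Rightarrow> ('a, 'b) L2" is "\<lambda>f x. - f x"
  by (auto intro: sq_integrable_uminus)
lift_definition minus_L2 :: "('a, 'b) L2 \<Rightarrow> ('a, 'b) L2 \<Rightarrow> ('a, 'b) L2" is "\<lambda>f g x. f x - g x"
  by (auto intro: sq_integrable_diff elim: eventually_elim2)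

instance
proof
  fix a b c :: "('a, 'b) L2" and r s :: real
  show "a + b + c = a + (b + c)"
    by transfer (simp add: sq_integrable_add add.assoc)
  show "a + b = b + a" by transfer (simp add: sq_integrable_add add.commute)
  show "0 + a = a" by transfer simp
  show "- a + a = 0"
    by transfer (simp add: sq_integrable_0)
  show "a - b = a + - b"
    by transfer (simp add: sq_integrable_diff)
  show "r *\<^sub>R (a + b) = r *\<^sub>R a + r *\<^sub>R b"
    by transfer (auto intro!: sq_integrable_add sq_integrable_scaleR simp: scaleR_add_right)
  show "(r + s) *\<^sub>R a = r *\<^sub>R a + s *\<^sub>R a"
    by transfer (auto intro!: sq_integrable_add sq_integrable_scaleR simp: scaleR_add_left)
  show "r *\<^sub>R s *\<^sub>R a = (r * s) *\<^sub>R a"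
    by transfer (auto intro!: sq_integrable_scaleR)
  show "1 *\<^sub>R a = a" by transfer simp
qed

end

lift_definition L2_inner :: "('a::euclidean_space, 'b::euclidean_space) L2 \<Rightarrow> ('a, 'b) L2 \<Rightarrow> real"
  is "\<lambda>f g. \<integral>x. f x \<bullet> g x \<partial>lborel"
proof (intro integral_cong_AE, goal_cases)
  case (3 f1 f2 g1 g2)
  then have "AE x in lborel. f1 x = f2 x" "AE x in lborel. g1 x = g2 x" by blast+
  then show ?case by eventually_elim simp
qed (auto intro: borel_measurable_integrable integrable_inner)

instantiation L2 :: (euclidean_space, euclidean_space) real_inner
begin

definition inner_L2 :: "('a, 'b) L2 \<Rightarrow> ('a, 'b) L2 \<Rightarrow> real" where "inner_L2 = L2_inner"
definition norm_L2 :: "('a, 'b) L2 \<Rightarrow> real" where "norm_L2 u = sqrt (L2_inner u u)"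
definition dist_L2 :: "('a, 'b) L2 \<Rightarrow> ('a, 'b) L2 \<Rightarrow> real" where "dist_L2 u v = sqrt (L2_inner (u - v) (u - v))"
definition sgn_L2 :: "('a, 'b) L2 \<Rightarrow> ('a, 'b) L2" where "sgn_L2 u = u /\<^sub>R sqrt (L2_inner u u)"
definition uniformity_L2 :: "(('a, 'b) L2 \<times> ('a, 'b) L2) filter" where
  "uniformity_L2 = (INF e\<in>{0<..}. principal {(x, y). dist x y < e})"
definition open_L2 :: "('a, 'b) L2 set \<Rightarrow> bool" where
  "open_L2 U = (\<forall>x\<in>U. eventually (\<lambda>(x', y). x' = x \<longrightarrow> y \<in> U) uniformity)"

instance
proof
  fix a b c :: "('a, 'b) L2" and r s :: real
  show "dist a b = norm (a - b)" by (simp add: dist_L2_def norm_L2_def)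
  show "sgn a = a /\<^sub>R norm a" by (simp add: sgn_L2_def norm_L2_def)
  show "norm a = sqrt (a \<bullet> a)" by (simp add: norm_L2_def inner_L2_def)
  show "a \<bullet> b = b \<bullet> a" unfolding inner_L2_def by transfer (simp add: inner_commute)
  show "(a + b) \<bullet> c = a \<bullet> c + b \<bullet> c" unfolding inner_L2_def
    by transfer (auto simp: inner_add_left intro!: Bochner_Integration.integral_add integrable_inner)
  show "r *\<^sub>R a \<bullet> b = r * (a \<bullet> b)" unfolding inner_L2_def by transfer simp
  show "0 \<le> a \<bullet> a" unfolding inner_L2_def by transfer simp
  show "(a \<bullet> a = 0) = (a = 0)" unfolding inner_L2_def
    by transfer (simp add: integral_inner_self_eq_0_iff sq_integrable_0)
qed (rule uniformity_L2_def open_L2_def)+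

end

lemma rep_sq_integrable: "sq_integrable (rep_L2 u)"
  using Quotient3_L2 by (metis (mono_tags, lifting) Quotient3_rep_reflp)

lemma rep_abs_L2: "sq_integrable f \<Longrightarrow> AE x in lborel. rep_L2 (abs_L2 f) x = f x"
  using rep_abs_rsp[OF Quotient3_L2, of f f] by (auto simp: eq_commute)

lemma L2_eqI: "AE x in lborel. rep_L2 u x = rep_L2 v x \<Longrightarrow> u = v"
  using Quotient3_rel_rep[OF Quotient3_L2, of u v] rep_sq_integrable by blast

lemma rep_add_L2: "AE x in lborel. rep_L2 (u + v) x = rep_L2 u x + rep_L2 v x"
proof -
  have "u + v = abs_L2 (\<lambda>x. rep_L2 u x + rep_L2 v x)" by (simp add: plus_L2_def)
  then show ?thesis using rep_abs_L2 sq_integrable_add rep_sq_integrable by metis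
qed

lemma rep_scaleR_L2: "AE x in lborel. rep_L2 (c *\<^sub>R u) x = c *\<^sub>R rep_L2 u x"
proof -
  have "c *\<^sub>R u = abs_L2 (\<lambda>x. c *\<^sub>R rep_L2 u x)" by (simp add: scaleR_L2_def)
  then show ?thesis using rep_abs_L2 sq_integrable_scaleR rep_sq_integrable by metis
qed

lemma rep_diff_L2: "AE x in lborel. rep_L2 (u - v) x = rep_L2 u x - rep_L2 v x"
  using rep_add_L2[of u "(-1) *\<^sub>R v"] rep_scaleR_L2[of "-1" v]
  by eventually_elim simp

lemma rep_zero_L2: "AE x in lborel. rep_L2 (0 :: ('a::euclidean_space, 'b::euclidean_space) L2) x = 0"
  using rep_abs_L2[OF sq_integrable_0] by (simp add: zero_L2_def)

lemma inner_L2: "u \<bullet> v = (\<integral>x. rep_L2 u x \<bullet> rep_L2 v x \<partial>lborel)"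
  by (simp add: inner_L2_def L2_inner_def)

lemma norm_L2_sq: "(norm u)\<^sup>2 = (\<integral>x. (norm (rep_L2 u x))\<^sup>2 \<partial>lborel)"
  by (simp add: power2_norm_eq_inner inner_L2)

lemma nn_integral_rep_L2: "(\<integral>\<^sup>+x. ennreal ((norm (rep_L2 u x))\<^sup>2) \<partial>lborel) = ennreal ((norm u)\<^sup>2)"
  unfolding norm_L2_sq by (intro nn_integral_eq_integral sq_integrable_norm rep_sq_integrable) simp

text \<open>
  Completeness (Riesz--Fischer): a subsequence with geometrically decaying increments converges almost
  everywhere, because a weighted sum of the squared increments is integrable.
\<close>

instance L2 :: (euclidean_space, euclidean_space) banach
proof
  fix X :: "nat \<Rightarrow> ('a, 'b) L2" assume X: "Cauchy X"
  have "\<exists>r. \<forall>k. True \<and> (r (Suc k) > r k \<and> (\<forall>n\<ge>r (Suc k). \<forall>l\<ge>r (Suc k). norm (X n - X l) < (1/2) ^ k))"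
  proof (rule dependent_nat_choice)
    fix x k :: nat
    obtain M where "\<forall>n\<ge>M. \<forall>l\<ge>M. norm (X n - X l) < (1/2) ^ k"
      using CauchyD[OF X, of "(1/2) ^ k"] by auto
    then show "\<exists>y. True \<and> (y > x \<and> (\<forall>n\<ge>y. \<forall>l\<ge>y. norm (X n - X l) < (1/2) ^ k))"
      by (intro exI[of _ "max M (Suc x)"]) auto
  qed simp
  then obtain r0 where r0: "\<And>k. r0 (Suc k) > r0 k"
    "\<And>k n l. n \<ge> r0 (Suc k) \<Longrightarrow> l \<ge> r0 (Suc k) \<Longrightarrow> norm (X n - X l) < (1/2) ^ k" by blast
  define r where "r k = r0 (Suc k)" for k
  have r: "strict_mono r" using r0(1) by (simp add: strict_mono_Suc_iff r_def)
  have rX: "norm (X (r (Suc k)) - X (r k)) < (1/2) ^ k" for k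
    by (rule r0(2)) (auto simp: r_def less_imp_le[OF r0(1)])
  define f where "f k = rep_L2 (X (r k))" for k
  have [measurable]: "f k \<in> borel_measurable borel" for k
    unfolding f_def by (rule sq_integrable_measurable[OF rep_sq_integrable])
  have fd: "(\<integral>\<^sup>+x. ennreal ((norm (f k x - f l x))\<^sup>2) \<partial>lborel) = ennreal ((norm (X (r k) - X (r l)))\<^sup>2)" for k l
  proof -
    have "AE x in lborel. ennreal ((norm (f k x - f l x))\<^sup>2) = ennreal ((norm (rep_L2 (X (r k) - X (r l)) x))\<^sup>2)"
      using rep_diff_L2[of "X (r k)" "X (r l)"] by eventually_elim (simp add: f_def)
    then show ?thesis by (subst nn_integral_cong_AE) (auto simp: nn_integral_rep_L2)
  qed
  have "(\<integral>\<^sup>+x. (\<Sum>k. ennreal (2 ^ k * (norm (f (Suc k) x - f k x))\<^sup>2)) \<partial>lborel)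
      = (\<Sum>k. \<integral>\<^sup>+x. ennreal (2 ^ k * (norm (f (Suc k) x - f k x))\<^sup>2) \<partial>lborel)"
    by (intro nn_integral_suminf) measurable
  also have "\<dots> = (\<Sum>k. ennreal (2 ^ k * (norm (X (r (Suc k)) - X (r k)))\<^sup>2))"
    by (simp add: ennreal_mult nn_integral_cmult fd)
  also have "\<dots> \<le> (\<Sum>k. ennreal ((1/2) ^ k))"
  proof (intro suminf_le summableI ennreal_leI)
    fix k
    have "(norm (X (r (Suc k)) - X (r k)))\<^sup>2 \<le> ((1/2) ^ k)\<^sup>2" using rX[of k] by (intro power_mono) auto
    then have "2 ^ k * (norm (X (r (Suc k)) - X (r k)))\<^sup>2 \<le> 2 ^ k * ((1/2) ^ k)\<^sup>2" by simp
    also have "\<dots> = (1/2) ^ k" by (simp add: power2_eq_square power_divide)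
    finally show "2 ^ k * (norm (X (r (Suc k)) - X (r k)))\<^sup>2 \<le> (1/2) ^ k" .
  qed
  also have "\<dots> < \<infinity>" by (simp add: suminf_ennreal2 summable_geometric)
  finally have "AE x in lborel. (\<Sum>k. ennreal (2 ^ k * (norm (f (Suc k) x - f k x))\<^sup>2)) \<noteq> \<infinity>"
    by (intro nn_integral_PInf_AE) auto
  then have conv: "AE x in lborel. convergent (\<lambda>k. f k x)"
  proof eventually_elim
    case (elim x)
    then have "summable (\<lambda>k. 2 ^ k * (norm (f (Suc k) x - f k x))\<^sup>2)"
      by (intro summable_suminf_not_top) (auto simp: top.not_eq_extremum)
    then obtain S where S: "\<And>k. norm (2 ^ k * (norm (f (Suc k) x - f k x))\<^sup>2) \<le> S"
      using summable_imp_bounded by (metis (no_types, lifting) bounded_iff rangeI)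
    have le: "norm (f (Suc k) x - f k x) \<le> sqrt S * (sqrt (1/2)) ^ k" for k
    proof -
      have "(norm (f (Suc k) x - f k x))\<^sup>2 \<le> S * (1/2) ^ k" using S[of k] by (simp add: field_simps power_divide)
      then have "sqrt ((norm (f (Suc k) x - f k x))\<^sup>2) \<le> sqrt (S * (1/2) ^ k)" by (rule real_sqrt_le_mono)
      moreover have "sqrt (S * (1/2) ^ k) = sqrt S * sqrt (1/2) ^ k"
        by (simp only: real_sqrt_mult real_sqrt_power)
      ultimately show ?thesis by (simp only: real_sqrt_abs abs_norm_cancel)
    qed
    have "summable (\<lambda>k. sqrt S * (sqrt (1/2)) ^ k)" by (intro summable_mult summable_geometric) simp
    then have "summable (\<lambda>k. f (Suc k) x - f k x)" by (rule summable_comparison_test'[OF _ le])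
    from summable_LIMSEQ[OF this] have "(\<lambda>m. f m x - f 0 x) \<longlonglongrightarrow> (\<Sum>k. f (Suc k) x - f k x)"
      by (simp only: sum_lessThan_telescope[of "\<lambda>i. f i x"])
    from tendsto_add[OF this tendsto_const[of "f 0 x"]] show "convergent (\<lambda>k. f k x)"
      by (auto simp: convergent_def)
  qed
  define g where "g x = lim (\<lambda>k. f k x)" for x
  have [measurable]: "g \<in> borel_measurable borel" unfolding g_def by measurable
  have lim: "AE x in lborel. (\<lambda>k. f k x) \<longlonglongrightarrow> g x"
    using conv by eventually_elim (simp add: g_def convergent_LIMSEQ_iff)
  have fatou: "(\<integral>\<^sup>+x. ennreal ((norm (f k x - g x))\<^sup>2) \<partial>lborel) \<le> ennreal (((1/2) ^ k)\<^sup>2)" for k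
  proof -
    have "(\<integral>\<^sup>+x. ennreal ((norm (f k x - g x))\<^sup>2) \<partial>lborel)
        = (\<integral>\<^sup>+x. liminf (\<lambda>l. ennreal ((norm (f k x - f l x))\<^sup>2)) \<partial>lborel)"
    proof (rule nn_integral_cong_AE, use lim in eventually_elim)
      case (elim x)
      have "(\<lambda>l. ennreal ((norm (f k x - f l x))\<^sup>2)) \<longlonglongrightarrow> ennreal ((norm (f k x - g x))\<^sup>2)"
        by (intro tendsto_intros tendsto_ennrealI elim)
      then show ?case by (intro lim_imp_Liminf[symmetric]) auto
    qed
    also have "\<dots> \<le> liminf (\<lambda>l. \<integral>\<^sup>+x. ennreal ((norm (f k x - f l x))\<^sup>2) \<partial>lborel)"
      by (intro nn_integral_liminf) measurable
    also have "\<dots> \<le> ennreal (((1/2) ^ k)\<^sup>2)"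
    proof (rule Liminf_le)
      show "\<forall>\<^sub>F l in sequentially. (\<integral>\<^sup>+x. ennreal ((norm (f k x - f l x))\<^sup>2) \<partial>lborel) \<le> ennreal (((1/2) ^ k)\<^sup>2)"
        using eventually_ge_at_top[of k]
      proof eventually_elim
        case (elim l)
        have "norm (X (r k) - X (r l)) < (1/2) ^ k"
          using elim strict_mono_less_eq[OF r] by (intro r0(2)) (auto simp: r_def)
        then show ?case unfolding fd by (intro ennreal_leI power_mono) auto
      qed
    qed simp
    finally show ?thesis .
  qed
  have "integrable lborel (\<lambda>x. (norm (f 0 x - g x))\<^sup>2)"
    using fatou[of 0] by (intro integrableI_bounded) (auto simp: less_top[symmetric] top_unique)
  then have "sq_integrable (\<lambda>x. f 0 x - g x)" by (simp add: sq_integrable_def)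
  from sq_integrable_add[OF rep_sq_integrable[of "X (r 0)"] sq_integrable_scaleR[OF this, of "-1"]]
  have g: "sq_integrable g" by (simp add: f_def)
  have norm_le: "norm (X (r k) - abs_L2 g) \<le> (1/2) ^ k" for k
  proof -
    have "AE x in lborel. ennreal ((norm (rep_L2 (X (r k) - abs_L2 g) x))\<^sup>2) = ennreal ((norm (f k x - g x))\<^sup>2)"
      using rep_diff_L2[of "X (r k)" "abs_L2 g"] rep_abs_L2[OF g] by eventually_elim (simp add: f_def)
    from nn_integral_cong_AE[OF this] fatou[of k]
    have "ennreal ((norm (X (r k) - abs_L2 g))\<^sup>2) \<le> ennreal (((1/2) ^ k)\<^sup>2)"
      by (simp only: nn_integral_rep_L2)
    then have "(norm (X (r k) - abs_L2 g))\<^sup>2 \<le> ((1/2) ^ k)\<^sup>2" by (subst (asm) ennreal_le_iff) auto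
    then show ?thesis by (rule power2_le_imp_le) simp
  qed
  have "(\<lambda>k. X (r k)) \<longlonglongrightarrow> abs_L2 g"
  proof (rule LIM_zero_cancel, rule Lim_null_comparison[OF always_eventually])
    show "\<forall>k. norm (X (r k) - abs_L2 g) \<le> (1/2) ^ k" using norm_le by blast
    show "(\<lambda>k. (1/2) ^ k :: real) \<longlonglongrightarrow> 0" by (intro LIMSEQ_realpow_zero) auto
  qed
  then have "X \<longlonglongrightarrow> abs_L2 g"
    by (intro Cauchy_converges_subseq[OF X r]) (simp add: comp_def)
  then show "convergent X" by (auto simp: convergent_def)
qed

definition L2_fun :: "('a::euclidean_space \<Rightarrow> 'b::euclidean_space) \<Rightarrow> bool" where
  "L2_fun f \<longleftrightarrow> (\<exists>u. AE x in lborel. rep_L2 u x = f x)"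

definition to_L2 :: "('a::euclidean_space \<Rightarrow> 'b::euclidean_space) \<Rightarrow> ('a, 'b) L2" where
  "to_L2 f = (SOME u. AE x in lborel. rep_L2 u x = f x)"

lemma L2_fun_sq_integrable: "sq_integrable f \<Longrightarrow> L2_fun f"
  unfolding L2_fun_def using rep_abs_L2 by blast

lemma rep_to_L2: "L2_fun f \<Longrightarrow> AE x in lborel. rep_L2 (to_L2 f) x = f x"
  unfolding L2_fun_def to_L2_def by (rule someI_ex)

lemma to_L2_eqI:
  assumes "AE x in lborel. rep_L2 u x = f x" shows "to_L2 f = u"
proof (rule L2_eqI)
  have "L2_fun f" using assms by (auto simp: L2_fun_def)
  from rep_to_L2[OF this] assms show "AE x in lborel. rep_L2 (to_L2 f) x = rep_L2 u x"
    by eventually_elim simp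
qed

lemma L2_fun_cong:
  assumes "L2_fun f" "AE x in lborel. g x = f x" shows "L2_fun g"
  unfolding L2_fun_def
  by (rule exI[of _ "to_L2 f"]) (use rep_to_L2[OF assms(1)] assms(2) in \<open>eventually_elim, simp\<close>)

lemma rep_measurable[measurable]: "rep_L2 u \<in> borel_measurable borel"
  by (rule sq_integrable_measurable[OF rep_sq_integrable])

lemma integrable_rep_norm: "integrable lborel (\<lambda>x. (norm (rep_L2 u x))\<^sup>2)"
  by (rule sq_integrable_norm[OF rep_sq_integrable])

lemma integrable_rep_inner: "integrable lborel (\<lambda>x. rep_L2 u x \<bullet> rep_L2 v x)"
  by (intro integrable_inner rep_sq_integrable)

lemma norm_L2_le:
  assumes "integrable lborel g" "AE x in lborel. (norm (rep_L2 u x))\<^sup>2 \<le> g x" "(\<integral>x. g x \<partial>lborel) \<le> C\<^sup>2" "0 \<le> C"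
  shows "norm u \<le> C"
proof (rule power2_le_imp_le)
  have "(norm u)\<^sup>2 \<le> (\<integral>x. g x \<partial>lborel)"
    unfolding norm_L2_sq by (intro integral_mono_AE integrable_rep_norm assms)
  with assms(3) show "(norm u)\<^sup>2 \<le> C\<^sup>2" by linarith
qed fact

lemma bounded_linear_to_L2:
  fixes F :: "('a::euclidean_space, 'b::euclidean_space) L2 \<Rightarrow> 'c::euclidean_space \<Rightarrow> 'd::euclidean_space"
  assumes "\<And>u. L2_fun (F u)"
    and "\<And>u v. AE x in lborel. F (u + v) x = F u x + F v x"
    and "\<And>c u. AE x in lborel. F (c *\<^sub>R u) x = c *\<^sub>R F u x"
    and "\<And>u. norm (to_L2 (F u)) \<le> norm u * C"
  shows "bounded_linear (\<lambda>u. to_L2 (F u))"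
proof (rule bounded_linear_intro[where K=C])
  note rep = rep_to_L2[OF assms(1)]
  show "to_L2 (F (u + v)) = to_L2 (F u) + to_L2 (F v)" for u v
    by (rule to_L2_eqI)
      (use rep_add_L2[of "to_L2 (F u)" "to_L2 (F v)"] rep[of u] rep[of v] assms(2)[of u v] in \<open>eventually_elim, simp\<close>)
  show "to_L2 (F (c *\<^sub>R u)) = c *\<^sub>R to_L2 (F u)" for c u
    by (rule to_L2_eqI)
      (use rep_scaleR_L2[of c "to_L2 (F u)"] rep[of u] assms(3)[of c u] in \<open>eventually_elim, simp\<close>)
qed (rule assms(4))

section \<open>Product domains\<close>

lemma AE_prod_fstD:
  fixes P :: "('a::euclidean_space \<times> 'b::euclidean_space) \<Rightarrow> bool"
  assumes "AE z in lborel. P z" shows "AE x in lborel. AE y in lborel. P (x, y)"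
proof -
  from assms have "AE z in lborel \<Otimes>\<^sub>M lborel. P z" by (simp only: lborel_prod)
  from lborel_pair.AE_pair[OF this] show ?thesis .
qed

lemma AE_prod_sndD:
  fixes P :: "('a::euclidean_space \<times> 'b::euclidean_space) \<Rightarrow> bool"
  assumes "AE z in lborel. P z" shows "AE y in lborel. AE x in lborel. P (x, y)"
proof -
  from assms obtain N where N: "{z. \<not> P z} \<subseteq> N" "emeasure lborel N = 0" "N \<in> sets lborel"
    by (auto elim!: AE_E)
  have N': "N \<in> sets (lborel \<Otimes>\<^sub>M lborel)" using N(3) by (simp only: lborel_prod)
  have "(\<integral>\<^sup>+y. emeasure lborel ((\<lambda>x. (x, y)) -` N) \<partial>lborel) = emeasure (lborel \<Otimes>\<^sub>M lborel) N"
    using lborel_pair.emeasure_pair_measure_alt2[OF N'] by simp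
  then have "(\<integral>\<^sup>+y. emeasure lborel ((\<lambda>x. (x, y)) -` N) \<partial>lborel) = 0"
    using N(2) by (simp only: lborel_prod)
  moreover have "(\<lambda>y. emeasure lborel ((\<lambda>x. (x, y)) -` N)) \<in> borel_measurable lborel"
    using lborel_pair.measurable_emeasure_Pair2[OF N'] by simp
  ultimately have "AE y in lborel. emeasure lborel ((\<lambda>x. (x, y)) -` N) = 0"
    by (simp add: nn_integral_0_iff_AE)
  then show ?thesis
  proof eventually_elim
    case (elim y)
    have "(\<lambda>x. (x, y)) -` N \<in> sets lborel" using measurable_sets[OF _ N(3), of "\<lambda>x. (x, y)" lborel] by simp
    with elim show ?case using N(1) by (intro AE_I) auto
  qed
qed

lemma AE_prod_fstI:
  fixes P :: "'a::euclidean_space \<Rightarrow> bool"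
  assumes "AE x in lborel. P x" shows "AE z in (lborel :: ('a \<times> 'b::euclidean_space) measure). P (fst z)"
proof -
  from assms obtain N where N: "{x. \<not> P x} \<subseteq> N" "emeasure lborel N = 0" "N \<in> sets lborel"
    by (auto elim!: AE_E)
  have "emeasure (lborel \<Otimes>\<^sub>M lborel) (N \<times> (UNIV :: 'b set)) = emeasure lborel N * emeasure lborel (UNIV :: 'b set)"
    using N(3) by (intro lborel.emeasure_pair_measure_Times) auto
  then have "emeasure lborel (N \<times> (UNIV :: 'b set)) = 0" by (simp only: lborel_prod N(2)) simp
  moreover have "N \<times> (UNIV :: 'b set) \<in> sets lborel"
    using N(3) pair_measureI[of N lborel "UNIV :: 'b set" lborel] by (simp only: lborel_prod) simp
  ultimately show ?thesis using N(1) by (intro AE_I[of _ _ "N \<times> (UNIV :: 'b set)"]) auto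
qed

context
  fixes f :: "('a::euclidean_space \<times> 'b::euclidean_space) \<Rightarrow> 'c::euclidean_space"
  assumes f: "integrable lborel f"
begin

private lemma f': "integrable (lborel \<Otimes>\<^sub>M lborel) f" using f by (simp only: lborel_prod)
private lemma f'': "integrable (lborel \<Otimes>\<^sub>M lborel) (case_prod (\<lambda>x y. f (x, y)))" using f' by simp

lemma AE_integrable_slice_fst: "AE x in lborel. integrable lborel (\<lambda>y. f (x, y))"
  using lborel_pair.AE_integrable_fst'[OF f'] by simp

lemma AE_integrable_slice_snd: "AE y in lborel. integrable lborel (\<lambda>x. f (x, y))"
  using lborel_pair.AE_integrable_snd[OF f''] by simp

lemma integrable_slice_integral_fst: "integrable lborel (\<lambda>x. \<integral>y. f (x, y) \<partial>lborel)"
  using lborel_pair.integrable_fst'[OF f'] by simp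

lemma integrable_slice_integral_snd: "integrable lborel (\<lambda>y. \<integral>x. f (x, y) \<partial>lborel)"
  using lborel_pair.integrable_snd[OF f''] by simp

lemma integral_prod_fst: "(\<integral>z. f z \<partial>lborel) = (\<integral>x. \<integral>y. f (x, y) \<partial>lborel \<partial>lborel)"
  using lborel_pair.integral_fst'[OF f'] by (simp only: lborel_prod)

lemma integral_prod_snd: "(\<integral>z. f z \<partial>lborel) = (\<integral>y. \<integral>x. f (x, y) \<partial>lborel \<partial>lborel)"
  using lborel_pair.integral_snd[OF f''] by (simp only: lborel_prod) simp

end

lemma integrable_prod_mult:
  fixes g :: "'a::euclidean_space \<Rightarrow> real" and h :: "'b::euclidean_space \<Rightarrow> real"
  assumes g: "integrable lborel g" and h: "integrable lborel h"
  shows "integrable lborel (\<lambda>z. h (snd z) * g (fst z))"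
    and "(\<integral>z. h (snd z) * g (fst z) \<partial>lborel) = (\<integral>y. h y \<partial>lborel) * (\<integral>x. g x \<partial>lborel)"
proof -
  have [measurable]: "g \<in> borel_measurable borel" "h \<in> borel_measurable borel"
    using g h borel_measurable_integrable by fastforce+
  have "integrable (lborel \<Otimes>\<^sub>M lborel) (\<lambda>z. h (snd z) * g (fst z))"
  proof (rule lborel_pair.Fubini_integrable)
    show "(\<lambda>z. h (snd z) * g (fst z)) \<in> borel_measurable (lborel \<Otimes>\<^sub>M lborel)" by measurable
    show "integrable lborel (\<lambda>x. \<integral>y. norm (h (snd (x, y)) * g (fst (x, y))) \<partial>lborel)"
      using g h by (simp add: abs_mult)
    show "AE x in lborel. integrable lborel (\<lambda>y. h (snd (x, y)) * g (fst (x, y)))"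
      using h by simp
  qed
  then show *: "integrable lborel (\<lambda>z. h (snd z) * g (fst z))" by (simp only: lborel_prod)
  show "(\<integral>z. h (snd z) * g (fst z) \<partial>lborel) = (\<integral>y. h y \<partial>lborel) * (\<integral>x. g x \<partial>lborel)"
    by (subst integral_prod_snd[OF *]) simp
qed

section \<open>Calculus in the time variable\<close>

lemma fst_borel_measurable[measurable]:
  "fst \<in> (borel :: ('a::second_countable_topology \<times> 'b::second_countable_topology) measure) \<rightarrow>\<^sub>M borel"
  by (intro borel_measurable_continuous_onI continuous_intros)

lemma snd_borel_measurable[measurable]:
  "snd \<in> (borel :: ('a::second_countable_topology \<times> 'b::second_countable_topology) measure) \<rightarrow>\<^sub>M borel"
  by (intro borel_measurable_continuous_onI continuous_intros)

lemma AE_sq_integrable_slice_fst: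
  fixes u :: "('a::euclidean_space \<times> 'b::euclidean_space, 'c::euclidean_space) L2"
  shows "AE x in lborel. sq_integrable (\<lambda>t. rep_L2 u (x, t))"
  using AE_integrable_slice_fst[OF integrable_rep_norm[of u]]
  by eventually_elim (simp add: sq_integrable_def)

lemma AE_sq_integrable_slice_snd:
  fixes u :: "('a::euclidean_space \<times> 'b::euclidean_space, 'c::euclidean_space) L2"
  shows "AE t in lborel. sq_integrable (\<lambda>x. rep_L2 u (x, t))"
  using AE_integrable_slice_snd[OF integrable_rep_norm[of u]]
  by eventually_elim (simp add: sq_integrable_def)

abbreviation (input) cut :: "real \<Rightarrow> (real \<Rightarrow> 'b::real_vector) \<Rightarrow> real \<Rightarrow> 'b" where
  "cut T f t \<equiv> indicator {0<..<T} t *\<^sub>R f t"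

definition primitive :: "(real \<Rightarrow> 'b::euclidean_space) \<Rightarrow> real \<Rightarrow> 'b" where
  "primitive f t = (\<integral>s. indicator {..<t} s *\<^sub>R f s \<partial>lborel)"

lemma integrable_indicator_scaleR:
  fixes f :: "'a::euclidean_space \<Rightarrow> 'b::euclidean_space"
  shows "S \<in> sets borel \<Longrightarrow> integrable lborel f \<Longrightarrow> integrable lborel (\<lambda>s. indicator S s *\<^sub>R f s)"
  by (rule integrable_mult_indicator) simp_all

lemma integrable_cut:
  assumes f: "sq_integrable f" shows "integrable lborel (cut T f)"
proof (rule Bochner_Integration.integrable_bound)
  note [measurable] = sq_integrable_measurable[OF f]
  have "integrable lborel (indicator {0<..<T} :: real \<Rightarrow> real)" by (intro integrable_real_indicator emeasure_bounded_finite) auto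
  then show "integrable lborel (\<lambda>t. indicator {0<..<T} t + (norm (f t))\<^sup>2)"
    by (intro Bochner_Integration.integrable_add sq_integrable_norm f)
  show "cut T f \<in> borel_measurable lborel" by measurable
  show "AE t in lborel. norm (cut T f t) \<le> norm (indicator {0<..<T} t + (norm (f t))\<^sup>2 :: real)"
  proof (intro AE_I2)
    fix t
    have "2 * norm (f t) \<le> (norm (f t))\<^sup>2 + 1"
      using zero_le_power2[of "norm (f t) - 1"] by (simp add: power2_diff)
    then have "norm (f t) \<le> 1 + (norm (f t))\<^sup>2" using norm_ge_zero[of "f t"] by linarith
    then show "norm (cut T f t) \<le> norm (indicator {0<..<T} t + (norm (f t))\<^sup>2 :: real)"
      by (auto simp: indicator_def)
  qed
qed

text \<open>
  Cauchy--Schwarz on an interval of length \<open>T\<close>.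
\<close>

lemma norm_integral_cut_le:
  assumes f: "sq_integrable f" and "0 < T" and S: "S \<in> sets borel" "S \<subseteq> {0<..<T}"
  shows "(norm (\<integral>t. indicator S t *\<^sub>R f t \<partial>lborel))\<^sup>2 \<le> T * (\<integral>t. (norm (f t))\<^sup>2 \<partial>lborel)"
proof -
  note [measurable] = sq_integrable_measurable[OF f] S(1)
  define g where "g t = indicator S t *\<^sub>R f t" for t
  define I where "I = (\<integral>t. g t \<partial>lborel)"
  have geq: "g t = indicator S t *\<^sub>R cut T f t" for t using S(2) by (auto simp: g_def indicator_def)
  have ig: "integrable lborel g"
    unfolding geq[abs_def] by (intro integrable_indicator_scaleR integrable_cut f S(1))
  have ig2: "integrable lborel (\<lambda>t. (norm (g t))\<^sup>2)"
    by (rule Bochner_Integration.integrable_bound[OF sq_integrable_norm[OF f]]) (auto simp: g_def indicator_def)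
  define c where "c = (1 / T) *\<^sub>R I"
  have ind: "integrable lborel (indicator {0<..<T} :: real \<Rightarrow> real)" "(\<integral>t. indicator {0<..<T} t \<partial>lborel) = T"
    using \<open>0 < T\<close> by (auto intro: integrable_real_indicator)
  have "0 \<le> (\<integral>t. (norm (g t))\<^sup>2 - 2 * (g t \<bullet> c) + indicator {0<..<T} t * (c \<bullet> c) \<partial>lborel)"
  proof (rule integral_nonneg_AE, intro AE_I2)
    fix t
    have "(norm (g t - c))\<^sup>2 = (norm (g t))\<^sup>2 - 2 * (g t \<bullet> c) + c \<bullet> c"
      by (simp add: power2_norm_eq_inner inner_diff_left inner_diff_right inner_commute)
    then have "0 \<le> (norm (g t))\<^sup>2 - 2 * (g t \<bullet> c) + c \<bullet> c" by (metis zero_le_power2)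
    then show "0 \<le> (norm (g t))\<^sup>2 - 2 * (g t \<bullet> c) + indicator {0<..<T} t * (c \<bullet> c)"
    proof (cases "t \<in> {0<..<T}")
      case False
      then have "t \<notin> S" using S(2) by blast
      then show ?thesis by (simp add: g_def indicator_def)
    qed simp
  qed
  also have "\<dots> = (\<integral>t. (norm (g t))\<^sup>2 \<partial>lborel) - 2 * (I \<bullet> c) + T * (c \<bullet> c)"
    using ig ig2 ind unfolding I_def by simp
  also have "\<dots> = (\<integral>t. (norm (g t))\<^sup>2 \<partial>lborel) - (norm I)\<^sup>2 / T"
    using \<open>0 < T\<close> by (simp add: c_def power2_norm_eq_inner field_simps)
  finally have "(norm I)\<^sup>2 \<le> T * (\<integral>t. (norm (g t))\<^sup>2 \<partial>lborel)" using \<open>0 < T\<close> by (simp add: field_simps)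
  also have "\<dots> \<le> T * (\<integral>t. (norm (f t))\<^sup>2 \<partial>lborel)"
    using \<open>0 < T\<close> ig2 sq_integrable_norm[OF f]
    by (intro mult_left_mono integral_mono) (auto simp: g_def indicator_def)
  finally show ?thesis by (simp add: I_def g_def)
qed

lemma primitive_cut_le:
  assumes "sq_integrable f" "0 < T"
  shows "(norm (primitive (cut T f) t))\<^sup>2 \<le> T * (\<integral>t. (norm (f t))\<^sup>2 \<partial>lborel)"
proof -
  have "primitive (cut T f) t = (\<integral>s. indicator ({..<t} \<inter> {0<..<T}) s *\<^sub>R f s \<partial>lborel)"
    unfolding primitive_def by (intro Bochner_Integration.integral_cong) (auto simp: indicator_def)
  then show ?thesis using norm_integral_cut_le[OF assms, of "{..<t} \<inter> {0<..<T}"] by simp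
qed

lemma primitive_measurable[measurable (raw)]:
  fixes f :: "'a::euclidean_space \<times> real \<Rightarrow> 'b::euclidean_space"
  assumes [measurable]: "f \<in> borel_measurable borel"
  shows "(\<lambda>z. primitive (\<lambda>s. f (fst z, s)) (snd z)) \<in> borel_measurable borel"
proof -
  have "(\<lambda>w. if snd w < snd (fst w) then f (fst (fst w), snd w) else 0)
      \<in> borel_measurable (borel :: (('a \<times> real) \<times> real) measure)"
    by measurable
  then have "case_prod (\<lambda>z s. if s < snd z then f (fst z, s) else 0) \<in> borel_measurable (borel \<Otimes>\<^sub>M lborel)"
    by (simp add: borel_prod[symmetric] case_prod_beta' cong: measurable_cong_sets)
  then have "(\<lambda>z. \<integral>s. (if s < snd z then f (fst z, s) else 0) \<partial>lborel) \<in> borel_measurable (borel :: ('a \<times> real) measure)"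
    by (rule lborel.borel_measurable_lebesgue_integral)
  moreover have "(\<lambda>z. primitive (\<lambda>s. f (fst z, s)) (snd z)) = (\<lambda>z. \<integral>s. (if s < snd z then f (fst z, s) else 0) \<partial>lborel)"
    unfolding primitive_def by (intro ext Bochner_Integration.integral_cong) (auto simp: indicator_def)
  ultimately show ?thesis by simp
qed

text \<open>
  Fubini's theorem on the triangle \<open>r < s\<close>. The bilinear map \<open>pr\<close> covers both the inner product, for the
  adjoint of time integration, and scalar multiplication, for the product rule.
\<close>

lemma triangle_swap:
  fixes f :: "real \<Rightarrow> 'b::euclidean_space" and g :: "real \<Rightarrow> 'c::euclidean_space"
    and pr :: "'b \<Rightarrow> 'c \<Rightarrow> 'd::euclidean_space"
  assumes f: "integrable lborel f" and g: "integrable lborel g" and "bounded_bilinear pr"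
  shows "(\<integral>s. pr (primitive f s) (g s) \<partial>lborel) = (\<integral>r. pr (f r) (\<integral>s. indicator {r<..} s *\<^sub>R g s \<partial>lborel) \<partial>lborel)"
proof -
  interpret pr: bounded_bilinear pr by fact
  have [measurable]: "f \<in> borel_measurable borel" "g \<in> borel_measurable borel"
    using f g borel_measurable_integrable by fastforce+
  obtain C where C: "0 < C" "\<And>a b. norm (pr a b) \<le> norm a * norm b * C" using pr.pos_bounded by blast
  define h where "h z = (if fst z < snd z then pr (f (fst z)) (g (snd z)) else 0)" for z
  have meas: "(\<lambda>z. pr (f (fst z)) (g (snd z))) \<in> borel_measurable (borel :: (real \<times> real) measure)"
  proof (rule borel_measurable_continuous_Pair[where H=pr and f="\<lambda>z. f (fst z)" and g="\<lambda>z. g (snd z)"])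
    show "continuous_on UNIV (\<lambda>x. pr (fst x) (snd x))" by (intro pr.continuous_on continuous_intros)
  qed measurable
  have ih: "integrable lborel h"
  proof (rule Bochner_Integration.integrable_bound)
    have "integrable lborel (\<lambda>z. norm (g (snd z)) * norm (f (fst z)))"
      by (intro integrable_prod_mult integrable_norm f g)
    then show "integrable lborel (\<lambda>z. C * (norm (g (snd z)) * norm (f (fst z))))" by simp
    show "h \<in> borel_measurable lborel" unfolding h_def using meas by simp
    show "AE z in lborel. norm (h z) \<le> norm (C * (norm (g (snd z)) * norm (f (fst z))))"
    proof (intro AE_I2)
      fix z
      show "norm (h z) \<le> norm (C * (norm (g (snd z)) * norm (f (fst z))))"
        using C(2)[of "f (fst z)" "g (snd z)"] C(1) by (simp add: h_def ac_simps)
    qed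
  qed
  have "(\<integral>s. pr (primitive f s) (g s) \<partial>lborel) = (\<integral>s. \<integral>r. h (r, s) \<partial>lborel \<partial>lborel)"
  proof (rule Bochner_Integration.integral_cong[OF refl])
    fix s
    have "(\<integral>r. pr (indicator {..<s} r *\<^sub>R f r) (g s) \<partial>lborel) = pr (primitive f s) (g s)"
      unfolding primitive_def
      by (intro integral_bounded_linear pr.bounded_linear_left integrable_indicator_scaleR f) simp
    moreover have "pr (indicator {..<s} r *\<^sub>R f r) (g s) = h (r, s)" for r
      by (auto simp: h_def indicator_def pr.zero_left)
    ultimately show "pr (primitive f s) (g s) = (\<integral>r. h (r, s) \<partial>lborel)" by simp
  qed
  also have "\<dots> = (\<integral>r. \<integral>s. h (r, s) \<partial>lborel \<partial>lborel)"
    using integral_prod_fst[OF ih] integral_prod_snd[OF ih] by simp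
  also have "\<dots> = (\<integral>r. pr (f r) (\<integral>s. indicator {r<..} s *\<^sub>R g s \<partial>lborel) \<partial>lborel)"
  proof (rule Bochner_Integration.integral_cong[OF refl])
    fix r
    have "(\<integral>s. pr (f r) (indicator {r<..} s *\<^sub>R g s) \<partial>lborel) = pr (f r) (\<integral>s. indicator {r<..} s *\<^sub>R g s \<partial>lborel)"
      by (intro integral_bounded_linear pr.bounded_linear_right integrable_indicator_scaleR g) simp
    moreover have "pr (f r) (indicator {r<..} s *\<^sub>R g s) = h (r, s)" for s
      by (auto simp: h_def indicator_def pr.zero_right)
    ultimately show "(\<integral>s. h (r, s) \<partial>lborel) = pr (f r) (\<integral>s. indicator {r<..} s *\<^sub>R g s \<partial>lborel)" by simp
  qed
  finally show ?thesis .
qed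

lemma integral_split_at:
  fixes f :: "real \<Rightarrow> 'b::euclidean_space"
  assumes f: "integrable lborel f"
  shows "(\<integral>s. indicator {r<..} s *\<^sub>R f s \<partial>lborel) = (\<integral>s. f s \<partial>lborel) - primitive f r"
proof -
  have "(\<integral>s. f s \<partial>lborel) - primitive f r = (\<integral>s. f s - indicator {..<r} s *\<^sub>R f s \<partial>lborel)"
    unfolding primitive_def using f by (simp add: integrable_indicator_scaleR)
  also have "\<dots> = (\<integral>s. indicator {r<..} s *\<^sub>R f s \<partial>lborel)"
  proof (rule integral_cong_AE)
    show "AE s in lborel. f s - indicator {..<r} s *\<^sub>R f s = indicator {r<..} s *\<^sub>R f s"
      using AE_lborel_singleton[of r] by eventually_elim (auto simp: indicator_def)
  qed (use borel_measurable_integrable[OF f] in measurable)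
  finally show ?thesis by simp
qed

text \<open>
  Integration by parts for functions that are only known as primitives is Fubini's theorem on the
  triangle, so neither factor has to be differentiable.
\<close>

lemma primitive_product_rule:
  fixes f :: "real \<Rightarrow> 'b::euclidean_space" and \<theta> :: "real \<Rightarrow> real" and a :: real
  assumes f: "integrable lborel f" and \<theta>: "integrable lborel \<theta>" "\<And>t. \<bar>\<theta> t\<bar> \<le> B"
  defines "\<Theta> \<equiv> \<lambda>t. a + primitive \<theta> t"
  shows "primitive (\<lambda>s. \<theta> s *\<^sub>R (y + primitive f s) + \<Theta> s *\<^sub>R f s) t + a *\<^sub>R y = \<Theta> t *\<^sub>R (y + primitive f t)"
proof -
  have [measurable]: "f \<in> borel_measurable borel" "\<theta> \<in> borel_measurable borel"
    using f \<theta>(1) borel_measurable_integrable by fastforce+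
  have pm: "primitive f \<in> borel_measurable borel" "primitive \<theta> \<in> borel_measurable borel"
  proof -
    have pair: "(\<lambda>t::real. (0::real, t)) \<in> borel \<rightarrow>\<^sub>M borel" by measurable
    show "primitive f \<in> borel_measurable borel"
      using measurable_compose[OF pair primitive_measurable[of "\<lambda>z. f (snd z)"]] by simp
    show "primitive \<theta> \<in> borel_measurable borel"
      using measurable_compose[OF pair primitive_measurable[of "\<lambda>z. \<theta> (snd z)"]] by simp
  qed
  note [measurable] = pm
  have prim_le: "norm (primitive g s) \<le> (\<integral>r. norm (g r) \<partial>lborel)"
    if "integrable lborel g" for g :: "real \<Rightarrow> 'e::euclidean_space" and s
  proof -
    have "norm (primitive g s) \<le> (\<integral>r. norm (indicator {..<s} r *\<^sub>R g r) \<partial>lborel)"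
      unfolding primitive_def by (rule integral_norm_bound)
    also have "\<dots> \<le> (\<integral>r. norm (g r) \<partial>lborel)"
      using that by (intro integral_mono integrable_norm integrable_indicator_scaleR) (auto simp: indicator_def)
    finally show ?thesis .
  qed
  have i1: "integrable lborel (\<lambda>s. \<theta> s *\<^sub>R primitive f s)"
  proof (rule Bochner_Integration.integrable_bound)
    show "integrable lborel (\<lambda>s. \<theta> s * (\<integral>r. norm (f r) \<partial>lborel))" using \<theta>(1) by simp
    show "AE s in lborel. norm (\<theta> s *\<^sub>R primitive f s) \<le> norm (\<theta> s * (\<integral>r. norm (f r) \<partial>lborel))"
      using prim_le[OF f] by (intro AE_I2) (simp add: abs_mult mult_left_mono)
  qed measurable
  have i2: "integrable lborel (\<lambda>s. \<Theta> s *\<^sub>R f s)"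
  proof (rule Bochner_Integration.integrable_bound)
    show "integrable lborel (\<lambda>s. (\<bar>a\<bar> + (\<integral>r. norm (\<theta> r) \<partial>lborel)) *\<^sub>R f s)" using f by simp
    show "(\<lambda>s. \<Theta> s *\<^sub>R f s) \<in> borel_measurable lborel" unfolding \<Theta>_def by measurable
    show "AE s in lborel. norm (\<Theta> s *\<^sub>R f s) \<le> norm ((\<bar>a\<bar> + (\<integral>r. norm (\<theta> r) \<partial>lborel)) *\<^sub>R f s)"
    proof (intro AE_I2)
      fix s
      have "\<bar>\<Theta> s\<bar> \<le> \<bar>a\<bar> + (\<integral>r. norm (\<theta> r) \<partial>lborel)" unfolding \<Theta>_def using prim_le[OF \<theta>(1), of s] by simp
      then have "\<bar>\<Theta> s\<bar> * norm (f s) \<le> \<bar>\<bar>a\<bar> + (\<integral>r. norm (\<theta> r) \<partial>lborel)\<bar> * norm (f s)"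
        by (intro mult_right_mono) auto
      then show "norm (\<Theta> s *\<^sub>R f s) \<le> norm ((\<bar>a\<bar> + (\<integral>r. norm (\<theta> r) \<partial>lborel)) *\<^sub>R f s)" by simp
    qed
  qed
  define g where "g s = indicator {..<t} s *\<^sub>R \<theta> s" for s
  have g: "integrable lborel g" unfolding g_def by (intro integrable_indicator_scaleR \<theta>(1)) simp
  have "primitive (\<lambda>s. \<theta> s *\<^sub>R primitive f s) t = (\<integral>s. g s *\<^sub>R primitive f s \<partial>lborel)"
    by (simp add: primitive_def g_def)
  also have "\<dots> = (\<integral>r. (\<integral>s. indicator {r<..} s *\<^sub>R g s \<partial>lborel) *\<^sub>R f r \<partial>lborel)"
    using triangle_swap[OF f g bounded_bilinear.flip[OF bounded_bilinear_scaleR]] .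
  also have "\<dots> = (\<integral>r. indicator {..<t} r *\<^sub>R ((\<Theta> t - \<Theta> r) *\<^sub>R f r) \<partial>lborel)"
  proof (rule Bochner_Integration.integral_cong[OF refl])
    fix r
    have "(\<integral>s. indicator {r<..} s *\<^sub>R g s \<partial>lborel) = primitive \<theta> t - primitive g r"
      using integral_split_at[OF g, of r] by (simp add: primitive_def g_def)
    also have "\<dots> = indicator {..<t} r * (\<Theta> t - \<Theta> r)"
    proof (cases "r < t")
      case True
      then have "primitive g r = primitive \<theta> r"
        unfolding primitive_def g_def by (intro Bochner_Integration.integral_cong) (auto simp: indicator_def)
      with True show ?thesis by (simp add: \<Theta>_def)
    next
      case False
      then have "primitive g r = primitive \<theta> t"
        unfolding primitive_def g_def by (intro Bochner_Integration.integral_cong) (auto simp: indicator_def)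
      with False show ?thesis by simp
    qed
    finally show "(\<integral>s. indicator {r<..} s *\<^sub>R g s \<partial>lborel) *\<^sub>R f r = indicator {..<t} r *\<^sub>R ((\<Theta> t - \<Theta> r) *\<^sub>R f r)"
      by simp
  qed
  also have "\<dots> = (\<integral>r. \<Theta> t *\<^sub>R (indicator {..<t} r *\<^sub>R f r) - indicator {..<t} r *\<^sub>R (\<Theta> r *\<^sub>R f r) \<partial>lborel)"
    by (intro Bochner_Integration.integral_cong) (auto simp: algebra_simps)
  also have "\<dots> = \<Theta> t *\<^sub>R primitive f t - primitive (\<lambda>s. \<Theta> s *\<^sub>R f s) t"
    unfolding primitive_def using f i2 by (simp add: integrable_indicator_scaleR del: scaleR_scaleR)
  finally have 1: "primitive (\<lambda>s. \<theta> s *\<^sub>R primitive f s) t = \<Theta> t *\<^sub>R primitive f t - primitive (\<lambda>s. \<Theta> s *\<^sub>R f s) t" .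
  have "primitive (\<lambda>s. \<theta> s *\<^sub>R (y + primitive f s) + \<Theta> s *\<^sub>R f s) t =
     (\<integral>s. (indicator {..<t} s *\<^sub>R \<theta> s) *\<^sub>R y + (indicator {..<t} s *\<^sub>R (\<theta> s *\<^sub>R primitive f s) + indicator {..<t} s *\<^sub>R (\<Theta> s *\<^sub>R f s)) \<partial>lborel)"
    unfolding primitive_def by (intro Bochner_Integration.integral_cong) (auto simp: algebra_simps)
  also have "\<dots> = primitive \<theta> t *\<^sub>R y + (primitive (\<lambda>s. \<theta> s *\<^sub>R primitive f s) t + primitive (\<lambda>s. \<Theta> s *\<^sub>R f s) t)"
    unfolding primitive_def using \<theta>(1) i1[unfolded primitive_def] i2
    by (simp add: integrable_indicator_scaleR del: scaleR_scaleR real_scaleR_def)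
  finally show ?thesis unfolding 1 by (simp add: \<Theta>_def algebra_simps)
qed

section \<open>Time integration as operators on space-time fields\<close>

definition time_embed :: "real \<Rightarrow> ('a::euclidean_space, 'b::euclidean_space) L2 \<Rightarrow> ('a \<times> real, 'b) L2" where
  "time_embed T y = to_L2 (\<lambda>z. indicator {0<..<T} (snd z) *\<^sub>R rep_L2 y (fst z))"

definition time_integral :: "real \<Rightarrow> ('a::euclidean_space \<times> real, 'b::euclidean_space) L2 \<Rightarrow> ('a, 'b) L2" where
  "time_integral T u = to_L2 (\<lambda>x. \<integral>t. cut T (\<lambda>s. rep_L2 u (x, s)) t \<partial>lborel)"

definition volterra :: "real \<Rightarrow> ('a::euclidean_space \<times> real, 'b::euclidean_space) L2 \<Rightarrow> ('a \<times> real, 'b) L2" where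
  "volterra T u = to_L2 (\<lambda>z. indicator {0<..<T} (snd z) *\<^sub>R primitive (cut T (\<lambda>s. rep_L2 u (fst z, s))) (snd z))"

definition volterra_adjoint :: "real \<Rightarrow> ('a::euclidean_space \<times> real, 'b::euclidean_space) L2 \<Rightarrow> ('a \<times> real, 'b) L2" where
  "volterra_adjoint T u = time_embed T (time_integral T u) - volterra T u"

definition time_mult :: "(real \<Rightarrow> real) \<Rightarrow> ('a::euclidean_space \<times> real, 'b::euclidean_space) L2 \<Rightarrow> ('a \<times> real, 'b) L2" where
  "time_mult \<theta> u = to_L2 (\<lambda>z. \<theta> (snd z) *\<^sub>R rep_L2 u z)"

definition bounded_fun :: "(real \<Rightarrow> real) \<Rightarrow> bool" where
  "bounded_fun \<theta> \<longleftrightarrow> \<theta> \<in> borel_measurable borel \<and> (\<exists>B. \<forall>t. \<bar>\<theta> t\<bar> \<le> B)"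

lemma integrable_interval_indicator: "integrable lborel (indicator {0<..<T} :: real \<Rightarrow> real)"
  by (intro integrable_real_indicator emeasure_bounded_finite) auto

context
  fixes T :: real
  assumes T: "0 < T"
begin

lemma time_embed_L2: "L2_fun (\<lambda>z. indicator {0<..<T} (snd z) *\<^sub>R rep_L2 y (fst z))"
proof (intro L2_fun_sq_integrable sq_integrable_bound)
  show "integrable lborel (\<lambda>z. indicator {0<..<T} (snd z) * (norm (rep_L2 y (fst z)))\<^sup>2)"
    by (intro integrable_prod_mult integrable_rep_norm integrable_interval_indicator)
  show "AE z in lborel. (norm (indicator {0<..<T} (snd z) *\<^sub>R rep_L2 y (fst z)))\<^sup>2 \<le> indicator {0<..<T} (snd z) * (norm (rep_L2 y (fst z)))\<^sup>2"
    by (intro AE_I2) (simp add: indicator_def)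
qed measurable

lemma rep_time_embed: "AE z in lborel. rep_L2 (time_embed T y) z = indicator {0<..<T} (snd z) *\<^sub>R rep_L2 y (fst z)"
  unfolding time_embed_def by (rule rep_to_L2[OF time_embed_L2])

lemma bounded_linear_time_embed: "bounded_linear (time_embed T :: ('a::euclidean_space, 'b::euclidean_space) L2 \<Rightarrow> _)"
  unfolding time_embed_def[abs_def]
proof (rule bounded_linear_to_L2[where C="sqrt T"])
  show "AE z in lborel. indicator {0<..<T} (snd z) *\<^sub>R rep_L2 (u + v) (fst z) =
      indicator {0<..<T} (snd z) *\<^sub>R rep_L2 u (fst z) + indicator {0<..<T} (snd z) *\<^sub>R rep_L2 v (fst z)"
    for u v :: "('a, 'b) L2"
    using AE_prod_fstI[OF rep_add_L2[of u v]] by eventually_elim (simp add: scaleR_add_right)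
  show "AE z in lborel. indicator {0<..<T} (snd z) *\<^sub>R rep_L2 (c *\<^sub>R u) (fst z) =
      c *\<^sub>R (indicator {0<..<T} (snd z) *\<^sub>R rep_L2 u (fst z))"
    for c and u :: "('a, 'b) L2"
    using AE_prod_fstI[OF rep_scaleR_L2[of c u]] by eventually_elim simp
  show "norm (to_L2 (\<lambda>z. indicator {0<..<T} (snd z) *\<^sub>R rep_L2 y (fst z))) \<le> norm y * sqrt T"
    for y :: "('a, 'b) L2"
    unfolding time_embed_def[symmetric]
  proof (rule norm_L2_le)
    show "integrable lborel (\<lambda>z. indicator {0<..<T} (snd z) * (norm (rep_L2 y (fst z)))\<^sup>2)"
      by (intro integrable_prod_mult integrable_rep_norm integrable_interval_indicator)
    show "AE z in lborel. (norm (rep_L2 (time_embed T y) z))\<^sup>2 \<le> indicator {0<..<T} (snd z) * (norm (rep_L2 y (fst z)))\<^sup>2"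
      using rep_time_embed[of y] by eventually_elim (simp add: indicator_def)
    show "(\<integral>z. indicator {0<..<T} (snd z) * (norm (rep_L2 y (fst z)))\<^sup>2 \<partial>lborel) \<le> (norm y * sqrt T)\<^sup>2"
      using integrable_prod_mult(2)[OF integrable_rep_norm[of y] integrable_interval_indicator[of T]] T
      by (simp add: power_mult_distrib norm_L2_sq mult.commute)
  qed (use T in simp)
qed (rule time_embed_L2)

lemma time_integral_bound:
  fixes u :: "('a::euclidean_space \<times> real, 'b::euclidean_space) L2"
  shows "AE x in lborel. (norm (\<integral>t. cut T (\<lambda>s. rep_L2 u (x, s)) t \<partial>lborel))\<^sup>2
      \<le> T * (\<integral>t. (norm (rep_L2 u (x, t)))\<^sup>2 \<partial>lborel)"
  using AE_sq_integrable_slice_fst[of u]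
  by eventually_elim (rule norm_integral_cut_le[OF _ T], auto)

lemma time_integral_L2:
  fixes u :: "('a::euclidean_space \<times> real, 'b::euclidean_space) L2"
  shows "L2_fun (\<lambda>x. \<integral>t. cut T (\<lambda>s. rep_L2 u (x, s)) t \<partial>lborel)"
proof (intro L2_fun_sq_integrable sq_integrable_bound)
  show "integrable lborel (\<lambda>x. T * (\<integral>t. (norm (rep_L2 u (x, t)))\<^sup>2 \<partial>lborel))"
    using integrable_slice_integral_fst[OF integrable_rep_norm[of u]] by simp
  have "(\<lambda>w. indicator {0<..<T} (snd w) *\<^sub>R rep_L2 u w) \<in> borel_measurable (borel :: ('a \<times> real) measure)"
    by measurable
  then have "case_prod (\<lambda>x t. cut T (\<lambda>s. rep_L2 u (x, s)) t) \<in> borel_measurable (borel \<Otimes>\<^sub>M lborel)"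
    by (simp add: borel_prod[symmetric] case_prod_beta' cong: measurable_cong_sets)
  then show "(\<lambda>x. \<integral>t. cut T (\<lambda>s. rep_L2 u (x, s)) t \<partial>lborel) \<in> borel_measurable borel"
    by (rule lborel.borel_measurable_lebesgue_integral)
qed (rule time_integral_bound)

lemma rep_time_integral:
  fixes u :: "('a::euclidean_space \<times> real, 'b::euclidean_space) L2"
  shows "AE x in lborel. rep_L2 (time_integral T u) x = (\<integral>t. cut T (\<lambda>s. rep_L2 u (x, s)) t \<partial>lborel)"
  unfolding time_integral_def by (rule rep_to_L2[OF time_integral_L2])

lemma AE_slices_add:
  fixes u v :: "('a::euclidean_space \<times> real, 'b::euclidean_space) L2"
  shows "AE x in lborel. integrable lborel (cut T (\<lambda>s. rep_L2 u (x, s))) \<and> integrable lborel (cut T (\<lambda>s. rep_L2 v (x, s)))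
     \<and> (AE s in lborel. rep_L2 (u + v) (x, s) = rep_L2 u (x, s) + rep_L2 v (x, s))"
  using AE_sq_integrable_slice_fst[of u] AE_sq_integrable_slice_fst[of v] AE_prod_fstD[OF rep_add_L2[of u v]]
  by eventually_elim (simp add: integrable_cut)

lemma bounded_linear_time_integral:
  "bounded_linear (time_integral T :: ('a::euclidean_space \<times> real, 'b::euclidean_space) L2 \<Rightarrow> _)"
  unfolding time_integral_def[abs_def]
proof (rule bounded_linear_to_L2[where C="sqrt T"])
  show "AE x in lborel. (\<integral>t. cut T (\<lambda>s. rep_L2 (u + v) (x, s)) t \<partial>lborel)
      = (\<integral>t. cut T (\<lambda>s. rep_L2 u (x, s)) t \<partial>lborel) + (\<integral>t. cut T (\<lambda>s. rep_L2 v (x, s)) t \<partial>lborel)"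
    for u v :: "('a \<times> real, 'b) L2"
    using AE_slices_add[of u v]
  proof eventually_elim
    case (elim x)
    then have "(\<integral>t. cut T (\<lambda>s. rep_L2 (u + v) (x, s)) t \<partial>lborel)
       = (\<integral>t. cut T (\<lambda>s. rep_L2 u (x, s)) t + cut T (\<lambda>s. rep_L2 v (x, s)) t \<partial>lborel)"
      by (intro integral_cong_AE) (auto elim!: eventually_mono simp: scaleR_add_right)
    with elim show ?case by simp
  qed
  show "AE x in lborel. (\<integral>t. cut T (\<lambda>s. rep_L2 (c *\<^sub>R u) (x, s)) t \<partial>lborel)
      = c *\<^sub>R (\<integral>t. cut T (\<lambda>s. rep_L2 u (x, s)) t \<partial>lborel)"
    for c and u :: "('a \<times> real, 'b) L2"
    using AE_prod_fstD[OF rep_scaleR_L2[of c u]]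
  proof eventually_elim
    case (elim x)
    then have "(\<integral>t. cut T (\<lambda>s. rep_L2 (c *\<^sub>R u) (x, s)) t \<partial>lborel)
       = (\<integral>t. c *\<^sub>R cut T (\<lambda>s. rep_L2 u (x, s)) t \<partial>lborel)"
      by (intro integral_cong_AE) (auto elim!: eventually_mono)
    then show ?case by (simp del: scaleR_scaleR)
  qed
  show "norm (to_L2 (\<lambda>x. \<integral>t. cut T (\<lambda>s. rep_L2 u (x, s)) t \<partial>lborel)) \<le> norm u * sqrt T"
    for u :: "('a \<times> real, 'b) L2"
    unfolding time_integral_def[symmetric]
  proof (rule norm_L2_le)
    show "integrable lborel (\<lambda>x. T * (\<integral>t. (norm (rep_L2 u (x, t)))\<^sup>2 \<partial>lborel))"
      using integrable_slice_integral_fst[OF integrable_rep_norm[of u]] by simp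
    show "AE x in lborel. (norm (rep_L2 (time_integral T u) x))\<^sup>2 \<le> T * (\<integral>t. (norm (rep_L2 u (x, t)))\<^sup>2 \<partial>lborel)"
      using rep_time_integral[of u] time_integral_bound[of u] by eventually_elim simp
    show "(\<integral>x. T * (\<integral>t. (norm (rep_L2 u (x, t)))\<^sup>2 \<partial>lborel) \<partial>lborel) \<le> (norm u * sqrt T)\<^sup>2"
      using integral_prod_fst[OF integrable_rep_norm[of u]] T
      by (simp add: power_mult_distrib norm_L2_sq mult.commute)
  qed (use T in simp)
qed (rule time_integral_L2)

lemma volterra_bound:
  fixes u :: "('a::euclidean_space \<times> real, 'b::euclidean_space) L2"
  shows "AE z in lborel. (norm (indicator {0<..<T} (snd z) *\<^sub>R primitive (cut T (\<lambda>s. rep_L2 u (fst z, s))) (snd z)))\<^sup>2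
      \<le> indicator {0<..<T} (snd z) * (T * (\<integral>t. (norm (rep_L2 u (fst z, t)))\<^sup>2 \<partial>lborel))"
  using AE_prod_fstI[OF AE_sq_integrable_slice_fst[of u]]
proof eventually_elim
  case (elim z)
  show ?case using primitive_cut_le[OF elim T, of "snd z"] by (cases "snd z \<in> {0<..<T}") simp_all
qed

lemma volterra_L2:
  fixes u :: "('a::euclidean_space \<times> real, 'b::euclidean_space) L2"
  shows "L2_fun (\<lambda>z. indicator {0<..<T} (snd z) *\<^sub>R primitive (cut T (\<lambda>s. rep_L2 u (fst z, s))) (snd z))"
proof (intro L2_fun_sq_integrable sq_integrable_bound)
  show "integrable lborel (\<lambda>z. indicator {0<..<T} (snd z) * (T * (\<integral>t. (norm (rep_L2 u (fst z, t)))\<^sup>2 \<partial>lborel)))"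
    using integrable_slice_integral_fst[OF integrable_rep_norm[of u]]
    by (intro integrable_prod_mult integrable_interval_indicator) simp
  have "(\<lambda>w. indicator {0<..<T} (snd w) *\<^sub>R rep_L2 u w) \<in> borel_measurable (borel :: ('a \<times> real) measure)"
    by measurable
  from primitive_measurable[OF this]
  show "(\<lambda>z. indicator {0<..<T} (snd z) *\<^sub>R primitive (cut T (\<lambda>s. rep_L2 u (fst z, s))) (snd z)) \<in> borel_measurable borel"
    by simp
qed (rule volterra_bound)

lemma rep_volterra:
  fixes u :: "('a::euclidean_space \<times> real, 'b::euclidean_space) L2"
  shows "AE z in lborel. rep_L2 (volterra T u) z =
    indicator {0<..<T} (snd z) *\<^sub>R primitive (cut T (\<lambda>s. rep_L2 u (fst z, s))) (snd z)"
  unfolding volterra_def by (rule rep_to_L2[OF volterra_L2])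

lemma bounded_linear_volterra:
  "bounded_linear (volterra T :: ('a::euclidean_space \<times> real, 'b::euclidean_space) L2 \<Rightarrow> _)"
  unfolding volterra_def[abs_def]
proof (rule bounded_linear_to_L2[where C=T])
  show "AE z in lborel. indicator {0<..<T} (snd z) *\<^sub>R primitive (cut T (\<lambda>s. rep_L2 (u + v) (fst z, s))) (snd z)
      = indicator {0<..<T} (snd z) *\<^sub>R primitive (cut T (\<lambda>s. rep_L2 u (fst z, s))) (snd z)
      + indicator {0<..<T} (snd z) *\<^sub>R primitive (cut T (\<lambda>s. rep_L2 v (fst z, s))) (snd z)"
    for u v :: "('a \<times> real, 'b) L2"
    using AE_prod_fstI[OF AE_slices_add[of u v]]
  proof eventually_elim
    case (elim z)
    have "primitive (cut T (\<lambda>s. rep_L2 (u + v) (fst z, s))) (snd z)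
       = (\<integral>t. indicator {..<snd z} t *\<^sub>R cut T (\<lambda>s. rep_L2 u (fst z, s)) t + indicator {..<snd z} t *\<^sub>R cut T (\<lambda>s. rep_L2 v (fst z, s)) t \<partial>lborel)"
      unfolding primitive_def
      by (intro integral_cong_AE) (use elim in \<open>auto elim!: eventually_mono simp: scaleR_add_right\<close>)
    also have "\<dots> = primitive (cut T (\<lambda>s. rep_L2 u (fst z, s))) (snd z) + primitive (cut T (\<lambda>s. rep_L2 v (fst z, s))) (snd z)"
      unfolding primitive_def by (rule Bochner_Integration.integral_add; rule integrable_indicator_scaleR) (use elim in auto)
    finally show ?case by (simp add: scaleR_add_right)
  qed
  show "AE z in lborel. indicator {0<..<T} (snd z) *\<^sub>R primitive (cut T (\<lambda>s. rep_L2 (c *\<^sub>R u) (fst z, s))) (snd z)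
      = c *\<^sub>R (indicator {0<..<T} (snd z) *\<^sub>R primitive (cut T (\<lambda>s. rep_L2 u (fst z, s))) (snd z))"
    for c and u :: "('a \<times> real, 'b) L2"
    using AE_prod_fstI[OF AE_prod_fstD[OF rep_scaleR_L2[of c u]]]
  proof eventually_elim
    case (elim z)
    have "primitive (cut T (\<lambda>s. rep_L2 (c *\<^sub>R u) (fst z, s))) (snd z)
       = (\<integral>t. c *\<^sub>R (indicator {..<snd z} t *\<^sub>R cut T (\<lambda>s. rep_L2 u (fst z, s)) t) \<partial>lborel)"
      unfolding primitive_def
      by (intro integral_cong_AE) (use elim in \<open>auto elim!: eventually_mono\<close>)
    also have "\<dots> = c *\<^sub>R primitive (cut T (\<lambda>s. rep_L2 u (fst z, s))) (snd z)"
      unfolding primitive_def by (rule integral_scaleR_right)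
    finally show ?case by (simp add: mult.commute)
  qed
  show "norm (to_L2 (\<lambda>z. indicator {0<..<T} (snd z) *\<^sub>R primitive (cut T (\<lambda>s. rep_L2 u (fst z, s))) (snd z))) \<le> norm u * T"
    for u :: "('a \<times> real, 'b) L2"
    unfolding volterra_def[symmetric]
  proof (rule norm_L2_le)
    have i: "integrable lborel (\<lambda>x. T * (\<integral>t. (norm (rep_L2 u (x, t)))\<^sup>2 \<partial>lborel))"
      using integrable_slice_integral_fst[OF integrable_rep_norm[of u]] by simp
    note prod = integrable_prod_mult[OF i integrable_interval_indicator[of T]]
    show "integrable lborel (\<lambda>z. indicator {0<..<T} (snd z) * (T * (\<integral>t. (norm (rep_L2 u (fst z, t)))\<^sup>2 \<partial>lborel)))"
      by (rule prod)
    show "AE z in lborel. (norm (rep_L2 (volterra T u) z))\<^sup>2 \<le> indicator {0<..<T} (snd z) * (T * (\<integral>t. (norm (rep_L2 u (fst z, t)))\<^sup>2 \<partial>lborel))"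
      using rep_volterra[of u] volterra_bound[of u] by eventually_elim simp
    show "(\<integral>z. indicator {0<..<T} (snd z) * (T * (\<integral>t. (norm (rep_L2 u (fst z, t)))\<^sup>2 \<partial>lborel)) \<partial>lborel) \<le> (norm u * T)\<^sup>2"
      using integral_prod_fst[OF integrable_rep_norm[of u]] T
      unfolding prod(2) by (simp add: power_mult_distrib norm_L2_sq mult.commute power2_eq_square[of T])
  qed (use T in simp)
qed (rule volterra_L2)

lemma bounded_linear_volterra_adjoint:
  "bounded_linear (volterra_adjoint T :: ('a::euclidean_space \<times> real, 'b::euclidean_space) L2 \<Rightarrow> _)"
  unfolding volterra_adjoint_def[abs_def]
  by (intro bounded_linear_sub bounded_linear_compose[OF bounded_linear_time_embed] bounded_linear_time_integral bounded_linear_volterra)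

lemma time_embed_adjoint:
  fixes u :: "('a::euclidean_space \<times> real, 'b::euclidean_space) L2"
  shows "time_embed T y \<bullet> u = y \<bullet> time_integral T u"
proof -
  have eq: "AE z in lborel. rep_L2 (time_embed T y) z \<bullet> rep_L2 u z = indicator {0<..<T} (snd z) *\<^sub>R rep_L2 y (fst z) \<bullet> rep_L2 u z"
    using rep_time_embed[of y] by eventually_elim simp
  then have i: "integrable lborel (\<lambda>z. indicator {0<..<T} (snd z) *\<^sub>R rep_L2 y (fst z) \<bullet> rep_L2 u z)"
    using integrable_rep_inner[of "time_embed T y" u] by (subst (asm) integrable_cong_AE) auto
  have "time_embed T y \<bullet> u = (\<integral>z. indicator {0<..<T} (snd z) *\<^sub>R rep_L2 y (fst z) \<bullet> rep_L2 u z \<partial>lborel)"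
    unfolding inner_L2 by (intro integral_cong_AE eq) measurable
  also have "\<dots> = (\<integral>x. \<integral>t. rep_L2 y x \<bullet> cut T (\<lambda>s. rep_L2 u (x, s)) t \<partial>lborel \<partial>lborel)"
    by (subst integral_prod_fst[OF i]) simp
  also have "\<dots> = (\<integral>x. rep_L2 y x \<bullet> rep_L2 (time_integral T u) x \<partial>lborel)"
  proof (rule integral_cong_AE)
    have "(\<lambda>x. \<integral>t. indicator {0<..<T} (snd (x, t)) *\<^sub>R rep_L2 y (fst (x, t)) \<bullet> rep_L2 u (x, t) \<partial>lborel) \<in> borel_measurable lborel"
      using integrable_slice_integral_fst[OF i] by (rule borel_measurable_integrable)
    then show "(\<lambda>x. \<integral>t. rep_L2 y x \<bullet> cut T (\<lambda>s. rep_L2 u (x, s)) t \<partial>lborel) \<in> borel_measurable lborel" by simp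
    show "AE x in lborel. (\<integral>t. rep_L2 y x \<bullet> cut T (\<lambda>s. rep_L2 u (x, s)) t \<partial>lborel) = rep_L2 y x \<bullet> rep_L2 (time_integral T u) x"
      using rep_time_integral[of u] AE_sq_integrable_slice_fst[of u]
    proof eventually_elim
      case (elim x)
      show ?case unfolding elim(1) by (rule integral_inner_right) (rule integrable_cut[OF elim(2)])
    qed
  qed measurable
  finally show ?thesis by (simp add: inner_L2)
qed

lemma volterra_adjoint_inner:
  fixes u v :: "('a::euclidean_space \<times> real, 'b::euclidean_space) L2"
  shows "volterra T u \<bullet> v = u \<bullet> volterra_adjoint T v"
proof -
  define F where "F z = indicator {0<..<T} (snd z) *\<^sub>R primitive (cut T (\<lambda>s. rep_L2 u (fst z, s))) (snd z)" for z
  have F: "AE z in lborel. rep_L2 (volterra T u) z = F z" unfolding F_def by (rule rep_volterra)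
  have "volterra T u \<bullet> v = (\<integral>x. \<integral>t. rep_L2 (volterra T u) (x, t) \<bullet> rep_L2 v (x, t) \<partial>lborel \<partial>lborel)"
    unfolding inner_L2 by (rule integral_prod_fst[OF integrable_rep_inner])
  also have "\<dots> = (\<integral>x. \<integral>t. rep_L2 u (x, t) \<bullet> rep_L2 (volterra_adjoint T v) (x, t) \<partial>lborel \<partial>lborel)"
  proof (rule integral_cong_AE)
    show "AE x in lborel. (\<integral>t. rep_L2 (volterra T u) (x, t) \<bullet> rep_L2 v (x, t) \<partial>lborel)
        = (\<integral>t. rep_L2 u (x, t) \<bullet> rep_L2 (volterra_adjoint T v) (x, t) \<partial>lborel)"
      using AE_prod_fstD[OF F] AE_prod_fstD[OF rep_volterra[of v]]
        AE_prod_fstD[OF rep_diff_L2[of "time_embed T (time_integral T v)" "volterra T v"]]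
        AE_prod_fstD[OF rep_time_embed[of "time_integral T v"]] rep_time_integral[of v]
        AE_sq_integrable_slice_fst[of u] AE_sq_integrable_slice_fst[of v]
    proof eventually_elim
      case (elim x)
      define f g where "f = cut T (\<lambda>s. rep_L2 u (x, s))" and "g = cut T (\<lambda>s. rep_L2 v (x, s))"
      have f: "integrable lborel f" and g: "integrable lborel g"
        unfolding f_def g_def by (intro integrable_cut elim)+
      have "(\<integral>t. rep_L2 (volterra T u) (x, t) \<bullet> rep_L2 v (x, t) \<partial>lborel) = (\<integral>t. primitive f t \<bullet> g t \<partial>lborel)"
      proof (rule integral_cong_AE)
        show "AE t in lborel. rep_L2 (volterra T u) (x, t) \<bullet> rep_L2 v (x, t) = primitive f t \<bullet> g t"
          using elim(1) by eventually_elim (simp add: F_def f_def g_def)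
        have [measurable]: "g \<in> borel_measurable borel" "f \<in> borel_measurable borel" unfolding f_def g_def by measurable
        have "primitive f \<in> borel_measurable borel"
          using measurable_compose[OF _ primitive_measurable[of "\<lambda>z. f (snd z)"], of "\<lambda>t. (0::real, t)" borel] by simp
        then show "(\<lambda>t. primitive f t \<bullet> g t) \<in> borel_measurable lborel" by simp
      qed measurable
      also have "\<dots> = (\<integral>r. f r \<bullet> (\<integral>s. indicator {r<..} s *\<^sub>R g s \<partial>lborel) \<partial>lborel)"
        by (rule triangle_swap[OF f g bounded_bilinear_inner])
      also have "\<dots> = (\<integral>t. rep_L2 u (x, t) \<bullet> rep_L2 (volterra_adjoint T v) (x, t) \<partial>lborel)"
      proof (rule integral_cong_AE)
        have "AE t in lborel. rep_L2 (volterra_adjoint T v) (x, t) =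
            indicator {0<..<T} t *\<^sub>R ((\<integral>s. g s \<partial>lborel) - primitive g t)"
          using elim(2,3,4) unfolding volterra_adjoint_def
          by eventually_elim (simp add: elim(5) g_def scaleR_diff_right)
        then show ae: "AE t in lborel. f t \<bullet> (\<integral>s. indicator {t<..} s *\<^sub>R g s \<partial>lborel) = rep_L2 u (x, t) \<bullet> rep_L2 (volterra_adjoint T v) (x, t)"
          by eventually_elim (simp add: integral_split_at[OF g] f_def)
        have [measurable]: "g \<in> borel_measurable borel" "f \<in> borel_measurable borel" unfolding f_def g_def by measurable
        have "primitive g \<in> borel_measurable borel"
          using measurable_compose[OF _ primitive_measurable[of "\<lambda>z. g (snd z)"], of "\<lambda>t. (0::real, t)" borel] by simp
        then show "(\<lambda>t. f t \<bullet> (\<integral>s. indicator {t<..} s *\<^sub>R g s \<partial>lborel)) \<in> borel_measurable lborel"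
          by (simp add: integral_split_at[OF g])
      qed measurable
      finally show ?case .
    qed
  qed (use integrable_slice_integral_fst[OF integrable_rep_inner] borel_measurable_integrable in blast)+
  also have "\<dots> = u \<bullet> volterra_adjoint T v"
    unfolding inner_L2 by (rule integral_prod_fst[OF integrable_rep_inner, symmetric])
  finally show ?thesis .
qed

end

lemma time_mult_L2:
  assumes "bounded_fun \<theta>" shows "L2_fun (\<lambda>z. \<theta> (snd z) *\<^sub>R rep_L2 u z)"
proof -
  from assms obtain B where [measurable]: "\<theta> \<in> borel_measurable borel" and B: "\<And>t. \<bar>\<theta> t\<bar> \<le> B"
    by (auto simp: bounded_fun_def)
  show ?thesis
  proof (intro L2_fun_sq_integrable sq_integrable_bound)
    show "integrable lborel (\<lambda>z. B\<^sup>2 * (norm (rep_L2 u z))\<^sup>2)" using integrable_rep_norm[of u] by simp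
    show "AE z in lborel. (norm (\<theta> (snd z) *\<^sub>R rep_L2 u z))\<^sup>2 \<le> B\<^sup>2 * (norm (rep_L2 u z))\<^sup>2"
      using B by (intro AE_I2) (auto simp: power_mult_distrib intro!: mult_right_mono abs_le_square_iff[THEN iffD1] intro: order_trans[OF _ abs_ge_self])
  qed measurable
qed

lemma rep_time_mult:
  "bounded_fun \<theta> \<Longrightarrow> AE z in lborel. rep_L2 (time_mult \<theta> u) z = \<theta> (snd z) *\<^sub>R rep_L2 u z"
  unfolding time_mult_def by (rule rep_to_L2[OF time_mult_L2])

lemma bounded_linear_time_mult:
  assumes \<theta>: "bounded_fun \<theta>"
  shows "bounded_linear (time_mult \<theta> :: ('a::euclidean_space \<times> real, 'b::euclidean_space) L2 \<Rightarrow> _)"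
proof -
  from \<theta> obtain B where B: "\<And>t. \<bar>\<theta> t\<bar> \<le> B" by (auto simp: bounded_fun_def)
  have B0: "0 \<le> B" using B[of 0] by linarith
  show ?thesis
    unfolding time_mult_def[abs_def]
  proof (rule bounded_linear_to_L2[where C=B])
    show "AE z in lborel. \<theta> (snd z) *\<^sub>R rep_L2 (u + v) z = \<theta> (snd z) *\<^sub>R rep_L2 u z + \<theta> (snd z) *\<^sub>R rep_L2 v z"
      for u v :: "('a \<times> real, 'b) L2"
      using rep_add_L2[of u v] by eventually_elim (simp add: scaleR_add_right)
    show "AE z in lborel. \<theta> (snd z) *\<^sub>R rep_L2 (c *\<^sub>R u) z = c *\<^sub>R (\<theta> (snd z) *\<^sub>R rep_L2 u z)"
      for c and u :: "('a \<times> real, 'b) L2"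
      using rep_scaleR_L2[of c u] by eventually_elim simp
    show "norm (to_L2 (\<lambda>z. \<theta> (snd z) *\<^sub>R rep_L2 u z)) \<le> norm u * B" for u :: "('a \<times> real, 'b) L2"
      unfolding time_mult_def[symmetric]
    proof (rule norm_L2_le)
      show "integrable lborel (\<lambda>z. B\<^sup>2 * (norm (rep_L2 u z))\<^sup>2)" using integrable_rep_norm[of u] by simp
      show "AE z in lborel. (norm (rep_L2 (time_mult \<theta> u) z))\<^sup>2 \<le> B\<^sup>2 * (norm (rep_L2 u z))\<^sup>2"
        using rep_time_mult[OF \<theta>, of u]
        by eventually_elim (use B in \<open>auto simp: power_mult_distrib intro!: mult_right_mono abs_le_square_iff[THEN iffD1] intro: order_trans[OF _ abs_ge_self]\<close>)
    qed (use B0 in \<open>simp_all add: norm_L2_sq power_mult_distrib mult.commute\<close>)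
  qed (rule time_mult_L2[OF \<theta>])
qed

lemma time_mult_sym: "bounded_fun \<theta> \<Longrightarrow> time_mult \<theta> u \<bullet> v = u \<bullet> time_mult \<theta> v"
  unfolding inner_L2
proof (rule integral_cong_AE)
  assume \<theta>: "bounded_fun \<theta>"
  show "AE z in lborel. rep_L2 (time_mult \<theta> u) z \<bullet> rep_L2 v z = rep_L2 u z \<bullet> rep_L2 (time_mult \<theta> v) z"
    using rep_time_mult[OF \<theta>, of u] rep_time_mult[OF \<theta>, of v] by eventually_elim simp
qed measurable

lemma norm_primitive_le:
  fixes g :: "real \<Rightarrow> 'e::euclidean_space"
  assumes "integrable lborel g" shows "norm (primitive g s) \<le> (\<integral>r. norm (g r) \<partial>lborel)"
proof -
  have "norm (primitive g s) \<le> (\<integral>r. norm (indicator {..<s} r *\<^sub>R g r) \<partial>lborel)"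
    unfolding primitive_def by (rule integral_norm_bound)
  also have "\<dots> \<le> (\<integral>r. norm (g r) \<partial>lborel)"
    using assms by (intro integral_mono integrable_norm integrable_indicator_scaleR) (auto simp: indicator_def)
  finally show ?thesis .
qed

lemma primitive_measurable1:
  fixes f :: "real \<Rightarrow> 'e::euclidean_space"
  assumes [measurable]: "f \<in> borel_measurable borel" shows "primitive f \<in> borel_measurable borel"
  using measurable_compose[OF _ primitive_measurable[of "\<lambda>z. f (snd z)"], of "\<lambda>t. (0::real, t)" borel] by simp

lemma integrable_cut_bounded:
  assumes "bounded_fun \<theta>" shows "integrable lborel (cut T \<theta>)"
proof -
  from assms obtain B where [measurable]: "\<theta> \<in> borel_measurable borel" and B: "\<And>t. \<bar>\<theta> t\<bar> \<le> B"
    by (auto simp: bounded_fun_def)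
  have "integrable lborel (\<lambda>t. indicator {0<..<T} t * B)" using integrable_interval_indicator[of T] by simp
  then show ?thesis
    by (rule Bochner_Integration.integrable_bound)
      (use B in \<open>auto simp: indicator_def abs_mult intro: order_trans[OF _ abs_ge_self]\<close>)
qed

lemma bounded_fun_primitive:
  assumes "bounded_fun \<theta>" shows "bounded_fun (\<lambda>t. a + primitive (cut T \<theta>) t)"
  unfolding bounded_fun_def
proof
  have [measurable]: "\<theta> \<in> borel_measurable borel" using assms by (simp add: bounded_fun_def)
  have "primitive (cut T \<theta>) \<in> borel_measurable borel" by (intro primitive_measurable1) measurable
  then show "(\<lambda>t. a + primitive (cut T \<theta>) t) \<in> borel_measurable borel" by simp
  show "\<exists>B. \<forall>t. \<bar>a + primitive (cut T \<theta>) t\<bar> \<le> B"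
  proof (intro exI allI)
    fix t
    show "\<bar>a + primitive (cut T \<theta>) t\<bar> \<le> \<bar>a\<bar> + (\<integral>r. norm (cut T \<theta> r) \<partial>lborel)"
      using norm_primitive_le[OF integrable_cut_bounded[OF assms, of T], of t] by (simp del: real_scaleR_def)
  qed
qed

text \<open>The product rule \<open>(\<Theta> v)' = \<theta> v + \<Theta> p\<close> for \<open>v = E y + K p\<close>, together with the value at \<open>T\<close>.\<close>

lemma time_mult_product_rule:
  fixes p :: "('a::euclidean_space \<times> real, 'b::euclidean_space) L2" and y :: "('a, 'b) L2" and a :: real
  assumes T: "0 < T" and \<theta>: "bounded_fun \<theta>"
  defines "v \<equiv> time_embed T y + volterra T p"
  defines "\<Theta> \<equiv> (\<lambda>t. a + primitive (cut T \<theta>) t)"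
  defines "q \<equiv> time_mult \<theta> v + time_mult \<Theta> p"
  shows "time_mult \<Theta> v = time_embed T (a *\<^sub>R y) + volterra T q"
    and "a *\<^sub>R y + time_integral T q = \<Theta> T *\<^sub>R (y + time_integral T p)"
proof -
  have \<Theta>: "bounded_fun \<Theta>" unfolding \<Theta>_def by (rule bounded_fun_primitive[OF \<theta>])
  have [measurable]: "\<theta> \<in> borel_measurable borel" "\<Theta> \<in> borel_measurable borel"
    using \<theta> \<Theta> by (auto simp: bounded_fun_def)
  obtain B where B: "\<And>t. \<bar>\<theta> t\<bar> \<le> B" using \<theta> by (auto simp: bounded_fun_def)
  have B': "\<bar>cut T \<theta> t\<bar> \<le> B" for t using B[of t] by (auto simp: indicator_def)
  have v: "AE z in lborel. rep_L2 v z = indicator {0<..<T} (snd z) *\<^sub>R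
      (rep_L2 y (fst z) + primitive (cut T (\<lambda>s. rep_L2 p (fst z, s))) (snd z))"
    using rep_add_L2[of "time_embed T y" "volterra T p"] rep_time_embed[OF T, of y] rep_volterra[OF T, of p]
    by eventually_elim (simp add: v_def scaleR_add_right)
  have q: "AE z in lborel. rep_L2 q z = \<theta> (snd z) *\<^sub>R rep_L2 v z + \<Theta> (snd z) *\<^sub>R rep_L2 p z"
    using rep_add_L2[of "time_mult \<theta> v" "time_mult \<Theta> p"] rep_time_mult[OF \<theta>, of v] rep_time_mult[OF \<Theta>, of p]
    by eventually_elim (simp add: q_def)
  have key: "AE x in lborel. \<forall>t. primitive (cut T (\<lambda>s. rep_L2 q (x, s))) t
      = \<Theta> t *\<^sub>R (rep_L2 y x + primitive (cut T (\<lambda>s. rep_L2 p (x, s))) t) - a *\<^sub>R rep_L2 y x"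
    using AE_prod_fstD[OF q] AE_prod_fstD[OF v] AE_sq_integrable_slice_fst[of p]
  proof eventually_elim
    case (elim x)
    define f where "f = cut T (\<lambda>s. rep_L2 p (x, s))"
    have f: "integrable lborel f" unfolding f_def by (rule integrable_cut[OF elim(3)])
    have [measurable]: "f \<in> borel_measurable borel" using borel_measurable_integrable[OF f] by simp
    have [measurable]: "primitive f \<in> borel_measurable borel" by (rule primitive_measurable1) simp
    show ?case
    proof
      fix t
      have "primitive (cut T (\<lambda>s. rep_L2 q (x, s))) t = primitive (\<lambda>s. cut T \<theta> s *\<^sub>R (rep_L2 y x + primitive f s) + \<Theta> s *\<^sub>R f s) t"
        unfolding primitive_def[of "cut T (\<lambda>s. rep_L2 q (x, s))"] primitive_def[of "\<lambda>s. cut T \<theta> s *\<^sub>R (rep_L2 y x + primitive f s) + \<Theta> s *\<^sub>R f s"]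
      proof (rule integral_cong_AE)
        show "AE s in lborel. indicator {..<t} s *\<^sub>R cut T (\<lambda>s. rep_L2 q (x, s)) s =
          indicator {..<t} s *\<^sub>R (cut T \<theta> s *\<^sub>R (rep_L2 y x + primitive f s) + \<Theta> s *\<^sub>R f s)"
          using elim(1,2) by eventually_elim (auto simp: f_def indicator_def)
      qed measurable
      then show "primitive (cut T (\<lambda>s. rep_L2 q (x, s))) t
          = \<Theta> t *\<^sub>R (rep_L2 y x + primitive (cut T (\<lambda>s. rep_L2 p (x, s))) t) - a *\<^sub>R rep_L2 y x"
        using primitive_product_rule[OF f integrable_cut_bounded[OF \<theta>, of T] B', where a=a and y="rep_L2 y x" and t=t]
        by (simp only: \<Theta>_def[symmetric] f_def[symmetric]) (simp add: \<Theta>_def eq_diff_eq)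
    qed
  qed
  show "time_mult \<Theta> v = time_embed T (a *\<^sub>R y) + volterra T q"
  proof (rule L2_eqI)
    show "AE z in lborel. rep_L2 (time_mult \<Theta> v) z = rep_L2 (time_embed T (a *\<^sub>R y) + volterra T q) z"
      using rep_time_mult[OF \<Theta>, of v] rep_add_L2[of "time_embed T (a *\<^sub>R y)" "volterra T q"]
        rep_time_embed[OF T, of "a *\<^sub>R y"] rep_volterra[OF T, of q] AE_prod_fstI[OF key] v
        AE_prod_fstI[OF rep_scaleR_L2[of a y]]
      by eventually_elim (simp add: algebra_simps)
  qed
  have at_T: "(\<integral>t. cut T f t \<partial>lborel) = primitive (cut T f) T" for f :: "real \<Rightarrow> 'b"
    unfolding primitive_def by (intro Bochner_Integration.integral_cong) (auto simp: indicator_def)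
  show "a *\<^sub>R y + time_integral T q = \<Theta> T *\<^sub>R (y + time_integral T p)"
  proof (rule L2_eqI)
    show "AE x in lborel. rep_L2 (a *\<^sub>R y + time_integral T q) x = rep_L2 (\<Theta> T *\<^sub>R (y + time_integral T p)) x"
      using rep_add_L2[of "a *\<^sub>R y" "time_integral T q"] rep_scaleR_L2[of a y] rep_time_integral[OF T, of q]
        rep_scaleR_L2[of "\<Theta> T" "y + time_integral T p"] rep_add_L2[of y "time_integral T p"] rep_time_integral[OF T, of p] key
      by eventually_elim (simp add: at_T)
  qed
qed

section \<open>Time slices\<close>

text \<open>
  For \<open>t\<close> outside a null set the slice is square integrable; elsewhere the value is arbitrary.
\<close>

definition slice :: "('a::euclidean_space \<times> real, 'b::euclidean_space) L2 \<Rightarrow> real \<Rightarrow> ('a, 'b) L2" where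
  "slice u t = to_L2 (\<lambda>x. rep_L2 u (x, t))"

lemma rep_slice: "AE t in lborel. AE x in lborel. rep_L2 (slice u t) x = rep_L2 u (x, t)"
  using AE_sq_integrable_slice_snd[of u]
  by eventually_elim (simp add: slice_def rep_to_L2 L2_fun_sq_integrable)

lemma slice_eqI:
  assumes "AE z in lborel. rep_L2 u z = f z" and "AE t in lborel. AE x in lborel. rep_L2 (w t) x = f (x, t)"
  shows "AE t in lborel. slice u t = w t"
  using rep_slice[of u] AE_prod_sndD[OF assms(1)] assms(2)
proof eventually_elim
  case (elim t)
  from elim have "AE x in lborel. rep_L2 (slice u t) x = rep_L2 (w t) x" by eventually_elim simp
  then show ?case by (rule L2_eqI)
qed

lemma slice_add: "AE t in lborel. slice (u + v) t = slice u t + slice v t"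
proof (rule slice_eqI[OF rep_add_L2])
  show "AE t in lborel. AE x in lborel. rep_L2 (slice u t + slice v t) x = rep_L2 u (x, t) + rep_L2 v (x, t)"
    using rep_slice[of u] rep_slice[of v]
  proof eventually_elim
    case (elim t)
    then show ?case using rep_add_L2[of "slice u t" "slice v t"] by eventually_elim simp
  qed
qed

lemma slice_diff: "AE t in lborel. slice (u - v) t = slice u t - slice v t"
proof (rule slice_eqI[OF rep_diff_L2])
  show "AE t in lborel. AE x in lborel. rep_L2 (slice u t - slice v t) x = rep_L2 u (x, t) - rep_L2 v (x, t)"
    using rep_slice[of u] rep_slice[of v]
  proof eventually_elim
    case (elim t)
    then show ?case using rep_diff_L2[of "slice u t" "slice v t"] by eventually_elim simp
  qed
qed

lemma slice_time_mult:
  assumes "bounded_fun \<theta>" shows "AE t in lborel. slice (time_mult \<theta> u) t = \<theta> t *\<^sub>R slice u t"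
proof (rule slice_eqI[OF rep_time_mult[OF assms]])
  show "AE t in lborel. AE x in lborel. rep_L2 (\<theta> t *\<^sub>R slice u t) x = \<theta> (snd (x, t)) *\<^sub>R rep_L2 u (x, t)"
    using rep_slice[of u]
  proof eventually_elim
    case (elim t)
    then show ?case using rep_scaleR_L2[of "\<theta> t" "slice u t"] by eventually_elim simp
  qed
qed

lemma slice_scaleR: "AE t in lborel. slice (c *\<^sub>R u) t = c *\<^sub>R slice u t"
proof (rule slice_eqI[OF rep_scaleR_L2])
  show "AE t in lborel. AE x in lborel. rep_L2 (c *\<^sub>R slice u t) x = c *\<^sub>R rep_L2 u (x, t)"
    using rep_slice[of u]
  proof eventually_elim
    case (elim t)
    then show ?case using rep_scaleR_L2[of c "slice u t"] by eventually_elim simp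
  qed
qed

lemma slice_embed:
  assumes "0 < T" shows "AE t in lborel. slice (time_embed T y) t = indicator {0<..<T} t *\<^sub>R y"
proof (rule slice_eqI[OF rep_time_embed[OF assms]])
  show "AE t in lborel. AE x in lborel. rep_L2 (indicator {0<..<T} t *\<^sub>R y) x = indicator {0<..<T} (snd (x, t)) *\<^sub>R rep_L2 y (fst (x, t))"
    by (rule AE_I2) (use rep_scaleR_L2[of _ y] in simp)
qed

text \<open>Inner products of slices are represented by a function that is measurable for every argument.\<close>

definition slice_inner :: "('a::euclidean_space \<times> real, 'b::euclidean_space) L2 \<Rightarrow> ('a \<times> real, 'b) L2 \<Rightarrow> real \<Rightarrow> real" where
  "slice_inner u v t = (\<integral>x. rep_L2 u (x, t) \<bullet> rep_L2 v (x, t) \<partial>lborel)"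

lemma integrable_slice_inner: "integrable lborel (slice_inner u v)"
  unfolding slice_inner_def[abs_def] by (rule integrable_slice_integral_snd[OF integrable_rep_inner])

lemma integral_slice_inner: "(\<integral>t. slice_inner u v t \<partial>lborel) = u \<bullet> v"
  unfolding slice_inner_def inner_L2 by (rule integral_prod_snd[OF integrable_rep_inner, symmetric])

lemma slice_inner_eq: "AE t in lborel. slice_inner u v t = slice u t \<bullet> slice v t"
  using rep_slice[of u] rep_slice[of v]
proof eventually_elim
  case (elim t)
  show ?case unfolding slice_inner_def inner_L2
    by (rule integral_cong_AE) (use elim in \<open>measurable, eventually_elim, simp\<close>)
qed

section \<open>Matrix multiplication operators\<close>

definition multiplier :: "('a::euclidean_space \<Rightarrow> 'b::euclidean_space \<Rightarrow> 'b) \<Rightarrow> real \<Rightarrow> bool" where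
  "multiplier A m \<longleftrightarrow> (\<forall>x. linear (A x)) \<and> (\<exists>C. \<forall>x \<xi>. norm (A x \<xi>) \<le> C * norm \<xi>) \<and>
     (\<lambda>z. A (fst z) (snd z)) \<in> borel_measurable borel \<and>
     (\<forall>x \<xi> \<eta>. A x \<xi> \<bullet> \<eta> = \<xi> \<bullet> A x \<eta>) \<and> 0 < m \<and> (\<forall>x \<xi>. m * (norm \<xi>)\<^sup>2 \<le> A x \<xi> \<bullet> \<xi>)"

definition mult_op :: "('a::euclidean_space \<Rightarrow> 'b::euclidean_space \<Rightarrow> 'b) \<Rightarrow> ('a, 'b) L2 \<Rightarrow> ('a, 'b) L2" where
  "mult_op A u = to_L2 (\<lambda>x. A x (rep_L2 u x))"

lemma multiplier_fst:
  assumes "multiplier A m"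
  shows "multiplier (\<lambda>z :: 'a::euclidean_space \<times> 'c::euclidean_space. A (fst z)) m"
proof -
  have [measurable]: "(\<lambda>z. A (fst z) (snd z)) \<in> borel_measurable borel" using assms by (simp add: multiplier_def)
  have "(\<lambda>z :: ('a \<times> 'c) \<times> 'b. (fst (fst z), snd z)) \<in> borel \<rightarrow>\<^sub>M borel" by measurable
  from measurable_compose[OF this, of "\<lambda>z. A (fst z) (snd z)" borel]
  have "(\<lambda>z :: ('a \<times> 'c) \<times> 'b. A (fst (fst z)) (snd z)) \<in> borel_measurable borel" by simp
  then show ?thesis using assms unfolding multiplier_def by blast
qed

context
  fixes A :: "'a::euclidean_space \<Rightarrow> 'b::euclidean_space \<Rightarrow> 'b" and m :: real
  assumes A: "multiplier A m"
begin

lemma mult_op_L2: "L2_fun (\<lambda>x. A x (rep_L2 u x))"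
proof -
  have meas: "(\<lambda>z. A (fst z) (snd z)) \<in> borel_measurable borel" using A by (simp add: multiplier_def)
  from A obtain C where C: "\<And>x \<xi>. norm (A x \<xi>) \<le> C * norm \<xi>" by (auto simp: multiplier_def)
  show ?thesis
  proof (intro L2_fun_sq_integrable sq_integrable_bound)
    show "integrable lborel (\<lambda>x. C\<^sup>2 * (norm (rep_L2 u x))\<^sup>2)" using integrable_rep_norm[of u] by simp
    show "AE x in lborel. (norm (A x (rep_L2 u x)))\<^sup>2 \<le> C\<^sup>2 * (norm (rep_L2 u x))\<^sup>2"
      using C by (intro AE_I2) (simp flip: power_mult_distrib add: power_mono)
    have "(\<lambda>x. (x, rep_L2 u x)) \<in> borel \<rightarrow>\<^sub>M borel" by measurable
    from measurable_compose[OF this meas] show "(\<lambda>x. A x (rep_L2 u x)) \<in> borel_measurable borel" by simp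
  qed
qed

lemma rep_mult_op: "AE x in lborel. rep_L2 (mult_op A u) x = A x (rep_L2 u x)"
  unfolding mult_op_def by (rule rep_to_L2[OF mult_op_L2])

lemma mult_op_inner: "mult_op A u \<bullet> v = (\<integral>x. A x (rep_L2 u x) \<bullet> rep_L2 v x \<partial>lborel)"
  and integrable_mult_op_inner: "integrable lborel (\<lambda>x. A x (rep_L2 u x) \<bullet> rep_L2 v x)"
proof -
  have ae: "AE x in lborel. rep_L2 (mult_op A u) x \<bullet> rep_L2 v x = A x (rep_L2 u x) \<bullet> rep_L2 v x"
    using rep_mult_op[of u] by eventually_elim simp
  have meas: "(\<lambda>z. A (fst z) (snd z)) \<in> borel_measurable borel" using A by (simp add: multiplier_def)
  have "(\<lambda>x. (x, rep_L2 u x)) \<in> borel \<rightarrow>\<^sub>M borel" by measurable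
  from measurable_compose[OF this meas] have [measurable]: "(\<lambda>x. A x (rep_L2 u x)) \<in> borel_measurable borel" by simp
  show "mult_op A u \<bullet> v = (\<integral>x. A x (rep_L2 u x) \<bullet> rep_L2 v x \<partial>lborel)"
    unfolding inner_L2 by (rule integral_cong_AE[OF _ _ ae]) measurable
  show "integrable lborel (\<lambda>x. A x (rep_L2 u x) \<bullet> rep_L2 v x)"
    using integrable_rep_inner[of "mult_op A u" v] by (subst (asm) integrable_cong_AE[OF _ _ ae]) measurable
qed

lemma coercive_mult_op: "coercive (mult_op A) m"
proof -
  have lin: "linear (A x)" for x using A by (simp add: multiplier_def)
  from A obtain C where C: "\<And>x \<xi>. norm (A x \<xi>) \<le> C * norm \<xi>" by (auto simp: multiplier_def)
  have C0: "norm (A x \<xi>) \<le> \<bar>C\<bar> * norm \<xi>" for x \<xi>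
    using C[of x \<xi>] by (meson abs_ge_self mult_right_mono norm_ge_zero order_trans)
  have "bounded_linear (mult_op A)"
    unfolding mult_op_def[abs_def]
  proof (rule bounded_linear_to_L2[where C="\<bar>C\<bar>"])
    show "AE x in lborel. A x (rep_L2 (u + v) x) = A x (rep_L2 u x) + A x (rep_L2 v x)" for u v :: "('a, 'b) L2"
      using rep_add_L2[of u v] by eventually_elim (simp add: linear_add[OF lin])
    show "AE x in lborel. A x (rep_L2 (c *\<^sub>R u) x) = c *\<^sub>R A x (rep_L2 u x)" for c and u :: "('a, 'b) L2"
      using rep_scaleR_L2[of c u] by eventually_elim (simp add: linear_scale[OF lin])
    show "norm (to_L2 (\<lambda>x. A x (rep_L2 u x))) \<le> norm u * \<bar>C\<bar>" for u :: "('a, 'b) L2"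
      unfolding mult_op_def[symmetric]
    proof (rule norm_L2_le)
      show "integrable lborel (\<lambda>x. C\<^sup>2 * (norm (rep_L2 u x))\<^sup>2)" using integrable_rep_norm[of u] by simp
      show "AE x in lborel. (norm (rep_L2 (mult_op A u) x))\<^sup>2 \<le> C\<^sup>2 * (norm (rep_L2 u x))\<^sup>2"
        using rep_mult_op[of u]
        by eventually_elim (use C in \<open>simp flip: power_mult_distrib add: power_mono\<close>)
    qed (simp_all add: norm_L2_sq power_mult_distrib mult.commute)
  qed (rule mult_op_L2)
  moreover have "mult_op A u \<bullet> v = u \<bullet> mult_op A v" for u v
    using A mult_op_inner[of u v] mult_op_inner[of v u]
    by (simp add: multiplier_def inner_commute[of u] inner_commute[of _ "A _ _"])
  moreover have "m * (norm u)\<^sup>2 \<le> mult_op A u \<bullet> u" for u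
  proof -
    have "(\<integral>x. m * (norm (rep_L2 u x))\<^sup>2 \<partial>lborel) \<le> (\<integral>x. A x (rep_L2 u x) \<bullet> rep_L2 u x \<partial>lborel)"
      using A integrable_rep_norm[of u] by (intro integral_mono integrable_mult_op_inner) (auto simp: multiplier_def)
    then show ?thesis by (simp add: mult_op_inner norm_L2_sq)
  qed
  moreover have "0 < m" using A by (simp add: multiplier_def)
  ultimately show ?thesis by (simp add: coercive_def)
qed

lemma volterra_mult_op:
  assumes T: "0 < T"
  shows "volterra T (mult_op (\<lambda>z. A (fst z)) u) = mult_op (\<lambda>z. A (fst z)) (volterra T u)"
proof (rule L2_eqI)
  have lin: "linear (A x)" for x using A by (simp add: multiplier_def)
  have mm: "multiplier (\<lambda>z :: 'a \<times> real. A (fst z)) m" by (rule multiplier_fst[OF A])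
  have *: "AE x in lborel. \<forall>t. primitive (cut T (\<lambda>s. rep_L2 (mult_op (\<lambda>z. A (fst z)) u) (x, s))) t
      = A x (primitive (cut T (\<lambda>s. rep_L2 u (x, s))) t)"
    using AE_prod_fstD[OF Submission.rep_mult_op[OF mm, of u]] AE_sq_integrable_slice_fst[of u]
  proof eventually_elim
    case (elim x)
    have bl: "bounded_linear (A x)" using lin by (simp add: linear_conv_bounded_linear)
    have [measurable]: "A x \<in> borel_measurable borel"
      using bl by (intro borel_measurable_continuous_onI bounded_linear.continuous_on[OF bl] continuous_intros)
    show ?case
    proof
      fix t
      have "primitive (cut T (\<lambda>s. rep_L2 (mult_op (\<lambda>z. A (fst z)) u) (x, s))) t
          = (\<integral>s. A x (indicator {..<t} s *\<^sub>R cut T (\<lambda>s. rep_L2 u (x, s)) s) \<partial>lborel)"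
        unfolding primitive_def
        by (rule integral_cong_AE) (use elim(1) in \<open>measurable, eventually_elim, simp add: linear_scale[OF lin]\<close>)
      also have "\<dots> = A x (primitive (cut T (\<lambda>s. rep_L2 u (x, s))) t)"
        unfolding primitive_def
        by (rule integral_bounded_linear[OF bl], rule integrable_indicator_scaleR) (simp, rule integrable_cut[OF elim(2)])
      finally show "primitive (cut T (\<lambda>s. rep_L2 (mult_op (\<lambda>z. A (fst z)) u) (x, s))) t
        = A x (primitive (cut T (\<lambda>s. rep_L2 u (x, s))) t)" .
    qed
  qed
  show "AE z in lborel. rep_L2 (volterra T (mult_op (\<lambda>z. A (fst z)) u)) z = rep_L2 (mult_op (\<lambda>z. A (fst z)) (volterra T u)) z"
    using rep_volterra[OF T, of "mult_op (\<lambda>z. A (fst z)) u"] Submission.rep_mult_op[OF mm, of "volterra T u"]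
      rep_volterra[OF T, of u] AE_prod_fstI[OF *]
    by eventually_elim (simp add: linear_scale[OF lin])
qed

lemma time_embed_mult_op:
  assumes T: "0 < T"
  shows "time_embed T (mult_op A y) = mult_op (\<lambda>z. A (fst z)) (time_embed T y)"
proof (rule L2_eqI)
  have lin: "linear (A x)" for x using A by (simp add: multiplier_def)
  have mm: "multiplier (\<lambda>z :: 'a \<times> real. A (fst z)) m" by (rule multiplier_fst[OF A])
  show "AE z in lborel. rep_L2 (time_embed T (mult_op A y)) z = rep_L2 (mult_op (\<lambda>z. A (fst z)) (time_embed T y)) z"
    using rep_time_embed[OF T, of "mult_op A y"] Submission.rep_mult_op[OF mm, of "time_embed T y"]
      rep_time_embed[OF T, of y] AE_prod_fstI[OF rep_mult_op[of y]]
    by eventually_elim (simp add: linear_scale[OF lin])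
qed

lemma time_mult_mult_op:
  assumes \<theta>: "bounded_fun \<theta>"
  shows "time_mult \<theta> (mult_op (\<lambda>z. A (fst z)) u) = mult_op (\<lambda>z. A (fst z)) (time_mult \<theta> u)"
proof (rule L2_eqI)
  have lin: "linear (A x)" for x using A by (simp add: multiplier_def)
  have mm: "multiplier (\<lambda>z :: 'a \<times> real. A (fst z)) m" by (rule multiplier_fst[OF A])
  show "AE z in lborel. rep_L2 (time_mult \<theta> (mult_op (\<lambda>z. A (fst z)) u)) z = rep_L2 (mult_op (\<lambda>z. A (fst z)) (time_mult \<theta> u)) z"
    using rep_time_mult[OF \<theta>, of "mult_op (\<lambda>z. A (fst z)) u"] Submission.rep_mult_op[OF mm, of u]
      rep_time_mult[OF \<theta>, of u] Submission.rep_mult_op[OF mm, of "time_mult \<theta> u"]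
    by eventually_elim (simp add: linear_scale[OF lin])
qed

end

section \<open>Closed operators acting on every time slice\<close>

definition time_graph :: "real \<Rightarrow> (('a::euclidean_space, 'b::euclidean_space) L2 \<times> ('a, 'b) L2) set \<Rightarrow>
    (('a \<times> real, 'b) L2 \<times> ('a \<times> real, 'b) L2) set" where
  "time_graph T G = {(u, r). AE t in lborel. t \<in> {0<..<T} \<longrightarrow> (slice u t, slice r t) \<in> G}"

text \<open>
  The exceptional null set is the same for all \<open>n\<close>. Therefore it can be combined with tests against all
  normal vectors of a closed subspace, which may be uncountably many.
\<close>

lemma slice_volterra_inner:
  fixes u :: "('a::euclidean_space \<times> real, 'b::euclidean_space) L2"
  assumes T: "0 < T"
  shows "AE t in lborel. \<forall>n. slice (volterra T u) t \<bullet> n = indicator {0<..<T} t * primitive (slice_inner u (time_embed T n)) t"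
  using AE_prod_sndD[OF rep_volterra[OF T, of u]] rep_slice[of "volterra T u"]
proof eventually_elim
  case (elim t)
  show ?case
  proof
    fix n
    define h where "h z = indicator {..<t} (snd z) *\<^sub>R (rep_L2 u z \<bullet> rep_L2 (time_embed T n) z)" for z
    have h: "integrable lborel h"
    proof (rule Bochner_Integration.integrable_bound[OF integrable_rep_inner[of u "time_embed T n"]])
      have "(\<lambda>z :: 'a \<times> real. indicator {..<t} (snd z) :: real) \<in> borel_measurable borel" by measurable
      then show "h \<in> borel_measurable lborel" unfolding h_def by simp
    qed (auto simp: h_def indicator_def)
    have "slice (volterra T u) t \<bullet> n = (\<integral>x. indicator {0<..<T} t * (\<integral>s. h (x, s) \<partial>lborel) \<partial>lborel)"
      unfolding inner_L2
    proof (rule integral_cong_AE)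
      show "AE x in lborel. rep_L2 (slice (volterra T u) t) x \<bullet> rep_L2 n x = indicator {0<..<T} t * (\<integral>s. h (x, s) \<partial>lborel)"
        using elim AE_prod_fstD[OF rep_time_embed[OF T, of n]] AE_sq_integrable_slice_fst[of u]
      proof eventually_elim
        case (elim x)
        have "(\<integral>s. h (x, s) \<partial>lborel) = (\<integral>s. (indicator {..<t} s *\<^sub>R cut T (\<lambda>s. rep_L2 u (x, s)) s) \<bullet> rep_L2 n x \<partial>lborel)"
          by (rule integral_cong_AE) (use elim(3) in \<open>(simp add: h_def, measurable)?, (eventually_elim, simp add: h_def)?\<close>)
        also have "\<dots> = primitive (cut T (\<lambda>s. rep_L2 u (x, s))) t \<bullet> rep_L2 n x"
          unfolding primitive_def
          by (rule integral_inner_left, rule integrable_indicator_scaleR) (simp, rule integrable_cut[OF elim(4)])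
        finally show ?case using elim(1,2) by simp
      qed
      show "(\<lambda>x. indicator {0<..<T} t * (\<integral>s. h (x, s) \<partial>lborel)) \<in> borel_measurable lborel"
        using borel_measurable_integrable[OF integrable_slice_integral_fst[OF h]] by simp
    qed measurable
    also have "\<dots> = indicator {0<..<T} t * (\<integral>x. (\<integral>s. h (x, s) \<partial>lborel) \<partial>lborel)" by simp
    also have "(\<integral>x. (\<integral>s. h (x, s) \<partial>lborel) \<partial>lborel) = (\<integral>s. (\<integral>x. h (x, s) \<partial>lborel) \<partial>lborel)"
      using integral_prod_fst[OF h] integral_prod_snd[OF h] by simp
    also have "\<dots> = primitive (slice_inner u (time_embed T n)) t"
      unfolding primitive_def by (simp add: h_def slice_inner_def)
    finally show "slice (volterra T u) t \<bullet> n = indicator {0<..<T} t * primitive (slice_inner u (time_embed T n)) t" .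
  qed
qed

context
  fixes T :: real and G :: "(('a::euclidean_space, 'b::euclidean_space) L2 \<times> ('a, 'b) L2) set"
  assumes T: "0 < T" and G: "closed G" "subspace G"
begin

lemma mem_graphI:
  assumes "\<And>n1 n2. (\<And>x y. (x, y) \<in> G \<Longrightarrow> x \<bullet> n1 + y \<bullet> n2 = 0) \<Longrightarrow> a \<bullet> n1 + b \<bullet> n2 = 0"
  shows "(a, b) \<in> G"
proof (rule mem_closed_subspace_if_orthogonal[OF G])
  fix z assume z: "\<And>s. s \<in> G \<Longrightarrow> z \<bullet> s = 0"
  have "a \<bullet> fst z + b \<bullet> snd z = 0"
  proof (rule assms)
    fix x y assume "(x, y) \<in> G"
    from z[OF this] show "x \<bullet> fst z + y \<bullet> snd z = 0" by (cases z) (simp add: inner_commute)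
  qed
  then show "z \<bullet> (a, b) = 0" by (cases z) (simp add: inner_commute)
qed

lemma subspace_time_graph: "subspace (time_graph T G)"
proof (rule subspaceI)
  have "AE t in lborel. slice (0 :: ('a \<times> real, 'b) L2) t = 0"
  proof (rule slice_eqI[OF rep_zero_L2])
    show "AE t in lborel. AE x in lborel. rep_L2 (0 :: ('a, 'b) L2) x = 0" by (rule AE_I2) (rule rep_zero_L2)
  qed
  then show "0 \<in> time_graph T G" using subspace_0[OF G(2)] by (auto simp: time_graph_def zero_prod_def elim!: eventually_mono)
next
  fix a b assume "a \<in> time_graph T G" "b \<in> time_graph T G"
  then obtain u r v s where ab: "a = (u, r)" "b = (v, s)"
    and 1: "AE t in lborel. t \<in> {0<..<T} \<longrightarrow> (slice u t, slice r t) \<in> G"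
    and 2: "AE t in lborel. t \<in> {0<..<T} \<longrightarrow> (slice v t, slice s t) \<in> G"
    by (cases a, cases b) (auto simp: time_graph_def)
  have "AE t in lborel. t \<in> {0<..<T} \<longrightarrow> (slice (u + v) t, slice (r + s) t) \<in> G"
    using 1 2 slice_add[of u v] slice_add[of r s]
    by eventually_elim (auto dest: subspace_add[OF G(2)])
  then show "a + b \<in> time_graph T G" by (simp add: ab time_graph_def)
next
  fix c :: real and a assume "a \<in> time_graph T G"
  then obtain u r where a: "a = (u, r)"
    and 1: "AE t in lborel. t \<in> {0<..<T} \<longrightarrow> (slice u t, slice r t) \<in> G"
    by (cases a) (auto simp: time_graph_def)
  have "AE t in lborel. t \<in> {0<..<T} \<longrightarrow> (slice (c *\<^sub>R u) t, slice (c *\<^sub>R r) t) \<in> G"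
    using 1 slice_scaleR[of c u] slice_scaleR[of c r]
    by eventually_elim (auto dest: subspace_scale[OF G(2)])
  then show "c *\<^sub>R a \<in> time_graph T G" by (simp add: a time_graph_def)
qed

lemma time_graph_time_mult:
  assumes \<theta>: "bounded_fun \<theta>" and "(u, r) \<in> time_graph T G"
  shows "(time_mult \<theta> u, time_mult \<theta> r) \<in> time_graph T G"
proof -
  have "AE t in lborel. t \<in> {0<..<T} \<longrightarrow> (slice u t, slice r t) \<in> G" using assms(2) by (simp add: time_graph_def)
  then have "AE t in lborel. t \<in> {0<..<T} \<longrightarrow> (slice (time_mult \<theta> u) t, slice (time_mult \<theta> r) t) \<in> G"
    using slice_time_mult[OF \<theta>, of u] slice_time_mult[OF \<theta>, of r]
    by eventually_elim (auto dest: subspace_scale[OF G(2)])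
  then show ?thesis by (simp add: time_graph_def)
qed

lemma time_graph_time_embed:
  assumes "(y, b) \<in> G" shows "(time_embed T y, time_embed T b) \<in> time_graph T G"
proof -
  have "AE t in lborel. t \<in> {0<..<T} \<longrightarrow> (slice (time_embed T y) t, slice (time_embed T b) t) \<in> G"
    using slice_embed[OF T, of y] slice_embed[OF T, of b] by eventually_elim (simp add: assms)
  then show ?thesis by (simp add: time_graph_def)
qed

lemma slice_inner_orthogonal:
  assumes "(u, r) \<in> time_graph T G" and n: "\<And>x y. (x, y) \<in> G \<Longrightarrow> x \<bullet> n1 + y \<bullet> n2 = 0"
  shows "AE t in lborel. slice_inner u (time_embed T n1) t + slice_inner r (time_embed T n2) t = 0"
proof -
  have "AE t in lborel. t \<in> {0<..<T} \<longrightarrow> (slice u t, slice r t) \<in> G" using assms(1) by (simp add: time_graph_def)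
  then show ?thesis
    using slice_inner_eq[of u "time_embed T n1"] slice_inner_eq[of r "time_embed T n2"]
      slice_embed[OF T, of n1] slice_embed[OF T, of n2]
    by eventually_elim (auto simp: indicator_def dest: n)
qed

text \<open>
  A slice lies in the closed subspace \<open>G\<close> iff it is orthogonal to the normals of \<open>G\<close>, and integration in
  time commutes with the inner product with a fixed vector.
\<close>

lemma time_graph_volterra:
  assumes ur: "(u, r) \<in> time_graph T G" shows "(volterra T u, volterra T r) \<in> time_graph T G"
proof -
  have prim: "primitive (slice_inner u (time_embed T n1)) t + primitive (slice_inner r (time_embed T n2)) t = 0"
    if n: "\<And>x y. (x, y) \<in> G \<Longrightarrow> x \<bullet> n1 + y \<bullet> n2 = 0" for n1 n2 t
  proof -
    have orth: "AE s in lborel. slice_inner u (time_embed T n1) s + slice_inner r (time_embed T n2) s = 0"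
      by (rule slice_inner_orthogonal[OF ur]) (rule n)
    have "primitive (slice_inner u (time_embed T n1)) t + primitive (slice_inner r (time_embed T n2)) t
       = (\<integral>s. indicator {..<t} s *\<^sub>R slice_inner u (time_embed T n1) s + indicator {..<t} s *\<^sub>R slice_inner r (time_embed T n2) s \<partial>lborel)"
      unfolding primitive_def
      by (rule Bochner_Integration.integral_add[symmetric]; rule integrable_indicator_scaleR) (simp_all add: integrable_slice_inner)
    also have "\<dots> = 0"
    proof (rule integral_eq_zero_AE)
      show "AE s in lborel. indicator {..<t} s *\<^sub>R slice_inner u (time_embed T n1) s + indicator {..<t} s *\<^sub>R slice_inner r (time_embed T n2) s = 0"
        using orth by eventually_elim (auto simp: indicator_def)
    qed
    finally show ?thesis .
  qed
  have "AE t in lborel. t \<in> {0<..<T} \<longrightarrow> (slice (volterra T u) t, slice (volterra T r) t) \<in> G"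
    using slice_volterra_inner[OF T, of u] slice_volterra_inner[OF T, of r]
  proof eventually_elim
    case (elim t)
    show ?case
    proof (intro impI mem_graphI)
      fix n1 n2 assume n: "\<And>x y. (x, y) \<in> G \<Longrightarrow> x \<bullet> n1 + y \<bullet> n2 = 0"
      have "primitive (slice_inner u (time_embed T n1)) t + primitive (slice_inner r (time_embed T n2)) t = 0"
        by (rule prim) (rule n)
      then show "slice (volterra T u) t \<bullet> n1 + slice (volterra T r) t \<bullet> n2 = 0"
        using elim by (simp flip: distrib_left)
    qed
  qed
  then show ?thesis by (simp add: time_graph_def)
qed

lemma time_graph_time_integral:
  assumes ur: "(u, r) \<in> time_graph T G" shows "(time_integral T u, time_integral T r) \<in> G"
proof (rule mem_graphI)
  fix n1 n2 assume n: "\<And>x y. (x, y) \<in> G \<Longrightarrow> x \<bullet> n1 + y \<bullet> n2 = 0"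
  have "time_integral T u \<bullet> n1 + time_integral T r \<bullet> n2 = u \<bullet> time_embed T n1 + r \<bullet> time_embed T n2"
    using time_embed_adjoint[OF T, of n1 u] time_embed_adjoint[OF T, of n2 r] by (simp add: inner_commute)
  also have "\<dots> = (\<integral>t. slice_inner u (time_embed T n1) t + slice_inner r (time_embed T n2) t \<partial>lborel)"
    by (simp add: integrable_slice_inner integral_slice_inner)
  also have "\<dots> = 0" by (rule integral_eq_zero_AE, rule slice_inner_orthogonal[OF ur]) (rule n)
  finally show "time_integral T u \<bullet> n1 + time_integral T r \<bullet> n2 = 0" .
qed

lemma time_graph_volterra_adjoint:
  assumes ur: "(u, r) \<in> time_graph T G" shows "(volterra_adjoint T u, volterra_adjoint T r) \<in> time_graph T G"
  using subspace_diff[OF subspace_time_graph time_graph_time_embed[OF time_graph_time_integral[OF ur]] time_graph_volterra[OF ur]]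
  by (simp add: volterra_adjoint_def)

text \<open>
  Convergence of fields implies convergence of almost all slices along a subsequence.
\<close>

lemma closed_time_graph: "closed (time_graph T G)"
  unfolding closed_sequential_limits
proof (intro allI impI, elim conjE)
  fix x :: "nat \<Rightarrow> ('a \<times> real, 'b) L2 \<times> ('a \<times> real, 'b) L2" and l
  assume x: "\<forall>n. x n \<in> time_graph T G" and lim: "x \<longlonglongrightarrow> l"
  define d where "d n = x n - l" for n
  define f where "f n t = slice_inner (fst (d n)) (fst (d n)) t + slice_inner (snd (d n)) (snd (d n)) t" for n t
  have f0: "0 \<le> f n t" for n t unfolding f_def slice_inner_def by (intro add_nonneg_nonneg integral_nonneg_AE) auto
  have "(\<lambda>n. norm (fst (d n)) ^ 2 + norm (snd (d n)) ^ 2) \<longlonglongrightarrow> norm (fst (l - l)) ^ 2 + norm (snd (l - l)) ^ 2"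
    unfolding d_def by (intro tendsto_intros lim)
  moreover have "(\<integral>t. norm (f n t) \<partial>lborel) = norm (fst (d n)) ^ 2 + norm (snd (d n)) ^ 2" for n
    using f0 by (simp add: abs_of_nonneg) (simp add: f_def integrable_slice_inner integral_slice_inner power2_norm_eq_inner)
  ultimately have "(\<lambda>n. \<integral>t. norm (f n t) \<partial>lborel) \<longlonglongrightarrow> 0" by simp
  moreover have "integrable lborel (f n)" for n
    unfolding f_def[abs_def] by (intro Bochner_Integration.integrable_add integrable_slice_inner)
  ultimately obtain s :: "nat \<Rightarrow> nat" where s: "strict_mono s" "AE t in lborel. (\<lambda>n. f (s n) t) \<longlonglongrightarrow> 0"
    using tendsto_L1_AE_subseq by blast
  have G': "AE t in lborel. \<forall>n. t \<in> {0<..<T} \<longrightarrow> (slice (fst (x n)) t, slice (snd (x n)) t) \<in> G"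
    unfolding AE_all_countable
  proof
    fix n show "AE t in lborel. t \<in> {0<..<T} \<longrightarrow> (slice (fst (x n)) t, slice (snd (x n)) t) \<in> G"
      using x[rule_format, of n] by (cases "x n") (simp add: time_graph_def)
  qed
  have fs: "AE t in lborel. \<forall>n. f n t = (norm (slice (fst (x n)) t - slice (fst l) t))\<^sup>2 + (norm (slice (snd (x n)) t - slice (snd l) t))\<^sup>2"
    unfolding AE_all_countable
  proof
    fix n
    show "AE t in lborel. f n t = (norm (slice (fst (x n)) t - slice (fst l) t))\<^sup>2 + (norm (slice (snd (x n)) t - slice (snd l) t))\<^sup>2"
      using slice_inner_eq[of "fst (d n)" "fst (d n)"] slice_inner_eq[of "snd (d n)" "snd (d n)"]
        slice_diff[of "fst (x n)" "fst l"] slice_diff[of "snd (x n)" "snd l"]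
      by eventually_elim (simp add: f_def d_def power2_norm_eq_inner)
  qed
  have "AE t in lborel. t \<in> {0<..<T} \<longrightarrow> (slice (fst l) t, slice (snd l) t) \<in> G"
    using s(2) G' fs
  proof eventually_elim
    case (elim t)
    have *: "(\<lambda>n. g (s n)) \<longlonglongrightarrow> c" if "\<And>n. (norm (g n - c))\<^sup>2 \<le> f n t" for g :: "nat \<Rightarrow> ('a, 'b) L2" and c
    proof (rule LIM_zero_cancel, rule tendsto_norm_zero_cancel)
      have "(\<lambda>n. sqrt (f (s n) t)) \<longlonglongrightarrow> sqrt 0" by (intro tendsto_intros elim(1))
      then have "(\<lambda>n. sqrt (f (s n) t)) \<longlonglongrightarrow> 0" by simp
      then show "(\<lambda>n. norm (g (s n) - c)) \<longlonglongrightarrow> 0"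
        by (rule Lim_null_comparison[OF always_eventually, rotated]) (use that in \<open>auto intro: real_le_rsqrt\<close>)
    qed
    show ?case
    proof
      assume t: "t \<in> {0<..<T}"
      have "(\<lambda>n. (slice (fst (x (s n))) t, slice (snd (x (s n))) t)) \<longlonglongrightarrow> (slice (fst l) t, slice (snd l) t)"
        by (intro tendsto_Pair *) (use elim(3) in auto)
      then show "(slice (fst l) t, slice (snd l) t) \<in> G"
        by (rule closed_sequentially[OF G(1), rotated]) (use elim(2) t in blast)
    qed
  qed
  then show "l \<in> time_graph T G" by (cases l) (simp add: time_graph_def)
qed

text \<open>
  The graph imposes no condition on the slices outside the time interval, so its adjoint must vanish
  there.
\<close>

lemma adjoint_time_graphI:
  assumes "AE t in lborel. t \<in> {0<..<T} \<longrightarrow> (slice v t, slice b t) \<in> adjoint_relation G"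
    and "AE t in lborel. t \<notin> {0<..<T} \<longrightarrow> slice v t = 0 \<and> slice b t = 0"
  shows "(v, b) \<in> adjoint_relation (time_graph T G)"
  unfolding adjoint_relation_def
proof (safe)
  fix u a assume "(u, a) \<in> time_graph T G"
  then have "AE t in lborel. t \<in> {0<..<T} \<longrightarrow> (slice u t, slice a t) \<in> G" by (simp add: time_graph_def)
  then have "AE t in lborel. slice_inner u b t = slice_inner a v t"
    using assms slice_inner_eq[of u b] slice_inner_eq[of a v]
  proof eventually_elim
    case (elim t)
    then show ?case by (cases "t \<in> {0<..<T}") (auto simp: adjoint_relation_def)
  qed
  then have "(\<integral>t. slice_inner u b t \<partial>lborel) = (\<integral>t. slice_inner a v t \<partial>lborel)"
    by (intro integral_cong_AE) (use integrable_slice_inner borel_measurable_integrable in blast)+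
  then show "u \<bullet> b = a \<bullet> v" by (simp add: integral_slice_inner)
qed

lemma adjoint_time_graph_time_embed:
  assumes "(y, b) \<in> adjoint_relation G"
  shows "(time_embed T y, time_embed T b) \<in> adjoint_relation (time_graph T G)"
proof (rule adjoint_time_graphI)
  show "AE t in lborel. t \<in> {0<..<T} \<longrightarrow> (slice (time_embed T y) t, slice (time_embed T b) t) \<in> adjoint_relation G"
    using slice_embed[OF T, of y] slice_embed[OF T, of b] by eventually_elim (simp add: assms)
  show "AE t in lborel. t \<notin> {0<..<T} \<longrightarrow> slice (time_embed T y) t = 0 \<and> slice (time_embed T b) t = 0"
    using slice_embed[OF T, of y] slice_embed[OF T, of b] by eventually_elim simp
qed

end

section \<open>The abstract Maxwell system\<close>

text \<open>
  The Maxwell operator \<open>(e, h) \<mapsto> (- curl h, curl\<^sup>* e)\<close>, where \<open>G\<close> is the graph of the curl. The adjoint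
  carries the boundary condition on \<open>e\<close>.
\<close>

definition skew_graph :: "('a::real_inner \<times> 'b::real_inner) set \<Rightarrow> (('b \<times> 'a) \<times> ('b \<times> 'a)) set" where
  "skew_graph G = {((e, h), (p, q)). (h, - p) \<in> G \<and> (e, q) \<in> adjoint_relation G}"

lemma subspace_adjoint_relation: "subspace (adjoint_relation G)"
  by (rule subspaceI) (fastforce simp: adjoint_relation_def zero_prod_def inner_add_right)+

text \<open>
  Skew-symmetry is the definition of the adjoint. Maximality is \<open>G\<^sup>*\<^sup>* = G\<close>: up to a sign and the
  order of the entries, the elements of the adjoint are the normals of \<open>G\<close>.
\<close>

lemma skew_adjoint_skew_graph:
  fixes G :: "('a::{real_inner,banach} \<times> 'b::{real_inner,banach}) set"
  assumes G: "closed G" "subspace G"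
  shows "skew_adjoint (skew_graph G)"
  unfolding skew_adjoint_def
proof (intro conjI allI)
  note Ga = subspace_adjoint_relation[of G]
  show "subspace (skew_graph G)"
  proof (rule subspaceI)
    show "0 \<in> skew_graph G"
      using subspace_0[OF G(2)] subspace_0[OF Ga] by (simp add: skew_graph_def zero_prod_def)
  next
    fix x y assume "x \<in> skew_graph G" "y \<in> skew_graph G"
    then obtain e h p q e' h' p' q' where xy: "x = ((e, h), (p, q))" "y = ((e', h'), (p', q'))"
      and 1: "(h, - p) \<in> G" "(e, q) \<in> adjoint_relation G" "(h', - p') \<in> G" "(e', q') \<in> adjoint_relation G"
      by (auto simp: skew_graph_def)
    from subspace_add[OF G(2) 1(1,3)] subspace_add[OF Ga 1(2,4)]
    show "x + y \<in> skew_graph G" by (simp add: xy skew_graph_def)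
  next
    fix c :: real and x assume "x \<in> skew_graph G"
    then obtain e h p q where x: "x = ((e, h), (p, q))"
      and 1: "(h, - p) \<in> G" "(e, q) \<in> adjoint_relation G"
      by (auto simp: skew_graph_def)
    from subspace_scale[OF G(2) 1(1), of c] subspace_scale[OF Ga 1(2), of c]
    show "c *\<^sub>R x \<in> skew_graph G" by (simp add: x skew_graph_def)
  qed
  fix u a :: "'b \<times> 'a"
  obtain e h p q where ua: "u = (e, h)" "a = (p, q)" by (cases u, cases a) auto
  show "(u, a) \<in> skew_graph G \<longleftrightarrow> (\<forall>(v, b)\<in>skew_graph G. a \<bullet> v = - (u \<bullet> b))"
  proof
    assume "(u, a) \<in> skew_graph G"
    then have 1: "(h, - p) \<in> G" "(e, q) \<in> adjoint_relation G" by (auto simp: ua skew_graph_def)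
    show "\<forall>(v, b)\<in>skew_graph G. a \<bullet> v = - (u \<bullet> b)"
    proof (clarify)
      fix e' h' p' q' assume "((e', h'), (p', q')) \<in> skew_graph G"
      then have 2: "(h', - p') \<in> G" "(e', q') \<in> adjoint_relation G" by (auto simp: skew_graph_def)
      from 1(2) 2(1) have "h' \<bullet> q = - p' \<bullet> e" unfolding adjoint_relation_def by blast
      moreover from 2(2) 1(1) have "h \<bullet> q' = - p \<bullet> e'" unfolding adjoint_relation_def by blast
      ultimately show "a \<bullet> (e', h') = - (u \<bullet> (p', q'))" by (simp add: ua inner_commute)
    qed
  next
    assume dual: "\<forall>(v, b)\<in>skew_graph G. a \<bullet> v = - (u \<bullet> b)"
    have "(e, q) \<in> adjoint_relation G"
      unfolding adjoint_relation_def
    proof (safe)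
      fix h' a' assume "(h', a') \<in> G"
      then have "((0, h'), (- a', 0)) \<in> skew_graph G"
        using subspace_0[OF Ga] by (simp add: skew_graph_def zero_prod_def)
      with dual have "a \<bullet> (0, h') = - (u \<bullet> (- a', 0))" by blast
      then show "h' \<bullet> q = a' \<bullet> e" by (simp add: ua inner_commute)
    qed
    moreover have "(h, - p) \<in> G"
    proof (rule mem_closed_subspace_if_orthogonal[OF G])
      fix z assume z: "\<And>s. s \<in> G \<Longrightarrow> z \<bullet> s = 0"
      obtain n1 n2 where n: "z = (n1, n2)" by (cases z)
      have "(n2, - n1) \<in> adjoint_relation G"
        unfolding adjoint_relation_def
      proof (safe)
        fix x y assume "(x, y) \<in> G"
        from z[OF this] show "x \<bullet> - n1 = y \<bullet> n2" by (simp add: n inner_commute)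
      qed
      then have "((n2, 0), (0, - n1)) \<in> skew_graph G"
        using subspace_0[OF G(2)] by (simp add: skew_graph_def zero_prod_def)
      with dual have "a \<bullet> (n2, 0) = - (u \<bullet> (0, - n1))" by blast
      then show "z \<bullet> (h, - p) = 0" by (simp add: ua n inner_commute)
    qed
    ultimately show "(u, a) \<in> skew_graph G" by (simp add: ua skew_graph_def)
  qed
qed

lemma adjoint_relation_commute:
  assumes "\<And>u a. (u, a) \<in> G \<Longrightarrow> (S u, S a) \<in> G" "\<And>u v. R u \<bullet> v = u \<bullet> S v"
    and "(v, b) \<in> adjoint_relation G"
  shows "(R v, R b) \<in> adjoint_relation G"
  unfolding adjoint_relation_def
proof (safe)
  fix u a assume "(u, a) \<in> G"
  from assms(1)[OF this] assms(3) have "S u \<bullet> b = S a \<bullet> v" unfolding adjoint_relation_def by blast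
  then show "u \<bullet> R b = a \<bullet> R v" by (metis assms(2) inner_commute)
qed

lemma bounded_linear_map_prod:
  assumes "bounded_linear f" "bounded_linear g" shows "bounded_linear (map_prod f g)"
proof -
  have "bounded_linear (\<lambda>x. (f (fst x), g (snd x)))"
    by (intro bounded_linear_Pair bounded_linear_compose[OF assms(1)] bounded_linear_compose[OF assms(2)]
        bounded_linear_fst bounded_linear_snd)
  then show ?thesis by (simp add: map_prod_def case_prod_beta')
qed

lemma coercive_map_prod:
  assumes f: "coercive f m1" and g: "coercive g m2"
  shows "coercive (map_prod f g) (min m1 m2)"
proof -
  have "min m1 m2 * (norm u)\<^sup>2 \<le> map_prod f g u \<bullet> u" for u
  proof (cases u)
    case (Pair a b)
    have "min m1 m2 * (norm a)\<^sup>2 \<le> m1 * (norm a)\<^sup>2" "min m1 m2 * (norm b)\<^sup>2 \<le> m2 * (norm b)\<^sup>2"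
      by (intro mult_right_mono; simp)+
    with coerciveD(4)[OF f, of a] coerciveD(4)[OF g, of b] show ?thesis
      by (simp add: Pair norm_Pair distrib_left)
  qed
  then show ?thesis using f g by (auto simp: coercive_def bounded_linear_map_prod)
qed

text \<open>
  The product rule for \<open>\<Theta> v\<close> inserted into the identity \<open>M p \<bullet> K q + M K p \<bullet> q = M E' p \<bullet> E' q\<close>, which is
  integration by parts for two functions vanishing at the initial time.
\<close>

lemma energy_identity:
  assumes T: "0 < T" and A: "multiplier A m" and \<theta>: "bounded_fun \<theta>"
  defines "M \<equiv> mult_op (\<lambda>z. A (fst z))"
  shows "2 * (M p \<bullet> time_mult (\<lambda>t. a + primitive (cut T \<theta>) t) (time_embed T y + volterra T p))
      + time_mult \<theta> (time_embed T y + volterra T p) \<bullet> M (time_embed T y + volterra T p)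
    = (a + primitive (cut T \<theta>) T) * (mult_op A (y + time_integral T p) \<bullet> (y + time_integral T p)) - a * (mult_op A y \<bullet> y)"
proof -
  define v where "v = time_embed T y + volterra T p"
  define \<Theta> where "\<Theta> = (\<lambda>t. a + primitive (cut T \<theta>) t)"
  define q where "q = time_mult \<theta> v + time_mult \<Theta> p"
  have \<Theta>: "bounded_fun \<Theta>" unfolding \<Theta>_def by (rule bounded_fun_primitive[OF \<theta>])
  note rule = time_mult_product_rule[OF T \<theta>, where p=p and y=y and a=a, folded v_def \<Theta>_def, folded q_def]
  have "coercive M m" unfolding M_def by (rule coercive_mult_op[OF multiplier_fst[OF A]])
  note M = coerciveD[OF this]
  note M0 = coerciveD[OF coercive_mult_op[OF A]]
  interpret M: bounded_linear M by (rule M(1))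
  interpret M0: bounded_linear "mult_op A" by (rule M0)
  let ?E = "time_embed T" and ?E' = "time_integral T" and ?K = "volterra T" and ?M0 = "mult_op A"
  have EM: "?E (?M0 w) = M (?E w)" for w unfolding M_def by (rule time_embed_mult_op[OF A T])
  have KM: "?K (M w) = M (?K w)" for w unfolding M_def by (rule volterra_mult_op[OF A T])
  have E'M: "?E' (M w) \<bullet> x = ?M0 (?E' w) \<bullet> x" for w x
  proof -
    have "?E' (M w) \<bullet> x = M w \<bullet> ?E x" by (metis time_embed_adjoint[OF T] inner_commute)
    also have "\<dots> = w \<bullet> ?E (?M0 x)" by (simp add: EM M(2))
    also have "\<dots> = ?E' w \<bullet> ?M0 x" by (metis time_embed_adjoint[OF T] inner_commute)
    finally show ?thesis by (simp add: M0(2))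
  qed
  have 1: "M p \<bullet> ?E w = ?M0 (?E' p) \<bullet> w" for w
    using E'M[of p w] time_embed_adjoint[OF T, of w "M p"] by (simp add: inner_commute)
  have 2: "M (?E y) \<bullet> q = ?M0 y \<bullet> ?E' q" by (simp flip: EM add: time_embed_adjoint[OF T])
  have 3: "M p \<bullet> ?K q + M (?K p) \<bullet> q = ?M0 (?E' p) \<bullet> ?E' q"
  proof -
    have "M (?K p) \<bullet> q = M p \<bullet> volterra_adjoint T q" by (simp flip: KM add: volterra_adjoint_inner[OF T])
    then have "M p \<bullet> ?K q + M (?K p) \<bullet> q = M p \<bullet> ?E (?E' q)"
      by (simp add: volterra_adjoint_def inner_diff_right)
    then show ?thesis by (simp add: 1)
  qed
  have "M p \<bullet> time_mult \<Theta> v + M v \<bullet> q = ?M0 (y + ?E' p) \<bullet> (a *\<^sub>R y + ?E' q) - a * (?M0 y \<bullet> y)"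
    using 1[of "a *\<^sub>R y"] 2 3
    by (simp add: rule(1)) (simp add: v_def M.add M0.add inner_add_left inner_add_right algebra_simps)
  moreover have "M v \<bullet> q = time_mult \<theta> v \<bullet> M v + M p \<bullet> time_mult \<Theta> v"
  proof -
    have "M v \<bullet> time_mult \<Theta> p = time_mult \<Theta> (M v) \<bullet> p" by (simp add: time_mult_sym[OF \<Theta>])
    also have "time_mult \<Theta> (M v) = M (time_mult \<Theta> v)" unfolding M_def by (rule time_mult_mult_op[OF A \<Theta>])
    finally show ?thesis by (simp add: q_def inner_add_right M(2) inner_commute)
  qed
  ultimately show ?thesis by (simp add: rule(2) \<Theta>_def v_def)
qed

locale maxwell_system =
  fixes T m1 m2 :: real and A1 A2 :: "'a::euclidean_space \<Rightarrow> 'b::euclidean_space \<Rightarrow> 'b"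
    and G :: "(('a, 'b) L2 \<times> ('a, 'b) L2) set"
  assumes T: "0 < T" and A1: "multiplier A1 m1" and A2: "multiplier A2 m2"
    and G: "closed G" "subspace G"
begin

abbreviation TE :: "('a, 'b) L2 \<times> ('a, 'b) L2 \<Rightarrow> ('a \<times> real, 'b) L2 \<times> ('a \<times> real, 'b) L2"
  where "TE \<equiv> map_prod (time_embed T) (time_embed T)"
abbreviation TI :: "('a \<times> real, 'b) L2 \<times> ('a \<times> real, 'b) L2 \<Rightarrow> ('a, 'b) L2 \<times> ('a, 'b) L2"
  where "TI \<equiv> map_prod (time_integral T) (time_integral T)"
abbreviation VT :: "('a \<times> real, 'b) L2 \<times> ('a \<times> real, 'b) L2 \<Rightarrow> ('a \<times> real, 'b) L2 \<times> ('a \<times> real, 'b) L2"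
  where "VT \<equiv> map_prod (volterra T) (volterra T)"
abbreviation VA :: "('a \<times> real, 'b) L2 \<times> ('a \<times> real, 'b) L2 \<Rightarrow> ('a \<times> real, 'b) L2 \<times> ('a \<times> real, 'b) L2"
  where "VA \<equiv> map_prod (volterra_adjoint T) (volterra_adjoint T)"
abbreviation MM :: "('a \<times> real, 'b) L2 \<times> ('a \<times> real, 'b) L2 \<Rightarrow> ('a \<times> real, 'b) L2 \<times> ('a \<times> real, 'b) L2"
  where "MM \<equiv> map_prod (mult_op (\<lambda>z. A1 (fst z))) (mult_op (\<lambda>z. A2 (fst z)))"
abbreviation MM0 :: "('a, 'b) L2 \<times> ('a, 'b) L2 \<Rightarrow> ('a, 'b) L2 \<times> ('a, 'b) L2"
  where "MM0 \<equiv> map_prod (mult_op A1) (mult_op A2)"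
abbreviation TM :: "(real \<Rightarrow> real) \<Rightarrow> ('a \<times> real, 'b) L2 \<times> ('a \<times> real, 'b) L2 \<Rightarrow> ('a \<times> real, 'b) L2 \<times> ('a \<times> real, 'b) L2"
  where "TM \<theta> \<equiv> map_prod (time_mult \<theta>) (time_mult \<theta>)"

sublocale evolution MM "min m1 m2" MM0 "min m1 m2" "skew_graph (time_graph T G)" "skew_graph G" TE TI VT VA
proof (rule evolution.intro)
  note tG = closed_time_graph[OF T G] subspace_time_graph[OF T G]
  show "coercive MM (min m1 m2)"
    by (intro coercive_map_prod coercive_mult_op multiplier_fst A1 A2)
  show "coercive MM0 (min m1 m2)" by (intro coercive_map_prod coercive_mult_op A1 A2)
  show "skew_adjoint (skew_graph (time_graph T G))" by (rule skew_adjoint_skew_graph[OF tG])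
  show "skew_adjoint (skew_graph G)" by (rule skew_adjoint_skew_graph[OF G])
  show "bounded_linear TE" by (intro bounded_linear_map_prod bounded_linear_time_embed T)
  show "bounded_linear TI" by (intro bounded_linear_map_prod bounded_linear_time_integral T)
  show "bounded_linear VT" by (intro bounded_linear_map_prod bounded_linear_volterra T)
  show "bounded_linear VA" by (intro bounded_linear_map_prod bounded_linear_volterra_adjoint T)
  show "VT u \<bullet> v = u \<bullet> VA v" for u v
    by (cases u, cases v) (simp add: volterra_adjoint_inner[OF T])
  show "TE y \<bullet> v = y \<bullet> TI v" for y v
    by (cases y, cases v) (simp add: time_embed_adjoint[OF T])
  show "VA u = TE (TI u) - VT u" for u by (cases u) (simp add: volterra_adjoint_def)
  show "VT (MM u) = MM (VT u)" for u
    by (cases u) (simp add: volterra_mult_op[OF A1 T] volterra_mult_op[OF A2 T])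
  show "TE (MM0 y) = MM (TE y)" for y
    by (cases y) (simp add: time_embed_mult_op[OF A1 T] time_embed_mult_op[OF A2 T])
  have neg: "volterra T (- u) = - volterra T u" "time_embed T (- y) = - time_embed T y"
    for u :: "('a \<times> real, 'b) L2" and y :: "('a, 'b) L2"
    by (rule linear_neg[OF bounded_linear.linear[OF bounded_linear_volterra[OF T]]],
        rule linear_neg[OF bounded_linear.linear[OF bounded_linear_time_embed[OF T]]])
  show "(VT u, VT a) \<in> skew_graph (time_graph T G)" if "(u, a) \<in> skew_graph (time_graph T G)" for u a
  proof -
    from that obtain e h p q where ua: "u = (e, h)" "a = (p, q)"
      and 1: "(h, - p) \<in> time_graph T G" "(e, q) \<in> adjoint_relation (time_graph T G)"
      by (auto simp: skew_graph_def)
    have "(volterra T e, volterra T q) \<in> adjoint_relation (time_graph T G)"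
      by (rule adjoint_relation_commute[OF time_graph_volterra_adjoint[OF T G] volterra_adjoint_inner[OF T] 1(2)])
    moreover have "(volterra T h, - volterra T p) \<in> time_graph T G"
      using time_graph_volterra[OF T G 1(1)] by (simp add: neg)
    ultimately show ?thesis by (simp add: ua skew_graph_def)
  qed
  show "(TE y, TE b) \<in> skew_graph (time_graph T G)" if "(y, b) \<in> skew_graph G" for y b
  proof -
    from that obtain e h p q where ua: "y = (e, h)" "b = (p, q)"
      and 1: "(h, - p) \<in> G" "(e, q) \<in> adjoint_relation G"
      by (auto simp: skew_graph_def)
    have "(time_embed T h, - time_embed T p) \<in> time_graph T G"
      using time_graph_time_embed[OF T G 1(1)] by (simp add: neg)
    with adjoint_time_graph_time_embed[OF T G 1(2)] show ?thesis by (simp add: ua skew_graph_def)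
  qed
qed

lemma time_weight_TM:
  assumes \<theta>: "bounded_fun \<theta>"
  shows "time_weight (TM (\<lambda>t. a + primitive (cut T \<theta>) t)) (TM \<theta>) a (a + primitive (cut T \<theta>) T)"
proof -
  define \<Theta> where "\<Theta> = (\<lambda>t. a + primitive (cut T \<theta>) t)"
  have \<Theta>: "bounded_fun \<Theta>" unfolding \<Theta>_def by (rule bounded_fun_primitive[OF \<theta>])
  show ?thesis
    unfolding time_weight_def \<Theta>_def[symmetric]
  proof (intro conjI allI impI)
    show "bounded_linear (TM \<Theta>)" "bounded_linear (TM \<theta>)"
      by (intro bounded_linear_map_prod bounded_linear_time_mult \<theta> \<Theta>)+
    show "TM \<Theta> u \<bullet> v = u \<bullet> TM \<Theta> v" for u v
      by (cases u, cases v) (simp add: time_mult_sym[OF \<Theta>])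
    show "(TM \<Theta> u, TM \<Theta> c) \<in> skew_graph (time_graph T G)" if "(u, c) \<in> skew_graph (time_graph T G)" for u c
    proof -
      from that obtain e h p q where ua: "u = (e, h)" "c = (p, q)"
        and 1: "(h, - p) \<in> time_graph T G" "(e, q) \<in> adjoint_relation (time_graph T G)"
        by (auto simp: skew_graph_def)
      have neg: "time_mult \<Theta> (- u) = - time_mult \<Theta> u" for u :: "('a \<times> real, 'b) L2"
        by (rule linear_neg[OF bounded_linear.linear[OF bounded_linear_time_mult[OF \<Theta>]]])
      have "(time_mult \<Theta> e, time_mult \<Theta> q) \<in> adjoint_relation (time_graph T G)"
        by (rule adjoint_relation_commute[OF time_graph_time_mult[OF T G \<Theta>] time_mult_sym[OF \<Theta>] 1(2)])
      moreover have "(time_mult \<Theta> h, - time_mult \<Theta> p) \<in> time_graph T G"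
        using time_graph_time_mult[OF T G \<Theta> 1(1)] by (simp add: neg)
      ultimately show ?thesis by (simp add: ua skew_graph_def)
    qed
    show "2 * (MM p \<bullet> TM \<Theta> (TE y + VT p)) + TM \<theta> (TE y + VT p) \<bullet> MM (TE y + VT p) =
        (a + primitive (cut T \<theta>) T) * (MM0 (y + TI p) \<bullet> (y + TI p)) - a * (MM0 y \<bullet> y)" for y p
    proof -
      obtain p1 p2 y1 y2 where py: "p = (p1, p2)" "y = (y1, y2)" by (cases p, cases y) auto
      from energy_identity[OF T A1 \<theta>, of p1 a y1, folded \<Theta>_def] energy_identity[OF T A2 \<theta>, of p2 a y2, folded \<Theta>_def]
      show ?thesis by (simp add: py algebra_simps)
    qed
  qed
qed

end

lemma time_mult_inner:
  "bounded_fun \<theta> \<Longrightarrow> u \<bullet> time_mult \<theta> v = (\<integral>z. \<theta> (snd z) * (rep_L2 u z \<bullet> rep_L2 v z) \<partial>lborel)"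
  and integrable_time_mult_inner:
  "bounded_fun \<theta> \<Longrightarrow> integrable lborel (\<lambda>z. \<theta> (snd z) * (rep_L2 u z \<bullet> rep_L2 v z))"
proof -
  assume \<theta>: "bounded_fun \<theta>"
  have [measurable]: "\<theta> \<in> borel_measurable borel" using \<theta> by (simp add: bounded_fun_def)
  have ae: "AE z in lborel. rep_L2 u z \<bullet> rep_L2 (time_mult \<theta> v) z = \<theta> (snd z) * (rep_L2 u z \<bullet> rep_L2 v z)"
    using rep_time_mult[OF \<theta>, of v] by eventually_elim simp
  show "u \<bullet> time_mult \<theta> v = (\<integral>z. \<theta> (snd z) * (rep_L2 u z \<bullet> rep_L2 v z) \<partial>lborel)"
    unfolding inner_L2 by (rule integral_cong_AE[OF _ _ ae]) measurable
  show "integrable lborel (\<lambda>z. \<theta> (snd z) * (rep_L2 u z \<bullet> rep_L2 v z))"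
    using integrable_rep_inner[of u "time_mult \<theta> v"] by (subst (asm) integrable_cong_AE[OF _ _ ae]) measurable
qed

lemma time_mult_inner_ge:
  assumes \<theta>: "bounded_fun \<theta>" and "\<And>t. c \<le> \<theta> t"
  shows "c * (norm v)\<^sup>2 \<le> v \<bullet> time_mult \<theta> v"
proof -
  have "(\<integral>z. c * (norm (rep_L2 v z))\<^sup>2 \<partial>lborel) \<le> (\<integral>z. \<theta> (snd z) * (rep_L2 v z \<bullet> rep_L2 v z) \<partial>lborel)"
    using integrable_rep_norm[of v] assms
    by (intro integral_mono integrable_time_mult_inner) (auto simp: power2_norm_eq_inner intro: mult_right_mono)
  then show ?thesis by (simp add: time_mult_inner[OF \<theta>] norm_L2_sq)
qed

section \<open>Monotone superposition operators and their Yosida regularisation\<close>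

definition monotone_field :: "('a::euclidean_space \<Rightarrow> 'b::euclidean_space \<Rightarrow> 'b) \<Rightarrow> real \<Rightarrow> bool" where
  "monotone_field f c \<longleftrightarrow> (\<forall>\<xi>. (\<lambda>z. f z \<xi>) \<in> borel_measurable borel) \<and> (\<forall>z. continuous_on UNIV (f z)) \<and>
     (\<forall>z \<xi>. norm (f z \<xi>) \<le> c * norm \<xi>) \<and> (\<forall>z \<xi> \<eta>. 0 \<le> (f z \<xi> - f z \<eta>) \<bullet> (\<xi> - \<eta>)) \<and> 0 < c"

text \<open>
  The resolvent of the map \<open>f z\<close>, applied pointwise.
\<close>

definition yosida :: "('a \<Rightarrow> 'b \<Rightarrow> 'b) \<Rightarrow> real \<Rightarrow> 'a \<Rightarrow> 'b::euclidean_space \<Rightarrow> 'b" where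
  "yosida f \<tau> z \<xi> = (SOME \<eta>. \<eta> + \<tau> *\<^sub>R f z \<eta> = \<xi>)"

definition superposition :: "('a::euclidean_space \<Rightarrow> 'b::euclidean_space \<Rightarrow> 'b) \<Rightarrow> ('a, 'b) L2 \<Rightarrow> ('a, 'b) L2" where
  "superposition f u = to_L2 (\<lambda>z. f z (rep_L2 u z))"

lemma dense_sequence_exists:
  "\<exists>q :: nat \<Rightarrow> 'b::euclidean_space. \<forall>U. open U \<longrightarrow> U \<noteq> {} \<longrightarrow> (\<exists>k. q k \<in> U)"
proof -
  obtain D :: "'b set" where D: "countable D" "\<And>U. open U \<Longrightarrow> U \<noteq> {} \<Longrightarrow> \<exists>d\<in>D. d \<in> U"
    using countable_dense_setE by blast
  have "D \<noteq> {}" using D(2)[of UNIV] by auto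
  with D show ?thesis by (intro exI[of _ "from_nat_into D"]) (metis from_nat_into_surj)
qed

text \<open>
  If \<open>F z\<close> is continuous and controls the distance to \<open>w z\<close>, then \<open>w\<close> is a limit of countably valued
  functions: pick the first point of a dense sequence at which \<open>F z\<close> is small.
\<close>

lemma measurable_root_approximation:
  fixes F :: "'a \<Rightarrow> 'b::euclidean_space \<Rightarrow> 'c::euclidean_space" and G :: "'a \<Rightarrow> 'b \<Rightarrow> 'd::euclidean_space"
  assumes F: "\<And>\<xi>. (\<lambda>z. F z \<xi>) \<in> borel_measurable M" "\<And>z. continuous_on UNIV (F z)"
    and w: "\<And>z. F z (w z) = 0" "\<And>z \<xi>. norm (\<xi> - w z) \<le> norm (F z \<xi>)"
    and G: "\<And>\<xi>. (\<lambda>z. G z \<xi>) \<in> borel_measurable M" "\<And>z. continuous_on UNIV (G z)"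
  shows "(\<lambda>z. G z (w z)) \<in> borel_measurable M"
proof -
  obtain q :: "nat \<Rightarrow> 'b" where q: "\<And>U. open U \<Longrightarrow> U \<noteq> {} \<Longrightarrow> \<exists>k. q k \<in> U"
    using dense_sequence_exists by metis
  define k where "k n z = (LEAST k. norm (F z (q k)) < inverse (real (Suc n)))" for n z
  have ex: "\<exists>k. norm (F z (q k)) < inverse (real (Suc n))" for n z
  proof -
    have "open {\<xi>. norm (F z \<xi>) < inverse (real (Suc n))}"
      by (intro open_Collect_less continuous_intros F(2)[THEN continuous_on_subset] subset_UNIV)
    moreover have "w z \<in> {\<xi>. norm (F z \<xi>) < inverse (real (Suc n))}" by (simp add: w(1))
    ultimately show ?thesis using q by blast
  qed
  have lt: "norm (F z (q (k n z))) < inverse (real (Suc n))" for n z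
    unfolding k_def by (rule LeastI_ex[OF ex])
  have [measurable]: "k n \<in> measurable M (count_space UNIV)" for n
  proof -
    note [measurable] = F(1)
    show ?thesis unfolding k_def by measurable
  qed
  show ?thesis
  proof (rule borel_measurable_LIMSEQ_metric)
    show "(\<lambda>z. G z (q (k n z))) \<in> borel_measurable M" for n
      by (rule measurable_compose_countable[where f="\<lambda>i z. G z (q i)"]) (use G(1) in auto)
    fix z
    have "(\<lambda>n. q (k n z)) \<longlonglongrightarrow> w z"
    proof (rule LIM_zero_cancel, rule Lim_null_comparison[OF always_eventually LIMSEQ_inverse_real_of_nat], rule allI)
      show "norm (q (k n z) - w z) \<le> inverse (real (Suc n))" for n
        using w(2)[of "q (k n z)" z] lt[of z n] by linarith
    qed
    then show "(\<lambda>n. G z (q (k n z))) \<longlonglongrightarrow> G z (w z)"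
      by (rule continuous_on_tendsto_compose[OF G(2)]) auto
  qed
qed

lemma caratheodory_composition:
  fixes f :: "'a \<Rightarrow> 'b::euclidean_space \<Rightarrow> 'c::euclidean_space"
  assumes "\<And>\<xi>. (\<lambda>z. f z \<xi>) \<in> borel_measurable M" "\<And>z. continuous_on UNIV (f z)" "u \<in> borel_measurable M"
  shows "(\<lambda>z. f z (u z)) \<in> borel_measurable M"
proof (rule measurable_root_approximation[where F="\<lambda>z \<xi>. \<xi> - u z" and w=u and G=f])
  show "(\<lambda>z. \<xi> - u z) \<in> borel_measurable M" for \<xi> using assms(3) by simp
  show "continuous_on UNIV (\<lambda>\<xi>. \<xi> - u z)" for z by (intro continuous_intros)
qed (use assms in simp_all)

lemma borel_version:
  fixes f :: "'a::euclidean_space \<Rightarrow> 'b::euclidean_space"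
  assumes "f \<in> borel_measurable lebesgue"
  shows "\<exists>g\<in>borel_measurable borel. AE x in lborel. f x = g x"
proof -
  have "\<forall>b\<in>Basis. \<exists>g\<in>borel_measurable lborel. AE x in lborel. f x \<bullet> b = (g x :: real)"
    using assms by (intro ballI completion_ex_borel_measurable_real borel_measurable_inner) simp_all
  then have "\<forall>b\<in>Basis. \<exists>g. g \<in> borel_measurable borel \<and> (AE x in lborel. f x \<bullet> b = (g x :: real))" by auto
  from bchoice[OF this] obtain g where g: "\<And>b. b \<in> Basis \<Longrightarrow> g b \<in> borel_measurable borel"
    "\<And>b. b \<in> Basis \<Longrightarrow> AE x in lborel. f x \<bullet> b = (g b x :: real)" by blast
  have "AE x in lborel. \<forall>b\<in>Basis. f x \<bullet> b = g b x" using g(2) by (simp add: AE_finite_all[OF finite_Basis])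
  then have "AE x in lborel. f x = (\<Sum>b\<in>Basis. g b x *\<^sub>R b)"
  proof eventually_elim
    case (elim x)
    have "f x = (\<Sum>b\<in>Basis. (f x \<bullet> b) *\<^sub>R b)" by (rule euclidean_representation[symmetric])
    with elim show ?case by simp
  qed
  moreover have "(\<lambda>x. \<Sum>b\<in>Basis. g b x *\<^sub>R b) \<in> borel_measurable borel"
    by (intro borel_measurable_sum borel_measurable_scaleR borel_measurable_const g(1))
  ultimately show ?thesis by (rule bexI)
qed

text \<open>
  By continuity the values on a countable dense set of \<open>\<xi>\<close> determine the function, so countably many
  exceptional null sets suffice.
\<close>

lemma caratheodory_borel_version:
  fixes f :: "'a::euclidean_space \<Rightarrow> 'b::euclidean_space \<Rightarrow> 'c::euclidean_space"
  assumes f: "\<And>\<xi>. (\<lambda>z. f z \<xi>) \<in> borel_measurable lebesgue" and cont: "\<And>z. continuous_on UNIV (f z)"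
  shows "\<exists>N\<in>null_sets lborel. \<forall>\<xi>. (\<lambda>z. if z \<in> N then 0 else f z \<xi>) \<in> borel_measurable borel"
proof -
  obtain q :: "nat \<Rightarrow> 'b" where q: "\<And>U. open U \<Longrightarrow> U \<noteq> {} \<Longrightarrow> \<exists>k. q k \<in> U"
    using dense_sequence_exists by metis
  have "\<forall>k. \<exists>g\<in>borel_measurable borel. AE z in lborel. f z (q k) = g z" using borel_version[OF f] by blast
  then obtain g where g: "\<And>k. g k \<in> borel_measurable borel" "\<And>k. AE z in lborel. f z (q k) = g k z" by metis
  have "AE z in lborel. \<forall>k. f z (q k) = g k z" using g(2) by (simp add: AE_all_countable)
  then obtain N where N: "N \<in> null_sets lborel" "{z. \<not> (\<forall>k. f z (q k) = g k z)} \<subseteq> N"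
    by (auto simp: eventually_ae_filter)
  have N': "N \<in> sets borel" using N(1) by auto
  define h where "h z \<xi> = (if z \<in> N then 0 else f z \<xi>)" for z \<xi>
  have hq: "(\<lambda>z. h z (q k)) \<in> borel_measurable borel" for k
  proof -
    have "(\<lambda>z. h z (q k)) = (\<lambda>z. if z \<in> N then 0 else g k z)" using N(2) by (auto simp: h_def fun_eq_iff)
    then show ?thesis using g(1)[of k] N' by simp
  qed
  have hc: "continuous_on UNIV (h z)" for z using cont[of z] by (cases "z \<in> N") (simp_all add: h_def[abs_def])
  have "(\<lambda>z. h z \<xi>) \<in> borel_measurable borel" for \<xi>
  proof -
    have "\<exists>k. norm (q k - \<xi>) < inverse (real (Suc n))" for n
      using q[of "ball \<xi> (inverse (real (Suc n)))"] by (auto simp: dist_norm norm_minus_commute)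
    then obtain k where k: "\<And>n. norm (q (k n) - \<xi>) < inverse (real (Suc n))" by metis
    have "(\<lambda>n. q (k n)) \<longlonglongrightarrow> \<xi>"
      by (rule LIM_zero_cancel, rule Lim_null_comparison[OF always_eventually LIMSEQ_inverse_real_of_nat]) (use k less_imp_le in blast)
    then show ?thesis
      by (intro borel_measurable_LIMSEQ_metric[OF hq[of "k _"]] continuous_on_tendsto_compose[OF hc]) auto
  qed
  with N(1) show ?thesis unfolding h_def by blast
qed

context
  fixes f :: "'a::euclidean_space \<Rightarrow> 'b::euclidean_space \<Rightarrow> 'b" and c :: real
  assumes f: "monotone_field f c"
begin

private lemma f_le: "norm (f z \<xi>) \<le> c * norm \<xi>" and f_mono: "0 \<le> (f z \<xi> - f z \<eta>) \<bullet> (\<xi> - \<eta>)"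
  and f_meas: "(\<lambda>z. f z \<xi>) \<in> borel_measurable borel" and f_cont: "continuous_on UNIV (f z)" and c: "0 < c"
  using f by (auto simp: monotone_field_def)

lemma expansive:
  assumes "0 < \<tau>" shows "norm (\<xi> - \<eta>) \<le> norm (\<xi> + \<tau> *\<^sub>R f z \<xi> - (\<eta> + \<tau> *\<^sub>R f z \<eta>))"
proof -
  define d where "d = \<xi> + \<tau> *\<^sub>R f z \<xi> - (\<eta> + \<tau> *\<^sub>R f z \<eta>)"
  have "norm (\<xi> - \<eta>) * norm (\<xi> - \<eta>) + \<tau> * ((f z \<xi> - f z \<eta>) \<bullet> (\<xi> - \<eta>)) = d \<bullet> (\<xi> - \<eta>)"
    by (simp add: d_def power2_eq_square[symmetric] power2_norm_eq_inner inner_add_left inner_diff_left algebra_simps)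
  moreover have "0 \<le> \<tau> * ((f z \<xi> - f z \<eta>) \<bullet> (\<xi> - \<eta>))" using assms f_mono by simp
  moreover have "d \<bullet> (\<xi> - \<eta>) \<le> norm d * norm (\<xi> - \<eta>)" by (rule norm_cauchy_schwarz)
  ultimately have "norm (\<xi> - \<eta>) * norm (\<xi> - \<eta>) \<le> norm d * norm (\<xi> - \<eta>)" by linarith
  then have "norm (\<xi> - \<eta>) \<le> norm d"
    by (cases "norm (\<xi> - \<eta>) = 0") (auto simp: mult_le_cancel_right)
  then show ?thesis by (simp add: d_def)
qed

text \<open>For small \<open>\<tau>\<close> the map \<open>\<eta> \<mapsto> \<xi> - \<tau> f z \<eta>\<close> sends a ball into itself, so Brouwer's theorem applies.\<close>

lemma yosida:
  assumes \<tau>: "0 < \<tau>" "\<tau> < 1 / (2 * c)"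
  shows "yosida f \<tau> z \<xi> + \<tau> *\<^sub>R f z (yosida f \<tau> z \<xi>) = \<xi>"
proof -
  define r where "r = 2 * norm \<xi> + 1"
  have r: "0 < r" by (simp add: r_def add_nonneg_pos)
  have cont: "continuous_on (cball 0 r) (\<lambda>\<eta>. \<xi> - \<tau> *\<^sub>R f z \<eta>)"
    by (intro continuous_intros continuous_on_subset[OF f_cont]) auto
  have maps: "(\<lambda>\<eta>. \<xi> - \<tau> *\<^sub>R f z \<eta>) \<in> cball 0 r \<rightarrow> cball 0 r"
  proof
    fix \<eta> :: 'b assume "\<eta> \<in> cball 0 r"
    then have "norm (\<tau> *\<^sub>R f z \<eta>) \<le> \<tau> * (c * r)"
      using \<tau> c f_le[of z \<eta>] by (auto intro!: mult_left_mono elim!: order_trans)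
    also have "\<dots> \<le> r / 2" using \<tau> c r by (simp add: field_simps)
    finally have "norm (\<xi> - \<tau> *\<^sub>R f z \<eta>) \<le> norm \<xi> + r / 2"
      using norm_triangle_ineq4[of \<xi> "\<tau> *\<^sub>R f z \<eta>"] by linarith
    moreover have "norm \<xi> + r / 2 \<le> r" by (simp add: r_def)
    ultimately show "\<xi> - \<tau> *\<^sub>R f z \<eta> \<in> cball 0 r" by simp
  qed
  obtain \<eta> where "\<xi> - \<tau> *\<^sub>R f z \<eta> = \<eta>" using brouwer_ball[OF r cont maps] by blast
  then have "\<eta> + \<tau> *\<^sub>R f z \<eta> = \<xi>" by (simp add: algebra_simps)
  then show ?thesis unfolding yosida_def by (rule someI)
qed

lemma yosida_nonexpansive:
  assumes \<tau>: "0 < \<tau>" "\<tau> < 1 / (2 * c)"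
  shows "norm (yosida f \<tau> z \<xi> - yosida f \<tau> z \<eta>) \<le> norm (\<xi> - \<eta>)"
  using expansive[OF \<tau>(1), of "yosida f \<tau> z \<xi>" "yosida f \<tau> z \<eta>" z] by (simp only: yosida[OF \<tau>])

lemma f_zero: "f z 0 = 0" using f_le[of z 0] by simp

lemma yosida_le:
  assumes \<tau>: "0 < \<tau>" "\<tau> < 1 / (2 * c)" shows "norm (yosida f \<tau> z \<xi>) \<le> norm \<xi>"
  using expansive[OF \<tau>(1), of "yosida f \<tau> z \<xi>" 0 z] by (simp only: yosida[OF \<tau>]) (simp add: f_zero)

lemma superposition_L2: "L2_fun (\<lambda>z. f z (rep_L2 u z))"
proof (intro L2_fun_sq_integrable sq_integrable_bound)
  show "integrable lborel (\<lambda>z. c\<^sup>2 * (norm (rep_L2 u z))\<^sup>2)" using integrable_rep_norm[of u] by simp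
  show "AE z in lborel. (norm (f z (rep_L2 u z)))\<^sup>2 \<le> c\<^sup>2 * (norm (rep_L2 u z))\<^sup>2"
    using f_le by (intro AE_I2) (simp flip: power_mult_distrib add: power_mono)
  show "(\<lambda>z. f z (rep_L2 u z)) \<in> borel_measurable borel"
    by (rule caratheodory_composition[OF f_meas f_cont rep_measurable])
qed

lemma rep_superposition: "AE z in lborel. rep_L2 (superposition f u) z = f z (rep_L2 u z)"
  unfolding superposition_def by (rule rep_to_L2[OF superposition_L2])

lemma superposition_le: "norm (superposition f u) \<le> c * norm u"
proof (rule norm_L2_le)
  show "integrable lborel (\<lambda>z. c\<^sup>2 * (norm (rep_L2 u z))\<^sup>2)" using integrable_rep_norm[of u] by simp
  show "AE z in lborel. (norm (rep_L2 (superposition f u) z))\<^sup>2 \<le> c\<^sup>2 * (norm (rep_L2 u z))\<^sup>2"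
    using rep_superposition[of u]
    by eventually_elim (use f_le in \<open>simp flip: power_mult_distrib add: power_mono\<close>)
qed (use c in \<open>simp_all add: norm_L2_sq power_mult_distrib\<close>)

context
  fixes \<tau> :: real
  assumes \<tau>: "0 < \<tau>" "\<tau> < 1 / (2 * c)"
begin

lemma yosida_L2: "L2_fun (\<lambda>z. yosida f \<tau> z (rep_L2 u z))"
proof (intro L2_fun_sq_integrable sq_integrable_bound[OF _ integrable_rep_norm[of u]])
  show "AE z in lborel. (norm (yosida f \<tau> z (rep_L2 u z)))\<^sup>2 \<le> (norm (rep_L2 u z))\<^sup>2"
    using yosida_le[OF \<tau>] by (intro AE_I2 power_mono) auto
  note [measurable] = f_meas
  show "(\<lambda>z. yosida f \<tau> z (rep_L2 u z)) \<in> borel_measurable borel"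
  proof (rule measurable_root_approximation[where G="\<lambda>z \<xi>. \<xi>" and F="\<lambda>z \<xi>. \<xi> + \<tau> *\<^sub>R f z \<xi> - rep_L2 u z"])
    show "yosida f \<tau> z (rep_L2 u z) + \<tau> *\<^sub>R f z (yosida f \<tau> z (rep_L2 u z)) - rep_L2 u z = 0" for z
      by (simp only: yosida[OF \<tau>]) simp
    show "norm (\<xi> - yosida f \<tau> z (rep_L2 u z)) \<le> norm (\<xi> + \<tau> *\<^sub>R f z \<xi> - rep_L2 u z)" for z \<xi>
      using expansive[OF \<tau>(1), of \<xi> "yosida f \<tau> z (rep_L2 u z)" z] by (simp only: yosida[OF \<tau>])
    show "continuous_on UNIV (\<lambda>\<xi>. \<xi> + \<tau> *\<^sub>R f z \<xi> - rep_L2 u z)" for z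
      by (intro continuous_intros f_cont)
  qed auto
qed

lemma rep_yosida: "AE z in lborel. rep_L2 (superposition (yosida f \<tau>) u) z = yosida f \<tau> z (rep_L2 u z)"
  unfolding superposition_def by (rule rep_to_L2[OF yosida_L2])

lemma yosida_superposition:
  "u - superposition (yosida f \<tau>) u = \<tau> *\<^sub>R superposition f (superposition (yosida f \<tau>) u)"
proof (rule L2_eqI)
  let ?J = "superposition (yosida f \<tau>) u"
  show "AE z in lborel. rep_L2 (u - ?J) z = rep_L2 (\<tau> *\<^sub>R superposition f ?J) z"
    using rep_diff_L2[of u ?J] rep_scaleR_L2[of \<tau> "superposition f ?J"] rep_superposition[of ?J] rep_yosida[of u]
  proof eventually_elim
    case (elim z)
    have "rep_L2 u z - yosida f \<tau> z (rep_L2 u z) = \<tau> *\<^sub>R f z (yosida f \<tau> z (rep_L2 u z))"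
      using yosida[OF \<tau>, of z "rep_L2 u z"] by (metis add_diff_cancel_left')
    with elim show ?case by simp
  qed
qed

lemma norm_yosida_le: "norm (superposition (yosida f \<tau>) u) \<le> norm u"
proof (rule norm_L2_le[OF integrable_rep_norm[of u]])
  show "AE z in lborel. (norm (rep_L2 (superposition (yosida f \<tau>) u) z))\<^sup>2 \<le> (norm (rep_L2 u z))\<^sup>2"
    using rep_yosida[of u] by eventually_elim (use yosida_le[OF \<tau>] in \<open>auto intro: power_mono\<close>)
qed (simp_all add: norm_L2_sq)

end

text \<open>
  A subsequence converges almost everywhere, and \<open>f\<close> is continuous in \<open>\<xi>\<close>. The growth bound dominates
  the difference up to a multiple of the squared distance of the arguments, which tends to zero.
\<close>

lemma superposition_continuous: "continuous_on UNIV (superposition f)"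
proof (rule continuous_on_sequentiallyI)
  fix x :: "nat \<Rightarrow> ('a, 'b) L2" and u assume lim: "x \<longlonglongrightarrow> u"
  let ?B = "superposition f"
  have nlim: "(\<lambda>n. (norm (x n - u))\<^sup>2) \<longlonglongrightarrow> 0"
  proof -
    have "(\<lambda>n. (norm (x n - u))\<^sup>2) \<longlonglongrightarrow> (norm (u - u))\<^sup>2" by (intro tendsto_intros lim)
    then show ?thesis by simp
  qed
  show "(\<lambda>n. ?B (x n)) \<longlonglongrightarrow> ?B u"
  proof (rule ccontr)
    assume "\<not> ?thesis"
    then obtain e where e: "0 < e" "\<And>N. \<exists>n\<ge>N. e \<le> dist (?B (x n)) (?B u)"
      unfolding lim_sequentially by (meson not_le)
    define S where "S = {n. e \<le> dist (?B (x n)) (?B u)}"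
    have "infinite S" unfolding infinite_nat_iff_unbounded_le using e(2) by (auto simp: S_def)
    define y where "y n = x (enumerate S n)" for n
    have sm: "strict_mono (enumerate S)" using \<open>infinite S\<close> by (rule strict_mono_enumerate)
    have ye: "e \<le> norm (?B (y n) - ?B u)" for n
      using enumerate_in_set[OF \<open>infinite S\<close>, of n] by (simp add: y_def S_def dist_norm)
    have ylim: "(\<lambda>n. (norm (y n - u))\<^sup>2) \<longlonglongrightarrow> 0"
      using LIMSEQ_subseq_LIMSEQ[OF nlim sm] by (simp add: comp_def y_def)
    have "(\<lambda>n. \<integral>z. norm ((norm (rep_L2 (y n - u) z))\<^sup>2) \<partial>lborel) \<longlonglongrightarrow> 0"
      using ylim by (simp add: norm_L2_sq)
    from tendsto_L1_AE_subseq[OF integrable_rep_norm this] obtain r :: "nat \<Rightarrow> nat" where r: "strict_mono r"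
      and ae: "AE z in lborel. (\<lambda>n. (norm (rep_L2 (y (r n) - u) z))\<^sup>2) \<longlonglongrightarrow> 0" by blast
    define a where "a n z = (norm (rep_L2 (?B (y (r n)) - ?B u) z))\<^sup>2" for n z
    define h where "h z = 6 * c\<^sup>2 * (norm (rep_L2 u z))\<^sup>2" for z
    have h: "integrable lborel h" unfolding h_def using integrable_rep_norm[of u] by simp
    have aeq: "AE z in lborel. \<forall>n. a n z = (norm (f z (rep_L2 (y (r n)) z) - f z (rep_L2 u z)))\<^sup>2
        \<and> rep_L2 (y (r n) - u) z = rep_L2 (y (r n)) z - rep_L2 u z"
      unfolding AE_all_countable
    proof
      fix n
      show "AE z in lborel. a n z = (norm (f z (rep_L2 (y (r n)) z) - f z (rep_L2 u z)))\<^sup>2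
        \<and> rep_L2 (y (r n) - u) z = rep_L2 (y (r n)) z - rep_L2 u z"
        using rep_diff_L2[of "?B (y (r n))" "?B u"] rep_superposition[of "y (r n)"] rep_superposition[of u]
          rep_diff_L2[of "y (r n)" u]
        by eventually_elim (simp add: a_def)
    qed
    \<comment> \<open>dominated part: the minimum of \<open>a n\<close> and \<open>h\<close>; the excess over \<open>h\<close> is controlled by \<open>y - u\<close>\<close>
    have "(\<lambda>n. \<integral>z. min (a n z) (h z) \<partial>lborel) \<longlonglongrightarrow> (\<integral>z. 0 \<partial>(lborel :: 'a measure))"
    proof (rule integral_dominated_convergence[where w=h])
      show "(\<lambda>z. min (a n z) (h z)) \<in> borel_measurable lborel" for n
        unfolding a_def h_def by measurable
      show "AE z in lborel. norm (min (a n z) (h z)) \<le> h z" for n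
        by (intro AE_I2) (auto simp: a_def h_def)
      show "AE z in lborel. (\<lambda>n. min (a n z) (h z)) \<longlonglongrightarrow> 0"
        using ae aeq
      proof eventually_elim
        case (elim z)
        have "(\<lambda>n. sqrt ((norm (rep_L2 (y (r n)) z - rep_L2 u z))\<^sup>2)) \<longlonglongrightarrow> sqrt 0"
          using tendsto_real_sqrt[OF elim(1)] elim(2) by simp
        then have "(\<lambda>n. norm (rep_L2 (y (r n)) z - rep_L2 u z)) \<longlonglongrightarrow> 0" by simp
        then have "(\<lambda>n. rep_L2 (y (r n)) z - rep_L2 u z) \<longlonglongrightarrow> 0" by (rule tendsto_norm_zero_cancel)
        then have "(\<lambda>n. rep_L2 (y (r n)) z) \<longlonglongrightarrow> rep_L2 u z" by (rule LIM_zero_cancel)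
        then have "(\<lambda>n. f z (rep_L2 (y (r n)) z)) \<longlonglongrightarrow> f z (rep_L2 u z)"
          by (rule continuous_on_tendsto_compose[OF f_cont]) auto
        then have "(\<lambda>n. (norm (f z (rep_L2 (y (r n)) z) - f z (rep_L2 u z)))\<^sup>2) \<longlonglongrightarrow> (norm (f z (rep_L2 u z) - f z (rep_L2 u z)))\<^sup>2"
          by (intro tendsto_intros)
        then have "(\<lambda>n. a n z) \<longlonglongrightarrow> 0" using elim(2) by simp
        then have "(\<lambda>n. min (a n z) (h z)) \<longlonglongrightarrow> min 0 (h z)" by (intro tendsto_intros)
        then show ?case by (simp add: h_def)
      qed
    qed (use h in simp_all)
    then have l1: "(\<lambda>n. \<integral>z. min (a n z) (h z) \<partial>lborel) \<longlonglongrightarrow> 0" by simp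
    have le: "(norm (?B (y (r n)) - ?B u))\<^sup>2 \<le> (\<integral>z. min (a n z) (h z) \<partial>lborel) + 4 * c\<^sup>2 * (norm (y (r n) - u))\<^sup>2" for n
    proof -
      have ia: "integrable lborel (a n)" unfolding a_def by (rule integrable_rep_norm)
      have im: "integrable lborel (\<lambda>z. min (a n z) (h z))" using ia h by simp
      have id: "integrable lborel (\<lambda>z. 4 * c\<^sup>2 * (norm (rep_L2 (y (r n) - u) z))\<^sup>2)" using integrable_rep_norm[of "y (r n) - u"] by simp
      have "(norm (?B (y (r n)) - ?B u))\<^sup>2 = (\<integral>z. a n z \<partial>lborel)" by (simp add: norm_L2_sq a_def)
      also have "\<dots> \<le> (\<integral>z. min (a n z) (h z) + 4 * c\<^sup>2 * (norm (rep_L2 (y (r n) - u) z))\<^sup>2 \<partial>lborel)"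
      proof (rule integral_mono_AE[OF ia Bochner_Integration.integrable_add[OF im id]])
        show "AE z in lborel. a n z \<le> min (a n z) (h z) + 4 * c\<^sup>2 * (norm (rep_L2 (y (r n) - u) z))\<^sup>2"
          using aeq
        proof eventually_elim
          case (elim z)
          define v w where "v = rep_L2 (y (r n)) z" and "w = rep_L2 u z"
          have 1: "(norm (f z v - f z w))\<^sup>2 \<le> 2 * (norm (f z v))\<^sup>2 + 2 * (norm (f z w))\<^sup>2"
            using norm_add_sq_le[of "f z v" "- f z w"] by simp
          have 2: "(norm (f z \<xi>))\<^sup>2 \<le> c\<^sup>2 * (norm \<xi>)\<^sup>2" for \<xi>
            using f_le[of z \<xi>] by (simp flip: power_mult_distrib add: power_mono)
          have "c\<^sup>2 * (norm v)\<^sup>2 \<le> c\<^sup>2 * (2 * (norm (v - w))\<^sup>2 + 2 * (norm w)\<^sup>2)"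
            using norm_add_sq_le[of "v - w" w] by (intro mult_left_mono) simp_all
          with 1 2[of v] 2[of w] have "(norm (f z v - f z w))\<^sup>2 \<le> 4 * c\<^sup>2 * (norm (v - w))\<^sup>2 + h z"
            unfolding h_def w_def[symmetric] distrib_left by linarith
          then show ?case using elim by (simp add: v_def w_def min_def)
        qed
      qed
      also have "\<dots> = (\<integral>z. min (a n z) (h z) \<partial>lborel) + 4 * c\<^sup>2 * (norm (y (r n) - u))\<^sup>2"
        using im id by (simp add: norm_L2_sq)
      finally show ?thesis .
    qed
    have "(\<lambda>n. (norm (y (r n) - u))\<^sup>2) \<longlonglongrightarrow> 0" using LIMSEQ_subseq_LIMSEQ[OF ylim r] by (simp add: comp_def)
    then have "(\<lambda>n. (\<integral>z. min (a n z) (h z) \<partial>lborel) + 4 * c\<^sup>2 * (norm (y (r n) - u))\<^sup>2) \<longlonglongrightarrow> 0 + 4 * c\<^sup>2 * 0"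
      by (intro tendsto_intros l1)
    moreover have "e\<^sup>2 \<le> (\<integral>z. min (a n z) (h z) \<partial>lborel) + 4 * c\<^sup>2 * (norm (y (r n) - u))\<^sup>2" for n
      using order_trans[OF power_mono[OF ye less_imp_le[OF e(1)], of 2] le] .
    ultimately have "e\<^sup>2 \<le> 0 + 4 * c\<^sup>2 * 0" by (intro LIMSEQ_le_const) auto
    then show False using e(1) by simp
  qed
qed

end

text \<open>Monotonicity and nonexpansiveness hold pointwise, hence with respect to every time weight.\<close>

lemma superposition_time_mult:
  fixes f :: "'a::euclidean_space \<times> real \<Rightarrow> 'b::euclidean_space \<Rightarrow> 'b"
  assumes f: "monotone_field f c" and \<theta>: "bounded_fun \<theta>" "\<And>t. 0 \<le> \<theta> t"
  shows "0 \<le> (superposition f u - superposition f v) \<bullet> time_mult \<theta> (u - v)"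
    and "0 < \<tau> \<Longrightarrow> \<tau> < 1 / (2 * c) \<Longrightarrow>
      (superposition (yosida f \<tau>) u - superposition (yosida f \<tau>) v) \<bullet> time_mult \<theta> (superposition (yosida f \<tau>) u - superposition (yosida f \<tau>) v)
      \<le> (u - v) \<bullet> time_mult \<theta> (u - v)"
proof -
  show "0 \<le> (superposition f u - superposition f v) \<bullet> time_mult \<theta> (u - v)"
    unfolding time_mult_inner[OF \<theta>(1)]
  proof (rule integral_nonneg_AE)
    show "AE z in lborel. 0 \<le> \<theta> (snd z) * (rep_L2 (superposition f u - superposition f v) z \<bullet> rep_L2 (u - v) z)"
      using rep_diff_L2[of "superposition f u" "superposition f v"] rep_diff_L2[of u v]
        rep_superposition[OF f, of u] rep_superposition[OF f, of v]
    proof eventually_elim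
      case (elim z)
      have "0 \<le> (f z (rep_L2 u z) - f z (rep_L2 v z)) \<bullet> (rep_L2 u z - rep_L2 v z)"
        using f unfolding monotone_field_def by blast
      with elim \<theta>(2) show ?case by simp
    qed
  qed
  assume \<tau>: "0 < \<tau>" "\<tau> < 1 / (2 * c)"
  let ?J = "superposition (yosida f \<tau>)"
  show "(?J u - ?J v) \<bullet> time_mult \<theta> (?J u - ?J v) \<le> (u - v) \<bullet> time_mult \<theta> (u - v)"
    unfolding time_mult_inner[OF \<theta>(1)]
  proof (rule integral_mono_AE)
    show "AE z in lborel. \<theta> (snd z) * (rep_L2 (?J u - ?J v) z \<bullet> rep_L2 (?J u - ?J v) z) \<le> \<theta> (snd z) * (rep_L2 (u - v) z \<bullet> rep_L2 (u - v) z)"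
      using rep_diff_L2[of "?J u" "?J v"] rep_diff_L2[of u v] rep_yosida[OF f \<tau>, of u] rep_yosida[OF f \<tau>, of v]
      by eventually_elim (use yosida_nonexpansive[OF f \<tau>] \<theta>(2) in \<open>simp add: dot_square_norm power_mono mult_left_mono\<close>)
  qed (intro integrable_time_mult_inner \<theta>)+
qed

section \<open>Smooth functions with compact support\<close>

lemma C_k_SucI:
  fixes f :: "'a::euclidean_space \<Rightarrow> 'b::real_normed_vector"
  assumes D: "\<And>x. (f has_derivative f' x) (at x)" and C: "\<And>v. C_k n (\<lambda>x. f' x v)"
  shows "C_k (Suc n) f"
proof -
  have "frechet_derivative f (at x) = f' x" for x using frechet_derivative_at[OF D] by simp
  moreover have "f differentiable_on UNIV" using D by (auto simp: differentiable_on_def differentiable_def)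
  ultimately show ?thesis using C by simp
qed

lemma C_k_SucD:
  fixes f :: "'a::euclidean_space \<Rightarrow> 'b::real_normed_vector"
  assumes "C_k (Suc n) f"
  shows "(f has_derivative frechet_derivative f (at x)) (at x)" "C_k n (\<lambda>x. frechet_derivative f (at x) v)"
  using assms by (auto simp: differentiable_on_def frechet_derivative_works)

lemma C_k_Suc_imp: "C_k (Suc n) f \<Longrightarrow> C_k n (f :: 'a::euclidean_space \<Rightarrow> 'b::real_normed_vector)"
proof (induction n arbitrary: f)
  case 0
  then show ?case by (simp add: differentiable_imp_continuous_on)
next
  case (Suc n)
  show ?case by (rule C_k_SucI[OF C_k_SucD(1)[OF Suc.prems]]) (intro Suc.IH C_k_SucD(2)[OF Suc.prems])
qed

lemma C_k_continuous: "C_k n f \<Longrightarrow> continuous_on UNIV (f :: 'a::euclidean_space \<Rightarrow> 'b::real_normed_vector)"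
  by (induction n arbitrary: f) (auto intro: differentiable_imp_continuous_on)

lemma C_k_const: "C_k n (\<lambda>x :: 'a::euclidean_space. c :: 'b::real_normed_vector)"
proof (induction n arbitrary: c)
  case (Suc n)
  show ?case by (rule C_k_SucI[where f'="\<lambda>x v. 0"]) (auto intro: Suc derivative_eq_intros)
qed simp

lemma C_k_add:
  fixes f g :: "'a::euclidean_space \<Rightarrow> 'b::real_normed_vector"
  shows "C_k n f \<Longrightarrow> C_k n g \<Longrightarrow> C_k n (\<lambda>x. f x + g x)"
proof (induction n arbitrary: f g)
  case (Suc n)
  show ?case
    by (rule C_k_SucI[OF has_derivative_add[OF C_k_SucD(1)[OF Suc.prems(1)] C_k_SucD(1)[OF Suc.prems(2)]]])
      (intro Suc.IH C_k_SucD(2) Suc.prems)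
qed (simp add: continuous_on_add)

lemma C_k_scaleR:
  fixes g :: "'a::euclidean_space \<Rightarrow> real" and f :: "'a \<Rightarrow> 'b::real_normed_vector"
  shows "C_k n g \<Longrightarrow> C_k n f \<Longrightarrow> C_k n (\<lambda>x. g x *\<^sub>R f x)"
proof (induction n arbitrary: f g)
  case (Suc n)
  show ?case
    by (rule C_k_SucI[OF has_derivative_scaleR[OF C_k_SucD(1)[OF Suc.prems(1)] C_k_SucD(1)[OF Suc.prems(2)]]])
      (intro C_k_add Suc.IH C_k_SucD(2)[OF Suc.prems(1)] C_k_SucD(2)[OF Suc.prems(2)] C_k_Suc_imp[OF Suc.prems(1)] C_k_Suc_imp[OF Suc.prems(2)])
qed (simp add: continuous_on_scaleR)

lemma C_k_mult: "C_k n g \<Longrightarrow> C_k n f \<Longrightarrow> C_k n (\<lambda>x. g x * f x :: real)"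
  for f g :: "'a::euclidean_space \<Rightarrow> real"
  using C_k_scaleR[of n g f] by simp

lemma C_k_prod: "finite I \<Longrightarrow> (\<And>i. i \<in> I \<Longrightarrow> C_k n (g i)) \<Longrightarrow> C_k n (\<lambda>x. \<Prod>i\<in>I. g i x :: real)"
  for g :: "'i \<Rightarrow> 'a::euclidean_space \<Rightarrow> real"
  by (induction I rule: finite_induct) (auto intro: C_k_const C_k_mult)

lemma C_k_linear:
  fixes f :: "'c::euclidean_space \<Rightarrow> 'b::real_normed_vector" and L :: "'a::euclidean_space \<Rightarrow> 'c"
  assumes L: "bounded_linear L" shows "C_k n f \<Longrightarrow> C_k n (\<lambda>x. f (L x))"
proof (induction n arbitrary: f)
  case 0
  then show ?case using continuous_on_compose2[of UNIV f UNIV L] bounded_linear.continuous_on[OF L continuous_on_id] by simp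
next
  case (Suc n)
  show ?case
    by (rule C_k_SucI[OF has_derivative_compose[OF bounded_linear.has_derivative[OF L has_derivative_ident] C_k_SucD(1)[OF Suc.prems]]])
      (intro Suc.IH C_k_SucD(2) Suc.prems)
qed

lemma C_k_compose:
  fixes f :: "'a::euclidean_space \<Rightarrow> real" and h :: "real \<Rightarrow> real"
  shows "C_k n h \<Longrightarrow> C_k n f \<Longrightarrow> C_k n (\<lambda>x. h (f x))"
proof (induction n arbitrary: h f)
  case 0
  then show ?case using continuous_on_compose2[of UNIV h UNIV f] by simp
next
  case (Suc n)
  note h = C_k_SucD[OF Suc.prems(1)] and f = C_k_SucD[OF Suc.prems(2)]
  have "frechet_derivative h (at y) v = frechet_derivative h (at y) 1 * v" for y v
    using linear_scale[OF has_derivative_linear[OF h(1)], of y v 1] by (simp add: mult.commute)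
  then have eq: "(\<lambda>x. frechet_derivative h (at (f x)) (frechet_derivative f (at x) v))
      = (\<lambda>x. frechet_derivative h (at (f x)) 1 * frechet_derivative f (at x) v)" for v by metis
  have "C_k n (\<lambda>x. frechet_derivative h (at (f x)) 1)"
    by (rule Suc.IH[where h="\<lambda>y. frechet_derivative h (at y) 1" and f=f, OF h(2) C_k_Suc_imp[OF Suc.prems(2)]])
  then show ?case
    by (intro C_k_SucI[OF has_derivative_compose[OF f(1) h(1)]]) (simp only: eq C_k_mult f(2))
qed

lemma C_k_derivative:
  fixes f f' :: "real \<Rightarrow> real"
  assumes "\<And>x. (f has_real_derivative f' x) (at x)" "C_k n f'"
  shows "C_k (Suc n) f"
  using assms by (intro C_k_SucI[where f'="\<lambda>x v. f' x * v"] C_k_mult C_k_const)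
    (auto simp: has_field_derivative_def)

lemma C_k_exp: "C_k n (exp :: real \<Rightarrow> real)"
  by (induction n) (auto intro!: continuous_intros C_k_derivative DERIV_exp simp del: C_k.simps(2))

text \<open>The functions \<open>x\<^sup>-\<^sup>k exp (- 1 / x)\<close> extended by zero; their derivatives are linear combinations of such functions.\<close>

definition flat :: "nat \<Rightarrow> real \<Rightarrow> real" where
  "flat k x = (if 0 < x then (1 / x) ^ k * exp (- (1 / x)) else 0)"

lemma flat_tendsto_0: "(flat k \<longlongrightarrow> 0) (at 0)"
proof (rule filterlim_split_at_real)
  show "(flat k \<longlongrightarrow> 0) (at_left 0)"
    by (rule Lim_transform_eventually[OF tendsto_const])
      (auto simp: flat_def eventually_at_filter)
  have "((\<lambda>x. (inverse x) ^ k / exp (inverse x)) \<longlongrightarrow> 0) (at_right (0::real))"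
    by (rule filterlim_compose[OF tendsto_power_div_exp_0 filterlim_inverse_at_top_right])
  then show "(flat k \<longlongrightarrow> 0) (at_right 0)"
    by (rule Lim_transform_eventually)
      (auto simp: flat_def eventually_at_filter exp_minus field_simps)
qed

lemma flat_derivative: "(flat k has_real_derivative - real k * flat (Suc k) x + flat (Suc (Suc k)) x) (at x)"
proof (cases x "0::real" rule: linorder_cases)
  case less
  then have "((\<lambda>x. 0) has_real_derivative - real k * flat (Suc k) x + flat (Suc (Suc k)) x) (at x)"
    by (simp add: flat_def)
  then show ?thesis
    by (rule has_field_derivative_transform_within_open[where S="{..<0}"]) (use less in \<open>auto simp: flat_def\<close>)
next
  case greater
  have "((\<lambda>x. (1 / x) ^ k * exp (- (1 / x))) has_real_derivative - real k * flat (Suc k) x + flat (Suc (Suc k)) x) (at x)"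
  proof -
    have D: "((\<lambda>x. 1 / x) has_real_derivative - ((1 / x)\<^sup>2)) (at x)"
      using greater by (auto intro!: derivative_eq_intros simp: power2_eq_square)
    have "((\<lambda>x. (1 / x) ^ k * exp (- (1 / x))) has_real_derivative
        (real k * (- ((1 / x)\<^sup>2) * (1 / x) ^ (k - Suc 0))) * exp (- (1 / x)) + (exp (- (1 / x)) * - (- ((1 / x)\<^sup>2))) * (1 / x) ^ k) (at x)"
      by (intro DERIV_mult DERIV_power DERIV_fun_exp DERIV_minus D)
    moreover have "real k * (- ((1 / x)\<^sup>2) * (1 / x) ^ (k - Suc 0)) = - real k * (1 / x) ^ Suc k"
      by (cases k) (simp_all add: power2_eq_square algebra_simps add_divide_distrib diff_divide_distrib)
    ultimately show ?thesis
      by (elim DERIV_cong, simp only:) (use greater in \<open>simp add: flat_def power2_eq_square algebra_simps\<close>)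
  qed
  then show ?thesis
    by (rule has_field_derivative_transform_within_open[where S="{0<..}"]) (use greater in \<open>auto simp: flat_def\<close>)
next
  case equal
  have "(\<lambda>h. (flat k (0 + h) - flat k 0) / h) = flat (Suc k)" by (auto simp: flat_def fun_eq_iff)
  then show ?thesis using flat_tendsto_0[of "Suc k"] by (simp add: equal DERIV_def) (simp add: flat_def)
qed

lemma C_k_flat: "C_k n (flat k)"
proof (induction n arbitrary: k)
  case 0
  show ?case by (simp add: DERIV_isCont[OF flat_derivative] continuous_at_imp_continuous_on)
next
  case (Suc n)
  show ?case by (rule C_k_derivative[OF flat_derivative]) (intro C_k_add C_k_mult C_k_const Suc)
qed

text \<open>Smooth functions that increase to the indicator of an open box.\<close>

definition box_bump :: "'a::euclidean_space \<Rightarrow> 'a \<Rightarrow> nat \<Rightarrow> 'a \<Rightarrow> real" where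
  "box_bump a b m x = 1 - exp (- (real m * (\<Prod>i\<in>Basis. flat 0 (x \<bullet> i - a \<bullet> i) * flat 0 (b \<bullet> i - x \<bullet> i))))"

lemma flat_nonneg: "0 \<le> flat k x" by (simp add: flat_def)

lemma C_k_box_bump: "C_k n (box_bump a b m)"
proof -
  have lin: "C_k n (\<lambda>x :: 'a. s * (x \<bullet> i) + c)" for s c :: real and i
  proof -
    have "C_k n (\<lambda>t :: real. t)"
      by (cases n) (auto intro!: C_k_derivative[where f'="\<lambda>_. 1"] C_k_const continuous_intros simp del: C_k.simps(2))
    from C_k_linear[OF bounded_linear_inner_left this] show ?thesis by (intro C_k_add C_k_mult C_k_const)
  qed
  have "C_k n (\<lambda>x. flat 0 (1 * (x \<bullet> i) + - (a \<bullet> i)) * flat 0 (-1 * (x \<bullet> i) + b \<bullet> i))" for i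
    by (intro C_k_mult C_k_compose[OF C_k_flat] lin)
  then have "C_k n (\<lambda>x. \<Prod>i\<in>Basis. flat 0 (1 * (x \<bullet> i) + - (a \<bullet> i)) * flat 0 (-1 * (x \<bullet> i) + b \<bullet> i))"
    by (rule C_k_prod[OF finite_Basis])
  then have "C_k n (\<lambda>x. (- real m) * (\<Prod>i\<in>Basis. flat 0 (1 * (x \<bullet> i) + - (a \<bullet> i)) * flat 0 (-1 * (x \<bullet> i) + b \<bullet> i)))"
    by (rule C_k_mult[OF C_k_const])
  from C_k_add[OF C_k_const C_k_mult[OF C_k_const C_k_compose[OF C_k_exp this]], of 1 "-1"]
  show ?thesis by (simp add: box_bump_def[abs_def])
qed

lemma box_bump_bounds: "0 \<le> box_bump a b m x" "box_bump a b m x \<le> 1"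
  by (auto simp: box_bump_def flat_nonneg intro!: mult_nonneg_nonneg prod_nonneg)

lemma box_bump_outside: "x \<notin> box a b \<Longrightarrow> box_bump a b m x = 0"
proof -
  assume "x \<notin> box a b"
  then obtain i where "i \<in> Basis" "x \<bullet> i \<le> a \<bullet> i \<or> b \<bullet> i \<le> x \<bullet> i" by (auto simp: mem_box not_less)
  then have "(\<Prod>i\<in>Basis. flat 0 (x \<bullet> i - a \<bullet> i) * flat 0 (b \<bullet> i - x \<bullet> i)) = 0"
    by (intro prod_zero bexI[of _ i]) (auto simp: flat_def)
  then show ?thesis by (simp add: box_bump_def)
qed

lemma box_bump_tendsto: "(\<lambda>m. box_bump a b m x) \<longlonglongrightarrow> indicator (box a b) x"
proof (cases "x \<in> box a b")
  case True
  define c where "c = (\<Prod>i\<in>Basis. flat 0 (x \<bullet> i - a \<bullet> i) * flat 0 (b \<bullet> i - x \<bullet> i))"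
  have c: "0 < c" unfolding c_def using True by (intro prod_pos) (auto simp: mem_box flat_def)
  have "(\<lambda>m. exp (- c) ^ m) \<longlonglongrightarrow> 0" using c by (intro LIMSEQ_realpow_zero) auto
  then have "(\<lambda>m. 1 - exp (- (real m * c))) \<longlonglongrightarrow> 1 - 0"
    by (intro tendsto_diff tendsto_const) (simp add: exp_of_nat_mult[symmetric])
  with True show ?thesis by (simp add: box_bump_def c_def)
qed (simp add: box_bump_outside)

section \<open>The fundamental lemma of the calculus of variations\<close>

text \<open>
  Boxes are stable under intersection and generate the Borel sets, so by Dynkin's argument the integral
  over every Borel set vanishes, in particular over the sets where \<open>f\<close> is positive or negative.
\<close>

lemma AE_zero_if_box_integrals_zero:
  fixes f :: "'a::euclidean_space \<Rightarrow> real"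
  assumes f: "integrable lborel f" and box: "\<And>a b. (\<integral>x. indicator (box a b) x * f x \<partial>lborel) = 0" and f0: "(\<integral>x. f x \<partial>lborel) = 0"
  shows "AE x in lborel. f x = 0"
proof -
  have [measurable]: "f \<in> borel_measurable borel" using borel_measurable_integrable[OF f] by simp
  have si: "integrable lborel (\<lambda>x. indicator A x * f x)" if "A \<in> sets borel" for A
    using integrable_mult_indicator[of A lborel f] that f by simp
  have stable: "Int_stable (range (\<lambda>(a, b). box a b :: 'a set))"
    by (auto simp: Int_stable_def box_Int_box)
  have sub: "range (\<lambda>(a, b). box a b :: 'a set) \<subseteq> Pow UNIV" by simp
  have zero: "(\<integral>x. indicator A x * f x \<partial>lborel) = 0" if "A \<in> sigma_sets UNIV (range (\<lambda>(a, b). box a b :: 'a set))" for A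
    using stable sub that
  proof (induction rule: sigma_sets_induct_disjoint)
    case (basic A) then show ?case using box by auto
  next
    case (compl A)
    have A: "A \<in> sets borel" using compl(1) by (simp add: borel_eq_box)
    have "(\<integral>x. indicator (UNIV - A) x * f x \<partial>lborel) = (\<integral>x. f x - indicator A x * f x \<partial>lborel)"
      by (intro Bochner_Integration.integral_cong) (auto simp: indicator_def)
    also have "\<dots> = 0" using f si[OF A] compl(2) f0 by simp
    finally show ?case .
  next
    case (union A)
    have A: "A i \<in> sets borel" for i using union(2) by (auto simp: borel_eq_box)
    have "(LINT x:(\<Union>i. A i)|lborel. f x) = (\<Sum>i. LINT x:A i|lborel. f x)"
      using A union(1) si[of "\<Union>i. A i"]
      by (intro lebesgue_integral_countable_add) (auto simp: disjoint_family_on_def set_integrable_def)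
    also have "\<dots> = 0" using union(3) by (simp add: set_lebesgue_integral_def)
    finally show ?case by (simp add: set_lebesgue_integral_def)
  qed simp
  then have zero': "(\<integral>x. indicator A x * f x \<partial>lborel) = 0" if "A \<in> sets borel" for A using that by (simp add: borel_eq_box)
  have "AE x in lborel. indicator {x. 0 < f x} x * f x = 0"
    using zero'[of "{x. 0 < f x}"] si[of "{x. 0 < f x}"]
      integral_nonneg_eq_0_iff_AE[of lborel "\<lambda>x. indicator {x. 0 < f x} x * f x"] by (auto simp: indicator_def)
  moreover have "AE x in lborel. indicator {x. f x < 0} x * - f x = 0"
    using zero'[of "{x. f x < 0}"] si[of "{x. f x < 0}"]
      integral_nonneg_eq_0_iff_AE[of lborel "\<lambda>x. indicator {x. f x < 0} x * - f x"] by (auto simp: indicator_def)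
  ultimately show ?thesis by eventually_elim (auto simp: indicator_def split: if_splits)
qed

lemma integrable_indicator_inner:
  assumes "sq_integrable f" "bounded S" "S \<in> sets borel"
  shows "integrable lborel (\<lambda>x. indicator S x * (f x \<bullet> c))"
proof -
  have "integrable lborel (indicator S :: 'a \<Rightarrow> real)"
    using assms by (intro integrable_real_indicator emeasure_bounded_finite) auto
  moreover have "(\<lambda>x. (norm (indicator S x *\<^sub>R c))\<^sup>2) = (\<lambda>x. indicator S x * (norm c)\<^sup>2)"
    by (auto simp: indicator_def fun_eq_iff)
  ultimately have "sq_integrable (\<lambda>x. indicator S x *\<^sub>R c)"
    unfolding sq_integrable_def using assms(3) by simp
  from integrable_inner[OF assms(1) this] show ?thesis by simp
qed

lemma AE_zero_on_open_if_box_integrals_zero: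
  fixes f :: "'a::euclidean_space \<Rightarrow> 'b::euclidean_space"
  assumes f: "sq_integrable f" and S: "open S"
    and box: "\<And>a b c. cbox a b \<subseteq> S \<Longrightarrow> (\<integral>x. indicator (box a b) x * (f x \<bullet> c) \<partial>lborel) = 0"
  shows "AE x in lborel. x \<in> S \<longrightarrow> f x = 0"
proof -
  obtain D where D: "countable D" "D \<subseteq> Pow S" "\<And>X. X \<in> D \<Longrightarrow> \<exists>a b. X = cbox a b" "\<Union>D = S"
    using open_countable_Union_open_cbox[OF S] by metis
  have "AE x in lborel. x \<in> X \<longrightarrow> f x = 0" if X: "X \<in> D" for X
  proof -
    from D(3)[OF X] obtain a b where ab: "X = cbox a b" by blast
    have sub: "cbox a b \<subseteq> S" using D(2) X ab by blast
    have "AE x in lborel. indicator (box a b) x * (f x \<bullet> c) = 0" for c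
    proof (rule AE_zero_if_box_integrals_zero)
      show "integrable lborel (\<lambda>x. indicator (box a b) x * (f x \<bullet> c))"
        by (rule integrable_indicator_inner[OF f]) auto
      show "(\<integral>x. indicator (box a b) x * (f x \<bullet> c) \<partial>lborel) = 0" by (rule box[OF sub])
      fix a' b'
      obtain a'' b'' where i: "box a b \<inter> box a' b' = box a'' b''" using box_Int_box[of a b a' b'] by blast
      show "(\<integral>x. indicator (box a' b') x * (indicator (box a b) x * (f x \<bullet> c)) \<partial>lborel) = 0"
      proof (cases "box a'' b'' = {}")
        case True
        then have "indicator (box a' b') x * (indicator (box a b) x * (f x \<bullet> c)) = 0" for x
          using i by (auto simp: indicator_def)
        then have "(\<integral>x. indicator (box a' b') x * (indicator (box a b) x * (f x \<bullet> c)) \<partial>lborel) = (\<integral>x. 0 \<partial>(lborel :: 'a measure))"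
          by (intro Bochner_Integration.integral_cong refl)
        then show ?thesis by simp
      next
        case False
        have "box a'' b'' \<subseteq> cbox a b" using i box_subset_cbox by blast
        then have "cbox a'' b'' \<subseteq> cbox a b" using False by (metis closed_cbox closure_box closure_minimal)
        with sub have "(\<integral>x. indicator (box a'' b'') x * (f x \<bullet> c) \<partial>lborel) = 0" by (intro box) auto
        moreover have "indicator (box a' b') x * (indicator (box a b) x * (f x \<bullet> c)) = indicator (box a'' b'') x * (f x \<bullet> c)" for x
          using i by (auto simp: indicator_def)
        then have "(\<integral>x. indicator (box a' b') x * (indicator (box a b) x * (f x \<bullet> c)) \<partial>lborel) = (\<integral>x. indicator (box a'' b'') x * (f x \<bullet> c) \<partial>lborel)"
          by (intro Bochner_Integration.integral_cong refl)
        ultimately show ?thesis by simp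
      qed
    qed
    then have "AE x in lborel. \<forall>c\<in>Basis. indicator (box a b) x * (f x \<bullet> c) = 0"
      unfolding AE_finite_all[OF finite_Basis] by blast
    moreover have "AE x in lborel. x \<notin> frontier (cbox a b)"
      using negligible_frontier_interval[of a b] by (simp add: negligible_iff_null_sets frontier_cbox) (auto dest!: AE_not_in simp: AE_completion_iff)
    ultimately show ?thesis
    proof eventually_elim
      case (elim x)
      show ?case
      proof
        assume "x \<in> X"
        then have "x \<in> box a b" using elim(2) by (simp add: ab frontier_cbox)
        with elim(1) have "\<forall>c\<in>Basis. f x \<bullet> c = 0" by simp
        then show "f x = 0" by (simp only: euclidean_all_zero_iff)
      qed
    qed
  qed
  then have "AE x in lborel. \<forall>X\<in>D. x \<in> X \<longrightarrow> f x = 0" unfolding AE_ball_countable[OF D(1)] by blast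
  then show ?thesis by eventually_elim (use D(4) in blast)
qed

section \<open>Fields on open sets as elements of the Hilbert space\<close>

definition fld :: "'a::euclidean_space set \<Rightarrow> ('a \<Rightarrow> real^3) \<Rightarrow> ('a, real^3) L2" where
  "fld S f = to_L2 (\<lambda>x. indicator S x *\<^sub>R f x)"

lemma lebesgue_measurable_AE_cong:
  fixes f g :: "'a::euclidean_space \<Rightarrow> 'b::euclidean_space"
  assumes g: "g \<in> borel_measurable borel" and ae: "AE x in lborel. f x = g x"
  shows "f \<in> borel_measurable lebesgue"
proof (rule measurableI)
  fix B :: "'b set" assume B: "B \<in> sets borel"
  from ae obtain N where N: "{x. f x \<noteq> g x} \<subseteq> N" "N \<in> null_sets lborel" by (auto simp: eventually_ae_filter)
  have "g -` B \<in> sets lebesgue" using measurable_sets[OF g B] by simp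
  moreover have sub: "X \<inter> N \<in> sets lebesgue" for X
    using null_sets_completion_subset[OF _ null_sets_completionI[OF N(2)], of "X \<inter> N"] by auto
  moreover have "N \<in> sets lebesgue" using sub[of UNIV] by simp
  moreover have eq: "f -` B \<inter> space lebesgue = (g -` B - N) \<union> (f -` B \<inter> N)" using N(1) by auto
  ultimately show "f -` B \<inter> space lebesgue \<in> sets lebesgue" unfolding eq by (intro sets.Un sets.Diff)
qed simp

context
  fixes S :: "'a::euclidean_space set"
  assumes S: "open S"
begin

private lemma S_sets: "S \<in> sets borel" "S \<in> sets lebesgue" "S \<inter> space lebesgue \<in> sets lebesgue"
  using S by auto

lemma AE_lebesgue_on_iff: "(AE x in lebesgue_on S. P x) \<longleftrightarrow> (AE x in lborel. x \<in> S \<longrightarrow> P x)"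
  by (simp add: AE_restrict_space_iff[OF S_sets(3)] AE_completion_iff)

lemma measurable_lebesgue_onI:
  fixes f g :: "'a \<Rightarrow> 'b::euclidean_space"
  assumes g: "g \<in> borel_measurable borel" and "AE x in lborel. x \<in> S \<longrightarrow> f x = g x"
  shows "f \<in> borel_measurable (lebesgue_on S)"
proof -
  have "(\<lambda>x. indicator S x *\<^sub>R f x) \<in> borel_measurable lebesgue"
  proof (rule lebesgue_measurable_AE_cong)
    show "(\<lambda>x. indicator S x *\<^sub>R g x) \<in> borel_measurable borel" using g S_sets by simp
    show "AE x in lborel. indicator S x *\<^sub>R f x = indicator S x *\<^sub>R g x"
      using assms(2) by eventually_elim (auto simp: indicator_def)
  qed
  then show ?thesis by (simp add: borel_measurable_restrict_space_iff[OF S_sets(3)])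
qed

lemma integral_lebesgue_on:
  fixes f g :: "'a \<Rightarrow> 'b::euclidean_space"
  assumes g: "g \<in> borel_measurable borel" and ae: "AE x in lborel. x \<in> S \<longrightarrow> f x = g x"
  shows "(\<integral>x. f x \<partial>lebesgue_on S) = (\<integral>x. indicator S x *\<^sub>R g x \<partial>lborel)"
    and "integrable (lebesgue_on S) f \<longleftrightarrow> integrable lborel (\<lambda>x. indicator S x *\<^sub>R g x)"
proof -
  have ig: "(\<lambda>x. indicator S x *\<^sub>R g x) \<in> borel_measurable lborel" using g S_sets by simp
  have gm: "g \<in> borel_measurable (lebesgue_on S)" by (rule measurable_lebesgue_onI[OF g]) simp
  have ae': "AE x in lebesgue_on S. f x = g x" by (simp add: AE_lebesgue_on_iff ae)
  note fm = measurable_lebesgue_onI[OF g ae]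
  have "(\<integral>x. f x \<partial>lebesgue_on S) = (\<integral>x. g x \<partial>lebesgue_on S)"
    by (rule integral_cong_AE[OF fm gm ae'])
  also have "\<dots> = (\<integral>x. indicator S x *\<^sub>R g x \<partial>lebesgue)"
    by (rule integral_restrict_space[OF S_sets(3)])
  also have "\<dots> = (\<integral>x. indicator S x *\<^sub>R g x \<partial>lborel)" by (rule integral_completion[OF ig])
  finally show "(\<integral>x. f x \<partial>lebesgue_on S) = (\<integral>x. indicator S x *\<^sub>R g x \<partial>lborel)" .
  have "integrable (lebesgue_on S) f \<longleftrightarrow> integrable (lebesgue_on S) g"
    by (rule integrable_cong_AE[OF fm gm ae'])
  also have "\<dots> \<longleftrightarrow> integrable lebesgue (\<lambda>x. indicator S x *\<^sub>R g x)"
    by (rule integrable_restrict_space[OF S_sets(3)])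
  also have "\<dots> \<longleftrightarrow> integrable lborel (\<lambda>x. indicator S x *\<^sub>R g x)" by (rule integrable_completion[OF ig])
  finally show "integrable (lebesgue_on S) f \<longleftrightarrow> integrable lborel (\<lambda>x. indicator S x *\<^sub>R g x)" .
qed

lemma L2_fieldsI:
  assumes "AE x in lborel. x \<in> S \<longrightarrow> f x = rep_L2 u x" shows "f \<in> L2_fields S"
proof -
  have ae: "AE x in lborel. x \<in> S \<longrightarrow> (norm (f x))\<^sup>2 = (norm (rep_L2 u x))\<^sup>2"
    using assms by eventually_elim simp
  have "integrable lborel (\<lambda>x. indicator S x *\<^sub>R (norm (rep_L2 u x))\<^sup>2)"
    using integrable_mult_indicator[of S lborel, OF _ integrable_rep_norm[of u]] S_sets by simp
  then have "integrable (lebesgue_on S) (\<lambda>x. (norm (f x))\<^sup>2)" by (simp add: integral_lebesgue_on(2)[OF _ ae])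
  moreover have "f \<in> borel_measurable (lebesgue_on S)" by (rule measurable_lebesgue_onI[OF rep_measurable assms])
  ultimately show ?thesis by (simp add: L2_fields_def)
qed

lemma rep_L2_fields: "rep_L2 u \<in> L2_fields S"
  by (rule L2_fieldsI[of _ u]) simp

lemma fld_L2: assumes "f \<in> L2_fields S" shows "L2_fun (\<lambda>x. indicator S x *\<^sub>R f x)"
proof -
  have fm: "f \<in> borel_measurable (lebesgue_on S)" and fi: "integrable (lebesgue_on S) (\<lambda>x. (norm (f x))\<^sup>2)"
    using assms by (auto simp: L2_fields_def)
  have "(\<lambda>x. indicator S x *\<^sub>R f x) \<in> borel_measurable lebesgue"
    using fm by (simp add: borel_measurable_restrict_space_iff[OF S_sets(3)])
  from borel_version[OF this] obtain g where g: "g \<in> borel_measurable borel"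
    "AE x in lborel. indicator S x *\<^sub>R f x = g x" by blast
  have ae: "AE x in lborel. x \<in> S \<longrightarrow> (norm (f x))\<^sup>2 = (norm (g x))\<^sup>2"
    using g(2) by eventually_elim auto
  have "integrable lborel (\<lambda>x. indicator S x *\<^sub>R (norm (g x))\<^sup>2)"
    using fi integral_lebesgue_on(2)[OF _ ae] g(1) by simp
  then have "sq_integrable g"
  proof (rule sq_integrable_bound[OF g(1)])
    show "AE x in lborel. (norm (g x))\<^sup>2 \<le> indicator S x *\<^sub>R (norm (g x))\<^sup>2"
      using g(2) by eventually_elim (auto simp: indicator_def split: if_splits)
  qed
  from L2_fun_cong[OF L2_fun_sq_integrable[OF this] g(2)] show ?thesis .
qed

lemma rep_fld: "f \<in> L2_fields S \<Longrightarrow> AE x in lborel. rep_L2 (fld S f) x = indicator S x *\<^sub>R f x"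
  unfolding fld_def by (rule rep_to_L2[OF fld_L2])

lemma fld_eqI: "(AE x in lborel. rep_L2 u x = indicator S x *\<^sub>R f x) \<Longrightarrow> fld S f = u"
  unfolding fld_def by (rule to_L2_eqI)

lemma fld_cong:
  assumes "f \<in> L2_fields S" "AE x in lborel. x \<in> S \<longrightarrow> g x = f x" shows "fld S g = fld S f"
  by (rule fld_eqI) (use rep_fld[OF assms(1)] assms(2) in \<open>eventually_elim, auto simp: indicator_def\<close>)

lemma fld_inner:
  assumes f: "f \<in> L2_fields S"
  shows "(\<integral>x. f x \<bullet> rep_L2 u x \<partial>lebesgue_on S) = fld S f \<bullet> u"
proof -
  have "AE x in lborel. x \<in> S \<longrightarrow> f x \<bullet> rep_L2 u x = rep_L2 (fld S f) x \<bullet> rep_L2 u x"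
    using rep_fld[OF f] by eventually_elim simp
  from integral_lebesgue_on(1)[OF _ this]
  have "(\<integral>x. f x \<bullet> rep_L2 u x \<partial>lebesgue_on S) = (\<integral>x. indicator S x *\<^sub>R (rep_L2 (fld S f) x \<bullet> rep_L2 u x) \<partial>lborel)" by simp
  also have "\<dots> = fld S f \<bullet> u" unfolding inner_L2
  proof (rule integral_cong_AE)
    show "AE x in lborel. indicator S x *\<^sub>R (rep_L2 (fld S f) x \<bullet> rep_L2 u x) = rep_L2 (fld S f) x \<bullet> rep_L2 u x"
      using rep_fld[OF f] by eventually_elim (simp add: indicator_def)
  qed (use S_sets in simp_all)
  finally show ?thesis .
qed

lemma integral_fld_cong:
  assumes f: "f \<in> L2_fields S" and u: "AE x in lborel. x \<in> S \<longrightarrow> g x = rep_L2 u x"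
  shows "(\<integral>x. f x \<bullet> g x \<partial>lebesgue_on S) = fld S f \<bullet> u"
proof -
  have "(\<integral>x. f x \<bullet> g x \<partial>lebesgue_on S) = (\<integral>x. f x \<bullet> rep_L2 u x \<partial>lebesgue_on S)"
  proof (rule integral_cong_AE)
    have m: "f \<in> borel_measurable (lebesgue_on S)" using f by (simp add: L2_fields_def)
    show "(\<lambda>x. f x \<bullet> g x) \<in> borel_measurable (lebesgue_on S)" "(\<lambda>x. f x \<bullet> rep_L2 u x) \<in> borel_measurable (lebesgue_on S)"
      using m measurable_lebesgue_onI[OF rep_measurable u] rep_L2_fields[of u] by (auto simp: L2_fields_def)
    show "AE x in lebesgue_on S. f x \<bullet> g x = f x \<bullet> rep_L2 u x"
      unfolding AE_lebesgue_on_iff using u by eventually_elim simp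
  qed
  then show ?thesis by (simp add: fld_inner[OF f])
qed

lemma fld_inner_fld:
  assumes f: "f \<in> L2_fields S" and g: "g \<in> L2_fields S"
  shows "(\<integral>x. f x \<bullet> g x \<partial>lebesgue_on S) = fld S f \<bullet> fld S g"
  by (rule integral_fld_cong[OF f]) (use rep_fld[OF g] in \<open>eventually_elim, simp\<close>)

lemma fld_rep_inner: "f \<in> L2_fields S \<Longrightarrow> fld S f \<bullet> fld S (rep_L2 u) = fld S f \<bullet> u"
  using fld_inner_fld[OF _ rep_L2_fields] fld_inner by metis

lemma L2_norm_fld: "f \<in> L2_fields S \<Longrightarrow> L2_norm S f = norm (fld S f)"
  by (simp add: L2_norm_def fld_inner_fld norm_eq_sqrt_inner)

lemma L2_fields_diff:
  assumes "f \<in> L2_fields S" "g \<in> L2_fields S"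
  shows "(\<lambda>x. f x - g x) \<in> L2_fields S" "fld S (\<lambda>x. f x - g x) = fld S f - fld S g"
proof -
  have ae: "AE x in lborel. rep_L2 (fld S f - fld S g) x = indicator S x *\<^sub>R (f x - g x)"
    using rep_diff_L2[of "fld S f" "fld S g"] rep_fld[OF assms(1)] rep_fld[OF assms(2)]
    by eventually_elim (simp add: scaleR_diff_right)
  show "(\<lambda>x. f x - g x) \<in> L2_fields S"
    by (rule L2_fieldsI[of _ "fld S f - fld S g"]) (use ae in \<open>eventually_elim, simp\<close>)
  show "fld S (\<lambda>x. f x - g x) = fld S f - fld S g" by (rule fld_eqI[OF ae])
qed

lemma continuous_compact_support_L2_fields:
  fixes \<phi> :: "'a \<Rightarrow> real^3"
  assumes c: "continuous_on UNIV \<phi>" and K: "compact K" and z: "\<And>x. x \<notin> K \<Longrightarrow> \<phi> x = 0"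
  shows "\<phi> \<in> L2_fields S" and "L2_fun \<phi>"
proof -
  have "compact (\<phi> ` K)" by (rule compact_continuous_image[OF continuous_on_subset[OF c] K]) simp
  then obtain B where B: "\<And>x. x \<in> K \<Longrightarrow> norm (\<phi> x) \<le> B" by (meson bounded_iff compact_imp_bounded imageI)
  have "integrable lborel (indicator K :: 'a \<Rightarrow> real)"
    using K by (intro integrable_real_indicator emeasure_bounded_finite compact_imp_bounded) (auto simp: compact_imp_closed)
  then have "integrable lborel (\<lambda>x. B\<^sup>2 * indicator K x)" by simp
  then have "sq_integrable \<phi>"
  proof (rule sq_integrable_bound[OF borel_measurable_continuous_onI[OF c]])
    show "AE x in lborel. (norm (\<phi> x))\<^sup>2 \<le> B\<^sup>2 * indicator K x"
      by (rule AE_I2) (use B z in \<open>auto simp: indicator_def intro!: power_mono\<close>)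
  qed
  then show "L2_fun \<phi>" by (rule L2_fun_sq_integrable)
  from rep_to_L2[OF this] show "\<phi> \<in> L2_fields S"
    by (intro L2_fieldsI[of _ "to_L2 \<phi>"]) (auto elim!: eventually_mono)
qed

lemma test_functions_L2_fields: "\<phi> \<in> test_functions S \<Longrightarrow> \<phi> \<in> L2_fields S"
proof (rule continuous_compact_support_L2_fields[where K="closure {x. \<phi> x \<noteq> 0}"])
  assume \<phi>: "\<phi> \<in> test_functions S"
  then have "C_k 0 \<phi>" unfolding test_functions_def by blast
  then show "continuous_on UNIV \<phi>" by simp
  show "compact (closure {x. \<phi> x \<noteq> 0})" using \<phi> by (simp add: test_functions_def)
  show "\<phi> x = 0" if "x \<notin> closure {x. \<phi> x \<noteq> 0}" for x using that closure_subset[of "{x. \<phi> x \<noteq> 0}"] by auto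
qed

end

lemma box_bump_test_function:
  fixes c :: "real^3"
  assumes "cbox a b \<subseteq> S"
  shows "(\<lambda>x. box_bump a b m x *\<^sub>R c) \<in> test_functions S"
proof -
  have "{x. box_bump a b m x *\<^sub>R c \<noteq> 0} \<subseteq> cbox a b"
    using box_bump_outside[of _ a b m] box_subset_cbox by force
  then have "closure {x. box_bump a b m x *\<^sub>R c \<noteq> 0} \<subseteq> cbox a b" by (intro closure_minimal) auto
  moreover from this have "compact (closure {x. box_bump a b m x *\<^sub>R c \<noteq> 0})"
    by (meson bounded_cbox bounded_subset closed_closure compact_eq_bounded_closed)
  moreover have "C_k n (\<lambda>x. box_bump a b m x *\<^sub>R c)" for n by (intro C_k_scaleR C_k_box_bump C_k_const)
  ultimately show ?thesis using assms unfolding test_functions_def by blast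
qed

lemma box_bump_integral_tendsto:
  assumes "sq_integrable f"
  shows "(\<lambda>m. \<integral>x. box_bump a b m x * (f x \<bullet> c) \<partial>lborel) \<longlonglongrightarrow> (\<integral>x. indicator (box a b) x * (f x \<bullet> c) \<partial>lborel)"
proof (rule integral_dominated_convergence[where w="\<lambda>x. \<bar>indicator (box a b) x * (f x \<bullet> c)\<bar>"])
  note [measurable] = sq_integrable_measurable[OF assms]
  have [measurable]: "box_bump a b m \<in> borel_measurable borel" for m
    by (rule borel_measurable_continuous_onI[OF C_k_continuous[OF C_k_box_bump[of 0]]])
  show "(\<lambda>x. box_bump a b m x * (f x \<bullet> c)) \<in> borel_measurable lborel" for m by measurable
  show "(\<lambda>x. indicator (box a b) x * (f x \<bullet> c)) \<in> borel_measurable lborel" by measurable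
  show "integrable lborel (\<lambda>x. \<bar>indicator (box a b) x * (f x \<bullet> c)\<bar>)"
    by (intro integrable_abs integrable_indicator_inner[OF assms]) auto
  show "AE x in lborel. (\<lambda>m. box_bump a b m x * (f x \<bullet> c)) \<longlonglongrightarrow> indicator (box a b) x * (f x \<bullet> c)"
    by (intro AE_I2 tendsto_mult tendsto_const box_bump_tendsto)
  show "AE x in lborel. norm (box_bump a b m x * (f x \<bullet> c)) \<le> \<bar>indicator (box a b) x * (f x \<bullet> c)\<bar>" for m
  proof (rule AE_I2)
    fix x
    show "norm (box_bump a b m x * (f x \<bullet> c)) \<le> \<bar>indicator (box a b) x * (f x \<bullet> c)\<bar>"
      using box_bump_bounds[of a b m x] box_bump_outside[of x a b m]
      by (cases "x \<in> box a b") (auto simp: abs_mult intro: mult_left_le_one_le)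
  qed
qed

lemma AE_zero_if_orthogonal_to_test_functions:
  assumes S: "open S" and orth: "\<And>\<phi>. \<phi> \<in> test_functions S \<Longrightarrow> fld S \<phi> \<bullet> w = 0"
  shows "AE x in lborel. x \<in> S \<longrightarrow> rep_L2 w x = 0"
proof (rule AE_zero_on_open_if_box_integrals_zero[OF rep_sq_integrable S])
  fix a b :: 'a and c :: "real^3" assume ab: "cbox a b \<subseteq> S"
  have "(\<integral>x. box_bump a b m x * (rep_L2 w x \<bullet> c) \<partial>lborel) = 0" for m
  proof -
    note t = box_bump_test_function[OF ab, of m c]
    have "AE x in lborel. rep_L2 (fld S (\<lambda>x. box_bump a b m x *\<^sub>R c)) x \<bullet> rep_L2 w x = box_bump a b m x * (rep_L2 w x \<bullet> c)"
      using rep_fld[OF S test_functions_L2_fields[OF S t]]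
    proof eventually_elim
      case (elim x)
      have "box_bump a b m x = 0" if "x \<notin> S" using that ab box_subset_cbox by (intro box_bump_outside) blast
      with elim show ?case by (cases "x \<in> S") (auto simp: inner_commute)
    qed
    moreover have "box_bump a b m \<in> borel_measurable borel"
      by (rule borel_measurable_continuous_onI[OF C_k_continuous[OF C_k_box_bump[of 0]]])
    ultimately have "fld S (\<lambda>x. box_bump a b m x *\<^sub>R c) \<bullet> w = (\<integral>x. box_bump a b m x * (rep_L2 w x \<bullet> c) \<partial>lborel)"
      unfolding inner_L2 by (intro integral_cong_AE) auto
    with orth[OF t] show ?thesis by simp
  qed
  with box_bump_integral_tendsto[OF rep_sq_integrable[of w], of a b c]
  show "(\<integral>x. indicator (box a b) x * (rep_L2 w x \<bullet> c) \<partial>lborel) = 0" by (simp add: LIMSEQ_const_iff)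
qed

section \<open>The weak curl\<close>

lemma curl_L2_fields:
  fixes \<phi> :: "real^3 \<Rightarrow> real^3"
  assumes S: "open S" and \<phi>: "\<phi> \<in> test_functions S" shows "curl \<phi> \<in> L2_fields S"
proof (rule continuous_compact_support_L2_fields[OF S, where K="closure {x. \<phi> x \<noteq> 0}"])
  have C: "C_k (Suc 0) \<phi>" using \<phi> unfolding test_functions_def by blast
  have c: "continuous_on UNIV (\<lambda>x. jacobian \<phi> (at x) $ i $ j)" for i j
    unfolding jacobian_def matrix_def using C by (auto intro!: continuous_intros)
  have "continuous_on UNIV (\<lambda>x. (\<chi> (i::3). if i = 1 then jacobian \<phi> (at x) $ 3 $ 2 - jacobian \<phi> (at x) $ 2 $ 3 else
      if i = 2 then jacobian \<phi> (at x) $ 1 $ 3 - jacobian \<phi> (at x) $ 3 $ 1 else jacobian \<phi> (at x) $ 2 $ 1 - jacobian \<phi> (at x) $ 1 $ 2))"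
  proof (intro continuous_on_vec_lambda)
    fix i :: 3
    show "continuous_on UNIV (\<lambda>x. if i = 1 then jacobian \<phi> (at x) $ 3 $ 2 - jacobian \<phi> (at x) $ 2 $ 3 else
      if i = 2 then jacobian \<phi> (at x) $ 1 $ 3 - jacobian \<phi> (at x) $ 3 $ 1 else jacobian \<phi> (at x) $ 2 $ 1 - jacobian \<phi> (at x) $ 1 $ 2)"
      by (cases "i = 1"; cases "i = 2") (simp_all add: continuous_on_diff c)
  qed
  also have "(\<lambda>x. (\<chi> (i::3). if i = 1 then jacobian \<phi> (at x) $ 3 $ 2 - jacobian \<phi> (at x) $ 2 $ 3 else
      if i = 2 then jacobian \<phi> (at x) $ 1 $ 3 - jacobian \<phi> (at x) $ 3 $ 1 else jacobian \<phi> (at x) $ 2 $ 1 - jacobian \<phi> (at x) $ 1 $ 2)) = curl \<phi>"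
    by (auto simp: fun_eq_iff curl_def Let_def vec_eq_iff forall_3)
  finally show "continuous_on UNIV (curl \<phi>)" .
  show "compact (closure {x. \<phi> x \<noteq> 0})" using \<phi> by (simp add: test_functions_def)
  fix x assume x: "x \<notin> closure {x. \<phi> x \<noteq> 0}"
  have "((\<lambda>x. 0) has_derivative (\<lambda>v. 0)) (at x)" by simp
  then have "(\<phi> has_derivative (\<lambda>v. 0)) (at x)"
  proof (rule has_derivative_transform_within_open[where s="- closure {x. \<phi> x \<noteq> 0}"])
    show "0 = \<phi> y" if "y \<in> - closure {x. \<phi> x \<noteq> 0}" for y using that closure_subset[of "{x. \<phi> x \<noteq> 0}"] by auto
  qed (use x in auto)
  from frechet_derivative_at[OF this] have "frechet_derivative \<phi> (at x) = (\<lambda>v. 0)" by simp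
  then show "curl \<phi> x = 0"
    by (simp add: curl_def jacobian_def matrix_def vec_eq_iff forall_3)
qed

text \<open>
  All pairs of fields on the whole space whose restrictions to \<open>\<Omega>\<close> are related by the weak curl; the
  values outside \<open>\<Omega>\<close> are arbitrary. As an intersection of kernels of continuous functionals the graph is
  closed.
\<close>

definition weak_curl_graph :: "(real^3) set \<Rightarrow> ((real^3, real^3) L2 \<times> (real^3, real^3) L2) set" where
  "weak_curl_graph \<Omega> = {(u, F). \<forall>\<phi>\<in>test_functions \<Omega>. fld \<Omega> (curl \<phi>) \<bullet> u = fld \<Omega> \<phi> \<bullet> F}"

lemma closed_weak_curl_graph: "closed (weak_curl_graph \<Omega>)"
proof -
  have "weak_curl_graph \<Omega> = (\<Inter>\<phi>\<in>test_functions \<Omega>. {x. fld \<Omega> (curl \<phi>) \<bullet> fst x = fld \<Omega> \<phi> \<bullet> snd x})"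
    by (auto simp: weak_curl_graph_def)
  also have "closed \<dots>" by (intro closed_INT ballI closed_Collect_eq continuous_intros)
  finally show ?thesis .
qed

lemma subspace_weak_curl_graph: "subspace (weak_curl_graph \<Omega>)"
  by (rule subspaceI) (auto simp: weak_curl_graph_def zero_prod_def inner_add_right)

context
  fixes \<Omega> :: "(real^3) set"
  assumes \<Omega>: "open \<Omega>"
begin

lemma has_weak_curl_iff:
  "has_weak_curl \<Omega> f F \<longleftrightarrow> f \<in> L2_fields \<Omega> \<and> F \<in> L2_fields \<Omega> \<and> (fld \<Omega> f, fld \<Omega> F) \<in> weak_curl_graph \<Omega>"
  using fld_inner_fld[OF \<Omega>] curl_L2_fields[OF \<Omega>] test_functions_L2_fields[OF \<Omega>]
  unfolding has_weak_curl_def weak_curl_graph_def by (auto simp: inner_commute[of "fld \<Omega> f"] inner_commute[of "fld \<Omega> F"])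

lemma has_weak_curl_rep: "(u, F) \<in> weak_curl_graph \<Omega> \<Longrightarrow> has_weak_curl \<Omega> (rep_L2 u) (rep_L2 F)"
  unfolding has_weak_curl_iff
  by (auto simp: rep_L2_fields[OF \<Omega>] weak_curl_graph_def fld_rep_inner[OF \<Omega>] curl_L2_fields[OF \<Omega>] test_functions_L2_fields[OF \<Omega>])

lemma weak_curl_unique:
  assumes "has_weak_curl \<Omega> f F" "has_weak_curl \<Omega> f F'"
  shows "AE x in lborel. x \<in> \<Omega> \<longrightarrow> F x = F' x"
proof -
  note a = assms[unfolded has_weak_curl_iff]
  have w0: "AE x in lborel. x \<in> \<Omega> \<longrightarrow> rep_L2 (fld \<Omega> F - fld \<Omega> F') x = 0"
  proof (rule AE_zero_if_orthogonal_to_test_functions[OF \<Omega>])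
    fix \<phi> :: "real^3 \<Rightarrow> real^3" assume "\<phi> \<in> test_functions \<Omega>"
    with a show "fld \<Omega> \<phi> \<bullet> (fld \<Omega> F - fld \<Omega> F') = 0" by (auto simp: weak_curl_graph_def inner_diff_right)
  qed
  have L: "F \<in> L2_fields \<Omega>" "F' \<in> L2_fields \<Omega>" using a by auto
  show ?thesis
    using w0 rep_diff_L2[of "fld \<Omega> F" "fld \<Omega> F'"] rep_fld[OF \<Omega> L(1)] rep_fld[OF \<Omega> L(2)] by eventually_elim auto
qed

lemma weak_curl_AE:
  assumes "has_weak_curl \<Omega> f F" shows "AE x in lborel. x \<in> \<Omega> \<longrightarrow> weak_curl \<Omega> f x = F x"
  using assms weak_curl_unique[of f "weak_curl \<Omega> f" F] unfolding weak_curl_def by (metis someI)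

text \<open>
  The condition that defines \<open>V\<^sub>0\<close> is the adjoint relation of the curl on \<open>V\<close>. Elements of the graph
  restrict to elements of \<open>V\<close>, and their chosen curl agrees almost everywhere with the second entry.
\<close>

lemma V0_space_adjoint:
  assumes u: "u \<in> V0_space \<Omega>" and F: "has_weak_curl \<Omega> u F"
  shows "(fld \<Omega> u, fld \<Omega> F) \<in> adjoint_relation (weak_curl_graph \<Omega>)"
  unfolding adjoint_relation_def
proof (safe)
  fix \<psi> S assume \<psi>: "(\<psi>, S) \<in> weak_curl_graph \<Omega>"
  note w = has_weak_curl_rep[OF \<psi>]
  have L: "u \<in> L2_fields \<Omega>" "F \<in> L2_fields \<Omega>" using F by (auto simp: has_weak_curl_def)
  have "rep_L2 \<psi> \<in> V_space \<Omega>" using w by (auto simp: V_space_def)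
  with u have "(\<integral>x. weak_curl \<Omega> u x \<bullet> rep_L2 \<psi> x \<partial>lebesgue_on \<Omega>) = (\<integral>x. u x \<bullet> weak_curl \<Omega> (rep_L2 \<psi>) x \<partial>lebesgue_on \<Omega>)"
    by (simp add: V0_space_def)
  also have "\<dots> = fld \<Omega> u \<bullet> S" by (rule integral_fld_cong[OF \<Omega> L(1) weak_curl_AE[OF w]])
  finally have 1: "(\<integral>x. weak_curl \<Omega> u x \<bullet> rep_L2 \<psi> x \<partial>lebesgue_on \<Omega>) = fld \<Omega> u \<bullet> S" .
  have wc: "weak_curl \<Omega> u \<in> L2_fields \<Omega>"
    using F unfolding weak_curl_def by (metis has_weak_curl_def someI)
  have "(\<integral>x. weak_curl \<Omega> u x \<bullet> rep_L2 \<psi> x \<partial>lebesgue_on \<Omega>) = fld \<Omega> (weak_curl \<Omega> u) \<bullet> \<psi>"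
    by (rule fld_inner[OF \<Omega> wc])
  also have "fld \<Omega> (weak_curl \<Omega> u) = fld \<Omega> F" by (rule fld_cong[OF \<Omega> L(2) weak_curl_AE[OF F]])
  finally show "\<psi> \<bullet> fld \<Omega> F = S \<bullet> fld \<Omega> u" using 1 by (simp add: inner_commute)
qed

end

section \<open>Test fields of the weak formulation\<close>

lemma primitive_continuous:
  fixes f :: "real \<Rightarrow> 'b::euclidean_space"
  assumes f: "integrable lborel f" shows "continuous_on UNIV (primitive f)"
proof (rule continuous_on_sequentiallyI)
  fix u :: "nat \<Rightarrow> real" and t assume u: "u \<longlonglongrightarrow> t"
  have [measurable]: "f \<in> borel_measurable borel" using borel_measurable_integrable[OF f] by simp
  show "(\<lambda>n. primitive f (u n)) \<longlonglongrightarrow> primitive f t"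
    unfolding primitive_def
  proof (rule integral_dominated_convergence[where w="\<lambda>s. norm (f s)"])
    show "integrable lborel (\<lambda>s. norm (f s))" using f by simp
    show "AE s in lborel. norm (indicator {..<u n} s *\<^sub>R f s) \<le> norm (f s)" for n
      by (rule AE_I2) (simp add: indicator_def)
    show "AE s in lborel. (\<lambda>n. indicator {..<u n} s *\<^sub>R f s) \<longlonglongrightarrow> indicator {..<t} s *\<^sub>R f s"
      using AE_lborel_singleton[of t]
    proof eventually_elim
      case (elim s)
      have "eventually (\<lambda>n. indicator {..<u n} s = (indicator {..<t} s :: real)) sequentially"
      proof (cases "s < t")
        case True
        from order_tendstoD(1)[OF u True] show ?thesis by eventually_elim (simp add: True)
      next
        case False
        with elim have "t < s" by simp
        from order_tendstoD(2)[OF u this] show ?thesis by eventually_elim (use False in simp)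
      qed
      then show ?case by (intro tendsto_eventually) (auto elim: eventually_mono)
    qed
  qed measurable
qed

lemma AE_eq_continuous_imp_eq:
  fixes f g :: "real \<Rightarrow> real"
  assumes T: "0 < T" and f: "continuous_on {0..T} f" and g: "continuous_on {0..T} g"
    and ae: "AE t in lborel. t \<in> {0<..<T} \<longrightarrow> f t = g t" and t: "t \<in> {0..T}"
  shows "f t = g t"
proof -
  let ?E = "{t \<in> {0..T}. f t - g t = 0}"
  have cl: "closed ?E" by (rule continuous_closed_preimage_constant[OF continuous_on_diff[OF f g] closed_atLeastAtMost])
  have "open ({0<..<T} - ?E)" using cl by (intro open_Diff) auto
  moreover have "negligible ({0<..<T} - ?E)"
  proof -
    from ae obtain N where N: "{t. \<not> (t \<in> {0<..<T} \<longrightarrow> f t = g t)} \<subseteq> N" "N \<in> null_sets lborel" by (auto simp: eventually_ae_filter)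
    have "{0<..<T} - ?E \<subseteq> N" using N(1) by auto
    moreover have "negligible N" unfolding negligible_iff_null_sets by (rule null_sets_completionI[OF N(2)])
    ultimately show ?thesis by (rule negligible_subset[rotated])
  qed
  ultimately have "{0<..<T} - ?E = {}" using open_not_negligible by blast
  then have "{0<..<T} \<subseteq> ?E" by blast
  then have "closure {0<..<T} \<subseteq> ?E" by (rule closure_minimal[OF _ cl])
  then have "t \<in> ?E" using t T by (auto simp: closure_greaterThanLessThan)
  then show ?thesis by simp
qed

lemma primitive_has_derivative:
  fixes \<zeta> :: "real \<Rightarrow> real"
  assumes c: "continuous_on UNIV \<zeta>" and z: "\<And>t. t < \<alpha> \<Longrightarrow> \<zeta> t = 0"
  shows "(primitive \<zeta> has_real_derivative \<zeta> t) (at t)"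
proof -
  define L where "L = min \<alpha> t - 1"
  have eq: "primitive \<zeta> s = integral {L..s} \<zeta>" for s
  proof -
    have "primitive \<zeta> s = (LINT x:{L..s}|lborel. \<zeta> x)"
      unfolding primitive_def set_lebesgue_integral_def
    proof (rule integral_cong_AE)
      have [measurable]: "\<zeta> \<in> borel_measurable borel" by (rule borel_measurable_continuous_onI[OF c])
      show "(\<lambda>x. indicator {..<s} x *\<^sub>R \<zeta> x) \<in> borel_measurable lborel" "(\<lambda>x. indicator {L..s} x *\<^sub>R \<zeta> x) \<in> borel_measurable lborel"
        by measurable
      show "AE x in lborel. indicator {..<s} x *\<^sub>R \<zeta> x = indicator {L..s} x *\<^sub>R \<zeta> x"
        using AE_lborel_singleton[of s] by eventually_elim (use z in \<open>auto simp: indicator_def L_def\<close>)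
    qed
    also have "\<dots> = integral {L..s} \<zeta>"
      by (intro set_borel_integral_eq_integral borel_integrable_atLeastAtMost' continuous_on_subset[OF c]) simp
    finally show ?thesis .
  qed
  have "((\<lambda>s. integral {L..s} \<zeta>) has_real_derivative \<zeta> t) (at t within {L..t + 1})"
    by (intro integral_has_real_derivative continuous_on_subset[OF c]) (auto simp: L_def)
  moreover have "at t within {L..t + 1} = at t" by (rule at_within_interior) (auto simp: L_def interior_atLeastAtMost_real)
  ultimately show ?thesis using eq[abs_def] by (simp add: fun_eq_iff[symmetric] ext[of "primitive \<zeta>", OF eq])
qed

definition vanishes_off :: "'a::euclidean_space set \<Rightarrow> ('a \<times> real, real^3) L2 \<Rightarrow> bool" where
  "vanishes_off S u \<longleftrightarrow> (AE z in lborel. fst z \<notin> S \<longrightarrow> rep_L2 u z = 0)"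

lemma vanishes_off_diff:
  assumes "vanishes_off S u" "vanishes_off S v" shows "vanishes_off S (u - v)"
  using assms rep_diff_L2[of u v] unfolding vanishes_off_def by eventually_elim auto

lemma vanishes_off_time_mult:
  assumes "bounded_fun \<theta>" "vanishes_off S u" shows "vanishes_off S (time_mult \<theta> u)"
  using assms(2) rep_time_mult[OF assms(1), of u] unfolding vanishes_off_def by eventually_elim simp

lemma vanishes_off_volterra:
  assumes "0 < T" "vanishes_off S u" shows "vanishes_off S (volterra T u)"
  unfolding vanishes_off_def
  using rep_volterra[OF assms(1), of u] AE_prod_fstI[OF AE_prod_fstD[OF assms(2)[unfolded vanishes_off_def]]]
proof eventually_elim
  case (elim z)
  show ?case
  proof
    assume "fst z \<notin> S"
    with elim(2) have "AE y in lborel. rep_L2 u (fst z, y) = 0" by simp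
    then have "primitive (cut T (\<lambda>s. rep_L2 u (fst z, s))) (snd z) = 0"
      unfolding primitive_def by (intro integral_eq_zero_AE) (auto elim: eventually_mono)
    with elim(1) show "rep_L2 (volterra T u) z = 0" by simp
  qed
qed

lemma vanishes_off_embed_integral:
  assumes T: "0 < T" and u: "vanishes_off S u" shows "vanishes_off S (time_embed T (c *\<^sub>R time_integral T u))"
proof -
  have "AE x in lborel. x \<notin> S \<longrightarrow> rep_L2 (c *\<^sub>R time_integral T u) x = 0"
    using rep_scaleR_L2[of c "time_integral T u"] rep_time_integral[OF T, of u] AE_prod_fstD[OF u[unfolded vanishes_off_def]]
  proof eventually_elim
    case (elim x)
    show ?case
    proof
      assume "x \<notin> S"
      with elim(3) have "AE y in lborel. rep_L2 u (x, y) = 0" by simp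
      then have "(\<integral>t. cut T (\<lambda>s. rep_L2 u (x, s)) t \<partial>lborel) = 0"
        by (intro integral_eq_zero_AE) (auto elim: eventually_mono)
      with elim show "rep_L2 (c *\<^sub>R time_integral T u) x = 0" by simp
    qed
  qed
  from rep_time_embed[OF T, of "c *\<^sub>R time_integral T u"] AE_prod_fstI[OF this] show ?thesis
    unfolding vanishes_off_def by eventually_elim simp
qed

lemma bounded_fun_compact_support:
  fixes \<zeta> :: "real \<Rightarrow> real"
  assumes c: "continuous_on UNIV \<zeta>" and z: "\<And>t. t \<notin> {\<alpha>..\<beta>} \<Longrightarrow> \<zeta> t = 0" shows "bounded_fun \<zeta>"
proof -
  have "compact (\<zeta> ` {\<alpha>..\<beta>})" by (rule compact_continuous_image[OF continuous_on_subset[OF c]]) auto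
  then obtain B where B: "\<And>x. x \<in> {\<alpha>..\<beta>} \<Longrightarrow> norm (\<zeta> x) \<le> B" by (meson bounded_iff compact_imp_bounded imageI)
  have "\<bar>\<zeta> t\<bar> \<le> \<bar>B\<bar>" for t using B[of t] z[of t] by (cases "t \<in> {\<alpha>..\<beta>}") auto
  then show ?thesis unfolding bounded_fun_def using borel_measurable_continuous_onI[OF c] by blast
qed

lemma L2_eq_zeroI:
  fixes u :: "('a::euclidean_space, 'b::euclidean_space) L2"
  assumes "AE x in lborel. rep_L2 u x = 0"
  shows "u = 0"
proof (rule L2_eqI)
  show "AE x in lborel. rep_L2 u x = rep_L2 0 x"
    using assms rep_zero_L2[where 'a='a and 'b='b] by eventually_elim simp
qed

lemma time_integral_time_mult_embed:
  assumes T: "0 < T" and \<zeta>: "bounded_fun \<zeta>"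
  shows "time_integral T (time_mult \<zeta> (time_embed T n)) = (\<integral>t. cut T \<zeta> t \<partial>lborel) *\<^sub>R n"
    and "volterra T (time_mult \<zeta> (time_embed T n)) = time_mult (primitive (cut T \<zeta>)) (time_embed T n)"
proof -
  interpret K: bounded_linear "volterra T :: ('a \<times> real, 'b) L2 \<Rightarrow> _" by (rule bounded_linear_volterra[OF T])
  interpret E: bounded_linear "time_embed T :: ('a, 'b) L2 \<Rightarrow> _" by (rule bounded_linear_time_embed[OF T])
  interpret I: bounded_linear "time_integral T :: ('a \<times> real, 'b) L2 \<Rightarrow> _" by (rule bounded_linear_time_integral[OF T])
  interpret m: bounded_linear "time_mult (\<lambda>t. 0 + primitive (cut T \<zeta>) t) :: ('a \<times> real, 'b) L2 \<Rightarrow> _"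
    by (rule bounded_linear_time_mult[OF bounded_fun_primitive[OF \<zeta>]])
  note p = time_mult_product_rule[OF T \<zeta>, where p=0 and y=n and a=0]
  have "primitive (cut T \<zeta>) T = (\<integral>t. cut T \<zeta> t \<partial>lborel)"
    unfolding primitive_def by (intro Bochner_Integration.integral_cong) (auto simp: indicator_def)
  with p show "time_integral T (time_mult \<zeta> (time_embed T n)) = (\<integral>t. cut T \<zeta> t \<partial>lborel) *\<^sub>R n"
    "volterra T (time_mult \<zeta> (time_embed T n)) = time_mult (primitive (cut T \<zeta>)) (time_embed T n)"
    by (simp_all add: K.zero E.zero I.zero m.zero[simplified])
qed

context
  fixes \<Omega> :: "(real^3) set" and T :: real
  assumes \<Omega>: "open \<Omega>" and T: "0 < T"
begin

lemma open_cylinder: "open (cylinder \<Omega> T)"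
  unfolding cylinder_def using \<Omega> by (intro open_Times) auto

lemma indicator_cylinder: "indicator (cylinder \<Omega> T) (x, t) = (indicator \<Omega> x * indicator {0<..<T} t :: real)"
  by (simp add: cylinder_def indicator_times)

lemma slice_fld:
  assumes f: "f \<in> L2_fields (cylinder \<Omega> T)"
  shows "AE t in lborel. (t \<in> {0<..<T} \<longrightarrow> (\<lambda>x. f (x, t)) \<in> L2_fields \<Omega> \<and> slice (fld (cylinder \<Omega> T) f) t = fld \<Omega> (\<lambda>x. f (x, t)))
    \<and> (t \<notin> {0<..<T} \<longrightarrow> slice (fld (cylinder \<Omega> T) f) t = 0)"
  using rep_slice[of "fld (cylinder \<Omega> T) f"] AE_prod_sndD[OF rep_fld[OF open_cylinder f]]
proof eventually_elim
  case (elim t)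
  from elim have ae: "AE x in lborel. rep_L2 (slice (fld (cylinder \<Omega> T) f) t) x = (indicator \<Omega> x * indicator {0<..<T} t) *\<^sub>R f (x, t)"
    by eventually_elim (simp add: indicator_cylinder)
  show ?case
  proof (intro conjI impI)
    assume t: "t \<in> {0<..<T}"
    show "(\<lambda>x. f (x, t)) \<in> L2_fields \<Omega>"
      by (rule L2_fieldsI[OF \<Omega>, of _ "slice (fld (cylinder \<Omega> T) f) t"]) (use ae t in \<open>auto elim: eventually_mono\<close>)
    show "slice (fld (cylinder \<Omega> T) f) t = fld \<Omega> (\<lambda>x. f (x, t))"
      by (rule fld_eqI[OF \<Omega>, symmetric]) (use ae t in \<open>auto elim: eventually_mono\<close>)
  next
    assume t: "t \<notin> {0<..<T}"
    show "slice (fld (cylinder \<Omega> T) f) t = 0"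
      by (rule L2_eq_zeroI) (use ae in eventually_elim, use t in simp)
  qed
qed

lemma vanishes_off_fld: "f \<in> L2_fields (cylinder \<Omega> T) \<Longrightarrow> vanishes_off \<Omega> (fld (cylinder \<Omega> T) f)"
  unfolding vanishes_off_def using rep_fld[OF open_cylinder, of f]
  by (auto elim!: eventually_mono simp: cylinder_def indicator_def split: prod.splits)

text \<open>
  The primitive \<open>\<theta>\<close> of \<open>\<zeta>\<close> has compact support because \<open>\<zeta>\<close> has mean zero. So the product of \<open>\<theta>\<close> with a
  function of \<open>x\<close> is an admissible test function, and its time derivative is the product with \<open>\<zeta>\<close>.
\<close>

lemma weak_time_derivative_orthogonal:
  fixes c :: "real^3" and m :: nat
  assumes wd: "has_weak_time_derivative \<Omega> T \<Phi> D"
    and \<zeta>: "\<And>n. C_k n \<zeta>" "\<And>t. t \<notin> {\<alpha>..\<beta>} \<Longrightarrow> \<zeta> t = 0" "0 < \<alpha>" "\<beta> < T" "(\<integral>t. \<zeta> t \<partial>lborel) = 0"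
    and ab: "cbox a b \<subseteq> \<Omega>"
  defines "N \<equiv> time_embed T (fld \<Omega> (\<lambda>x. box_bump a b m x *\<^sub>R c))"
  shows "(fld (cylinder \<Omega> T) \<Phi> - volterra T (fld (cylinder \<Omega> T) D)) \<bullet> time_mult \<zeta> N = 0"
proof -
  let ?Q = "cylinder \<Omega> T"
  define \<theta> where "\<theta> = primitive \<zeta>"
  have \<zeta>c: "continuous_on UNIV \<zeta>" using \<zeta>(1)[of 0] by simp
  have \<zeta>b: "bounded_fun \<zeta>" by (rule bounded_fun_compact_support[OF \<zeta>c \<zeta>(2)])
  have cut: "cut T \<zeta> = \<zeta>" using \<zeta>(2-4) by (auto simp: fun_eq_iff indicator_def) force+
  have i\<zeta>: "integrable lborel \<zeta>" using integrable_cut_bounded[OF \<zeta>b, of T] by (simp only: cut)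
  have \<theta>D: "(\<theta> has_real_derivative \<zeta> t) (at t)" for t
    unfolding \<theta>_def by (rule primitive_has_derivative[OF \<zeta>c, of \<alpha>]) (use \<zeta>(2) in auto)
  have \<theta>C: "C_k n \<theta>" for n
    by (rule C_k_Suc_imp, rule C_k_derivative[OF \<theta>D \<zeta>(1)])
  have \<theta>0: "\<theta> t = 0" if "t \<notin> {\<alpha>..\<beta>}" for t
  proof (cases "t < \<alpha>")
    case True
    then have "indicator {..<t} s *\<^sub>R \<zeta> s = 0" for s using \<zeta>(2)[of s] by (auto simp: indicator_def)
    then have "\<theta> t = (\<integral>s. 0 \<partial>(lborel :: real measure))"
      unfolding \<theta>_def primitive_def by (intro Bochner_Integration.integral_cong refl)
    then show ?thesis by simp
  next
    case False
    with that have "indicator {..<t} s *\<^sub>R \<zeta> s = \<zeta> s" for s using \<zeta>(2)[of s] by (auto simp: indicator_def)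
    then have "\<theta> t = (\<integral>s. \<zeta> s \<partial>lborel)"
      unfolding \<theta>_def primitive_def by (intro Bochner_Integration.integral_cong refl)
    then show ?thesis using \<zeta>(5) by simp
  qed
  have \<theta>b: "bounded_fun \<theta>"
    by (rule bounded_fun_compact_support[OF _ \<theta>0]) (use \<theta>C[of 0] in simp_all)
  define \<psi> where "\<psi> x = box_bump a b m x *\<^sub>R c" for x
  have \<psi>t: "\<psi> \<in> test_functions \<Omega>" unfolding \<psi>_def[abs_def] by (rule box_bump_test_function[OF ab])
  have \<psi>L: "\<psi> \<in> L2_fields \<Omega>" by (rule test_functions_L2_fields[OF \<Omega> \<psi>t])
  have \<psi>0: "\<psi> x = 0" if "x \<notin> cbox a b" for x
    using that box_subset_cbox[of a b] box_bump_outside[of x a b m] by (auto simp: \<psi>_def)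
  have \<psi>C: "C_k n \<psi>" for n using \<psi>t by (auto simp: test_functions_def)
  define \<phi> where "\<phi> z = \<theta> (snd z) *\<^sub>R \<psi> (fst z)" for z
  have supp: "closure {z. \<phi> z \<noteq> 0} \<subseteq> cbox a b \<times> {\<alpha>..\<beta>}"
    proof (rule closure_minimal)
    show "{z. \<phi> z \<noteq> 0} \<subseteq> cbox a b \<times> {\<alpha>..\<beta>}"
    proof
      fix z assume "z \<in> {z. \<phi> z \<noteq> 0}"
      then have "\<theta> (snd z) \<noteq> 0" "\<psi> (fst z) \<noteq> 0" by (auto simp: \<phi>_def)
      then show "z \<in> cbox a b \<times> {\<alpha>..\<beta>}" using \<psi>0[of "fst z"] \<theta>0[of "snd z"] by (cases z) auto
    qed
  qed (intro closed_Times closed_cbox closed_atLeastAtMost)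
  have \<phi>t: "\<phi> \<in> test_functions ?Q"
    unfolding test_functions_def
  proof (intro CollectI conjI allI)
    show "C_k n \<phi>" for n unfolding \<phi>_def[abs_def]
      by (intro C_k_scaleR C_k_linear[OF bounded_linear_snd] C_k_linear[OF bounded_linear_fst] \<theta>C \<psi>C)
    have "compact (cbox a b \<times> {\<alpha>..\<beta>})" by (intro compact_Times) auto
    then show "compact (closure {z. \<phi> z \<noteq> 0})" using supp compact_Int_closed[OF _ closed_closure] by (metis inf.absorb2)
    show "closure {z. \<phi> z \<noteq> 0} \<subseteq> ?Q" using supp ab \<zeta>(3,4) by (force simp: cylinder_def)
  qed
  have deriv: "frechet_derivative \<phi> (at z) (0, 1) = \<zeta> (snd z) *\<^sub>R \<psi> (fst z)" for z
  proof -
    have d\<theta>: "((\<lambda>z. \<theta> (snd z)) has_derivative (\<lambda>h. \<zeta> (snd z) * snd h)) (at z)"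
      using has_derivative_compose[OF bounded_linear.has_derivative[OF bounded_linear_snd has_derivative_ident] \<theta>D[of "snd z", unfolded has_field_derivative_def]]
      by simp
    have d\<psi>: "((\<lambda>z. \<psi> (fst z)) has_derivative (\<lambda>h. frechet_derivative \<psi> (at (fst z)) (fst h))) (at z)"
      by (rule has_derivative_compose[OF bounded_linear.has_derivative[OF bounded_linear_fst has_derivative_ident] C_k_SucD(1)[OF \<psi>C]])
    have z0: "frechet_derivative \<psi> (at (fst z)) 0 = 0" by (rule linear_0[OF has_derivative_linear[OF C_k_SucD(1)[OF \<psi>C]]])
    have "(\<phi> has_derivative (\<lambda>h. \<theta> (snd z) *\<^sub>R frechet_derivative \<psi> (at (fst z)) (fst h) + (\<zeta> (snd z) * snd h) *\<^sub>R \<psi> (fst z))) (at z)"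
      unfolding \<phi>_def[abs_def] by (rule has_derivative_scaleR[OF d\<theta> d\<psi>])
    from frechet_derivative_at[OF this, symmetric] show ?thesis by (simp add: z0)
  qed
  have fldN: "fld ?Q (\<lambda>z. \<eta> (snd z) *\<^sub>R \<psi> (fst z)) = time_mult \<eta> N \<and> (\<lambda>z. \<eta> (snd z) *\<^sub>R \<psi> (fst z)) \<in> L2_fields ?Q"
    if \<eta>: "bounded_fun \<eta>" for \<eta>
  proof -
    have ae: "AE z in lborel. rep_L2 (time_mult \<eta> N) z = indicator ?Q z *\<^sub>R (\<eta> (snd z) *\<^sub>R \<psi> (fst z))"
      using rep_time_mult[OF \<eta>, of N] rep_time_embed[OF T, of "fld \<Omega> \<psi>"] AE_prod_fstI[OF rep_fld[OF \<Omega> \<psi>L]]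
    proof eventually_elim
      case (elim z)
      have "N = time_embed T (fld \<Omega> \<psi>)" by (simp add: N_def \<psi>_def[abs_def])
      with elim show ?case by (cases z) (simp add: indicator_cylinder mult.commute mult.left_commute)
    qed
    have "(\<lambda>z. \<eta> (snd z) *\<^sub>R \<psi> (fst z)) \<in> L2_fields ?Q"
      by (rule L2_fieldsI[OF open_cylinder, of _ "time_mult \<eta> N"]) (use ae in \<open>auto elim: eventually_mono\<close>)
    with fld_eqI[OF open_cylinder ae] show ?thesis by blast
  qed
  have L: "\<Phi> \<in> L2_fields ?Q" "D \<in> L2_fields ?Q" using wd by (auto simp: has_weak_time_derivative_def)
  have "fld ?Q \<Phi> \<bullet> time_mult \<zeta> N = (\<integral>z. \<Phi> z \<bullet> frechet_derivative \<phi> (at z) (0, 1) \<partial>lebesgue_on ?Q)"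
    using fldN[OF \<zeta>b] fld_inner_fld[OF open_cylinder L(1)] by (simp add: deriv del: inner_scaleR_right)
  also have "\<dots> = - (\<integral>z. D z \<bullet> \<phi> z \<partial>lebesgue_on ?Q)" using wd \<phi>t by (auto simp: has_weak_time_derivative_def)
  also have "\<dots> = - (fld ?Q D \<bullet> time_mult \<theta> N)"
    using fldN[OF \<theta>b] fld_inner_fld[OF open_cylinder L(2)] by (simp add: \<phi>_def[abs_def] del: inner_scaleR_right)
  finally have 1: "fld ?Q \<Phi> \<bullet> time_mult \<zeta> N = - (fld ?Q D \<bullet> time_mult \<theta> N)" .
  interpret E: bounded_linear "time_embed T :: (real^3, real^3) L2 \<Rightarrow> _" by (rule bounded_linear_time_embed[OF T])
  have "volterra_adjoint T (time_mult \<zeta> N) = - time_mult \<theta> N"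
    unfolding volterra_adjoint_def N_def
    by (simp only: time_integral_time_mult_embed[OF T \<zeta>b] cut \<zeta>(5) \<theta>_def scaleR_zero_left E.zero) simp
  then have "volterra T (fld ?Q D) \<bullet> time_mult \<zeta> N = - (fld ?Q D \<bullet> time_mult \<theta> N)"
    by (simp add: volterra_adjoint_inner[OF T])
  with 1 show ?thesis by (simp add: inner_diff_left)
qed

end

lemma normalised_time_bump:
  fixes T :: real
  assumes T: "0 < T"
  shows "\<exists>(\<kappa> :: real \<Rightarrow> real) \<alpha> \<beta>. (\<forall>n. C_k n \<kappa>) \<and> (\<forall>t. t \<notin> {\<alpha>..\<beta>} \<longrightarrow> \<kappa> t = 0) \<and> 0 < \<alpha> \<and> \<beta> < T \<and> (\<integral>t. \<kappa> t \<partial>lborel) = 1"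
proof -
  define \<alpha> \<beta> where "\<alpha> = T / 4" and "\<beta> = T / 2"
  have ab: "0 < \<alpha>" "\<alpha> < \<beta>" "\<beta> < T" using T by (auto simp: \<alpha>_def \<beta>_def)
  have out: "box_bump \<alpha> \<beta> m t = 0" if "t \<notin> {\<alpha><..<\<beta>}" for m t using that by (intro box_bump_outside) (simp add: box_real)
  have "sq_integrable (indicator {0<..<T} :: real \<Rightarrow> real)"
  proof -
    have "(\<lambda>t. (norm (indicator {0<..<T} t :: real))\<^sup>2) = indicator {0<..<T}" by (auto simp: indicator_def fun_eq_iff)
    then show ?thesis unfolding sq_integrable_def using integrable_interval_indicator[of T] by simp
  qed
  from box_bump_integral_tendsto[OF this, of \<alpha> \<beta> 1]
  have "(\<lambda>m. \<integral>t. box_bump \<alpha> \<beta> m t \<partial>lborel) \<longlonglongrightarrow> (\<integral>t. indicator {\<alpha><..<\<beta>} t \<partial>lborel)"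
  proof (rule back_subst[of "\<lambda>x. x"])
    have "box_bump \<alpha> \<beta> m t * ((indicator {0<..<T} t :: real) \<bullet> 1) = box_bump \<alpha> \<beta> m t" for m t
      using out[of t m] ab by (cases "t \<in> {\<alpha><..<\<beta>}") (auto simp: indicator_def inner_real_def)
    moreover have "indicator (box \<alpha> \<beta>) t * ((indicator {0<..<T} t :: real) \<bullet> 1) = (indicator {\<alpha><..<\<beta>} t :: real)" for t
      using ab by (auto simp: indicator_def box_real inner_real_def)
    ultimately show "((\<lambda>m. \<integral>t. box_bump \<alpha> \<beta> m t * ((indicator {0<..<T} t :: real) \<bullet> 1) \<partial>lborel) \<longlonglongrightarrow> (\<integral>t. indicator (box \<alpha> \<beta>) t * ((indicator {0<..<T} t :: real) \<bullet> 1) \<partial>lborel))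
      = ((\<lambda>m. \<integral>t. box_bump \<alpha> \<beta> m t \<partial>lborel) \<longlonglongrightarrow> (\<integral>t. indicator {\<alpha><..<\<beta>} t \<partial>lborel))" by (simp only:)
  qed
  moreover have "(\<integral>t. indicator {\<alpha><..<\<beta>} t \<partial>lborel) = \<beta> - \<alpha>" using ab by simp
  ultimately have "(\<lambda>m. \<integral>t. box_bump \<alpha> \<beta> m t \<partial>lborel) \<longlonglongrightarrow> \<beta> - \<alpha>" by simp
  from order_tendstoD(1)[OF this, of 0] ab obtain m where m: "0 < (\<integral>t. box_bump \<alpha> \<beta> m t \<partial>lborel)"
    by (auto simp: eventually_sequentially)
  define I where "I = (\<integral>t. box_bump \<alpha> \<beta> m t \<partial>lborel)"
  have "C_k n (\<lambda>t. (1 / I) * box_bump \<alpha> \<beta> m t)" for n by (intro C_k_mult C_k_const C_k_box_bump)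
  moreover have "(1 / I) * box_bump \<alpha> \<beta> m t = 0" if "t \<notin> {\<alpha>..\<beta>}" for t using out[of t m] that by auto
  moreover have "(\<integral>t. (1 / I) * box_bump \<alpha> \<beta> m t \<partial>lborel) = 1" using m by (simp add: I_def)
  ultimately show ?thesis using ab by (intro exI[of _ "\<lambda>t. (1 / I) * box_bump \<alpha> \<beta> m t"] exI[of _ \<alpha>] exI[of _ \<beta>]) simp
qed

lemma box_Pair_eq: "box (a, c) (b, d) = box a b \<times> box c d"
  by (force simp: box_def Basis_prod_def)

lemma time_mult_lin:
  assumes "bounded_fun f" "bounded_fun g" "bounded_fun (\<lambda>t. f t - c * g t)"
  shows "time_mult (\<lambda>t. f t - c * g t) u = time_mult f u - c *\<^sub>R time_mult g u"
proof (rule L2_eqI)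
  show "AE z in lborel. rep_L2 (time_mult (\<lambda>t. f t - c * g t) u) z = rep_L2 (time_mult f u - c *\<^sub>R time_mult g u) z"
    using rep_time_mult[OF assms(1), of u] rep_time_mult[OF assms(2), of u] rep_time_mult[OF assms(3), of u]
      rep_diff_L2[of "time_mult f u" "c *\<^sub>R time_mult g u"] rep_scaleR_L2[of c "time_mult g u"]
    by eventually_elim (simp add: scaleR_diff_left)
qed

text \<open>
  A test field is determined by its time derivative and its initial value: with \<open>d = - \<partial>\<^sub>t \<Phi>\<close> it is
  \<open>\<Phi>(t) = \<integral>\<^sub>t\<^sup>T d\<close>. Testing with products shows that \<open>\<Phi> - \<integral>\<^sub>0\<^sup>t \<partial>\<^sub>t \<Phi>\<close> does not depend on
  time; the continuous representative identifies the constant.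
\<close>

lemma test_field_volterra:
  assumes \<Omega>: "open \<Omega>" and T: "0 < T" and wd: "has_weak_time_derivative \<Omega> T \<Phi> D"
    and rep: "continuous_rep \<Omega> T \<Phi> v" and vT: "AE x in lebesgue_on \<Omega>. v T x = 0"
  shows "fld (cylinder \<Omega> T) \<Phi> = volterra_adjoint T (- fld (cylinder \<Omega> T) D)"
    and "time_integral T (- fld (cylinder \<Omega> T) D) = fld \<Omega> (v 0)"
proof -
  let ?Q = "cylinder \<Omega> T"
  define P De where "P = fld ?Q \<Phi>" and "De = fld ?Q D"
  note oQ = open_cylinder[OF \<Omega> T]
  have L: "\<Phi> \<in> L2_fields ?Q" "D \<in> L2_fields ?Q" using wd by (auto simp: has_weak_time_derivative_def)
  obtain \<kappa> :: "real \<Rightarrow> real" and \<alpha>\<^sub>0 \<beta>\<^sub>0 where \<kappa>: "\<And>n. C_k n \<kappa>" "\<And>t. t \<notin> {\<alpha>\<^sub>0..\<beta>\<^sub>0} \<Longrightarrow> \<kappa> t = 0" "0 < \<alpha>\<^sub>0" "\<beta>\<^sub>0 < T" "(\<integral>t. \<kappa> t \<partial>lborel) = 1"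
    using normalised_time_bump[OF T] by blast
  have \<kappa>b: "bounded_fun \<kappa>" by (rule bounded_fun_compact_support[OF _ \<kappa>(2)]) (use \<kappa>(1)[of 0] in simp_all)
  define W where "W = P - volterra T De"
  define a where "a = time_integral T (time_mult \<kappa> W)"
  define U where "U = W - time_embed T a"
  interpret E: bounded_linear "time_embed T :: (real^3, real^3) L2 \<Rightarrow> _" by (rule bounded_linear_time_embed[OF T])
  interpret I: bounded_linear "time_integral T :: (_, real^3) L2 \<Rightarrow> (real^3, real^3) L2" by (rule bounded_linear_time_integral[OF T])
  interpret K: bounded_linear "volterra T :: (_, real^3) L2 \<Rightarrow> ((real^3) \<times> real, real^3) L2" by (rule bounded_linear_volterra[OF T])
  \<comment> \<open>subtracting a multiple of \<open>\<kappa>\<close> makes the time factor mean zero; \<open>a\<close> makes \<open>U\<close> orthogonal to products with \<open>\<kappa>\<close>\<close>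
  have orth: "U \<bullet> time_mult (box_bump \<alpha> \<beta> m) (time_embed T (fld \<Omega> (\<lambda>x. box_bump a0 b0 m x *\<^sub>R c))) = 0"
    if ab: "cbox a0 b0 \<subseteq> \<Omega>" and \<alpha>\<beta>: "0 < \<alpha>" "\<beta> < T" for a0 b0 \<alpha> \<beta> m c
  proof -
    define n where "n = fld \<Omega> (\<lambda>x. box_bump a0 b0 m x *\<^sub>R c)"
    define f where "f = box_bump \<alpha> \<beta> m"
    have f0: "f t = 0" if "t \<notin> {\<alpha>..\<beta>}" for t
      using that unfolding f_def by (intro box_bump_outside) (auto simp: box_real)
    have fC: "C_k n f" for n unfolding f_def by (rule C_k_box_bump)
    have fb: "bounded_fun f" by (rule bounded_fun_compact_support[OF _ f0]) (use fC[of 0] in simp_all)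
    have cut: "cut T f = f" "cut T \<kappa> = \<kappa>" using f0 \<kappa>(2-4) \<alpha>\<beta> by (force simp: fun_eq_iff indicator_def)+
    have int: "integrable lborel f" "integrable lborel \<kappa>"
      using integrable_cut_bounded[OF fb, of T] integrable_cut_bounded[OF \<kappa>b, of T] by (simp_all only: cut)
    define s where "s = (\<integral>t. f t \<partial>lborel)"
    define \<zeta> where "\<zeta> t = f t - s * \<kappa> t" for t
    have \<zeta>C: "C_k n \<zeta>" for n
      using C_k_add[OF fC C_k_mult[OF C_k_const \<kappa>(1)], of n "- s"] by (simp add: \<zeta>_def[abs_def])
    have \<zeta>0: "\<zeta> t = 0" if "t \<notin> {min \<alpha> \<alpha>\<^sub>0..max \<beta> \<beta>\<^sub>0}" for t
    proof -
      have "t \<notin> {\<alpha>..\<beta>}" "t \<notin> {\<alpha>\<^sub>0..\<beta>\<^sub>0}" using that by auto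
      then show ?thesis using f0[of t] \<kappa>(2)[of t] by (simp add: \<zeta>_def)
    qed
    have \<zeta>b: "bounded_fun (\<lambda>t. f t - s * \<kappa> t)"
      by (rule bounded_fun_compact_support[OF _ \<zeta>0[unfolded \<zeta>_def]]) (use \<zeta>C[of 0] in \<open>simp_all add: \<zeta>_def[abs_def]\<close>)
    have "(\<integral>t. \<zeta> t \<partial>lborel) = 0" using int \<kappa>(5) by (simp add: \<zeta>_def s_def)
    from weak_time_derivative_orthogonal[OF \<Omega> T wd \<zeta>C \<zeta>0 _ _ this ab, where m=m and c=c]
    have "W \<bullet> time_mult \<zeta> (time_embed T n) = 0" using \<alpha>\<beta> \<kappa>(3,4) by (simp add: W_def P_def De_def n_def)
    then have 1: "W \<bullet> time_mult f (time_embed T n) = s * (W \<bullet> time_mult \<kappa> (time_embed T n))"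
      by (simp add: \<zeta>_def[abs_def] time_mult_lin[OF fb \<kappa>b \<zeta>b] inner_diff_right)
    have "time_embed T a \<bullet> time_mult f (time_embed T n) = s * (a \<bullet> n)"
      by (simp only: time_embed_adjoint[OF T] time_integral_time_mult_embed[OF T fb] cut s_def inner_scaleR_right)
    also have "a \<bullet> n = time_embed T n \<bullet> time_mult \<kappa> W"
      unfolding a_def by (simp add: time_embed_adjoint[OF T] inner_commute)
    also have "\<dots> = W \<bullet> time_mult \<kappa> (time_embed T n)"
      using time_mult_sym[OF \<kappa>b, of "time_embed T n" W] by (simp add: inner_commute)
    finally show ?thesis using 1 by (simp add: U_def inner_diff_left f_def n_def)
  qed
  have onQ: "AE z in lborel. z \<in> ?Q \<longrightarrow> rep_L2 U z = 0"
  proof (rule AE_zero_on_open_if_box_integrals_zero[OF rep_sq_integrable oQ])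
    fix A B :: "(real^3) \<times> real" and c :: "real^3" assume AB: "cbox A B \<subseteq> ?Q"
    obtain a0 \<alpha> b0 \<beta> where A: "A = (a0, \<alpha>)" "B = (b0, \<beta>)" by (cases A, cases B) auto
    \<comment> \<open>approximate the indicator function of a box by a product of smooth bumps\<close>
    have bp: "box A B = box a0 b0 \<times> {\<alpha><..<\<beta>}" unfolding A by (simp add: box_Pair_eq box_real)
    have cp: "cbox A B = cbox a0 b0 \<times> {\<alpha>..\<beta>}" by (simp only: A cbox_Pair_eq box_real)
    show "(\<integral>z. indicator (box A B) z * (rep_L2 U z \<bullet> c) \<partial>lborel) = 0"
    proof (cases "box A B = {}")
      case False
      then obtain z where "z \<in> box a0 b0 \<times> {\<alpha><..<\<beta>}" using bp by blast
      then obtain x t where xt: "x \<in> box a0 b0" "t \<in> {\<alpha><..<\<beta>}" by blast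
      then have ne: "x \<in> cbox a0 b0" "\<alpha> \<le> \<beta>" using box_subset_cbox by auto
      have c1: "cbox a0 b0 \<subseteq> \<Omega>"
      proof
        fix y assume "y \<in> cbox a0 b0"
        then have "(y, \<alpha>) \<in> cbox A B" using ne cp by simp
        then show "y \<in> \<Omega>" using AB by (auto simp: cylinder_def)
      qed
      have "(x, \<alpha>) \<in> cbox A B" "(x, \<beta>) \<in> cbox A B" using ne cp by auto
      then have c2: "0 < \<alpha>" "\<beta> < T" using AB by (auto simp: cylinder_def)
      define p where "p m z = box_bump \<alpha> \<beta> m (snd z) * box_bump a0 b0 m (fst z)" for m z
      have [measurable]: "box_bump \<alpha> \<beta> m \<in> borel_measurable borel" "box_bump a0 b0 m \<in> borel_measurable borel" for m
        by (rule borel_measurable_continuous_onI[OF C_k_continuous[OF C_k_box_bump[of 0]]])+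
      have p_out: "p m z = 0" if "z \<notin> box A B" for m z
        using that bp box_bump_outside[of "snd z" \<alpha> \<beta> m] box_bump_outside[of "fst z" a0 b0 m]
        by (cases z) (auto simp: p_def box_real)
      have zero: "(\<integral>z. p m z * (rep_L2 U z \<bullet> c) \<partial>lborel) = 0" for m
      proof -
        let ?\<psi> = "\<lambda>x. box_bump a0 b0 m x *\<^sub>R c"
        have fb: "bounded_fun (box_bump \<alpha> \<beta> m)"
          unfolding bounded_fun_def using box_bump_bounds[of \<alpha> \<beta> m] by (auto intro!: exI[of _ 1])
        note \<psi>L = test_functions_L2_fields[OF \<Omega> box_bump_test_function[OF c1, of m c]]
        have ae: "AE z in lborel. rep_L2 U z \<bullet> rep_L2 (time_mult (box_bump \<alpha> \<beta> m) (time_embed T (fld \<Omega> ?\<psi>))) z = p m z * (rep_L2 U z \<bullet> c)"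
          using rep_time_mult[OF fb, of "time_embed T (fld \<Omega> ?\<psi>)"] rep_time_embed[OF T, of "fld \<Omega> ?\<psi>"] AE_prod_fstI[OF rep_fld[OF \<Omega> \<psi>L]]
        proof eventually_elim
          case (elim z)
          show ?case
          proof (cases "z \<in> box A B")
            case True
            then have "fst z \<in> cbox a0 b0" "snd z \<in> {\<alpha><..<\<beta>}" using bp box_subset_cbox by (auto simp: mem_Times_iff)
            then have "fst z \<in> \<Omega>" "snd z \<in> {0<..<T}" using c1 c2 by auto
            with elim show ?thesis by (simp add: p_def)
          next
            case False
            with p_out[OF False, of m] elim show ?thesis by (auto simp: p_def)
          qed
        qed
        have "(\<integral>z. p m z * (rep_L2 U z \<bullet> c) \<partial>lborel) = U \<bullet> time_mult (box_bump \<alpha> \<beta> m) (time_embed T (fld \<Omega> ?\<psi>))"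
          unfolding inner_L2 by (rule integral_cong_AE[symmetric]) (use ae in \<open>auto simp: p_def\<close>)
        then show ?thesis by (simp only: orth[OF c1 c2])
      qed
      have "(\<lambda>m. \<integral>z. p m z * (rep_L2 U z \<bullet> c) \<partial>lborel) \<longlonglongrightarrow> (\<integral>z. indicator (box A B) z * (rep_L2 U z \<bullet> c) \<partial>lborel)"
      proof (rule integral_dominated_convergence[where w="\<lambda>z. \<bar>indicator (box A B) z * (rep_L2 U z \<bullet> c)\<bar>"])
        show "integrable lborel (\<lambda>z. \<bar>indicator (box A B) z * (rep_L2 U z \<bullet> c)\<bar>)"
          by (intro integrable_abs integrable_indicator_inner rep_sq_integrable) auto
        show "AE z in lborel. (\<lambda>m. p m z * (rep_L2 U z \<bullet> c)) \<longlonglongrightarrow> indicator (box A B) z * (rep_L2 U z \<bullet> c)"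
        proof (intro AE_I2 tendsto_mult tendsto_const)
          fix z :: "(real^3) \<times> real"
          have "(\<lambda>m. p m z) \<longlonglongrightarrow> indicator (box \<alpha> \<beta>) (snd z) * indicator (box a0 b0) (fst z)"
            unfolding p_def by (intro tendsto_mult box_bump_tendsto)
          also have "indicator (box \<alpha> \<beta>) (snd z) * indicator (box a0 b0) (fst z) = (indicator (box A B) z :: real)"
            unfolding bp by (cases z) (auto simp: indicator_def box_real)
          finally show "(\<lambda>m. p m z) \<longlonglongrightarrow> indicator (box A B) z" .
        qed
        show "AE z in lborel. norm (p m z * (rep_L2 U z \<bullet> c)) \<le> \<bar>indicator (box A B) z * (rep_L2 U z \<bullet> c)\<bar>" for m
        proof (rule AE_I2)
          fix z
          have "\<bar>p m z\<bar> \<le> 1" using box_bump_bounds[of \<alpha> \<beta> m "snd z"] box_bump_bounds[of a0 b0 m "fst z"]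
            by (simp add: p_def abs_mult mult_le_one)
          then show "norm (p m z * (rep_L2 U z \<bullet> c)) \<le> \<bar>indicator (box A B) z * (rep_L2 U z \<bullet> c)\<bar>"
            using p_out[of z m] by (cases "z \<in> box A B") (auto simp: abs_mult intro: mult_left_le_one_le)
        qed
      qed (auto simp: p_def)
      then show ?thesis by (simp add: zero LIMSEQ_const_iff)
    qed simp
  qed
  have "vanishes_off \<Omega> U"
  proof -
    have "vanishes_off \<Omega> W" unfolding W_def P_def De_def
      by (intro vanishes_off_diff vanishes_off_volterra T vanishes_off_fld[OF \<Omega> T] L)
    then show ?thesis unfolding U_def a_def
      using vanishes_off_embed_integral[OF T vanishes_off_time_mult[OF \<kappa>b], of \<Omega> W 1] by (intro vanishes_off_diff) simp_all
  qed
  moreover have "AE z in lborel. snd z \<notin> {0<..<T} \<longrightarrow> rep_L2 U z = 0"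
    using rep_diff_L2[of W "time_embed T a"] rep_diff_L2[of P "volterra T De"] rep_time_embed[OF T, of a] rep_volterra[OF T, of De]
      rep_fld[OF oQ L(1)]
  proof eventually_elim
    case (elim z)
    show ?case
    proof
      assume "snd z \<notin> {0<..<T}"
      then have "indicator {0<..<T} (snd z) = (0::real)" "indicator ?Q z = (0::real)" by (cases z; auto simp: cylinder_def)+
      with elim show "rep_L2 U z = 0" by (simp add: U_def W_def P_def)
    qed
  qed
  ultimately have "AE z in lborel. rep_L2 U z = 0"
    using onQ unfolding vanishes_off_def
  proof eventually_elim
    case (elim z) then show ?case by (cases z) (auto simp: cylinder_def)
  qed
  then have "U = 0" by (rule L2_eq_zeroI)
  then have P: "P = time_embed T a + volterra T De" by (simp add: U_def W_def algebra_simps)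
  \<comment> \<open>compare with the continuous representative\<close>
  have vL: "v t \<in> L2_fields \<Omega>" if "t \<in> {0..T}" for t using rep that by (simp add: continuous_rep_def)
  have main: "fld \<Omega> (v t) \<bullet> n = a \<bullet> n + primitive (slice_inner De (time_embed T n)) t" if t: "t \<in> {0..T}" for t n
  proof (rule AE_eq_continuous_imp_eq[OF T _ _ _ t])
    show "continuous_on {0..T} (\<lambda>t. fld \<Omega> (v t) \<bullet> n)"
    proof (rule continuous_on_inner[OF _ continuous_on_const])
      show "continuous_on {0..T} (\<lambda>t. fld \<Omega> (v t))"
        unfolding continuous_on_def
      proof
        fix t assume t: "t \<in> {0..T}"
        have "((\<lambda>s. L2_norm \<Omega> (\<lambda>x. v s x - v t x)) \<longlongrightarrow> 0) (at t within {0..T})"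
          using rep t by (simp add: continuous_rep_def)
        moreover have "\<forall>\<^sub>F s in at t within {0..T}. L2_norm \<Omega> (\<lambda>x. v s x - v t x) = norm (fld \<Omega> (v s) - fld \<Omega> (v t))"
          unfolding eventually_at_filter
          proof (intro always_eventually allI impI)
            fix s assume "s \<in> {0..T}"
            note D = L2_fields_diff[OF \<Omega> vL[OF this] vL[OF t]]
            show "L2_norm \<Omega> (\<lambda>x. v s x - v t x) = norm (fld \<Omega> (v s) - fld \<Omega> (v t))"
              by (simp only: L2_norm_fld[OF \<Omega> D(1)] D(2))
          qed
        ultimately have "((\<lambda>s. norm (fld \<Omega> (v s) - fld \<Omega> (v t))) \<longlongrightarrow> 0) (at t within {0..T})"
          by (rule Lim_transform_eventually)
        then show "((\<lambda>s. fld \<Omega> (v s)) \<longlongrightarrow> fld \<Omega> (v t)) (at t within {0..T})"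
          by (rule LIM_zero_cancel[OF tendsto_norm_zero_cancel])
      qed
    qed
    show "continuous_on {0..T} (\<lambda>t. a \<bullet> n + primitive (slice_inner De (time_embed T n)) t)"
      by (intro continuous_intros continuous_on_subset[OF primitive_continuous[OF integrable_slice_inner]]) auto
    have "AE t in lborel. t \<in> {0<..<T} \<longrightarrow> (AE x in lborel. x \<in> \<Omega> \<longrightarrow> \<Phi> (x, t) = v t x)"
      using rep AE_lebesgue_on_iff[of "{0<..<T}"] AE_lebesgue_on_iff[OF \<Omega>] by (simp add: continuous_rep_def)
    then show "AE t in lborel. t \<in> {0<..<T} \<longrightarrow> fld \<Omega> (v t) \<bullet> n = a \<bullet> n + primitive (slice_inner De (time_embed T n)) t"
      using slice_fld[OF \<Omega> T L(1)] slice_add[of "time_embed T a" "volterra T De"] slice_embed[OF T, of a] slice_volterra_inner[OF T, of De]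
    proof eventually_elim
      case (elim t)
      show ?case
      proof
        assume t: "t \<in> {0<..<T}"
        then have "fld \<Omega> (\<lambda>x. \<Phi> (x, t)) = fld \<Omega> (v t)" using elim(1) by (intro fld_cong[OF \<Omega> vL]) auto
        then have "fld \<Omega> (v t) = a + slice (volterra T De) t" using elim t by (simp add: P[unfolded P_def])
        then show "fld \<Omega> (v t) \<bullet> n = a \<bullet> n + primitive (slice_inner De (time_embed T n)) t"
          using elim(5) t by (simp add: inner_add_left)
      qed
    qed
  qed
  have off: "AE t in lborel. t \<notin> {0<..<T} \<longrightarrow> slice_inner De (time_embed T n) t = 0" for n
    using slice_inner_eq[of De "time_embed T n"] slice_embed[OF T, of n] by eventually_elim simp
  have "primitive (slice_inner De (time_embed T n)) 0 = 0" for n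
    unfolding primitive_def by (rule integral_eq_zero_AE) (use off[of n] in \<open>eventually_elim, auto simp: indicator_def\<close>)
  then have v0: "fld \<Omega> (v 0) \<bullet> n = a \<bullet> n" for n using main[of 0 n] T by simp
  then have v0: "fld \<Omega> (v 0) = a" using vector_eq_rdot by blast
  have pT: "primitive (slice_inner De (time_embed T n)) T = time_integral T De \<bullet> n" for n
  proof -
    have "primitive (slice_inner De (time_embed T n)) T = (\<integral>t. slice_inner De (time_embed T n) t \<partial>lborel)"
      unfolding primitive_def
    proof (rule integral_cong_AE)
      show "AE t in lborel. indicator {..<T} t *\<^sub>R slice_inner De (time_embed T n) t = slice_inner De (time_embed T n) t"
        using off[of n] by eventually_elim (auto simp: indicator_def)
    qed (use borel_measurable_integrable[OF integrable_slice_inner[of De "time_embed T n"]] in auto)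
    also have "\<dots> = De \<bullet> time_embed T n" by (rule integral_slice_inner)
    also have "\<dots> = time_integral T De \<bullet> n" using time_embed_adjoint[OF T, of n De] by (simp add: inner_commute)
    finally show ?thesis .
  qed
  have "fld \<Omega> (v T) = 0"
  proof (rule L2_eq_zeroI)
    show "AE x in lborel. rep_L2 (fld \<Omega> (v T)) x = 0"
      using rep_fld[OF \<Omega> vL[of T]] vT[unfolded AE_lebesgue_on_iff[OF \<Omega>]] T by (auto elim!: eventually_elim2 simp: indicator_def)
  qed
  then have "(a + time_integral T De) \<bullet> n = 0" for n using main[of T n] T by (simp add: pT inner_add_left)
  then have "a + time_integral T De = 0" using inner_eq_zero_iff by blast
  then have aT: "a = - time_integral T De" by (simp add: eq_neg_iff_add_eq_0)
  show "time_integral T (- fld ?Q D) = fld \<Omega> (v 0)" unfolding v0 De_def[symmetric] by (simp add: aT I.neg)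
  show "fld ?Q \<Phi> = volterra_adjoint T (- fld ?Q D)"
    unfolding P_def[symmetric] De_def[symmetric] P volterra_adjoint_def by (simp add: I.neg K.neg E.neg aT)
qed

section \<open>Data of the Maxwell problem as Borel coefficients\<close>

lemma matrix_vector_bounded_bilinear: "bounded_bilinear (\<lambda>(B :: real^3^3) \<xi>. B *v \<xi>)"
proof -
  have "bilinear (\<lambda>(B :: real^3^3) \<xi>. B *v \<xi>)"
    unfolding bilinear_def
    by (auto intro!: linearI simp: matrix_vector_mult_add_rdistrib matrix_vector_right_distrib
        matrix_vector_mult_scaleR scaleR_matrix_vector_assoc)
  then show ?thesis by (simp add: bilinear_conv_bounded_bilinear)
qed

lemma norm_matrix_le:
  fixes B :: "real^3^3"
  assumes "\<And>i k. \<bar>B $ i $ k\<bar> \<le> c"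
  shows "norm B \<le> 9 * c"
proof -
  have row: "norm (B $ i) \<le> 3 * c" for i
  proof -
    have "norm (B $ i) \<le> (\<Sum>k\<in>UNIV. \<bar>B $ i $ k\<bar>)" by (rule norm_le_l1_cart)
    also have "\<dots> \<le> (\<Sum>k\<in>(UNIV :: 3 set). c)" by (intro sum_mono assms)
    finally show ?thesis by simp
  qed
  have "norm B \<le> (\<Sum>i\<in>UNIV. norm (B $ i))" unfolding norm_vec_def by (rule L2_set_le_sum) simp
  also have "\<dots> \<le> (\<Sum>i\<in>(UNIV :: 3 set). 3 * c)" by (intro sum_mono row)
  finally show ?thesis by simp
qed

text \<open>
  The symmetric matrices with bounded norm that satisfy the lower bound form a closed set. Hence a
  Borel version of the matrix field can be replaced by a multiple of the identity wherever it
  violates these conditions, which happens outside \<open>\<Omega>\<close> and on a null set only.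
\<close>

lemma material_matrix_multiplier:
  assumes \<Omega>: "open \<Omega>" and m: "0 < m" and A: "material_matrix \<Omega> m A"
  shows "\<exists>A'. multiplier A' m \<and> (AE x in lborel. x \<in> \<Omega> \<longrightarrow> (\<forall>\<xi>. A' x \<xi> = A x *v \<xi>))"
proof -
  interpret B: bounded_bilinear "\<lambda>(B :: real^3^3) \<xi>. B *v \<xi>" by (rule matrix_vector_bounded_bilinear)
  obtain M where M: "\<And>x i k. x \<in> \<Omega> \<Longrightarrow> \<bar>A x $ i $ k\<bar> \<le> M"
    using A unfolding material_matrix_def by blast
  have "A \<in> borel_measurable (lebesgue_on \<Omega>)"
    unfolding borel_measurable_euclidean_space[of A]
  proof
    fix b :: "real^3^3" assume "b \<in> Basis"
    then obtain i k where b: "b = axis i (axis k 1)" by (auto simp: Basis_vec_def)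
    have "(\<lambda>x. A x $ i $ k) \<in> borel_measurable (lebesgue_on \<Omega>)" using A by (simp add: material_matrix_def)
    then show "(\<lambda>x. A x \<bullet> b) \<in> borel_measurable (lebesgue_on \<Omega>)" by (simp add: b inner_axis)
  qed
  then have "(\<lambda>x. if x \<in> \<Omega> then A x else 0) \<in> borel_measurable lebesgue"
    using \<Omega> by (subst borel_measurable_if) auto
  from borel_version[OF this] obtain g where g[measurable]: "g \<in> borel_measurable borel"
    and gA: "AE x in lborel. (if x \<in> \<Omega> then A x else 0) = g x" by blast
  define C where "C = {B :: real^3^3. transpose B = B \<and> norm B \<le> 9 * M \<and> (\<forall>\<xi>. m * (norm \<xi>)\<^sup>2 \<le> (B *v \<xi>) \<bullet> \<xi>)}"
  have "linear (transpose :: real^3^3 \<Rightarrow> real^3^3)"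
    by (rule linearI) (simp_all add: transpose_def vec_eq_iff)
  then have ct: "continuous_on UNIV (transpose :: real^3^3 \<Rightarrow> real^3^3)"
    by (simp add: linear_continuous_on linear_conv_bounded_linear)
  have cv: "continuous_on UNIV (\<lambda>B :: real^3^3. B *v \<xi>)" for \<xi>
    by (intro B.continuous_on continuous_intros)
  have "C = {B. transpose B = B} \<inter> {B. norm B \<le> 9 * M} \<inter> (\<Inter>\<xi>. {B. m * (norm \<xi>)\<^sup>2 \<le> (B *v \<xi>) \<bullet> \<xi>})"
    by (auto simp: C_def)
  also have "closed \<dots>"
    by (intro closed_Int closed_INT ballI closed_Collect_eq closed_Collect_le continuous_intros ct cv)
  finally have [measurable]: "C \<in> sets borel" by (rule borel_closed)
  define A' where "A' x \<xi> = (if g x \<in> C then g x *v \<xi> else m *\<^sub>R \<xi>)" for x \<xi>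
  have "AE x in lborel. x \<in> \<Omega> \<longrightarrow> (\<forall>\<xi>. A' x \<xi> = A x *v \<xi>)"
    using gA
  proof eventually_elim
    case (elim x)
    show ?case
    proof
      assume x: "x \<in> \<Omega>"
      then have "g x = A x" using elim by simp
      moreover have "A x \<in> C" using A x norm_matrix_le[OF M[OF x]] by (simp add: C_def material_matrix_def)
      ultimately show "\<forall>\<xi>. A' x \<xi> = A x *v \<xi>" by (simp add: A'_def)
    qed
  qed
  moreover have "multiplier A' m"
    unfolding multiplier_def
  proof (intro conjI allI)
    show "linear (A' x)" for x
      by (cases "g x \<in> C") (auto intro!: linearI simp: A'_def B.add_right B.scaleR_right algebra_simps)
    obtain K where K: "0 < K" "\<And>B \<xi>. norm (B *v \<xi>) \<le> norm (B :: real^3^3) * norm \<xi> * K" using B.pos_bounded by blast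
    have "norm (A' x \<xi>) \<le> (9 * \<bar>M\<bar> * K + m) * norm \<xi>" for x \<xi>
    proof (cases "g x \<in> C")
      case True
      then have "norm (A' x \<xi>) \<le> norm (g x) * norm \<xi> * K" by (simp add: A'_def K(2))
      also have "\<dots> \<le> (9 * \<bar>M\<bar>) * norm \<xi> * K"
        using True K(1) by (intro mult_right_mono) (auto simp: C_def)
      also have "\<dots> \<le> (9 * \<bar>M\<bar> * K + m) * norm \<xi>" using m by (simp add: algebra_simps)
      finally show ?thesis .
    next
      case False
      have "0 \<le> 9 * \<bar>M\<bar> * K * norm \<xi>" using K(1) by simp
      then show ?thesis using False m by (simp add: A'_def algebra_simps)
    qed
    then show "\<exists>C. \<forall>x \<xi>. norm (A' x \<xi>) \<le> C * norm \<xi>" by blast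
    have "continuous_on UNIV (\<lambda>z :: (real^3^3) \<times> (real^3). fst z *v snd z)"
      by (intro B.continuous_on continuous_intros)
    then have [measurable]: "(\<lambda>z. g (fst z) *v snd z) \<in> borel_measurable borel"
      using borel_measurable_continuous_Pair[where H="\<lambda>B \<xi>. B *v \<xi>", OF measurable_compose[OF fst_borel_measurable g] snd_borel_measurable]
      by simp
    show "(\<lambda>z. A' (fst z) (snd z)) \<in> borel_measurable borel"
      unfolding A'_def using measurable_compose[OF fst_borel_measurable g] by measurable
    show "A' x \<xi> \<bullet> \<eta> = \<xi> \<bullet> A' x \<eta>" for x \<xi> \<eta>
    proof (cases "g x \<in> C")
      case True
      then have "transpose (g x) = g x" by (simp add: C_def)
      then have "g x *v \<xi> = \<xi> v* g x" by (metis transpose_matrix_vector)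
      then have "(g x *v \<xi>) \<bullet> \<eta> = \<xi> \<bullet> (g x *v \<eta>)" by (simp add: dot_lmul_matrix)
      then show ?thesis using True by (simp add: A'_def)
    qed (simp add: A'_def)
    show "m * (norm \<xi>)\<^sup>2 \<le> A' x \<xi> \<bullet> \<xi>" for x \<xi>
      by (auto simp: A'_def C_def power2_norm_eq_inner)
  qed (rule m)
  ultimately show ?thesis by blast
qed

text \<open>
  Only the values of the nonlinearity on \<open>Q\<close> and away from a null set matter; there its monotonicity
  is that of \<open>j\<close>, because \<open>j\<^sub>0\<close> cancels in differences.
\<close>

lemma caratheodory_monotone_field:
  assumes Q: "open Q" and c: "0 < c" and f: "caratheodory Q f"
    and le: "\<And>z \<xi>. z \<in> Q \<Longrightarrow> norm (f z \<xi>) \<le> c * norm \<xi>"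
    and mono: "\<And>z \<xi> \<eta>. z \<in> Q \<Longrightarrow> 0 \<le> (f z \<xi> - f z \<eta>) \<bullet> (\<xi> - \<eta>)"
  shows "\<exists>f'. monotone_field f' c \<and> (AE z in lborel. z \<in> Q \<longrightarrow> f' z = f z)"
proof -
  define f1 where "f1 z \<xi> = (if z \<in> Q \<and> continuous_on UNIV (f z) then f z \<xi> else 0)" for z \<xi>
  have ae: "AE z in lborel. z \<in> Q \<longrightarrow> continuous_on UNIV (f z)"
    using f AE_lebesgue_on_iff[OF Q] by (simp add: caratheodory_def)
  have cont: "continuous_on UNIV (f1 z)" for z
    by (cases "z \<in> Q \<and> continuous_on UNIV (f z)") (auto simp: f1_def[abs_def])
  have meas: "(\<lambda>z. f1 z \<xi>) \<in> borel_measurable lebesgue" for \<xi>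
  proof -
    have "(\<lambda>z. if z \<in> Q then f z \<xi> else 0) \<in> borel_measurable lebesgue"
      using f Q by (subst borel_measurable_if) (auto simp: caratheodory_def)
    from borel_version[OF this] obtain g where g: "g \<in> borel_measurable borel"
      "AE z in lborel. (if z \<in> Q then f z \<xi> else 0) = g z" by blast
    show ?thesis
    proof (rule lebesgue_measurable_AE_cong[OF g(1)])
      show "AE z in lborel. f1 z \<xi> = g z" using g(2) ae by eventually_elim (auto simp: f1_def)
    qed
  qed
  obtain N where N: "N \<in> null_sets lborel" "\<And>\<xi>. (\<lambda>z. if z \<in> N then 0 else f1 z \<xi>) \<in> borel_measurable borel"
    using caratheodory_borel_version[of f1, OF meas cont] by blast
  define f' where "f' z \<xi> = (if z \<in> N then 0 else f1 z \<xi>)" for z \<xi>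
  have "monotone_field f' c"
    unfolding monotone_field_def
  proof (intro conjI allI)
    show "(\<lambda>z. f' z \<xi>) \<in> borel_measurable borel" for \<xi> unfolding f'_def by (rule N(2))
    show "continuous_on UNIV (f' z)" for z using cont[of z] by (cases "z \<in> N") (simp_all add: f'_def[abs_def])
    show "norm (f' z \<xi>) \<le> c * norm \<xi>" for z \<xi> using le[of z \<xi>] c by (auto simp: f'_def f1_def)
    show "0 \<le> (f' z \<xi> - f' z \<eta>) \<bullet> (\<xi> - \<eta>)" for z \<xi> \<eta> using mono[of z \<xi> \<eta>] by (auto simp: f'_def f1_def)
  qed (rule c)
  moreover have "AE z in lborel. z \<in> Q \<longrightarrow> f' z = f z"
    using ae AE_not_in[OF N(1)] by eventually_elim (auto simp: f'_def f1_def fun_eq_iff)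
  ultimately show ?thesis by blast
qed

section \<open>Existence and energy estimate for the Maxwell system\<close>

lemma bounded_fun_const [simp]: "bounded_fun (\<lambda>_. c)"
  by (auto simp: bounded_fun_def)

lemma time_mult_const: "time_mult (\<lambda>_. c) u = c *\<^sub>R u"
proof (rule L2_eqI)
  show "AE z in lborel. rep_L2 (time_mult (\<lambda>_. c) u) z = rep_L2 (c *\<^sub>R u) z"
    using rep_time_mult[OF bounded_fun_const, of c u] rep_scaleR_L2[of c u] by eventually_elim simp
qed

lemma cut_integral_const: "0 < T \<Longrightarrow> (\<integral>t. cut T (\<lambda>_. c) t \<partial>lborel) = T * (c :: real)"
  by simp

lemma primitive_final: "primitive (cut T \<theta>) T = (\<integral>t. cut T \<theta> t \<partial>lborel)"
  unfolding primitive_def by (rule Bochner_Integration.integral_cong) (auto simp: indicator_def)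

lemma primitive_bounds:
  assumes \<theta>: "bounded_fun \<theta>" "\<And>t. 0 \<le> \<theta> t"
  shows "0 \<le> primitive (cut T \<theta>) t" "primitive (cut T \<theta>) t \<le> (\<integral>s. cut T \<theta> s \<partial>lborel)"
proof -
  show "0 \<le> primitive (cut T \<theta>) t"
    unfolding primitive_def by (rule integral_nonneg_AE) (simp add: \<theta>(2))
  have "primitive (cut T \<theta>) t \<le> norm (primitive (cut T \<theta>) t)" by simp
  also have "\<dots> \<le> (\<integral>s. norm (cut T \<theta> s) \<partial>lborel)" by (rule norm_primitive_le[OF integrable_cut_bounded[OF \<theta>(1)]])
  also have "\<dots> = (\<integral>s. cut T \<theta> s \<partial>lborel)" using \<theta>(2) by (simp add: abs_mult)
  finally show "primitive (cut T \<theta>) t \<le> (\<integral>s. cut T \<theta> s \<partial>lborel)" .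
qed

lemma primitive_cut_uminus: "primitive (cut T (\<lambda>t. - \<theta> t)) s = - primitive (cut T \<theta>) s"
  unfolding primitive_def by simp

lemma norm_time_mult_le:
  assumes \<theta>: "bounded_fun \<theta>" "\<And>t. \<bar>\<theta> t\<bar> \<le> c"
  shows "norm (time_mult \<theta> u) \<le> c * norm u"
proof (rule norm_L2_le)
  show "integrable lborel (\<lambda>z. c\<^sup>2 * (norm (rep_L2 u z))\<^sup>2)" using integrable_rep_norm[of u] by simp
  show "AE z in lborel. (norm (rep_L2 (time_mult \<theta> u) z))\<^sup>2 \<le> c\<^sup>2 * (norm (rep_L2 u z))\<^sup>2"
    using rep_time_mult[OF \<theta>(1), of u]
  proof eventually_elim
    case (elim z)
    have "(\<theta> (snd z))\<^sup>2 \<le> c\<^sup>2" using \<theta>(2)[of "snd z"] abs_ge_zero order_trans by (intro abs_le_square_iff[THEN iffD1]) fastforce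
    with elim show ?case by (simp add: power_mult_distrib mult_right_mono)
  qed
  have "0 \<le> c" using \<theta>(2)[of 0] by linarith
  then show "0 \<le> c * norm u" by simp
qed (simp add: norm_L2_sq power_mult_distrib)

lemma superposition_zero:
  assumes "monotone_field f c" shows "superposition f 0 = 0"
  using superposition_le[OF assms, of 0] by simp

context maxwell_system
begin

text \<open>
  The monotone perturbation acts on the first component only. The weights required by the abstract
  theorem are the functions \<open>1 + t\<close> and \<open>1 + T - t\<close> of time; the second one is bounded below by \<open>1\<close> and
  has final value \<open>1\<close>.
\<close>

theorem weak_solution_exists_monotone:
  assumes f: "monotone_field f c"
  shows "\<exists>e h. weak_solution u0 (g - (superposition f e, 0)) (e, h)"
proof -
  have c: "0 < c" using f by (simp add: monotone_field_def)
  define \<Theta> :: "real \<Rightarrow> real" where "\<Theta> t = 1 + primitive (cut T (\<lambda>_. 1)) t" for t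
  define \<Psi> :: "real \<Rightarrow> real" where "\<Psi> t = (1 + T) + primitive (cut T (\<lambda>_. - 1)) t" for t
  have b: "bounded_fun \<Theta>" "bounded_fun \<Psi>" unfolding \<Theta>_def \<Psi>_def by (intro bounded_fun_primitive bounded_fun_const)+
  note pb = primitive_bounds[of "\<lambda>_. 1" T, simplified cut_integral_const[OF T], OF bounded_fun_const]
  have \<Theta>0: "0 \<le> \<Theta> t" for t using pb(1)[of t] by (simp add: \<Theta>_def)
  have \<Psi>1: "1 \<le> \<Psi> t" for t
    using pb(2)[of t] T unfolding \<Psi>_def primitive_cut_uminus[of T "\<lambda>_. 1"] by simp
  then have \<Psi>0: "0 \<le> \<Psi> t" for t using order_trans[of 0 1 "\<Psi> t"] by simp
  have prod: "v \<bullet> TM \<theta> v = fst v \<bullet> time_mult \<theta> (fst v) + snd v \<bullet> time_mult \<theta> (snd v)" for v \<theta>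
    by (cases v) simp
  have \<Psi>T: "(1 + T) + primitive (cut T (\<lambda>_. - 1)) T = 1"
    unfolding primitive_cut_uminus[of T "\<lambda>_. 1"] primitive_final cut_integral_const[OF T] by simp
  define J where "J \<tau> u = (superposition (yosida f \<tau>) (fst u), snd u)" for \<tau> and u :: "('a \<times> real, 'b) L2 \<times> ('a \<times> real, 'b) L2"
  define B where "B u = (superposition f (fst u), 0 :: ('a \<times> real, 'b) L2)" for u :: "('a \<times> real, 'b) L2 \<times> ('a \<times> real, 'b) L2"
  have TM1: "TM (\<lambda>_. 1) = (\<lambda>x. x)" "TM (\<lambda>_. - 1) = (\<lambda>x. - x)"
    by (auto simp: fun_eq_iff time_mult_const)
  have ex: "\<exists>u. weak_solution u0 (g - B u) u"
  proof (rule monotone_weak_solution_exists[where \<Theta>="TM \<Theta>" and Q="TM \<Psi>" and J=J and c=1 and ?\<tau>0.0="1 / (2 * c)" and L=c])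
    show "time_weight (TM \<Theta>) (\<lambda>x. x) 1 (1 + primitive (cut T (\<lambda>_. 1)) T)"
      using time_weight_TM[OF bounded_fun_const[of 1], of 1] unfolding \<Theta>_def[abs_def] TM1 .
    show "time_weight (TM \<Psi>) (\<lambda>x. - x) (1 + T) 1"
      using time_weight_TM[OF bounded_fun_const[of "- 1"], of "1 + T"]
      unfolding \<Psi>T \<Psi>_def[abs_def] TM1 .
    show "0 \<le> v \<bullet> TM \<Theta> v" for v
      using time_mult_inner_ge[OF b(1), of 0 "fst v"] time_mult_inner_ge[OF b(1), of 0 "snd v"] \<Theta>0 by (simp add: prod)
    show "1 * (norm v)\<^sup>2 \<le> v \<bullet> TM \<Psi> v" for v
      using time_mult_inner_ge[OF b(2) \<Psi>1, of "fst v"] time_mult_inner_ge[OF b(2) \<Psi>1, of "snd v"]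
      unfolding prod by (cases v) (simp add: norm_Pair)
    show "u - J \<tau> u = \<tau> *\<^sub>R B (J \<tau> u)" if "0 < \<tau>" "\<tau> < 1 / (2 * c)" for \<tau> u
      using yosida_superposition[OF f that, of "fst u"] by (cases u) (simp add: J_def B_def)
    show "(J \<tau> u - J \<tau> v) \<bullet> TM \<Psi> (J \<tau> u - J \<tau> v) \<le> (u - v) \<bullet> TM \<Psi> (u - v)" if "0 < \<tau>" "\<tau> < 1 / (2 * c)" for \<tau> u v
      using superposition_time_mult(2)[OF f b(2) \<Psi>0 that, of "fst u" "fst v"] by (simp add: prod J_def)
    show "norm (J \<tau> u) \<le> norm u" if "0 < \<tau>" "\<tau> < 1 / (2 * c)" for \<tau> u
      using norm_yosida_le[OF f that, of "fst u"] by (cases u) (simp add: J_def norm_Pair power_mono)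
    show "norm (B u) \<le> c * norm u" for u
    proof -
      have "norm (B u) \<le> c * norm (fst u)" using superposition_le[OF f, of "fst u"] by (simp add: B_def norm_Pair)
      also have "\<dots> \<le> c * norm u" using c norm_fst_le[of "fst u" "snd u"] by (intro mult_left_mono) simp_all
      finally show ?thesis .
    qed
    show "0 \<le> (B u - B v) \<bullet> TM \<Psi> (u - v)" for u v
      using superposition_time_mult(1)[OF f b(2) \<Psi>0, of "fst u" "fst v"] by (cases u, cases v) (simp add: B_def)
    have "continuous_on UNIV (\<lambda>u :: ('a \<times> real, 'b) L2 \<times> ('a \<times> real, 'b) L2. superposition f (fst u))"
      by (rule continuous_on_compose2[OF superposition_continuous[OF f]]) (auto intro!: continuous_intros)
    then show "continuous_on UNIV B" unfolding B_def[abs_def] by (intro continuous_on_Pair continuous_on_const)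
    show "0 \<le> 1 + T" "0 \<le> (1::real)" "0 < (1::real)" "0 < 1 / (2 * c)" "0 \<le> c" using c T by simp_all
  qed
  from ex obtain u where "weak_solution u0 (g - B u) u" by blast
  then show ?thesis by (intro exI[of _ "fst u"] exI[of _ "snd u"]) (simp add: B_def)
qed

text \<open>
  The energy of the slices at time \<open>t\<close>, in a form that is measurable without exceptional sets.
\<close>

definition energy_density :: "('a \<times> real, 'b) L2 \<Rightarrow> ('a \<times> real, 'b) L2 \<Rightarrow> real \<Rightarrow> real" where
  "energy_density e h t = slice_inner (mult_op (\<lambda>z. A1 (fst z)) e) e t + slice_inner (mult_op (\<lambda>z. A2 (fst z)) h) h t"

lemma integrable_energy_density: "integrable lborel (energy_density e h)"
  unfolding energy_density_def[abs_def] by (intro Bochner_Integration.integrable_add integrable_slice_inner)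

lemma integral_slice_inner_mult:
  assumes k: "bounded_fun k"
  shows "(\<integral>t. k t * slice_inner u v t \<partial>lborel) = u \<bullet> time_mult k v"
    and "integrable lborel (\<lambda>t. k t * slice_inner u v t)"
proof -
  note int = integrable_time_mult_inner[OF k, of u v]
  show "(\<integral>t. k t * slice_inner u v t \<partial>lborel) = u \<bullet> time_mult k v"
    unfolding time_mult_inner[OF k] integral_prod_snd[OF int] by (simp add: slice_inner_def)
  show "integrable lborel (\<lambda>t. k t * slice_inner u v t)"
    using integrable_slice_integral_snd[OF int] by (simp add: slice_inner_def)
qed

lemma integral_energy_density:
  assumes k: "bounded_fun k"
  shows "(\<integral>t. k t * energy_density e h t \<partial>lborel) = TM k (e, h) \<bullet> MM (e, h)"
  unfolding energy_density_def distrib_left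
  by (simp add: integral_slice_inner_mult[OF k] inner_commute)

text \<open>
  With \<open>\<Theta>(t) = \<integral>\<^sub>t\<^sup>T k\<close> as weight, the energy inequality bounds the mean of the energy with density
  \<open>k\<close>: the weight vanishes at the final time, and monotonicity makes the contribution of the
  nonlinearity nonnegative because \<open>f\<close> vanishes at zero.
\<close>

lemma weighted_energy_bound:
  assumes f: "monotone_field f c" and sol: "weak_solution u0 ((g, 0) - (superposition f e, 0)) (e, h)"
    and k: "bounded_fun k" "\<And>t. 0 \<le> k t"
  shows "(\<integral>t. k t * energy_density e h t \<partial>lborel)
    \<le> (\<integral>t. cut T k t \<partial>lborel) * (MM0 u0 \<bullet> u0 + 2 * (norm g * norm e))"
proof -
  define a where "a = (\<integral>t. cut T k t \<partial>lborel)"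
  define \<Theta> where "\<Theta> t = a + primitive (cut T (\<lambda>t. - k t)) t" for t
  have kb: "bounded_fun (\<lambda>t. - k t)" using k(1) by (auto simp: bounded_fun_def)
  have \<Theta>b: "bounded_fun \<Theta>" unfolding \<Theta>_def by (rule bounded_fun_primitive[OF kb])
  have \<Theta>: "0 \<le> \<Theta> t" "\<Theta> t \<le> a" for t
    using primitive_bounds[OF k, of T t] unfolding \<Theta>_def primitive_cut_uminus a_def by simp_all
  have a: "0 \<le> a" using \<Theta>[of 0] by simp
  have final: "a + primitive (cut T (\<lambda>t. - k t)) T = 0"
    unfolding primitive_cut_uminus primitive_final a_def by simp
  have "- (TM (\<lambda>t. - k t) (e, h) \<bullet> MM (e, h))
      \<le> a * (MM0 u0 \<bullet> u0) + 2 * (((g, 0) - (superposition f e, 0)) \<bullet> TM \<Theta> (e, h))"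
    by (rule energy_inequality[OF sol time_weight_TM[OF kb, of a, unfolded final, folded \<Theta>_def[abs_def]] a]) simp
  moreover have "- (TM (\<lambda>t. - k t) (e, h) \<bullet> MM (e, h)) = (\<integral>t. k t * energy_density e h t \<partial>lborel)"
    using integral_energy_density[OF kb, of e h] by simp
  moreover have "((g, 0) - (superposition f e, 0)) \<bullet> TM \<Theta> (e, h) \<le> a * (norm g * norm e)"
  proof -
    have "0 \<le> superposition f e \<bullet> time_mult \<Theta> e"
      using superposition_time_mult(1)[OF f \<Theta>b \<Theta>(1), of e 0] by (simp add: superposition_zero[OF f])
    moreover have "g \<bullet> time_mult \<Theta> e \<le> norm g * (a * norm e)"
    proof -
      have "g \<bullet> time_mult \<Theta> e \<le> norm g * norm (time_mult \<Theta> e)" by (rule norm_cauchy_schwarz)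
      also have "\<dots> \<le> norm g * (a * norm e)"
        by (intro mult_left_mono norm_time_mult_le[OF \<Theta>b]) (use \<Theta> in auto)
      finally show ?thesis .
    qed
    ultimately show ?thesis by (simp add: inner_diff_left algebra_simps)
  qed
  ultimately show ?thesis by (simp add: a_def algebra_simps)
qed

text \<open>
  Taking indicator functions for \<open>k\<close> bounds the energy almost everywhere by a quantity that contains
  \<open>\<parallel>e\<parallel>\<close>; taking \<open>k = 1\<close> bounds \<open>\<parallel>e\<parallel>\<close> by the data.
\<close>

lemma energy_estimate:
  assumes f: "monotone_field f c" and sol: "weak_solution u0 ((g, 0) - (superposition f e, 0)) (e, h)"
  shows "AE t in lborel. t \<in> {0<..<T} \<longrightarrow>
    energy_density e h t \<le> 2 * (MM0 u0 \<bullet> u0) + 4 * T / m1 * (norm g)\<^sup>2"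
proof -
  define N0 x y where "N0 = MM0 u0 \<bullet> u0" and "x = norm e" and "y = norm g"
  have m1: "0 < m1" using A1 by (simp add: multiplier_def)
  have "m1 * x\<^sup>2 \<le> T * (N0 + 2 * (y * x))"
  proof -
    have "m1 * x\<^sup>2 \<le> mult_op (\<lambda>z. A1 (fst z)) e \<bullet> e"
      unfolding x_def using coerciveD(4)[OF coercive_mult_op[OF multiplier_fst[OF A1]]] .
    also have "\<dots> \<le> MM (e, h) \<bullet> (e, h)"
    proof -
      have "m2 * (norm h)\<^sup>2 \<le> mult_op (\<lambda>z. A2 (fst z)) h \<bullet> h"
        using coerciveD(4)[OF coercive_mult_op[OF multiplier_fst[OF A2]]] .
      moreover have "0 < m2" using A2 by (simp add: multiplier_def)
      ultimately have "0 \<le> mult_op (\<lambda>z. A2 (fst z)) h \<bullet> h"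
        by (meson less_imp_le mult_nonneg_nonneg order_trans zero_le_power2)
      then show ?thesis by simp
    qed
    also have "\<dots> \<le> T * (N0 + 2 * (y * x))"
      using weighted_energy_bound[OF f sol bounded_fun_const[of 1]] integral_energy_density[OF bounded_fun_const[of 1], of e h]
      unfolding cut_integral_const[OF T] by (simp add: time_mult_const inner_commute N0_def x_def y_def)
    finally show ?thesis .
  qed
  \<comment> \<open>Young's inequality, with weights that allow the term \<open>m1 x\<^sup>2\<close> to be absorbed by the bound above\<close>
  moreover have "2 * T * (2 * (y * x)) \<le> m1 * x\<^sup>2 + 4 * T\<^sup>2 / m1 * y\<^sup>2"
  proof -
    have "0 \<le> (m1 * x - 2 * T * y)\<^sup>2 / m1" using m1 by simp
    also have "\<dots> = m1 * x\<^sup>2 + 4 * T\<^sup>2 / m1 * y\<^sup>2 - 2 * T * (2 * (y * x))"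
      using m1 by (simp add: power2_eq_square field_simps)
    finally show ?thesis by simp
  qed
  ultimately have "T * (2 * (y * x)) \<le> T * (N0 + 4 * T / m1 * y\<^sup>2)"
    by (simp add: algebra_simps power2_eq_square)
  then have "2 * (y * x) \<le> N0 + 4 * T / m1 * y\<^sup>2" using T by (simp only: mult_le_cancel_left_pos)
  then have C: "N0 + 2 * (y * x) \<le> 2 * N0 + 4 * T / m1 * y\<^sup>2" by simp
  define C where "C = N0 + 2 * (y * x)"
  define E where "E = energy_density e h"
  have iE: "integrable lborel E" unfolding E_def by (rule integrable_energy_density)
  then have [measurable]: "E \<in> borel_measurable borel" using borel_measurable_integrable[OF iE] by simp
  \<comment> \<open>the set where the bound fails is a null set, since \<open>E - C\<close> is positive there but has nonpositive integral\<close>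
  define S where "S = {t. t \<in> {0<..<T} \<and> C < E t}"
  have [measurable]: "S \<in> sets borel" unfolding S_def by measurable
  define k where "k = (indicator S :: real \<Rightarrow> real)"
  have kb: "bounded_fun k" unfolding bounded_fun_def k_def by (auto intro!: exI[of _ 1] simp: indicator_def)
  have cutk: "cut T k = k" by (auto simp: k_def S_def fun_eq_iff indicator_def)
  have ik: "integrable lborel k" using integrable_cut_bounded[OF kb, of T] by (simp only: cutk)
  have ikE: "integrable lborel (\<lambda>t. k t * E t)"
    unfolding k_def using integrable_mult_indicator[of S lborel E] iE by simp
  have "(\<integral>t. k t * E t \<partial>lborel) \<le> (\<integral>t. k t \<partial>lborel) * C"
    using weighted_energy_bound[OF f sol kb] unfolding cutk by (simp add: E_def C_def N0_def x_def y_def k_def)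
  then have "(\<integral>t. k t * (E t - C) \<partial>lborel) \<le> 0"
    using ik ikE by (simp add: right_diff_distrib)
  moreover have nn: "0 \<le> k t * (E t - C)" for t by (simp add: k_def S_def indicator_def)
  ultimately have "(\<integral>t. k t * (E t - C) \<partial>lborel) = 0" by (intro antisym integral_nonneg_AE) auto
  moreover have "integrable lborel (\<lambda>t. k t * (E t - C))" using ik ikE by (simp add: right_diff_distrib)
  ultimately have "AE t in lborel. k t * (E t - C) = 0"
    using integral_nonneg_eq_0_iff_AE[of lborel "\<lambda>t. k t * (E t - C)"] nn by simp
  then show ?thesis
  proof eventually_elim
    case (elim t)
    show ?case
    proof
      assume t: "t \<in> {0<..<T}"
      with elim have "E t \<le> C" by (auto simp: k_def S_def indicator_def split: if_splits)
      then show "energy_density e h t \<le> 2 * (MM0 u0 \<bullet> u0) + 4 * T / m1 * (norm g)\<^sup>2"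
        using C by (simp add: E_def C_def N0_def y_def)
    qed
  qed
qed

end

section \<open>Bochner measurability of the time slices\<close>

context
  fixes S :: "'a::euclidean_space set"
  assumes S: "open S"
begin

text \<open>
  Restriction to \<open>S\<close> followed by extension by zero is an orthogonal projection.
\<close>

lemma norm_fld_rep_le: "norm (fld S (rep_L2 w)) \<le> norm w"
proof -
  let ?v = "fld S (rep_L2 w)"
  have "norm ?v * norm ?v = ?v \<bullet> w"
    using fld_rep_inner[OF S rep_L2_fields[OF S], of w w] by (simp flip: power2_norm_eq_inner power2_eq_square)
  also have "\<dots> \<le> norm ?v * norm w" by (rule norm_cauchy_schwarz)
  finally show ?thesis by (cases "norm ?v = 0") (auto simp: mult_le_cancel_left)
qed

lemma L2_norm_le_rep:
  assumes ae: "AE x in lborel. x \<in> S \<longrightarrow> f x = rep_L2 w x"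
  shows "f \<in> L2_fields S" "fld S f = fld S (rep_L2 w)" "L2_norm S f \<le> norm w"
proof -
  show 1: "f \<in> L2_fields S" by (rule L2_fieldsI[OF S ae])
  show 2: "fld S f = fld S (rep_L2 w)" by (rule fld_cong[OF S rep_L2_fields[OF S] ae])
  show "L2_norm S f \<le> norm w" using norm_fld_rep_le[of w] by (simp add: L2_norm_fld[OF S 1] 2)
qed

lemma integral_fld_rep:
  assumes g: "g \<in> L2_fields S" and k: "AE x in lborel. x \<in> S \<longrightarrow> k x = rep_L2 w x"
  shows "(\<integral>x. k x \<bullet> g x \<partial>lebesgue_on S) = w \<bullet> fld S g"
    and "integrable (lebesgue_on S) (\<lambda>x. k x \<bullet> g x)"
proof -
  show "(\<integral>x. k x \<bullet> g x \<partial>lebesgue_on S) = w \<bullet> fld S g"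
    using integral_fld_cong[OF S g k] by (simp add: inner_commute)
  have [measurable]: "S \<in> sets borel" using S by simp
  have ae: "AE x in lborel. x \<in> S \<longrightarrow> k x \<bullet> g x = rep_L2 w x \<bullet> rep_L2 (fld S g) x"
    using k rep_fld[OF S g] by eventually_elim simp
  have "integrable lborel (\<lambda>x. indicator S x *\<^sub>R (rep_L2 w x \<bullet> rep_L2 (fld S g) x))"
    by (intro integrable_mult_indicator integrable_rep_inner) simp
  then show "integrable (lebesgue_on S) (\<lambda>x. k x \<bullet> g x)"
    using integral_lebesgue_on(2)[OF S _ ae] by simp
qed

end

lemma L2_fun_box: "L2_fun (\<lambda>x. indicator (box a b) x *\<^sub>R c)"
proof (intro L2_fun_sq_integrable sq_integrable_bound)
  have "integrable lborel (indicator (box a b) :: 'a \<Rightarrow> real)"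
    by (intro integrable_real_indicator emeasure_bounded_finite) auto
  then show "integrable lborel (\<lambda>x. indicator (box a b) x * (norm c)\<^sup>2)" by simp
  show "AE x in lborel. (norm (indicator (box a b) x *\<^sub>R c))\<^sup>2 \<le> indicator (box a b) x * (norm c)\<^sup>2"
    by (intro AE_I2) (simp add: indicator_def)
qed measurable

text \<open>
  Fields that are simple functions of time form a subspace which contains the indicator functions of
  boxes and is therefore dense; convergence in \<open>L\<^sup>2\<close> gives pointwise convergence of a subsequence of
  the slices.
\<close>

lemma slice_simple_approximation:
  fixes u :: "('a::euclidean_space \<times> real, 'b::euclidean_space) L2"
  shows "\<exists>\<sigma>. (\<forall>n::nat. simple_function lborel (\<sigma> n)) \<and> (AE t in lborel. (\<lambda>n. \<sigma> n t) \<longlonglongrightarrow> slice u t)"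
proof -
  define S where "S = {u :: ('a \<times> real, 'b) L2. \<exists>\<sigma>. simple_function lborel \<sigma> \<and> (AE t in lborel. slice u t = \<sigma> t)}"
  have "subspace S"
  proof (rule subspaceI)
    have "AE t in lborel. slice (0 :: ('a \<times> real, 'b) L2) t = 0"
      using slice_scaleR[of 0 "0 :: ('a \<times> real, 'b) L2"] by simp
    then show "0 \<in> S" unfolding S_def by (intro CollectI exI[of _ "\<lambda>_. 0"]) simp
  next
    fix x y assume "x \<in> S" "y \<in> S"
    then obtain \<sigma> \<tau> where s: "simple_function lborel \<sigma>" "AE t in lborel. slice x t = \<sigma> t"
      "simple_function lborel \<tau>" "AE t in lborel. slice y t = \<tau> t" by (auto simp: S_def)
    have "AE t in lborel. slice (x + y) t = \<sigma> t + \<tau> t"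
      using s(2,4) slice_add[of x y] by eventually_elim simp
    then show "x + y \<in> S" unfolding S_def using simple_function_compose2[OF s(1,3), of "(+)"] by blast
  next
    fix c x assume "x \<in> S"
    then obtain \<sigma> where s: "simple_function lborel \<sigma>" "AE t in lborel. slice x t = \<sigma> t" by (auto simp: S_def)
    have "AE t in lborel. slice (c *\<^sub>R x) t = c *\<^sub>R \<sigma> t" using s(2) slice_scaleR[of c x] by eventually_elim simp
    then show "c *\<^sub>R x \<in> S" unfolding S_def using simple_function_compose1[OF s(1), of "\<lambda>w. c *\<^sub>R w"] by blast
  qed
  note sub = closed_subspace_closure[OF this]
  have "u \<in> closure S"
  proof (rule mem_closed_subspace_if_orthogonal[OF closed_closure sub])
    fix z assume z: "\<And>s. s \<in> closure S \<Longrightarrow> z \<bullet> s = 0"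
    have "AE x in lborel. x \<in> UNIV \<longrightarrow> rep_L2 z x = 0"
    proof (rule AE_zero_on_open_if_box_integrals_zero[OF rep_sq_integrable open_UNIV])
      fix a b :: "'a \<times> real" and c :: 'b
      obtain a0 \<alpha> b0 \<beta> where A: "a = (a0, \<alpha>)" "b = (b0, \<beta>)" by (cases a, cases b) auto
      define w :: "('a \<times> real, 'b) L2" where "w = to_L2 (\<lambda>x. indicator (box a b) x *\<^sub>R c)"
      define y :: "('a, 'b) L2" where "y = to_L2 (\<lambda>x. indicator (box a0 b0) x *\<^sub>R c)"
      have rw: "AE x in lborel. rep_L2 w x = indicator (box a b) x *\<^sub>R c" unfolding w_def by (rule rep_to_L2[OF L2_fun_box])
      have "AE t in lborel. slice w t = (indicator (box \<alpha> \<beta>) t :: real) *\<^sub>R y"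
      proof (rule slice_eqI[OF rw], rule AE_I2)
        fix t
        show "AE x in lborel. rep_L2 ((indicator (box \<alpha> \<beta>) t :: real) *\<^sub>R y) x = indicator (box a b) (x, t) *\<^sub>R c"
          using rep_scaleR_L2[of "indicator (box \<alpha> \<beta>) t" y] rep_to_L2[OF L2_fun_box[of a0 b0 c], folded y_def]
          by eventually_elim (auto simp: A box_Pair_eq indicator_def)
      qed
      moreover have "simple_function lborel (\<lambda>t. (indicator (box \<alpha> \<beta>) t :: real) *\<^sub>R y)"
        by (rule simple_function_compose1[where g="\<lambda>r. r *\<^sub>R y"]) (rule simple_function_indicator, simp)
      ultimately have "w \<in> S" unfolding S_def by blast
      then have "z \<bullet> w = 0" using closure_subset by (intro z) blast
      moreover have "z \<bullet> w = (\<integral>x. indicator (box a b) x * (rep_L2 z x \<bullet> c) \<partial>lborel)"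
        unfolding inner_L2
      proof (rule integral_cong_AE)
        show "AE x in lborel. rep_L2 z x \<bullet> rep_L2 w x = indicator (box a b) x * (rep_L2 z x \<bullet> c)"
          using rw by eventually_elim simp
      qed measurable
      ultimately show "(\<integral>x. indicator (box a b) x * (rep_L2 z x \<bullet> c) \<partial>lborel) = 0" by simp
    qed
    then have "z = 0" by (intro L2_eq_zeroI) simp
    then show "z \<bullet> u = 0" by simp
  qed
  then obtain x where x: "\<And>n. x n \<in> S" "x \<longlonglongrightarrow> u" unfolding closure_sequential by blast
  have "\<forall>n. \<exists>\<sigma>. simple_function lborel \<sigma> \<and> (AE t in lborel. slice (x n) t = \<sigma> t)" using x(1) by (simp add: S_def)
  then obtain \<sigma> where \<sigma>: "\<And>n. simple_function lborel (\<sigma> n)" "\<And>n. AE t in lborel. slice (x n) t = \<sigma> n t" by metis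
  define D where "D n t = slice_inner (x n - u) (x n - u) t" for n t
  have D0: "0 \<le> D n t" for n t unfolding D_def slice_inner_def by (intro integral_nonneg_AE) auto
  have "(\<lambda>n. (norm (x n - u))\<^sup>2) \<longlonglongrightarrow> 0" using tendsto_power[OF tendsto_norm[OF LIM_zero[OF x(2)]], of 2] by simp
  moreover have "(\<integral>t. norm (D n t) \<partial>lborel) = (norm (x n - u))\<^sup>2" for n
    using D0[of n] by (simp add: abs_of_nonneg) (simp add: D_def integral_slice_inner power2_norm_eq_inner)
  ultimately have "(\<lambda>n. \<integral>t. norm (D n t) \<partial>lborel) \<longlonglongrightarrow> 0" by simp
  from tendsto_L1_AE_subseq[OF _ this] obtain r where r: "AE t in lborel. (\<lambda>n. D (r n) t) \<longlonglongrightarrow> 0"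
    unfolding D_def using integrable_slice_inner by blast
  have "AE t in lborel. \<forall>n. D n t = (norm (\<sigma> n t - slice u t))\<^sup>2"
    unfolding AE_all_countable
  proof
    fix n
    show "AE t in lborel. D n t = (norm (\<sigma> n t - slice u t))\<^sup>2"
      using slice_inner_eq[of "x n - u" "x n - u"] slice_diff[of "x n" u] \<sigma>(2)[of n]
      by eventually_elim (simp add: D_def power2_norm_eq_inner)
  qed
  with r have "AE t in lborel. (\<lambda>n. \<sigma> (r n) t) \<longlonglongrightarrow> slice u t"
  proof eventually_elim
    case (elim t)
    then have "(\<lambda>n. sqrt ((norm (\<sigma> (r n) t - slice u t))\<^sup>2)) \<longlonglongrightarrow> sqrt 0" by (intro tendsto_real_sqrt) simp
    then have "(\<lambda>n. norm (\<sigma> (r n) t - slice u t)) \<longlonglongrightarrow> 0" by simp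
    then show ?case by (rule LIM_zero_cancel[OF tendsto_norm_zero_cancel])
  qed
  with \<sigma>(1) show ?thesis by (intro exI[of _ "\<lambda>n. \<sigma> (r n)"]) simp
qed

lemma simple_function_lebesgue_on:
  assumes "simple_function lborel \<sigma>" "S \<in> sets borel"
  shows "simple_function (lebesgue_on S) \<sigma>"
  unfolding simple_function_def
proof
  have fin: "finite (range \<sigma>)" and m: "\<And>x. \<sigma> -` {\<sigma> x} \<in> sets borel"
    using assms(1) by (auto simp: simple_function_def)
  show "finite (\<sigma> ` space (lebesgue_on S))" using fin by (rule finite_subset[rotated]) auto
  show "\<forall>x\<in>\<sigma> ` space (lebesgue_on S). \<sigma> -` {x} \<inter> space (lebesgue_on S) \<in> sets (lebesgue_on S)"
    using m assms(2) by (auto simp: sets_restrict_space_iff space_restrict_space)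
qed

text \<open>
  Simple functions with values in classes of fields are turned into simple functions with values in
  fields by choosing representatives. Restriction to \<open>\<Omega>\<close> does not increase distances, so the
  approximation survives.
\<close>

lemma Linf_bochner_slices:
  fixes u :: "((real^3) \<times> real, real^3) L2"
  assumes \<Omega>: "open \<Omega>" and C: "AE t in lborel. t \<in> {0<..<T} \<longrightarrow> norm (slice u t) \<le> C"
  shows "time_slices (rep_L2 u) \<in> Linf_bochner T (L2_fields \<Omega>) (L2_norm \<Omega>)"
proof -
  obtain \<sigma> where \<sigma>: "\<And>n. simple_function lborel (\<sigma> n)" "AE t in lborel. (\<lambda>n. \<sigma> n t) \<longlonglongrightarrow> slice u t"
    using slice_simple_approximation[of u] by blast
  have aeI: "AE t in lebesgue_on {0<..<T}. P t" if "AE t in lborel. t \<in> {0<..<T} \<longrightarrow> P t" for P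
    using that AE_lebesgue_on_iff[of "{0<..<T}" P] by simp
  have "AE t in lborel. t \<in> {0<..<T} \<longrightarrow> time_slices (rep_L2 u) t \<in> L2_fields \<Omega> \<and> L2_norm \<Omega> (time_slices (rep_L2 u) t) \<le> C"
    using rep_slice[of u] C
  proof eventually_elim
    case (elim t)
    have "AE x in lborel. x \<in> \<Omega> \<longrightarrow> time_slices (rep_L2 u) t x = rep_L2 (slice u t) x"
      using elim(1) by eventually_elim (simp add: time_slices_def)
    note le = L2_norm_le_rep[OF \<Omega> this]
    from le(1,3) elim(2) show ?case by auto
  qed
  then have *: "AE t in lborel. t \<in> {0<..<T} \<longrightarrow> time_slices (rep_L2 u) t \<in> L2_fields \<Omega>"
    "AE t in lborel. t \<in> {0<..<T} \<longrightarrow> L2_norm \<Omega> (time_slices (rep_L2 u) t) \<le> C"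
    by (auto elim: eventually_mono)
  have "AE t in lborel. t \<in> {0<..<T} \<longrightarrow> (\<lambda>n. L2_norm \<Omega> (\<lambda>x. rep_L2 (\<sigma> n t) x - time_slices (rep_L2 u) t x)) \<longlonglongrightarrow> 0"
    using rep_slice[of u] \<sigma>(2)
  proof eventually_elim
    case (elim t)
    have "norm (L2_norm \<Omega> (\<lambda>x. rep_L2 (\<sigma> n t) x - time_slices (rep_L2 u) t x)) \<le> norm (\<sigma> n t - slice u t)" for n
    proof -
      have "AE x in lborel. x \<in> \<Omega> \<longrightarrow> rep_L2 (\<sigma> n t) x - time_slices (rep_L2 u) t x = rep_L2 (\<sigma> n t - slice u t) x"
        using elim(1) rep_diff_L2[of "\<sigma> n t" "slice u t"] by eventually_elim (simp add: time_slices_def)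
      note le = L2_norm_le_rep[OF \<Omega> this]
      show ?thesis using le(3) by (simp add: L2_norm_fld[OF \<Omega> le(1)])
    qed
    moreover have "(\<lambda>n. norm (\<sigma> n t - slice u t)) \<longlonglongrightarrow> 0" using elim(2) by (intro tendsto_norm_zero LIM_zero)
    ultimately show ?case by (rule impI[OF Lim_null_comparison[OF always_eventually, OF allI]])
  qed
  note conv = aeI[OF this]
  have "bochner_measurable T (L2_fields \<Omega>) (L2_norm \<Omega>) (time_slices (rep_L2 u))"
    unfolding bochner_measurable_def
  proof (intro conjI exI[of _ "\<lambda>n t. rep_L2 (\<sigma> n t)"] allI)
    show "AE t in lebesgue_on {0<..<T}. time_slices (rep_L2 u) t \<in> L2_fields \<Omega>" by (rule aeI[OF *(1)])
    show "simple_function (lebesgue_on {0<..<T}) (\<lambda>t. rep_L2 (\<sigma> n t))" for n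
      by (rule simple_function_lebesgue_on[OF simple_function_compose1[OF \<sigma>(1)]]) simp
    show "(\<lambda>t. rep_L2 (\<sigma> n t)) ` {0<..<T} \<subseteq> L2_fields \<Omega>" for n using rep_L2_fields[OF \<Omega>] by blast
    show "AE t in lebesgue_on {0<..<T}. (\<lambda>n. L2_norm \<Omega> (\<lambda>x. rep_L2 (\<sigma> n t) x - time_slices (rep_L2 u) t x)) \<longlonglongrightarrow> 0"
      by (rule conv)
  qed
  then show ?thesis unfolding Linf_bochner_def using aeI[OF *(2)] by blast
qed

section \<open>From the operator equation to the weak formulation\<close>

context
  fixes A' :: "'a::euclidean_space \<Rightarrow> 'b::euclidean_space \<Rightarrow> 'b" and m :: real
  assumes A': "multiplier A' m"
begin

lemma multiplier_zero: "A' x 0 = 0"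
  using A' by (auto simp: multiplier_def intro: linear_0)

lemma mult_op_inner_nonneg: "0 \<le> mult_op A' u \<bullet> u" and mult_op_inner_coercive: "m * (norm u)\<^sup>2 \<le> mult_op A' u \<bullet> u"
proof -
  show le: "m * (norm u)\<^sup>2 \<le> mult_op A' u \<bullet> u" by (rule coerciveD(4)[OF coercive_mult_op[OF A']])
  have "0 \<le> m * (norm u)\<^sup>2" using A' by (simp add: multiplier_def)
  with le show "0 \<le> mult_op A' u \<bullet> u" by simp
qed

lemma slice_inner_mult_op:
  "AE t in lborel. slice_inner (mult_op (\<lambda>z. A' (fst z)) u) u t = mult_op A' (slice u t) \<bullet> slice u t"
proof -
  have "AE t in lborel. slice (mult_op (\<lambda>z. A' (fst z)) u) t = mult_op A' (slice u t)"
  proof (rule slice_eqI[OF rep_mult_op[OF multiplier_fst[OF A']]])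
    show "AE t in lborel. AE x in lborel. rep_L2 (mult_op A' (slice u t)) x = A' (fst (x, t)) (rep_L2 u (x, t))"
      using rep_slice[of u]
    proof eventually_elim
      case (elim t)
      then show ?case using rep_mult_op[OF A', of "slice u t"] by eventually_elim simp
    qed
  qed
  then show ?thesis using slice_inner_eq[of "mult_op (\<lambda>z. A' (fst z)) u" u] by eventually_elim simp
qed

end

context
  fixes \<Omega> :: "(real^3) set" and m :: real and A :: "real^3 \<Rightarrow> real^3^3" and A' :: "real^3 \<Rightarrow> real^3 \<Rightarrow> real^3"
  assumes \<Omega>: "open \<Omega>" and A': "multiplier A' m"
    and AA': "AE x in lborel. x \<in> \<Omega> \<longrightarrow> (\<forall>\<xi>. A' x \<xi> = A x *v \<xi>)"
begin

lemma integral_material: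
  assumes f: "f \<in> L2_fields \<Omega>" and g: "g \<in> L2_fields \<Omega>"
  shows "(\<integral>x. (A x *v f x) \<bullet> g x \<partial>lebesgue_on \<Omega>) = mult_op A' (fld \<Omega> f) \<bullet> fld \<Omega> g"
proof (rule integral_fld_rep(1)[OF \<Omega> g])
  show "AE x in lborel. x \<in> \<Omega> \<longrightarrow> A x *v f x = rep_L2 (mult_op A' (fld \<Omega> f)) x"
    using rep_mult_op[OF A', of "fld \<Omega> f"] rep_fld[OF \<Omega> f] AA' by eventually_elim simp
qed

lemma integral_material_cylinder:
  assumes T: "0 < T" and g: "g \<in> L2_fields (cylinder \<Omega> T)"
  shows "(\<integral>z. (A (fst z) *v rep_L2 u z) \<bullet> g z \<partial>lebesgue_on (cylinder \<Omega> T)) = mult_op (\<lambda>z. A' (fst z)) u \<bullet> fld (cylinder \<Omega> T) g"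
proof (rule integral_fld_rep(1)[OF open_cylinder[OF \<Omega> T] g])
  show "AE z in lborel. z \<in> cylinder \<Omega> T \<longrightarrow> A (fst z) *v rep_L2 u z = rep_L2 (mult_op (\<lambda>z. A' (fst z)) u) z"
    using rep_mult_op[OF multiplier_fst[OF A'], of u] AE_prod_fstI[OF AA'] by eventually_elim (auto simp: cylinder_def)
qed

lemma weighted_norm_sq:
  assumes f: "f \<in> L2_fields \<Omega>"
  shows "(weighted_norm \<Omega> A f)\<^sup>2 = mult_op A' (fld \<Omega> f) \<bullet> fld \<Omega> f"
  unfolding weighted_norm_def weighted_inner_def integral_material[OF f f]
  using mult_op_inner_nonneg[OF A'] by simp

text \<open>Extending a field from \<open>\<Omega>\<close> to the whole space can only increase its energy.\<close>

lemma weighted_norm_sq_le: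
  assumes "AE x in lborel. x \<in> \<Omega> \<longrightarrow> f x = rep_L2 u x"
  shows "(weighted_norm \<Omega> A f)\<^sup>2 \<le> mult_op A' u \<bullet> u"
proof -
  note f = L2_norm_le_rep[OF \<Omega> assms]
  let ?v = "fld \<Omega> (rep_L2 u)"
  have "mult_op A' ?v \<bullet> ?v \<le> mult_op A' u \<bullet> u"
    unfolding mult_op_inner[OF A']
  proof (rule integral_mono_AE)
    show "AE x in lborel. A' x (rep_L2 ?v x) \<bullet> rep_L2 ?v x \<le> A' x (rep_L2 u x) \<bullet> rep_L2 u x"
      using rep_fld[OF \<Omega> rep_L2_fields[OF \<Omega>], of u]
    proof eventually_elim
      case (elim x)
      have "0 \<le> m * (norm (rep_L2 u x))\<^sup>2" "m * (norm (rep_L2 u x))\<^sup>2 \<le> A' x (rep_L2 u x) \<bullet> rep_L2 u x"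
        using A' by (auto simp: multiplier_def)
      with elim show ?case by (cases "x \<in> \<Omega>") (auto simp: multiplier_zero[OF A'])
    qed
  qed (rule integrable_mult_op_inner[OF A'])+
  then show ?thesis by (simp add: weighted_norm_sq[OF f(1)] f(2))
qed

end

text \<open>
  The extensions by zero of an admissible test field and its curl belong to the space-time graph of
  the curl or, if the slices are in \<open>V\<^sub>0\<close>, of its adjoint.
\<close>

context
  fixes \<Omega> :: "(real^3) set" and T :: real
  assumes \<Omega>: "open \<Omega>" and T: "0 < T"
begin

lemma test_field_time_graph:
  assumes "maxwell_test_field \<Omega> T W \<Phi> R D v"
  shows "(fld (cylinder \<Omega> T) \<Phi>, fld (cylinder \<Omega> T) R) \<in> time_graph T (weak_curl_graph \<Omega>)"
proof -
  have L: "\<Phi> \<in> L2_fields (cylinder \<Omega> T)" "R \<in> L2_fields (cylinder \<Omega> T)"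
    and c: "AE t in lborel. t \<in> {0<..<T} \<longrightarrow> has_weak_curl \<Omega> (time_slices \<Phi> t) (time_slices R t)"
    using assms AE_lebesgue_on_iff[of "{0<..<T}"] by (auto simp: maxwell_test_field_def)
  show ?thesis
    unfolding time_graph_def mem_Collect_eq prod.case
    using slice_fld[OF \<Omega> T L(1)] slice_fld[OF \<Omega> T L(2)] c
    by eventually_elim (simp add: has_weak_curl_iff[OF \<Omega>] time_slices_def)
qed

lemma test_field_adjoint_time_graph:
  assumes "maxwell_test_field \<Omega> T (V0_space \<Omega>) \<Phi> R D v"
  shows "(fld (cylinder \<Omega> T) \<Phi>, fld (cylinder \<Omega> T) R) \<in> adjoint_relation (time_graph T (weak_curl_graph \<Omega>))"
proof -
  have L: "\<Phi> \<in> L2_fields (cylinder \<Omega> T)" "R \<in> L2_fields (cylinder \<Omega> T)"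
    and c: "AE t in lborel. t \<in> {0<..<T} \<longrightarrow> has_weak_curl \<Omega> (time_slices \<Phi> t) (time_slices R t)"
    and V: "AE t in lborel. t \<in> {0<..<T} \<longrightarrow> time_slices \<Phi> t \<in> V0_space \<Omega>"
    using assms AE_lebesgue_on_iff[of "{0<..<T}"] by (auto simp: maxwell_test_field_def L2_bochner_def bochner_measurable_def)
  note sl = slice_fld[OF \<Omega> T L(1)] slice_fld[OF \<Omega> T L(2)]
  show ?thesis
  proof (rule adjoint_time_graphI[OF T closed_weak_curl_graph subspace_weak_curl_graph])
    show "AE t in lborel. t \<in> {0<..<T} \<longrightarrow> (slice (fld (cylinder \<Omega> T) \<Phi>) t, slice (fld (cylinder \<Omega> T) R) t) \<in> adjoint_relation (weak_curl_graph \<Omega>)"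
      using sl c V
    proof eventually_elim
      case (elim t)
      show ?case
      proof
        assume t: "t \<in> {0<..<T}"
        with elim have "(fld \<Omega> (time_slices \<Phi> t), fld \<Omega> (time_slices R t)) \<in> adjoint_relation (weak_curl_graph \<Omega>)"
          by (intro V0_space_adjoint[OF \<Omega>]) auto
        with elim t show "(slice (fld (cylinder \<Omega> T) \<Phi>) t, slice (fld (cylinder \<Omega> T) R) t) \<in> adjoint_relation (weak_curl_graph \<Omega>)"
          by (simp add: time_slices_def)
      qed
    qed
    show "AE t in lborel. t \<notin> {0<..<T} \<longrightarrow> slice (fld (cylinder \<Omega> T) \<Phi>) t = 0 \<and> slice (fld (cylinder \<Omega> T) R) t = 0"
      using sl by eventually_elim simp
  qed
qed

lemma test_field_volterra_adjoint:
  assumes "maxwell_test_field \<Omega> T W \<Phi> R D v"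
  shows "\<Phi> \<in> L2_fields (cylinder \<Omega> T)" "R \<in> L2_fields (cylinder \<Omega> T)" "D \<in> L2_fields (cylinder \<Omega> T)" "v 0 \<in> L2_fields \<Omega>"
    "volterra_adjoint T (- fld (cylinder \<Omega> T) D) = fld (cylinder \<Omega> T) \<Phi>"
    "time_integral T (- fld (cylinder \<Omega> T) D) = fld \<Omega> (v 0)"
proof -
  have wd: "has_weak_time_derivative \<Omega> T \<Phi> D" and rep: "continuous_rep \<Omega> T \<Phi> v" and vT: "AE x in lebesgue_on \<Omega>. v T x = 0"
    and R: "R \<in> L2_fields (cylinder \<Omega> T)"
    using assms by (simp_all add: maxwell_test_field_def)
  show "\<Phi> \<in> L2_fields (cylinder \<Omega> T)" "D \<in> L2_fields (cylinder \<Omega> T)" using wd by (simp_all add: has_weak_time_derivative_def)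
  show "R \<in> L2_fields (cylinder \<Omega> T)" by (rule R)
  show "v 0 \<in> L2_fields \<Omega>" using rep T by (simp add: continuous_rep_def)
  show "volterra_adjoint T (- fld (cylinder \<Omega> T) D) = fld (cylinder \<Omega> T) \<Phi>" "time_integral T (- fld (cylinder \<Omega> T) D) = fld \<Omega> (v 0)"
    using test_field_volterra[OF \<Omega> T wd rep vT] by simp_all
qed

text \<open>
  A test field is \<open>\<Phi> = K' d\<close> with \<open>d = - \<partial>\<^sub>t \<Phi>\<close>. Placed in the first component it lies in the domain of
  the adjoint of the curl, placed in the second component in the domain of the curl; these two choices
  in the operator equation give the two equations of the weak formulation.
\<close>

theorem maxwell_weak_solution_if_operator_solution:
  assumes mat1: "multiplier A1 m1" "AE x in lborel. x \<in> \<Omega> \<longrightarrow> (\<forall>\<xi>. A1 x \<xi> = \<epsilon> x *v \<xi>)"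
    and mat2: "multiplier A2 m2" "AE x in lborel. x \<in> \<Omega> \<longrightarrow> (\<forall>\<xi>. A2 x \<xi> = \<mu> x *v \<xi>)"
    and MS: "maxwell_system T m1 m2 A1 A2 (weak_curl_graph \<Omega>)"
    and sol: "evolution.weak_solution (map_prod (mult_op (\<lambda>z. A1 (fst z))) (mult_op (\<lambda>z. A2 (fst z))))
      (skew_graph (time_graph T (weak_curl_graph \<Omega>))) (map_prod (time_embed T) (time_embed T))
      (map_prod (volterra_adjoint T) (volterra_adjoint T)) (fld \<Omega> e0, fld \<Omega> h0) (- k, 0) (e, h)"
    and init: "e0 \<in> L2_fields \<Omega>" "h0 \<in> L2_fields \<Omega>"
    and k: "AE z in lborel. z \<in> cylinder \<Omega> T \<longrightarrow> j z (rep_L2 e z) = rep_L2 k z"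
  shows "maxwell_weak_solution \<Omega> T \<epsilon> \<mu> j e0 h0 (rep_L2 e) (rep_L2 h)"
proof -
  let ?Q = "cylinder \<Omega> T"
  interpret maxwell_system T m1 m2 A1 A2 "weak_curl_graph \<Omega>" by (rule MS)
  note oQ = open_cylinder[OF \<Omega> T]
  have G: "(0, 0) \<in> time_graph T (weak_curl_graph \<Omega>)" "(0, 0) \<in> adjoint_relation (time_graph T (weak_curl_graph \<Omega>))"
    using subspace_0[OF subspace_time_graph[OF T closed_weak_curl_graph subspace_weak_curl_graph, of \<Omega>]]
    by (auto simp: zero_prod_def adjoint_relation_def)
  have VA0: "volterra_adjoint T 0 = (0 :: ((real^3) \<times> real, real^3) L2)"
    by (rule linear_0[OF bounded_linear.linear[OF bounded_linear_volterra_adjoint[OF T]]])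
  have embed: "mult_op (\<lambda>z. B (fst z)) (time_embed T y) \<bullet> d = mult_op B y \<bullet> time_integral T d"
    if "multiplier B b" for B :: "real^3 \<Rightarrow> real^3 \<Rightarrow> real^3" and b y d
    using time_embed_mult_op[OF that T, of y] time_embed_adjoint[OF T, of "mult_op B y" d] by simp
  have rep_int: "integrable (lebesgue_on ?Q) (\<lambda>z. rep_L2 u z \<bullet> g z)"
    "(\<integral>z. rep_L2 u z \<bullet> g z \<partial>lebesgue_on ?Q) = u \<bullet> fld ?Q g" if "g \<in> L2_fields ?Q" for u g
    using integral_fld_rep[OF oQ that, of "rep_L2 u" u] by auto
  show ?thesis
    unfolding maxwell_weak_solution_def
  proof (intro conjI allI impI)
    show "rep_L2 e \<in> L2_fields ?Q" "rep_L2 h \<in> L2_fields ?Q" by (rule rep_L2_fields[OF oQ])+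
  next
    fix \<Phi> R D v assume tf: "maxwell_test_field \<Omega> T (V0_space \<Omega>) \<Phi> R D v"
    note t = test_field_volterra_adjoint[OF tf]
    let ?D = "fld ?Q D"
    have "(VA (- ?D, 0), (0, fld ?Q R)) \<in> skew_graph (time_graph T (weak_curl_graph \<Omega>))"
      using test_field_adjoint_time_graph[OF tf] G by (simp add: skew_graph_def t VA0)
    with sol[unfolded weak_solution_def] have
      "MM (e, h) \<bullet> (- ?D, 0) - (e, h) \<bullet> (0, fld ?Q R) = (- k, 0) \<bullet> VA (- ?D, 0) + MM (TE (fld \<Omega> e0, fld \<Omega> h0)) \<bullet> (- ?D, 0)"
      by blast
    then have eq: "- (mult_op (\<lambda>z. A1 (fst z)) e \<bullet> ?D) - h \<bullet> fld ?Q R + k \<bullet> fld ?Q \<Phi> = mult_op A1 (fld \<Omega> e0) \<bullet> fld \<Omega> (v 0)"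
      using embed[OF mat1(1), of "fld \<Omega> e0" "- ?D"] by (simp add: t)
    have "(\<integral>z. - (rep_L2 h z \<bullet> R z) + j z (rep_L2 e z) \<bullet> \<Phi> z \<partial>lebesgue_on ?Q) = - (h \<bullet> fld ?Q R) + k \<bullet> fld ?Q \<Phi>"
      using rep_int[OF t(2), of h] integral_fld_rep[OF oQ t(1) k] by simp
    then show "- (\<integral>z. (\<epsilon> (fst z) *v rep_L2 e z) \<bullet> D z \<partial>lebesgue_on ?Q)
        + (\<integral>z. - (rep_L2 h z \<bullet> R z) + j z (rep_L2 e z) \<bullet> \<Phi> z \<partial>lebesgue_on ?Q)
        = (\<integral>x. (\<epsilon> x *v e0 x) \<bullet> v 0 x \<partial>lebesgue_on \<Omega>)"
      using eq by (simp add: integral_material_cylinder[OF \<Omega> mat1 T t(3)] integral_material[OF \<Omega> mat1 init(1) t(4)])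
  next
    fix \<Phi> R D v assume tf: "maxwell_test_field \<Omega> T (V_space \<Omega>) \<Phi> R D v"
    note t = test_field_volterra_adjoint[OF tf]
    let ?D = "fld ?Q D"
    have "(VA (0, - ?D), (- fld ?Q R, 0)) \<in> skew_graph (time_graph T (weak_curl_graph \<Omega>))"
      using test_field_time_graph[OF tf] G by (simp add: skew_graph_def t VA0)
    with sol[unfolded weak_solution_def] have
      "MM (e, h) \<bullet> (0, - ?D) - (e, h) \<bullet> (- fld ?Q R, 0) = (- k, 0) \<bullet> VA (0, - ?D) + MM (TE (fld \<Omega> e0, fld \<Omega> h0)) \<bullet> (0, - ?D)"
      by blast
    then have eq: "- (mult_op (\<lambda>z. A2 (fst z)) h \<bullet> ?D) + e \<bullet> fld ?Q R = mult_op A2 (fld \<Omega> h0) \<bullet> fld \<Omega> (v 0)"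
      using embed[OF mat2(1), of "fld \<Omega> h0" "- ?D"] by (simp add: t VA0)
    then show "- (\<integral>z. (\<mu> (fst z) *v rep_L2 h z) \<bullet> D z \<partial>lebesgue_on ?Q) + (\<integral>z. rep_L2 e z \<bullet> R z \<partial>lebesgue_on ?Q)
        = (\<integral>x. (\<mu> x *v h0 x) \<bullet> v 0 x \<partial>lebesgue_on \<Omega>)"
      by (simp add: integral_material_cylinder[OF \<Omega> mat2 T t(3)] integral_material[OF \<Omega> mat2 init(2) t(4)] rep_int(2)[OF t(2)])
  qed
qed

end

lemma AE_lebesgue_on_interval:
  assumes "AE t in lborel. t \<in> {0<..<T} \<longrightarrow> P t"
  shows "AE t in lebesgue_on {0..T :: real}. P t"
proof -
  have "AE t in lborel. t \<noteq> 0 \<and> t \<noteq> T" using AE_lborel_singleton[of 0] AE_lborel_singleton[of T] by eventually_elim simp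
  with assms have "AE t in lborel. t \<in> {0..T} \<longrightarrow> P t" by eventually_elim auto
  then show ?thesis by (simp add: AE_restrict_space_iff AE_completion_iff)
qed

lemma Linf_bochner_if_energy_bound:
  fixes u :: "((real^3) \<times> real, real^3) L2"
  assumes \<Omega>: "open \<Omega>" and m: "0 < m" and C: "AE t in lborel. t \<in> {0<..<T} \<longrightarrow> m * (norm (slice u t))\<^sup>2 \<le> C"
  shows "time_slices (rep_L2 u) \<in> Linf_bochner T (L2_fields \<Omega>) (L2_norm \<Omega>)"
proof (rule Linf_bochner_slices[OF \<Omega>])
  show "AE t in lborel. t \<in> {0<..<T} \<longrightarrow> norm (slice u t) \<le> sqrt (C / m)"
    using C by eventually_elim (use m in \<open>auto intro!: real_le_rsqrt simp: field_simps\<close>)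
qed

text \<open>
  The data are replaced by Borel coefficients on the whole space, which changes neither the equations in
  \<open>\<Omega>\<close> nor the weighted norms of fields on \<open>\<Omega>\<close>. The constant is the one of the energy estimate with
  \<open>\<epsilon>\<^sub>*\<close> as lower bound.
\<close>

theorem theorem5p1:
  fixes T c1 eps_star :: real
  assumes "0 < T" and "0 < c1" and "0 < eps_star"
  shows "\<exists>c>0. \<forall>(\<Omega> :: (real^3) set) (\<epsilon> :: real^3 \<Rightarrow> real^3^3) (\<mu> :: real^3 \<Rightarrow> real^3^3) (mu_star :: real)
      (j0 :: (real^3) \<times> real \<Rightarrow> real^3) (j1 :: (real^3) \<times> real \<Rightarrow> real^3 \<Rightarrow> real^3)
      (j :: (real^3) \<times> real \<Rightarrow> real^3 \<Rightarrow> real^3) (e0 :: real^3 \<Rightarrow> real^3) (h0 :: real^3 \<Rightarrow> real^3).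
    open \<Omega> \<longrightarrow>
    material_matrix \<Omega> eps_star \<epsilon> \<longrightarrow>
    0 < mu_star \<longrightarrow> material_matrix \<Omega> mu_star \<mu> \<longrightarrow>
    (\<forall>z\<in>cylinder \<Omega> T. \<forall>\<xi>. j z \<xi> = j0 z + j1 z \<xi>) \<longrightarrow>
    j0 \<in> L2_fields (cylinder \<Omega> T) \<longrightarrow>
    caratheodory (cylinder \<Omega> T) j1 \<longrightarrow>
    (\<forall>z\<in>cylinder \<Omega> T. \<forall>\<xi>. norm (j1 z \<xi>) \<le> c1 * norm \<xi>) \<longrightarrow>
    (\<forall>z\<in>cylinder \<Omega> T. \<forall>\<xi> \<eta>. (j z \<xi> - j z \<eta>) \<bullet> (\<xi> - \<eta>) \<ge> 0) \<longrightarrow>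
    e0 \<in> L2_fields \<Omega> \<longrightarrow> h0 \<in> L2_fields \<Omega> \<longrightarrow>
    (\<exists>e h. maxwell_weak_solution \<Omega> T \<epsilon> \<mu> j e0 h0 e h \<and>
       time_slices e \<in> Linf_bochner T (L2_fields \<Omega>) (L2_norm \<Omega>) \<and>
       time_slices h \<in> Linf_bochner T (L2_fields \<Omega>) (L2_norm \<Omega>) \<and>
       (AE t in lebesgue_on {0..T}.
          (weighted_norm \<Omega> \<epsilon> (time_slices e t))\<^sup>2 + (weighted_norm \<Omega> \<mu> (time_slices h t))\<^sup>2
          \<le> c * ((weighted_norm \<Omega> \<epsilon> e0)\<^sup>2 + (weighted_norm \<Omega> \<mu> h0)\<^sup>2
                 + (L2_norm (cylinder \<Omega> T) j0)\<^sup>2)))"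
proof (rule exI[of _ "2 + 4 * T / eps_star"], rule conjI, goal_cases)
  case 1
  show ?case using assms by (simp add: add_pos_nonneg)
next
  case 2
  show ?case
  proof (intro allI impI)
    fix \<Omega> :: "(real^3) set" and \<epsilon> \<mu> :: "real^3 \<Rightarrow> real^3^3" and mu_star :: real
      and j0 :: "(real^3) \<times> real \<Rightarrow> real^3" and j1 j :: "(real^3) \<times> real \<Rightarrow> real^3 \<Rightarrow> real^3"
      and e0 h0 :: "real^3 \<Rightarrow> real^3"
    let ?Q = "cylinder \<Omega> T"
    assume \<Omega>: "open \<Omega>" and \<epsilon>: "material_matrix \<Omega> eps_star \<epsilon>" and mu_star: "0 < mu_star" and \<mu>: "material_matrix \<Omega> mu_star \<mu>"
      and j: "\<forall>z\<in>?Q. \<forall>\<xi>. j z \<xi> = j0 z + j1 z \<xi>" and j0: "j0 \<in> L2_fields ?Q" and j1: "caratheodory ?Q j1"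
      and growth: "\<forall>z\<in>?Q. \<forall>\<xi>. norm (j1 z \<xi>) \<le> c1 * norm \<xi>"
      and mono: "\<forall>z\<in>?Q. \<forall>\<xi> \<eta>. (j z \<xi> - j z \<eta>) \<bullet> (\<xi> - \<eta>) \<ge> 0"
      and init: "e0 \<in> L2_fields \<Omega>" "h0 \<in> L2_fields \<Omega>"
    note T = assms(1)
    note oQ = open_cylinder[OF \<Omega> T]
    obtain A1 where mat1: "multiplier A1 eps_star" "AE x in lborel. x \<in> \<Omega> \<longrightarrow> (\<forall>\<xi>. A1 x \<xi> = \<epsilon> x *v \<xi>)"
      using material_matrix_multiplier[OF \<Omega> assms(3) \<epsilon>] by blast
    obtain A2 where mat2: "multiplier A2 mu_star" "AE x in lborel. x \<in> \<Omega> \<longrightarrow> (\<forall>\<xi>. A2 x \<xi> = \<mu> x *v \<xi>)"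
      using material_matrix_multiplier[OF \<Omega> mu_star \<mu>] by blast
    have mono1: "0 \<le> (j1 z \<xi> - j1 z \<eta>) \<bullet> (\<xi> - \<eta>)" if "z \<in> ?Q" for z \<xi> \<eta>
      using mono[rule_format, OF that, of \<xi> \<eta>] by (simp add: j[rule_format, OF that])
    have "\<exists>f. monotone_field f c1 \<and> (AE z in lborel. z \<in> ?Q \<longrightarrow> f z = j1 z)"
      by (rule caratheodory_monotone_field[OF oQ assms(2) j1]) (rule growth[rule_format] mono1; assumption)+
    then obtain f where f: "monotone_field f c1" "AE z in lborel. z \<in> ?Q \<longrightarrow> f z = j1 z"
      by blast
    define g where "g = - fld ?Q j0"
    interpret maxwell_system T eps_star mu_star A1 A2 "weak_curl_graph \<Omega>"
      by (intro maxwell_system.intro T mat1(1) mat2(1) closed_weak_curl_graph subspace_weak_curl_graph)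
    obtain e h where sol: "weak_solution (fld \<Omega> e0, fld \<Omega> h0) ((g, 0) - (superposition f e, 0)) (e, h)"
      using weak_solution_exists_monotone[OF f(1)] by blast
    have weak: "maxwell_weak_solution \<Omega> T \<epsilon> \<mu> j e0 h0 (rep_L2 e) (rep_L2 h)"
    proof (rule maxwell_weak_solution_if_operator_solution[OF \<Omega> T mat1 mat2 maxwell_system_axioms _ init])
      show "weak_solution (fld \<Omega> e0, fld \<Omega> h0) (- (fld ?Q j0 + superposition f e), 0) (e, h)"
        using sol by (simp add: g_def)
      show "AE z in lborel. z \<in> ?Q \<longrightarrow> j z (rep_L2 e z) = rep_L2 (fld ?Q j0 + superposition f e) z"
        using rep_add_L2[of "fld ?Q j0" "superposition f e"] rep_fld[OF oQ j0] rep_superposition[OF f(1), of e] f(2)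
        by eventually_elim (use j in auto)
    qed
    define N0 where "N0 = (weighted_norm \<Omega> \<epsilon> e0)\<^sup>2 + (weighted_norm \<Omega> \<mu> h0)\<^sup>2"
    define J where "J = (L2_norm ?Q j0)\<^sup>2"
    define C where "C = 2 * N0 + 4 * T / eps_star * J"
    have "MM0 (fld \<Omega> e0, fld \<Omega> h0) \<bullet> (fld \<Omega> e0, fld \<Omega> h0) = N0"
      by (simp add: N0_def weighted_norm_sq[OF \<Omega> mat1 init(1)] weighted_norm_sq[OF \<Omega> mat2 init(2)])
    moreover have "(norm g)\<^sup>2 = J" by (simp add: g_def J_def L2_norm_fld[OF oQ j0])
    ultimately have en: "AE t in lborel. t \<in> {0<..<T} \<longrightarrow>
        mult_op A1 (slice e t) \<bullet> slice e t + mult_op A2 (slice h t) \<bullet> slice h t \<le> C"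
      using energy_estimate[OF f(1) sol] slice_inner_mult_op[OF mat1(1), of e] slice_inner_mult_op[OF mat2(1), of h]
      unfolding energy_density_def C_def by (auto elim: eventually_elim2)
    have bounds: "time_slices (rep_L2 e) \<in> Linf_bochner T (L2_fields \<Omega>) (L2_norm \<Omega>)"
      "time_slices (rep_L2 h) \<in> Linf_bochner T (L2_fields \<Omega>) (L2_norm \<Omega>)"
    proof (rule Linf_bochner_if_energy_bound[OF \<Omega> assms(3), of T e C])
      show "AE t in lborel. t \<in> {0<..<T} \<longrightarrow> eps_star * (norm (slice e t))\<^sup>2 \<le> C"
        using en
      proof eventually_elim
        case (elim t)
        show ?case using elim mult_op_inner_coercive[OF mat1(1), of "slice e t"] mult_op_inner_nonneg[OF mat2(1), of "slice h t"] by auto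
      qed
      show "time_slices (rep_L2 h) \<in> Linf_bochner T (L2_fields \<Omega>) (L2_norm \<Omega>)"
      proof (rule Linf_bochner_if_energy_bound[OF \<Omega> mu_star])
        show "AE t in lborel. t \<in> {0<..<T} \<longrightarrow> mu_star * (norm (slice h t))\<^sup>2 \<le> C"
          using en
        proof eventually_elim
          case (elim t)
          show ?case using elim mult_op_inner_nonneg[OF mat1(1), of "slice e t"] mult_op_inner_coercive[OF mat2(1), of "slice h t"] by auto
        qed
      qed
    qed
    have "AE t in lebesgue_on {0..T}. (weighted_norm \<Omega> \<epsilon> (time_slices (rep_L2 e) t))\<^sup>2
        + (weighted_norm \<Omega> \<mu> (time_slices (rep_L2 h) t))\<^sup>2 \<le> (2 + 4 * T / eps_star) * (N0 + J)"
    proof (rule AE_lebesgue_on_interval)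
      have C: "C \<le> (2 + 4 * T / eps_star) * (N0 + J)"
        using assms by (simp add: C_def N0_def J_def algebra_simps add_nonneg_nonneg)
      show "AE t in lborel. t \<in> {0<..<T} \<longrightarrow> (weighted_norm \<Omega> \<epsilon> (time_slices (rep_L2 e) t))\<^sup>2
          + (weighted_norm \<Omega> \<mu> (time_slices (rep_L2 h) t))\<^sup>2 \<le> (2 + 4 * T / eps_star) * (N0 + J)"
        using en rep_slice[of e] rep_slice[of h]
      proof eventually_elim
        case (elim t)
        have "(weighted_norm \<Omega> \<epsilon> (time_slices (rep_L2 e) t))\<^sup>2 \<le> mult_op A1 (slice e t) \<bullet> slice e t"
          by (rule weighted_norm_sq_le[OF \<Omega> mat1]) (use elim(2) in \<open>auto simp: time_slices_def elim: eventually_mono\<close>)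
        moreover have "(weighted_norm \<Omega> \<mu> (time_slices (rep_L2 h) t))\<^sup>2 \<le> mult_op A2 (slice h t) \<bullet> slice h t"
          by (rule weighted_norm_sq_le[OF \<Omega> mat2]) (use elim(3) in \<open>auto simp: time_slices_def elim: eventually_mono\<close>)
        ultimately show ?case using elim(1) C by auto
      qed
    qed
    then show "\<exists>e h. maxwell_weak_solution \<Omega> T \<epsilon> \<mu> j e0 h0 e h \<and>
       time_slices e \<in> Linf_bochner T (L2_fields \<Omega>) (L2_norm \<Omega>) \<and>
       time_slices h \<in> Linf_bochner T (L2_fields \<Omega>) (L2_norm \<Omega>) \<and>
       (AE t in lebesgue_on {0..T}.
          (weighted_norm \<Omega> \<epsilon> (time_slices e t))\<^sup>2 + (weighted_norm \<Omega> \<mu> (time_slices h t))\<^sup>2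
          \<le> (2 + 4 * T / eps_star) * ((weighted_norm \<Omega> \<epsilon> e0)\<^sup>2 + (weighted_norm \<Omega> \<mu> h0)\<^sup>2
                 + (L2_norm (cylinder \<Omega> T) j0)\<^sup>2))"
      using weak bounds unfolding N0_def J_def by blast
  qed
qed

end
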